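(* For each $N\ge1$ let $(\Omega_N,\mathcal F^N,P_N)$ be a probability space with a filtration $\{\mathcal G_{N,n}\}_{n\ge0}$ and real random variables $U_{N,n}$, $n\ge1$, satisfying conditions B1–B4 of the context. Let $\mathcal X$ be a complete separable metric space, $k_N\ge0$ integers with $k_N/N\to t_0$, and $F_N$ a $\mathcal G_{N,k_N}$-measurable $\mathcal X$-valued random variable whose distribution $\lambda_N$ under $P_N$ converges weakly to a probability measure $\lambda$ on $\mathcal X$. Set $\xi_{N,k_N}(t)=N^{-1/2}\sum_{k_N+1\le n\le k_N+Nt}U_{N,n}$. Then the joint distribution of $(F_N,\xi_{N,k_N}(\cdot))$ converges weakly on $\mathcal X\times D[0,T]$ to $\lambda\times\gamma$, where $\gamma$ is the distribution of a Gaussian process with independent increments, mean $0$ and variance $A(t+t_0)-A(t_0)$. In particular, any limit in distribution of $\xi_N(t)=N^{-1/2}\sum_{1\le n\le Nt}U_{N,n}$ is a process with independent increments. The assumption $k_N/N\to t_0$ can be dropped provided that for some function $\tilde A(t)$, $$\lim_{N\to\infty}\Big\|\frac1N\sum_{k_N+1\le n\le k_N+Nt}W_{N,n}^2-\tilde A(t)\Big\|_{L^1(P_N)}=0,$$ in which case the variance of the limiting Gaussian process is $\tilde A(t)$.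
   Context: Conditions. B1: $U_{N,n}$ is $\mathcal G_{N,n}$-measurable. B2: the family $\{U_{N,n}^2\}$ is uniformly integrable. B3: $\|E[U_{N,m}|\mathcal G_{N,n}]\|_{L^2(P_N)}\le c(m-n)$ for all $N$ and $n\le m$, for some sequence $c(\cdot)\ge0$ with $\sum_{k\ge0}c(k)<\infty$. B4: with $W_{N,n}=U_{N,n}+\sum_{m\ge n+1}E[U_{N,m}|\mathcal G_{N,n}]-\sum_{m\ge n}E[U_{N,m}|\mathcal G_{N,n-1}]$, there is an increasing function $A(t)$ such that $\lim_{N\to\infty}\|\frac1N\sum_{1\le n\le Nt}W_{N,n}^2-A(t)\|_{L^1(P_N)}=0$ for each $t$. $D[0,T]$ is the Skorokhod space. *)

theory Defs
  imports "HOL-Probability.Probability"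
begin

definition Dspace :: "real \<Rightarrow> (real \<Rightarrow> real) set" where
  "Dspace T = {f. (\<forall>t. t \<notin> {0..T} \<longrightarrow> f t = 0)
     \<and> (\<forall>t\<in>{0..<T}. (f \<longlongrightarrow> f t) (at_right t))
     \<and> (\<forall>t\<in>{0<..T}. \<exists>l. (f \<longlongrightarrow> l) (at_left t))}"

definition time_changes :: "real \<Rightarrow> (real \<Rightarrow> real) set" where
  "time_changes T = {r. strict_mono_on {0..T} r \<and> continuous_on {0..T} r
                        \<and> bij_betw r {0..T} {0..T}}"

definition sk_dist :: "real \<Rightarrow> (real \<Rightarrow> real) \<Rightarrow> (real \<Rightarrow> real) \<Rightarrow> real" where
  "sk_dist T f g = Inf {e. 0 \<le> e \<and> (\<exists>r\<in>time_changes T. \<forall>t\<in>{0..T}.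
        \<bar>r t - t\<bar> \<le> e \<and> \<bar>f t - g (r t)\<bar> \<le> e)}"

definition weak_conv_meas :: "(nat \<Rightarrow> 'x::metric_space measure) \<Rightarrow> 'x measure \<Rightarrow> bool" where
  "weak_conv_meas \<mu>s \<mu> \<longleftrightarrow> (\<forall>g :: 'x \<Rightarrow> real. continuous_on UNIV g \<and> bounded (range g)
      \<longrightarrow> (\<lambda>n. integral\<^sup>L (\<mu>s n) g) \<longlonglongrightarrow> integral\<^sup>L \<mu> g)"

definition bcont_XD :: "real \<Rightarrow> ('x::metric_space \<Rightarrow> (real \<Rightarrow> real) \<Rightarrow> real) \<Rightarrow> bool" where
  "bcont_XD T h \<longleftrightarrow> (\<exists>B. \<forall>x. \<forall>f\<in>Dspace T. \<bar>h x f\<bar> \<le> B) \<and>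
     (\<forall>x. \<forall>f\<in>Dspace T. \<forall>e>0. \<exists>d>0. \<forall>y. \<forall>g\<in>Dspace T.
         dist x y + sk_dist T f g < d \<longrightarrow> \<bar>h x f - h y g\<bar> < e)"

definition bcont_D :: "real \<Rightarrow> ((real \<Rightarrow> real) \<Rightarrow> real) \<Rightarrow> bool" where
  "bcont_D T h \<longleftrightarrow> (\<exists>B. \<forall>f\<in>Dspace T. \<bar>h f\<bar> \<le> B) \<and>
     (\<forall>f\<in>Dspace T. \<forall>e>0. \<exists>d>0. \<forall>g\<in>Dspace T.
         sk_dist T f g < d \<longrightarrow> \<bar>h f - h g\<bar> < e)"

definition weak_conv_XD :: "real \<Rightarrow> (nat \<Rightarrow> 'a measure) \<Rightarrow> (nat \<Rightarrow> 'a \<Rightarrow> 'x::metric_space)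
     \<Rightarrow> (nat \<Rightarrow> 'a \<Rightarrow> real \<Rightarrow> real) \<Rightarrow> ('x \<times> (real \<Rightarrow> real)) measure \<Rightarrow> bool" where
  "weak_conv_XD T M F Xi \<nu> \<longleftrightarrow> (\<forall>h. bcont_XD T h \<longrightarrow>
     (\<lambda>N. \<integral>\<omega>. h (F N \<omega>) (Xi N \<omega>) \<partial>M N) \<longlonglongrightarrow> (\<integral>p. h (fst p) (snd p) \<partial>\<nu>))"

definition weak_conv_D :: "real \<Rightarrow> (nat \<Rightarrow> 'a measure)
     \<Rightarrow> (nat \<Rightarrow> 'a \<Rightarrow> real \<Rightarrow> real) \<Rightarrow> (real \<Rightarrow> real) measure \<Rightarrow> bool" where
  "weak_conv_D T M Xi \<nu> \<longleftrightarrow> (\<forall>h. bcont_D T h \<longrightarrow>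
     (\<lambda>N. \<integral>\<omega>. h (Xi N \<omega>) \<partial>M N) \<longlonglongrightarrow> (\<integral>f. h f \<partial>\<nu>))"

definition centered_gaussian :: "'q measure \<Rightarrow> ('q \<Rightarrow> real) \<Rightarrow> real \<Rightarrow> bool" where
  "centered_gaussian Q X v \<longleftrightarrow> X \<in> borel_measurable Q \<and> 0 \<le> v \<and>
     (if v = 0 then (AE q in Q. X q = 0)
      else distr Q borel X = density lborel (normal_density 0 (sqrt v)))"

text \<open>gamma is the law, on D[0,T] (with the sigma-algebra generated by evaluations, i.e.
  the Borel sigma-algebra of the Skorokhod topology), of a Gaussian process with
  independent increments, mean 0 and variance V(t), t in [0,T].\<close>
definition gaussian_ii_law :: "real \<Rightarrow> (real \<Rightarrow> real) \<Rightarrow> (real \<Rightarrow> real) measure \<Rightarrow> bool" where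
  "gaussian_ii_law T V \<gamma> \<longleftrightarrow> prob_space \<gamma> \<and> space \<gamma> \<subseteq> Dspace T \<and>
     sets \<gamma> = sigma_sets (space \<gamma>) {{f\<in>space \<gamma>. f t \<in> B} | t B. t \<in> {0..T} \<and> B \<in> sets borel} \<and>
     (AE f in \<gamma>. f 0 = 0) \<and>
     (\<forall>s t. 0 \<le> s \<and> s \<le> t \<and> t \<le> T \<longrightarrow> centered_gaussian \<gamma> (\<lambda>f. f t - f s) (V t - V s)) \<and>
     (\<forall>n (ts :: nat \<Rightarrow> real). 0 \<le> ts 0 \<and> ts n \<le> T \<and> (\<forall>i<n. ts i \<le> ts (Suc i)) \<longrightarrow>
        prob_space.indep_vars \<gamma> (\<lambda>_. borel) (\<lambda>i f. f (ts (Suc i)) - f (ts i)) {..<n})"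

definition filtration_on :: "'a measure \<Rightarrow> (nat \<Rightarrow> 'a measure) \<Rightarrow> bool" where
  "filtration_on M G \<longleftrightarrow> (\<forall>n. subalgebra M (G n)) \<and> (\<forall>n m. n \<le> m \<longrightarrow> sets (G n) \<subseteq> sets (G m))"

definition UI_squares :: "(nat \<Rightarrow> 'a measure) \<Rightarrow> (nat \<Rightarrow> nat \<Rightarrow> 'a \<Rightarrow> real) \<Rightarrow> bool" where
  "UI_squares M U \<longleftrightarrow> (\<forall>e>0. \<exists>K. \<forall>N\<ge>1. \<forall>n\<ge>1.
     (\<integral>\<^sup>+\<omega>. ennreal ((U N n \<omega>)\<^sup>2 * indicator {\<omega>. (U N n \<omega>)\<^sup>2 > K} \<omega>) \<partial>M N) \<le> ennreal e)"

definition L2_norm_le :: "'a measure \<Rightarrow> ('a \<Rightarrow> real) \<Rightarrow> real \<Rightarrow> bool" where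
  "L2_norm_le M f c \<longleftrightarrow> 0 \<le> c \<and> (\<integral>\<^sup>+\<omega>. ennreal ((f \<omega>)\<^sup>2) \<partial>M) \<le> ennreal (c\<^sup>2)"

definition L1_norm :: "'a measure \<Rightarrow> ('a \<Rightarrow> real) \<Rightarrow> ennreal" where
  "L1_norm M f = (\<integral>\<^sup>+\<omega>. ennreal \<bar>f \<omega>\<bar> \<partial>M)"

definition Wmart :: "(nat \<Rightarrow> 'a measure) \<Rightarrow> (nat \<Rightarrow> nat \<Rightarrow> 'a measure) \<Rightarrow> (nat \<Rightarrow> nat \<Rightarrow> 'a \<Rightarrow> real)
      \<Rightarrow> nat \<Rightarrow> nat \<Rightarrow> 'a \<Rightarrow> real" where
  "Wmart M G U N n \<omega> = U N n \<omega>
     + (\<Sum>j. real_cond_exp (M N) (G N n) (U N (n + 1 + j)) \<omega>)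
     - (\<Sum>j. real_cond_exp (M N) (G N (n - 1)) (U N (n + j)) \<omega>)"

definition xi_proc :: "real \<Rightarrow> (nat \<Rightarrow> nat \<Rightarrow> 'a \<Rightarrow> real) \<Rightarrow> nat \<Rightarrow> nat \<Rightarrow> 'a \<Rightarrow> real \<Rightarrow> real" where
  "xi_proc T U N k \<omega> = (\<lambda>t. if t \<in> {0..T}
       then (\<Sum>n\<in>{k+1..k + nat \<lfloor>real N * t\<rfloor>}. U N n \<omega>) / sqrt (real N) else 0)"

end

theory Submission
  imports Defs
begin

text \<open>Condition B3 makes \<open>R n = (\<Sum>j. E[U (n + 1 + j) | G n])\<close> an \<open>L\<^sup>2\<close>-convergent series, and
  \<open>W n = U n + R n - R (n - 1)\<close> is a martingale difference, so the partial sums of \<open>U\<close> and \<open>W\<close>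
  differ by the telescoped \<open>R\<close>, which is uniformly negligible after division by \<open>sqrt N\<close> because
  the squares \<open>(R n)\<^sup>2\<close> are uniformly integrable. Truncating and recentring \<open>W / sqrt N\<close> gives a
  martingale difference array bounded by a null sequence with the same limiting quadratic variation.

  For such an array \<open>exp (i \<theta> X + \<theta>\<^sup>2 X\<^sup>2 / 2)\<close> is almost a martingale. On a block of times
  this yields the Gaussian limit of the increment; testing against a bounded function of the past
  (the given \<open>F\<close> and the earlier increments) only tilts the measure, so the new
  increment is asymptotically independent of the past and the limit law is built up block by block.
  A real exponential supermartingale controls the oscillation within a block.

  The limit \<open>\<gamma>\<close> is the law of \<open>sqrt (V T) B (V t / V T)\<close> for a Brownian motion \<open>B\<close>.
  As \<open>\<gamma>\<close> lives on continuous paths, the uniform distance may replace the Skorokhod distance;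
  bounded continuous functionals are then squeezed between their Lipschitz inf-convolutions.\<close>

section \<open>Weak limits from Lipschitz test functions\<close>

text \<open>Two obstacles shape the argument. The quadratic variation is only known to converge in
  L1, which puts no bound on the variation itself, while the compensated exponential can be
  controlled only where the variation is bounded. The array is therefore stopped once its variation
  overshoots the limit by 1, and L1 convergence makes the overshoot rare.

  Inside the blocks a second-moment maximal inequality is too weak: m blocks of variance of order
  1/m give a total probability of order m * (1/m), which does not vanish. An exponential inequality
  gives m * exp (- const * m) instead. It asks for every block to be small; this follows from the
  uniform second moments of W, which make the limiting variance Lipschitz.

  Path space with the uniform distance is not separable, so continuity alone does not give
  measurability of functionals. Each path is routed through finitely many real coordinates: summands
  for the sampled paths, grid values for the continuous ones.\<close>

definition dcont :: "'b set \<Rightarrow> ('b \<Rightarrow> 'b \<Rightarrow> real) \<Rightarrow> ('b \<Rightarrow> real) \<Rightarrow> bool" where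
  "dcont S d h \<longleftrightarrow> (\<forall>x\<in>S. \<forall>e>0. \<exists>\<delta>>0. \<forall>y\<in>S. d x y < \<delta> \<longrightarrow> \<bar>h x - h y\<bar> < e)"

definition pseudometric_on :: "'b set \<Rightarrow> ('b \<Rightarrow> 'b \<Rightarrow> real) \<Rightarrow> bool" where
  "pseudometric_on S d \<longleftrightarrow> (\<forall>x\<in>S. d x x = 0) \<and> (\<forall>x\<in>S. \<forall>y\<in>S. 0 \<le> d x y \<and> d x y = d y x)
     \<and> (\<forall>x\<in>S. \<forall>y\<in>S. \<forall>z\<in>S. d x z \<le> d x y + d y z)"

text \<open>The Pasch-Hausdorff envelope: on a pseudometric space, the largest
  \<open>j\<close>-Lipschitz minorant of a bounded \<open>h\<close>.\<close>

definition inf_conv :: "'b set \<Rightarrow> ('b \<Rightarrow> 'b \<Rightarrow> real) \<Rightarrow> ('b \<Rightarrow> real) \<Rightarrow> nat \<Rightarrow> 'b \<Rightarrow> real" where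
  "inf_conv S d h j x = (INF y\<in>S. h y + real j * d x y)"

context
  fixes S :: "'b set" and d :: "'b \<Rightarrow> 'b \<Rightarrow> real" and h :: "'b \<Rightarrow> real" and B :: real
  assumes pm: "pseudometric_on S d" and bd: "\<And>x. x \<in> S \<Longrightarrow> \<bar>h x\<bar> \<le> B"
begin

lemma inf_conv_bdd_below: "x \<in> S \<Longrightarrow> bdd_below ((\<lambda>y. h y + real j * d x y) ` S)"
proof (rule bdd_belowI2[where m="-B"])
  fix y assume "x \<in> S" "y \<in> S"
  then have "0 \<le> d x y" "\<bar>h y\<bar> \<le> B" using pm bd by (auto simp: pseudometric_on_def)
  then show "- B \<le> h y + real j * d x y"
    using mult_nonneg_nonneg[of "real j" "d x y"] by linarith
qed

lemma inf_conv_le: "x \<in> S \<Longrightarrow> inf_conv S d h j x \<le> h x"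
proof -
  assume x: "x \<in> S"
  have "inf_conv S d h j x \<le> h x + real j * d x x"
    unfolding inf_conv_def by (rule cINF_lower[OF inf_conv_bdd_below]) (use x in auto)
  then show ?thesis using pm x by (simp add: pseudometric_on_def)
qed

lemma inf_conv_ge:
  assumes x: "x \<in> S" and "\<And>y. y \<in> S \<Longrightarrow> c \<le> h y + real j * d x y"
  shows "c \<le> inf_conv S d h j x"
  unfolding inf_conv_def by (rule cINF_greatest) (use assms in auto)

lemma inf_conv_bound: "x \<in> S \<Longrightarrow> \<bar>inf_conv S d h j x\<bar> \<le> B"
proof -
  assume x: "x \<in> S"
  have "- B \<le> inf_conv S d h j x"
  proof (rule inf_conv_ge[OF x])
    fix y assume y: "y \<in> S"
    then have "0 \<le> d x y" "\<bar>h y\<bar> \<le> B" using x pm bd by (auto simp: pseudometric_on_def)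
    moreover have "0 \<le> real j * d x y" using calculation by simp
    ultimately show "- B \<le> h y + real j * d x y" by linarith
  qed
  with inf_conv_le[OF x, of j] bd[OF x] show ?thesis by linarith
qed

lemma inf_conv_lipschitz:
  assumes x: "x \<in> S" and y: "y \<in> S"
  shows "\<bar>inf_conv S d h j x - inf_conv S d h j y\<bar> \<le> real j * d x y"
proof -
  have *: "inf_conv S d h j a \<le> inf_conv S d h j b + real j * d a b" if "a \<in> S" "b \<in> S" for a b
  proof -
    have "inf_conv S d h j a - real j * d a b \<le> inf_conv S d h j b"
    proof (rule inf_conv_ge[OF that(2)])
      fix z assume z: "z \<in> S"
      have "inf_conv S d h j a \<le> h z + real j * d a z"
        unfolding inf_conv_def by (rule cINF_lower[OF inf_conv_bdd_below]) (use that z in auto)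
      also have "h z + real j * d a z \<le> h z + real j * (d a b + d b z)"
          using that z pm by (intro add_left_mono mult_left_mono) (auto simp: pseudometric_on_def)
      finally show "inf_conv S d h j a - real j * d a b \<le> h z + real j * d b z"
        by (simp add: algebra_simps mult_left_mono)
    qed
    then show ?thesis by simp
  qed
  have "d x y = d y x" using pm x y by (auto simp: pseudometric_on_def)
  with *[OF x y] *[OF y x] show ?thesis by auto
qed

text \<open>A competitor \<open>y\<close> at distance at least \<delta> pays at least j * \<delta>,
  which exceeds the total oscillation 2 * B once \<open>j\<close> is large. Only points of the
  \<delta>-ball compete, and there continuity at \<open>x\<close> decides.\<close>

lemma inf_conv_tendsto:
  assumes c: "dcont S d h" and x: "x \<in> S"
  shows "(\<lambda>j. inf_conv S d h j x) \<longlonglongrightarrow> h x"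
proof (rule LIMSEQ_I)
  fix e :: real assume e: "0 < e"
  then obtain \<delta> where \<delta>: "\<delta> > 0" "\<And>y. y \<in> S \<Longrightarrow> d x y < \<delta> \<Longrightarrow> \<bar>h x - h y\<bar> < e/2"
    using c[unfolded dcont_def, rule_format, OF x, of "e/2"] by auto
  obtain J :: nat where J: "2 * B < real J * \<delta>"
    using reals_Archimedean3[OF \<delta>(1)] by blast
  show "\<exists>no. \<forall>n\<ge>no. norm (inf_conv S d h n x - h x) < e"
  proof (intro exI allI impI)
    fix n assume n: "n \<ge> J"
    have "h x - e/2 \<le> inf_conv S d h n x"
    proof (rule inf_conv_ge[OF x])
      fix y assume y: "y \<in> S"
      have d0: "0 \<le> d x y" using x y pm by (auto simp: pseudometric_on_def)
      show "h x - e/2 \<le> h y + real n * d x y"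
      proof (cases "d x y < \<delta>")
        case True
        have "0 \<le> real n * d x y" using d0 by simp
        with \<delta>(2)[OF y True] show ?thesis by linarith
      next
        case False
        have "real J * \<delta> \<le> real n * d x y" using n False \<delta>(1) by (intro mult_mono) auto
        with J bd[OF x] bd[OF y] e show ?thesis by linarith
      qed
    qed
    with inf_conv_le[OF x, of n] e show "norm (inf_conv S d h n x - h x) < e" by simp
  qed
qed

end

lemma dcont_lipschitz:
  assumes "\<And>x y. x \<in> S \<Longrightarrow> y \<in> S \<Longrightarrow> \<bar>h x - h y\<bar> \<le> L * d x y" "0 \<le> L"
  shows "dcont S d h"
  unfolding dcont_def
proof (intro ballI allI impI)
  fix x e assume x: "x \<in> S" and e: "0 < (e::real)"
  show "\<exists>\<delta>>0. \<forall>y\<in>S. d x y < \<delta> \<longrightarrow> \<bar>h x - h y\<bar> < e"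
  proof (intro exI[of _ "e / (L + 1)"] conjI ballI impI)
    show "0 < e / (L+1)" using e assms(2) by simp
    fix y assume y: "y \<in> S" "d x y < e / (L + 1)"
    have "\<bar>h x - h y\<bar> \<le> L * d x y" using assms x y by auto
    also have "\<dots> \<le> L * (e / (L+1))" using y assms(2) by (intro mult_left_mono) auto
    also have "\<dots> < e" using e assms(2) by (simp add: field_simps)
    finally show "\<bar>h x - h y\<bar> < e" .
  qed
qed

lemma dcont_uminus: "dcont S d h \<Longrightarrow> dcont S d (\<lambda>x. - h x)"
  by (simp add: dcont_def abs_minus_commute)

text \<open>Replacing \<open>h\<close> by an envelope lowers its integral under every
  \<open>M N\<close>, and under \<open>Q\<close> costs little by dominated convergence; this bounds
  the liminf from below. Applied to - h as well it bounds the limsup. Measurability is assumed for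
  all \<open>dcont\<close> functions because the pseudometric generates no sigma-algebra
  here.\<close>

lemma weak_limit_from_lipschitz:
  fixes Z :: "nat \<Rightarrow> 'a \<Rightarrow> 'b" and Y :: "'c \<Rightarrow> 'b"
  assumes pm: "pseudometric_on S d"
    and prob: "\<And>N. prob_space (M N)" "prob_space Q"
    and ZS: "\<And>N w. w \<in> space (M N) \<Longrightarrow> Z N w \<in> S" and YS: "\<And>w. w \<in> space Q \<Longrightarrow> Y w \<in> S"
    and measZ: "\<And>h N. dcont S d h \<Longrightarrow> (\<lambda>w. h (Z N w)) \<in> borel_measurable (M N)"
    and measY: "\<And>h. dcont S d h \<Longrightarrow> (\<lambda>w. h (Y w)) \<in> borel_measurable Q"
    and lip: "\<And>h L B. (\<And>x. x \<in> S \<Longrightarrow> \<bar>h x\<bar> \<le> B) \<Longrightarrow> 0 \<le> L \<Longrightarrow>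
        (\<And>x y. x \<in> S \<Longrightarrow> y \<in> S \<Longrightarrow> \<bar>h x - h y\<bar> \<le> L * d x y) \<Longrightarrow>
        (\<lambda>N. \<integral>w. h (Z N w) \<partial>M N) \<longlonglongrightarrow> (\<integral>w. h (Y w) \<partial>Q)"
    and bd: "\<And>x. x \<in> S \<Longrightarrow> \<bar>h x\<bar> \<le> B" and c: "dcont S d h"
  shows "(\<lambda>N. \<integral>w. h (Z N w) \<partial>M N) \<longlonglongrightarrow> (\<integral>w. h (Y w) \<partial>Q)"
proof -
  have lower: "eventually (\<lambda>N. (\<integral>w. g (Y w) \<partial>Q) - e < (\<integral>w. g (Z N w) \<partial>M N)) sequentially"
    if bdg: "\<And>x. x \<in> S \<Longrightarrow> \<bar>g x\<bar> \<le> B" and cg: "dcont S d g" and e: "0 < e" for g e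
  proof -
    interpret Q: prob_space Q by fact
    let ?g = "inf_conv S d g"
    note L = inf_conv_lipschitz[where h=g and B=B, OF pm bdg]
    have cj: "dcont S d (?g j)" for j
      by (rule dcont_lipschitz[where L="real j"]) (use L in auto)
    have "(\<lambda>j. \<integral>w. ?g j (Y w) \<partial>Q) \<longlonglongrightarrow> (\<integral>w. g (Y w) \<partial>Q)"
    proof (rule integral_dominated_convergence[where w="\<lambda>_. B"])
      show "AE w in Q. (\<lambda>j. ?g j (Y w)) \<longlonglongrightarrow> g (Y w)"
        using inf_conv_tendsto[where h=g and B=B, OF pm bdg cg] YS by auto
      show "AE w in Q. norm (?g j (Y w)) \<le> B" for j
        using inf_conv_bound[where h=g and B=B, OF pm bdg] YS by auto
    qed (use measY cg cj in auto)
    then have "eventually (\<lambda>j. (\<integral>w. ?g j (Y w) \<partial>Q) > (\<integral>w. g (Y w) \<partial>Q) - e/2) sequentially"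
      by (rule order_tendstoD(1)) (use e in simp)
    then obtain j where j: "(\<integral>w. ?g j (Y w) \<partial>Q) > (\<integral>w. g (Y w) \<partial>Q) - e/2"
      by (auto simp: eventually_sequentially)
    have "(\<lambda>N. \<integral>w. ?g j (Z N w) \<partial>M N) \<longlonglongrightarrow> (\<integral>w. ?g j (Y w) \<partial>Q)"
      by (rule lip[where L="real j" and B=B]) (use L inf_conv_bound[where h=g and B=B, OF pm bdg] in auto)
    then have "eventually (\<lambda>N. (\<integral>w. ?g j (Z N w) \<partial>M N) > (\<integral>w. ?g j (Y w) \<partial>Q) - e/2) sequentially"
      by (rule order_tendstoD(1)) (use e in simp)
    then show ?thesis
    proof eventually_elim
      case (elim N)
      interpret N: prob_space "M N" by fact
      have "(\<integral>w. ?g j (Z N w) \<partial>M N) \<le> (\<integral>w. g (Z N w) \<partial>M N)"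
      proof (rule integral_mono_AE)
        show "integrable (M N) (\<lambda>w. ?g j (Z N w))"
          by (rule N.integrable_const_bound[where B=B])
             (use inf_conv_bound[where h=g and B=B, OF pm bdg] ZS measZ cj in auto)
        show "integrable (M N) (\<lambda>w. g (Z N w))"
          by (rule N.integrable_const_bound[where B=B]) (use bdg ZS measZ cg in auto)
        show "AE w in M N. ?g j (Z N w) \<le> g (Z N w)"
          using inf_conv_le[where h=g and B=B, OF pm bdg] ZS by auto
      qed
      with elim j show ?case by linarith
    qed
  qed
  show ?thesis
  proof (rule LIMSEQ_I)
    fix e :: real assume e: "0 < e"
    have "eventually (\<lambda>N. (\<integral>w. - h (Y w) \<partial>Q) - e < (\<integral>w. - h (Z N w) \<partial>M N)) sequentially"
      by (rule lower[OF _ dcont_uminus[OF c] e]) (use bd in auto)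
    moreover have "eventually (\<lambda>N. (\<integral>w. h (Y w) \<partial>Q) - e < (\<integral>w. h (Z N w) \<partial>M N)) sequentially"
      by (rule lower[OF bd c e])
    ultimately have "eventually (\<lambda>N. norm ((\<integral>w. h (Z N w) \<partial>M N) - (\<integral>w. h (Y w) \<partial>Q)) < e) sequentially"
      by eventually_elim auto
    then show "\<exists>no. \<forall>n\<ge>no. norm ((\<integral>w. h (Z n w) \<partial>M n) - (\<integral>w. h (Y w) \<partial>Q)) < e"
      by (simp add: eventually_sequentially)
  qed
qed

section \<open>Bounded martingale differences\<close>

lemma norm_integral_le:
  fixes f :: "'a \<Rightarrow> 'b::{banach,second_countable_topology}"
  assumes "integrable M f" "integrable M g" "\<And>x. x \<in> space M \<Longrightarrow> norm (f x) \<le> g x"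
  shows "norm (\<integral>x. f x \<partial>M) \<le> (\<integral>x. g x \<partial>M)"
  using integral_norm_bound[of M f] integral_mono[OF integrable_norm[OF assms(1)] assms(2,3)] by linarith

lemma filtration_onD:
  assumes "filtration_on M G"
  shows "subalgebra M (G n)" "i \<le> j \<Longrightarrow> subalgebra (G j) (G i)" "space (G n) = space M"
  using assms by (auto simp: filtration_on_def subalgebra_def)

lemma filtration_measurable:
  assumes "filtration_on M G" "f \<in> measurable (G i) K"
  shows "f \<in> measurable M K" "i \<le> j \<Longrightarrow> f \<in> measurable (G j) K"
  using measurable_from_subalg filtration_onD[OF assms(1)] assms(2) by blast+

text \<open>Vanishing conditional expectation, written as orthogonality to all bounded weights from
  the past. The estimates below use it in exactly this form, and no almost-everywhere identities
  between versions have to be carried along. The value at 0 is unconstrained, since it has no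
  past.\<close>

definition mds :: "'a measure \<Rightarrow> (nat \<Rightarrow> 'a measure) \<Rightarrow> (nat \<Rightarrow> 'a \<Rightarrow> real) \<Rightarrow> bool" where
  "mds M G X \<longleftrightarrow> (\<forall>i. X (Suc i) \<in> borel_measurable (G (Suc i)) \<and> integrable M (X (Suc i)) \<and>
     (\<forall>w B. w \<in> borel_measurable (G i) \<longrightarrow> (\<forall>x\<in>space M. \<bar>w x\<bar> \<le> B) \<longrightarrow>
        (\<integral>x. w x * X (Suc i) x \<partial>M) = 0))"

lemma mdsD:
  assumes "mds M G X"
  shows "X (Suc i) \<in> borel_measurable (G (Suc i))" "integrable M (X (Suc i))"
    "w \<in> borel_measurable (G i) \<Longrightarrow> (\<And>x. x \<in> space M \<Longrightarrow> \<bar>w x\<bar> \<le> B) \<Longrightarrow> (\<integral>x. w x * X (Suc i) x \<partial>M) = 0"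
  using assms unfolding mds_def by blast+

lemma mds_complex:
  fixes w :: "'a \<Rightarrow> complex"
  assumes f: "filtration_on M G" and X: "mds M G X" and w: "w \<in> borel_measurable (G i)"
    and b: "\<And>x. x \<in> space M \<Longrightarrow> norm (w x) \<le> B"
  shows "(\<integral>x. w x * complex_of_real (X (Suc i) x) \<partial>M) = 0"
proof -
  have wM: "w \<in> borel_measurable M" by (rule filtration_measurable(1)[OF f w])
  have XM: "X (Suc i) \<in> borel_measurable M" using mdsD(2)[OF X] by auto
  have int: "integrable M (\<lambda>x. w x * complex_of_real (X (Suc i) x))"
  proof (rule Bochner_Integration.integrable_bound)
    show "integrable M (\<lambda>x. B * X (Suc i) x)" using mdsD(2)[OF X] by auto
    show "AE x in M. norm (w x * complex_of_real (X (Suc i) x)) \<le> norm (B * X (Suc i) x)"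
    proof (rule AE_I2)
      fix x assume "x \<in> space M"
      then have "norm (w x) \<le> \<bar>B\<bar>" using b by fastforce
      then show "norm (w x * complex_of_real (X (Suc i) x)) \<le> norm (B * X (Suc i) x)"
        by (simp add: norm_mult abs_mult mult_right_mono)
    qed
  qed (use wM XM in measurable)
  have "Re (\<integral>x. w x * complex_of_real (X (Suc i) x) \<partial>M) = (\<integral>x. Re (w x) * X (Suc i) x \<partial>M)"
    using integral_Re[OF int] by simp
  also have "\<dots> = 0"
    by (rule mdsD(3)[OF X, where B=B]) (use w b in \<open>auto intro: order_trans[OF abs_Re_le_cmod]\<close>)
  finally have R: "Re (\<integral>x. w x * complex_of_real (X (Suc i) x) \<partial>M) = 0" .
  have "Im (\<integral>x. w x * complex_of_real (X (Suc i) x) \<partial>M) = (\<integral>x. Im (w x) * X (Suc i) x \<partial>M)"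
    using integral_Im[OF int] by simp
  also have "\<dots> = 0"
    by (rule mdsD(3)[OF X, where B=B]) (use w b in \<open>auto intro: order_trans[OF abs_Im_le_cmod]\<close>)
  finally show ?thesis using R by (simp add: complex_eq_iff)
qed

text \<open>With z = x^2/2 + i x the real part of z^2/2 is - x^2/2 up to order four, so it cancels
  the compensator and only cubic terms survive. The Taylor remainder contributes 27/8, from |z|
  \<le> 3/2 * |x| and exp (1/2) \<le> 2; the leftover of the quadratic polynomial contributes 1;
  their sum is rounded up to 5.\<close>

lemma exp_compensated_bound:
  fixes x :: real
  assumes "\<bar>x\<bar> \<le> 1"
  shows "norm (exp (Complex (x\<^sup>2 / 2) x) - 1 - \<i> * complex_of_real x) \<le> 5 * \<bar>x\<bar> ^ 3"
proof -
  define z where "z = Complex (x\<^sup>2 / 2) x"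
  have x2: "x\<^sup>2 \<le> \<bar>x\<bar>" "x\<^sup>2 \<le> 1"
    using power_decreasing[of 1 2 "\<bar>x\<bar>"] power_decreasing[of 0 2 "\<bar>x\<bar>"] assms by auto
  have nz: "norm z \<le> 3/2 * \<bar>x\<bar>"
    using cmod_le[of z] x2 by (simp add: z_def)
  have "norm (exp z - (\<Sum>k\<le>2. z ^ k / (fact k))) \<le> exp\<bar>Re z\<bar> * (norm z) ^ (Suc 2) / (fact 2)"
    by (rule Taylor_exp)
  also have "\<dots> \<le> 2 * (3/2 * \<bar>x\<bar>) ^ 3 / 2"
  proof -
    have "exp \<bar>Re z\<bar> \<le> exp (1/2)" using x2 by (simp add: z_def)
    also have "\<dots> \<le> (2::real)" by (rule exp_half_le2)
    finally have "exp \<bar>Re z\<bar> \<le> 2" .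
    moreover have "norm z ^ 3 \<le> (3/2 * \<bar>x\<bar>) ^ 3" using nz by (intro power_mono) auto
    ultimately have "exp \<bar>Re z\<bar> * norm z ^ 3 \<le> 2 * (3/2 * \<bar>x\<bar>) ^ 3" by (intro mult_mono) auto
    then have "exp \<bar>Re z\<bar> * norm z ^ 3 / 2 \<le> 2 * (3/2 * \<bar>x\<bar>) ^ 3 / 2" by (rule divide_right_mono) simp
    moreover have "Suc 2 = 3" "fact 2 = (2::real)" by (simp_all add: eval_nat_numeral)
    ultimately show ?thesis by simp
  qed
  finally have 1: "norm (exp z - (\<Sum>k\<le>2. z ^ k / (fact k))) \<le> 27/8 * \<bar>x\<bar> ^ 3"
    by (simp add: power_mult_distrib power_divide)
  have "(\<Sum>k\<le>2. z ^ k / (fact k)) - 1 - \<i> * complex_of_real x = Complex (x^4 / 8) (x^3 / 2)"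
    by (simp add: numeral_2_eq_2 z_def complex_eq_iff power2_eq_square)
       (simp add: field_simps eval_nat_numeral)
  also have "norm \<dots> \<le> \<bar>x^4 / 8\<bar> + \<bar>x^3 / 2\<bar>" using cmod_le by (metis complex.sel)
  also have "\<dots> \<le> \<bar>x\<bar>^3"
  proof -
    have "\<bar>x^4\<bar> \<le> \<bar>x\<bar>^3"
      using power_decreasing[of 3 4 "\<bar>x\<bar>"] assms by (simp add: power_abs)
    moreover have "\<bar>x^3\<bar> = \<bar>x\<bar>^3" by (simp add: power_abs)
    ultimately have "\<bar>x^4\<bar> / 8 + \<bar>x^3\<bar> / 2 \<le> \<bar>x\<bar>^3" using zero_le_power[of "\<bar>x\<bar>" 3] by linarith
    then show ?thesis by simp
  qed
  finally have 2: "norm ((\<Sum>k\<le>2. z ^ k / (fact k)) - 1 - \<i> * complex_of_real x) \<le> \<bar>x\<bar>^3" .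
  have "exp z - 1 - \<i> * complex_of_real x = (exp z - (\<Sum>k\<le>2. z ^ k / (fact k))) + ((\<Sum>k\<le>2. z ^ k / (fact k)) - 1 - \<i> * complex_of_real x)"
    by simp
  then have "norm (exp z - 1 - \<i> * complex_of_real x) \<le> 27/8 * \<bar>x\<bar> ^ 3 + \<bar>x\<bar>^3"
    using norm_triangle_le[OF add_mono[OF 1 2]] by (simp only: )
  then show ?thesis unfolding z_def by (rule order_trans) simp
qed

lemma filtration_sum_measurable:
  assumes "filtration_on M G" "mds M G X" "g \<in> borel_measurable borel" "r \<le> r'"
  shows "(\<lambda>x. \<Sum>n\<in>{Suc l..r}. (g (X n x)::real)) \<in> borel_measurable (G r')"
proof (rule borel_measurable_sum)
  fix n assume "n \<in> {Suc l..r}"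
  then obtain m where m: "n = Suc m" "Suc m \<le> r'" using assms(4) by (cases n) auto
  have "X n \<in> borel_measurable (G r')"
    unfolding m by (rule filtration_measurable(2)[OF assms(1) mdsD(1)[OF assms(2)] m(2)])
  then show "(\<lambda>x. g (X n x)) \<in> borel_measurable (G r')"
    by (rule measurable_compose[OF _ assms(3)])
qed

context prob_space
begin

text \<open>Each new factor is 1 + i t X plus a cubic error. The linear term integrates to zero
  against the past, and |X|^3 \<le> a * X^2 makes the cubic errors add up to \<open>a\<close> times
  the expected quadratic variation. The bound \<open>C\<close> is what keeps the weight
  \<open>exp (t\<^sup>2 / 2 * Q)\<close> under control.\<close>

lemma exponential_martingale_bound:
  fixes X :: "nat \<Rightarrow> 'a \<Rightarrow> real" and u :: "'a \<Rightarrow> real"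
  assumes f: "filtration_on M G" and X: "mds M G X"
    and a: "\<And>n x. x \<in> space M \<Longrightarrow> \<bar>X n x\<bar> \<le> a" "\<bar>t\<bar> * a \<le> 1"
    and C: "\<And>x. x \<in> space M \<Longrightarrow> (\<Sum>n\<in>{Suc l..r}. (X n x)\<^sup>2) \<le> C"
    and u: "u \<in> borel_measurable (G l)" "\<And>x. x \<in> space M \<Longrightarrow> \<bar>u x\<bar> \<le> 1"
    and lr: "l \<le> r"
  shows "norm ((\<integral>x. complex_of_real (u x) * exp (Complex (t\<^sup>2 / 2 * (\<Sum>n\<in>{Suc l..r}. (X n x)\<^sup>2)) (t * (\<Sum>n\<in>{Suc l..r}. X n x))) \<partial>M)
       - (\<integral>x. u x \<partial>M)) \<le> 5 * \<bar>t\<bar> ^ 3 * exp (t\<^sup>2 / 2 * C) * a * (\<integral>x. (\<Sum>n\<in>{Suc l..r}. (X n x)\<^sup>2) \<partial>M)"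
proof -
  define S where "S r x = (\<Sum>n\<in>{Suc l..r}. X n x)" for r x
  define Q where "Q r x = (\<Sum>n\<in>{Suc l..r}. (X n x)\<^sup>2)" for r x
  define R where "R r x = complex_of_real (u x) * exp (Complex (t\<^sup>2 / 2 * Q r x) (t * S r x))" for r x
  define K where "K = 5 * \<bar>t\<bar> ^ 3 * exp (t\<^sup>2 / 2 * C) * a"
  have Smeas: "S m \<in> borel_measurable (G m)" for m
    unfolding S_def using filtration_sum_measurable[OF f X, of "\<lambda>x. x" m m l] by simp
  have Qmeas: "Q m \<in> borel_measurable (G m)" for m
    unfolding Q_def using filtration_sum_measurable[OF f X, of "\<lambda>x. x\<^sup>2" m m l] by simp
  have Rmeas: "R m \<in> borel_measurable (G m)" if "l \<le> m" for m
  proof -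
    note [measurable] = Smeas[of m] Qmeas[of m] filtration_measurable(2)[OF f u(1) that]
    show ?thesis unfolding R_def Complex_eq by measurable
  qed
  have QC: "Q m x \<le> C" if "x \<in> space M" "m \<le> r" for m x
  proof -
    have "Q m x \<le> Q r x" unfolding Q_def by (rule sum_mono2) (use that in auto)
    then show ?thesis using C[OF that(1)] by (simp add: Q_def)
  qed
  have Q0: "0 \<le> Q m x" for m x unfolding Q_def by (simp add: sum_nonneg)
  have Rb: "norm (R m x) \<le> exp (t\<^sup>2 / 2 * C)" if "x \<in> space M" "m \<le> r" for m x
  proof -
    have "norm (R m x) = \<bar>u x\<bar> * exp (t\<^sup>2 / 2 * Q m x)" by (simp add: R_def norm_mult)
    also have "\<dots> \<le> 1 * exp (t\<^sup>2 / 2 * C)"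
      using u(2)[OF that(1)] QC[OF that] by (intro mult_mono) (auto intro: mult_left_mono)
    finally show ?thesis by simp
  qed
  have a0: "0 \<le> a" using a(1) not_empty by (meson abs_ge_zero ex_in_conv order_trans)
  have XM[measurable]: "X (Suc m) \<in> borel_measurable M" for m using mdsD(2)[OF X] by auto
  have X2: "integrable M (\<lambda>x. (X (Suc m) x)\<^sup>2)" for m
  proof (rule integrable_const_bound[where B="a\<^sup>2"])
    show "AE x in M. norm ((X (Suc m) x)\<^sup>2) \<le> a\<^sup>2"
      using a(1) a0 by (auto intro!: AE_I2 simp: abs_le_square_iff[symmetric])
  qed measurable
  have iQ: "integrable M (Q m)" for m
  proof -
    have "integrable M (\<lambda>x. (X n x)\<^sup>2)" if "n \<in> {Suc l..m}" for n using that X2 by (cases n) auto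
    then show ?thesis unfolding Q_def by auto
  qed
  have iR: "integrable M (R m)" if "l \<le> m" "m \<le> r" for m
    by (rule integrable_const_bound[where B="exp (t\<^sup>2 / 2 * C)"])
       (use Rb that filtration_measurable(1)[OF f Rmeas] in auto)
  have "m \<le> r \<Longrightarrow> norm ((\<integral>x. R m x \<partial>M) - (\<integral>x. u x \<partial>M)) \<le> K * (\<integral>x. Q m x \<partial>M)" if "l \<le> m" for m
    using that
  proof (induction m rule: dec_induct)
    case base
    have "R l = (\<lambda>x. complex_of_real (u x))"
      by (simp add: R_def Q_def S_def fun_eq_iff zero_complex.code[symmetric])
    then show ?case by (simp add: Q_def)
  next
    case (step m)
    then have mr: "m \<le> r" and lm: "l \<le> m" by auto
    let ?X = "X (Suc m)"
    have SQ: "S (Suc m) x = S m x + ?X x" "Q (Suc m) x = Q m x + (?X x)\<^sup>2" for x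
      using lm by (auto simp: S_def Q_def)
    let ?E = "\<lambda>x. exp (Complex ((t * ?X x)\<^sup>2 / 2) (t * ?X x)) - 1 - \<i> * complex_of_real (t * ?X x)"
    have RS: "R (Suc m) x - R m x - (\<i> * complex_of_real t) * (R m x * complex_of_real (?X x)) = R m x * ?E x" for x
    proof -
      have "Complex (t\<^sup>2 / 2 * Q (Suc m) x) (t * S (Suc m) x)
          = Complex (t\<^sup>2 / 2 * Q m x) (t * S m x) + Complex ((t * ?X x)\<^sup>2 / 2) (t * ?X x)"
        by (simp add: SQ complex_eq_iff field_simps)
      then have "R (Suc m) x = R m x * exp (Complex ((t * ?X x)\<^sup>2 / 2) (t * ?X x))"
        by (simp add: R_def exp_add)
      then show ?thesis by (simp add: algebra_simps)
    qed
    have o: "(\<integral>x. R m x * complex_of_real (?X x) \<partial>M) = 0"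
      by (rule mds_complex[OF f X Rmeas[OF lm], where B="exp (t\<^sup>2 / 2 * C)"]) (use Rb mr in auto)
    have io: "integrable M (\<lambda>x. R m x * complex_of_real (?X x))"
    proof (rule integrable_const_bound[where B="exp (t\<^sup>2 / 2 * C) * a"])
      show "AE x in M. norm (R m x * complex_of_real (?X x)) \<le> exp (t\<^sup>2 / 2 * C) * a"
        using Rb[OF _ mr] a(1) by (auto intro!: AE_I2 mult_mono simp: norm_mult)
    qed (use filtration_measurable(1)[OF f Rmeas[OF lm]] in measurable)
    have "(\<integral>x. R (Suc m) x \<partial>M) - (\<integral>x. R m x \<partial>M)
       = (\<integral>x. R (Suc m) x - R m x - (\<i> * complex_of_real t) * (R m x * complex_of_real (?X x)) \<partial>M)"
      using iR[of "Suc m"] iR[of m] step lm io o by simp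
    also have "\<dots> = (\<integral>x. R m x * ?E x \<partial>M)" by (simp only: RS)
    also have "norm \<dots> \<le> (\<integral>x. K * (?X x)\<^sup>2 \<partial>M)"
    proof (rule norm_integral_le)
      show "integrable M (\<lambda>x. R m x * ?E x)"
        unfolding RS[symmetric] using iR[of "Suc m"] iR[of m] step lm io by simp
      show "integrable M (\<lambda>x. K * (?X x)\<^sup>2)" using X2 by simp
      fix x assume x: "x \<in> space M"
      have "\<bar>t * ?X x\<bar> \<le> \<bar>t\<bar> * a" using a(1)[OF x] by (auto simp: abs_mult intro: mult_left_mono)
      then have t1: "\<bar>t * ?X x\<bar> \<le> 1" using a(2) by linarith
      have "norm (?E x) \<le> 5 * \<bar>t * ?X x\<bar> ^ 3" by (rule exp_compensated_bound[OF t1])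
      also have "\<dots> = 5 * \<bar>t\<bar>^3 * (\<bar>?X x\<bar> * (?X x)\<^sup>2)"
        using power_Suc[of "\<bar>?X x\<bar>" 2] by (simp add: abs_mult power_mult_distrib)
      also have "\<dots> \<le> 5 * \<bar>t\<bar>^3 * (a * (?X x)\<^sup>2)"
        using a(1)[OF x] by (intro mult_left_mono mult_right_mono) auto
      finally have "norm (R m x * ?E x) \<le> exp (t\<^sup>2 / 2 * C) * (5 * \<bar>t\<bar>^3 * (a * (?X x)\<^sup>2))"
        unfolding norm_mult using Rb[OF x mr] by (intro mult_mono) auto
      then show "norm (R m x * ?E x) \<le> K * (?X x)\<^sup>2" by (simp add: K_def algebra_simps)
    qed
    finally have "norm ((\<integral>x. R (Suc m) x \<partial>M) - (\<integral>x. R m x \<partial>M)) \<le> K * (\<integral>x. (?X x)\<^sup>2 \<partial>M)"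
      by simp
    moreover have "(\<integral>x. Q (Suc m) x \<partial>M) = (\<integral>x. Q m x \<partial>M) + (\<integral>x. (?X x)\<^sup>2 \<partial>M)"
      unfolding SQ using iQ X2 by simp
    moreover have "norm ((\<integral>x. R m x \<partial>M) - (\<integral>x. u x \<partial>M)) \<le> K * (\<integral>x. Q m x \<partial>M)" using step.IH mr by simp
    ultimately show ?case
      using norm_triangle_ineq[of "(\<integral>x. R (Suc m) x \<partial>M) - (\<integral>x. R m x \<partial>M)" "(\<integral>x. R m x \<partial>M) - (\<integral>x. u x \<partial>M)"]
      by (simp add: distrib_left)
  qed
  from this[OF lr order_refl] show ?thesis by (simp add: R_def K_def Q_def S_def)
qed

end

lemma abs_exp_minus_one_le: "\<bar>exp y - 1\<bar> \<le> \<bar>y\<bar> * exp \<bar>y\<bar>" for y :: real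
proof -
  have 1: "1 - exp (- z) \<le> z" "exp z - 1 \<le> z * exp z" if "0 \<le> z" for z :: real
  proof -
    show z: "1 - exp (- z) \<le> z" using exp_ge_add_one_self[of "-z"] by linarith
    have "(1 - exp (- z)) * exp z \<le> z * exp z" using z by (intro mult_right_mono) auto
    then show "exp z - 1 \<le> z * exp z" by (simp add: left_diff_distrib exp_minus)
  qed
  show ?thesis
  proof (cases "0 \<le> y")
    case True then show ?thesis using 1(2)[of y] by simp
  next
    case False
    then have "\<bar>exp y - 1\<bar> \<le> \<bar>y\<bar> * 1" using 1(1)[of "-y"] by simp
    also have "\<dots> \<le> \<bar>y\<bar> * exp \<bar>y\<bar>" by (intro mult_left_mono) auto
    finally show ?thesis .
  qed
qed

text \<open>Stopping makes the exponential estimate available without a bound on the quadratic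
  variation. Three errors are added: X against the stopped Y, the random compensator against its
  deterministic value at s, and the exponential estimate for Y. The first two are controlled by the
  L1 distance of the variation from s, the third by \<open>a\<close>.\<close>

lemma (in prob_space) mds_char_bound:
  fixes X :: "nat \<Rightarrow> 'a \<Rightarrow> real" and u :: "'a \<Rightarrow> real" and s t a :: real
  assumes f: "filtration_on M G" and X: "mds M G X"
    and a: "\<And>n x. x \<in> space M \<Longrightarrow> \<bar>X n x\<bar> \<le> a" "a \<le> 1" "\<bar>t\<bar> * a \<le> 1"
    and u: "u \<in> borel_measurable (G l)" "\<And>x. x \<in> space M \<Longrightarrow> \<bar>u x\<bar> \<le> 1"
    and lr: "l \<le> r" and s: "0 \<le> s"
  shows "norm ((\<integral>x. complex_of_real (u x) * iexp (t * (\<Sum>n\<in>{Suc l..r}. X n x)) \<partial>M)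
       - exp (- t\<^sup>2 * s / 2) * (\<integral>x. u x \<partial>M))
     \<le> (2 + t\<^sup>2 / 2 * exp (t\<^sup>2 * (s + 2) / 2)) * (\<integral>x. \<bar>(\<Sum>n\<in>{Suc l..r}. (X n x)\<^sup>2) - s\<bar> \<partial>M)
       + 5 * \<bar>t\<bar> ^ 3 * exp (t\<^sup>2 / 2 * (s + 2)) * (s + 2) * a"
proof -
  define S where "S r x = (\<Sum>n\<in>{Suc l..r}. X n x)" for r x
  define Q where "Q r x = (\<Sum>n\<in>{Suc l..r}. (X n x)\<^sup>2)" for r x
  \<comment> \<open>The test looks at the variation before step n, so stopping is predictable and
    the step that crosses s + 1 is still taken. That step adds at most a^2 \<le> 1, hence the bound
    s + 2 for the stopped variation.\<close>
  define Y where "Y n x = (if Q (n - 1) x \<le> s + 1 then X n x else 0)" for n x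
  define SY where "SY r x = (\<Sum>n\<in>{Suc l..r}. Y n x)" for r x
  define QY where "QY r x = (\<Sum>n\<in>{Suc l..r}. (Y n x)\<^sup>2)" for r x
  have a0: "0 \<le> a" using a(1) not_empty by (meson abs_ge_zero ex_in_conv order_trans)
  have Qmeas: "Q m \<in> borel_measurable (G m)" for m
    unfolding Q_def using filtration_sum_measurable[OF f X, of "\<lambda>x. x\<^sup>2" m m l] by simp
  have XM[measurable]: "X (Suc m) \<in> borel_measurable M" for m using mdsD(2)[OF X] by auto
  have Qmono: "Q m x \<le> Q m' x" if "m \<le> m'" for m m' x
    unfolding Q_def by (rule sum_mono2) (use that in auto)
  have Ymds: "mds M G Y"
    unfolding mds_def
  proof (intro allI conjI impI)
    fix i
    have Qi[measurable]: "Q i \<in> borel_measurable (G i)" by (rule Qmeas)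
    have Qi'[measurable]: "Q i \<in> borel_measurable (G (Suc i))" by (rule filtration_measurable(2)[OF f Qi]) simp
    have Qi''[measurable]: "Q i \<in> borel_measurable M" by (rule filtration_measurable(1)[OF f Qi])
    note [measurable] = mdsD(1)[OF X, of i]
    have YG: "Y (Suc i) \<in> borel_measurable (G (Suc i))" unfolding Y_def by simp
    then show "Y (Suc i) \<in> borel_measurable (G (Suc i))" .
    note [measurable] = filtration_measurable(1)[OF f YG]
    show "integrable M (Y (Suc i))"
      by (rule Bochner_Integration.integrable_bound[OF mdsD(2)[OF X, of i]]) (auto simp: Y_def)
    fix w B assume w[measurable]: "w \<in> borel_measurable (G i)" and B: "\<forall>x\<in>space M. \<bar>w x\<bar> \<le> (B::real)"
    \<comment> \<open>The stopping indicator depends on the first i steps only, so it is absorbed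
      into the weight.\<close>
    have "(\<integral>x. (if Q i x \<le> s + 1 then w x else 0) * X (Suc i) x \<partial>M) = 0"
    proof (rule mdsD(3)[OF X, where B=B])
      fix x assume "x \<in> space M"
      then have "\<bar>w x\<bar> \<le> B" using B by auto
      then show "\<bar>if Q i x \<le> s + 1 then w x else 0\<bar> \<le> B" by auto
    qed measurable
    also have "(\<lambda>x. (if Q i x \<le> s + 1 then w x else 0) * X (Suc i) x) = (\<lambda>x. w x * Y (Suc i) x)"
      by (auto simp: Y_def)
    finally show "(\<integral>x. w x * Y (Suc i) x \<partial>M) = 0" .
  qed
  have Ya: "\<bar>Y n x\<bar> \<le> a" if "x \<in> space M" for n x using a(1)[OF that, of n] a0 by (auto simp: Y_def)
  have eq: "QY m x = Q m x \<and> SY m x = S m x" if "Q m x \<le> s + 1" for m x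
  proof -
    have "Y n x = X n x" if n: "n \<in> {Suc l..m}" for n
    proof -
      have "Q (n - 1) x \<le> Q m x" by (rule Qmono) (use n in auto)
      then show ?thesis using \<open>Q m x \<le> s + 1\<close> by (simp add: Y_def)
    qed
    then show ?thesis by (simp add: QY_def SY_def Q_def S_def)
  qed
  have QYle: "QY m x \<le> Q m x" for m x unfolding QY_def Q_def by (rule sum_mono) (auto simp: Y_def)
  have stop: "QY m x \<le> s + 1 + a\<^sup>2 \<and> (Q m x > s + 1 \<longrightarrow> QY m x > s + 1)" if x: "x \<in> space M" and "l \<le> m" for m x
    using \<open>l \<le> m\<close>
  proof (induction m rule: dec_induct)
    case base show ?case using s by (simp add: QY_def Q_def)
  next
    case (step m)
    have Q': "Q (Suc m) x = Q m x + (X (Suc m) x)\<^sup>2" "QY (Suc m) x = QY m x + (Y (Suc m) x)\<^sup>2"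
      using step by (simp_all add: Q_def QY_def)
    show ?case
    proof (cases "Q m x \<le> s + 1")
      case True
      have "(X (Suc m) x)\<^sup>2 \<le> a\<^sup>2" using a(1)[OF x, of "Suc m"] a0 by (simp add: abs_le_square_iff[symmetric])
      then show ?thesis using eq[OF True] True Q' by (auto simp: Y_def)
    next
      case False
      then show ?thesis using step Q' by (auto simp: Y_def)
    qed
  qed
  have a21: "a\<^sup>2 \<le> 1" using a(2) a0 by (simp add: power_le_one)
  have QYC: "QY r x \<le> s + 2" if "x \<in> space M" for x using stop[OF that lr] a21 by simp
  have QY0: "0 \<le> QY r x" for x unfolding QY_def by (simp add: sum_nonneg)
  \<comment> \<open>Either nothing was stopped and both variations agree, or both exceed s + 1 and
    the stopped one is the smaller, hence the nearer to s.\<close>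
  have dQ: "\<bar>QY r x - s\<bar> \<le> \<bar>Q r x - s\<bar>" if "x \<in> space M" for x
    using stop[OF that lr] QYle[of r x] eq[of r x] by (cases "Q r x \<le> s + 1") auto
  have X2: "integrable M (\<lambda>x. (X (Suc m) x)\<^sup>2)" for m
  proof (rule integrable_const_bound[where B="a\<^sup>2"])
    show "AE x in M. norm ((X (Suc m) x)\<^sup>2) \<le> a\<^sup>2"
      using a(1) a0 by (auto intro!: AE_I2 simp: abs_le_square_iff[symmetric])
  qed measurable
  have iQ: "integrable M (Q m)" for m
  proof -
    have "integrable M (\<lambda>x. (X n x)\<^sup>2)" if "n \<in> {Suc l..m}" for n using that X2 by (cases n) auto
    then show ?thesis unfolding Q_def by auto
  qed
  have id: "integrable M (\<lambda>x. \<bar>Q r x - s\<bar>)" using iQ by auto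
  define I where "I = (\<integral>x. \<bar>Q r x - s\<bar> \<partial>M)"
  note um = filtration_measurable(1)[OF f u(1)]
  have SM: "S r \<in> borel_measurable M"
    unfolding S_def using filtration_measurable(1)[OF f filtration_sum_measurable[OF f X, of "\<lambda>x. x" r r l]] by simp
  have SYM: "SY r \<in> borel_measurable M"
    unfolding SY_def using filtration_measurable(1)[OF f filtration_sum_measurable[OF f Ymds, of "\<lambda>x. x" r r l]] by simp
  have QYM: "QY r \<in> borel_measurable M"
    unfolding QY_def using filtration_measurable(1)[OF f filtration_sum_measurable[OF f Ymds, of "\<lambda>x. x\<^sup>2" r r l]] by simp
  note [measurable] = um SM SYM QYM
  let ?E0 = "\<integral>x. complex_of_real (u x) * iexp (t * S r x) \<partial>M"
  let ?E1 = "\<integral>x. complex_of_real (u x) * iexp (t * SY r x) \<partial>M"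
  let ?E2 = "\<integral>x. complex_of_real (u x) * exp (Complex (t\<^sup>2 / 2 * QY r x) (t * SY r x)) \<partial>M"
  have i0: "integrable M (\<lambda>x. complex_of_real (u x) * iexp (t * S r x))"
    by (rule integrable_const_bound[where B=1]) (use u(2) in \<open>auto simp: norm_mult\<close>)
  have i1: "integrable M (\<lambda>x. complex_of_real (u x) * iexp (t * SY r x))"
    by (rule integrable_const_bound[where B=1]) (use u(2) in \<open>auto simp: norm_mult\<close>)
  have i2: "integrable M (\<lambda>x. complex_of_real (u x) * exp (Complex (t\<^sup>2 / 2 * QY r x) (t * SY r x)))"
  proof (rule integrable_const_bound[where B="exp (t\<^sup>2 / 2 * (s + 2))"])
    have "\<bar>u x\<bar> * exp (t\<^sup>2 / 2 * QY r x) \<le> 1 * exp (t\<^sup>2 / 2 * (s + 2))" if "x \<in> space M" for x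
      using u(2)[OF that] QYC[OF that] by (intro mult_mono) (auto intro: mult_left_mono)
    then show "AE x in M. norm (complex_of_real (u x) * exp (Complex (t\<^sup>2 / 2 * QY r x) (t * SY r x))) \<le> exp (t\<^sup>2 / 2 * (s + 2))"
      by (auto simp: norm_mult)
  qed (unfold Complex_eq, measurable)
  \<comment> \<open>The sums differ only where the variation exceeds s + 1, and there 2 \<le> 2 * |Q
    - s|: Markov's inequality in pointwise form.\<close>
  have A: "norm (?E0 - ?E1) \<le> 2 * I"
  proof -
    have "norm (?E0 - ?E1) = norm (\<integral>x. complex_of_real (u x) * iexp (t * S r x) - complex_of_real (u x) * iexp (t * SY r x) \<partial>M)"
      using i0 i1 by simp
    also have "\<dots> \<le> (\<integral>x. 2 * \<bar>Q r x - s\<bar> \<partial>M)"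
    proof (rule norm_integral_le)
      fix x assume x: "x \<in> space M"
      show "norm (complex_of_real (u x) * iexp (t * S r x) - complex_of_real (u x) * iexp (t * SY r x)) \<le> 2 * \<bar>Q r x - s\<bar>"
      proof (cases "Q r x \<le> s + 1")
        case True then show ?thesis using eq[OF True] by simp
      next
        case False
        have "norm (complex_of_real (u x) * iexp (t * S r x) - complex_of_real (u x) * iexp (t * SY r x)) \<le>
           norm (complex_of_real (u x) * iexp (t * S r x)) + norm (complex_of_real (u x) * iexp (t * SY r x))"
          by (rule norm_triangle_ineq4)
        also have "\<dots> \<le> 2" using u(2)[OF x] by (simp add: norm_mult)
        finally have "norm (complex_of_real (u x) * iexp (t * S r x) - complex_of_real (u x) * iexp (t * SY r x)) \<le> 2" .
        moreover have "2 \<le> 2 * \<bar>Q r x - s\<bar>" using False abs_ge_self[of "Q r x - s"] by simp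
        ultimately show ?thesis by (rule order_trans)
      qed
    qed (use i0 i1 id in auto)
    finally show ?thesis by (simp add: I_def)
  qed
  have Bd: "norm (?E1 - exp (- t\<^sup>2 * s / 2) * ?E2) \<le> t\<^sup>2 / 2 * exp (t\<^sup>2 * (s + 2) / 2) * I"
  proof -
    have "norm (?E1 - exp (- t\<^sup>2 * s / 2) * ?E2)
       = norm (\<integral>x. complex_of_real (u x) * iexp (t * SY r x) - exp (- t\<^sup>2 * s / 2) * (complex_of_real (u x) * exp (Complex (t\<^sup>2 / 2 * QY r x) (t * SY r x))) \<partial>M)"
      using i1 i2 by simp
    also have "\<dots> \<le> (\<integral>x. t\<^sup>2 / 2 * exp (t\<^sup>2 * (s + 2) / 2) * \<bar>Q r x - s\<bar> \<partial>M)"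
    proof (rule norm_integral_le)
      fix x assume x: "x \<in> space M"
      define y where "y = t\<^sup>2 / 2 * (QY r x - s)"
      have "complex_of_real (- t\<^sup>2 * s / 2) + Complex (t\<^sup>2 / 2 * QY r x) (t * SY r x)
          = complex_of_real y + \<i> * complex_of_real (t * SY r x)"
        by (simp add: complex_eq_iff y_def field_simps)
      then have "complex_of_real (exp (- t\<^sup>2 * s / 2)) * exp (Complex (t\<^sup>2 / 2 * QY r x) (t * SY r x))
          = complex_of_real (exp y) * iexp (t * SY r x)"
        by (simp only: exp_of_real[symmetric] exp_add[symmetric])
      then have "complex_of_real (u x) * iexp (t * SY r x) - exp (- t\<^sup>2 * s / 2) * (complex_of_real (u x) * exp (Complex (t\<^sup>2 / 2 * QY r x) (t * SY r x)))
         = complex_of_real (u x) * iexp (t * SY r x) * complex_of_real (1 - exp y)"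
        by (simp add: algebra_simps)
      also have "norm \<dots> = \<bar>u x\<bar> * \<bar>1 - exp y\<bar>" by (simp only: norm_mult norm_exp_i_times norm_of_real)
      also have "\<dots> \<le> 1 * (\<bar>y\<bar> * exp \<bar>y\<bar>)"
        using u(2)[OF x] abs_exp_minus_one_le[of y] by (intro mult_mono) (auto simp: abs_minus_commute)
      also have "\<bar>y\<bar> * exp \<bar>y\<bar> \<le> (t\<^sup>2 / 2 * \<bar>Q r x - s\<bar>) * exp (t\<^sup>2 * (s + 2) / 2)"
      proof (rule mult_mono)
        show "\<bar>y\<bar> \<le> t\<^sup>2 / 2 * \<bar>Q r x - s\<bar>" using dQ[OF x] by (auto simp: y_def abs_mult intro: mult_left_mono)
        have "\<bar>QY r x - s\<bar> \<le> s + 2" using QYC[OF x] QY0[of x] s by linarith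
        then have "\<bar>y\<bar> \<le> t\<^sup>2 / 2 * (s + 2)" by (auto simp: y_def abs_mult intro: mult_left_mono)
        then show "exp \<bar>y\<bar> \<le> exp (t\<^sup>2 * (s + 2) / 2)" by simp
      qed auto
      finally show "norm (complex_of_real (u x) * iexp (t * SY r x) - exp (- t\<^sup>2 * s / 2) * (complex_of_real (u x) * exp (Complex (t\<^sup>2 / 2 * QY r x) (t * SY r x))))
         \<le> t\<^sup>2 / 2 * exp (t\<^sup>2 * (s + 2) / 2) * \<bar>Q r x - s\<bar>" by (simp add: mult_ac)
    qed (use i1 i2 id in auto)
    finally show ?thesis by (simp add: I_def)
  qed
  have Cd: "norm (exp (- t\<^sup>2 * s / 2) * ?E2 - exp (- t\<^sup>2 * s / 2) * (\<integral>x. u x \<partial>M)) \<le> 5 * \<bar>t\<bar> ^ 3 * exp (t\<^sup>2 / 2 * (s + 2)) * (s + 2) * a"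
  proof -
    have "norm (?E2 - (\<integral>x. u x \<partial>M)) \<le> 5 * \<bar>t\<bar> ^ 3 * exp (t\<^sup>2 / 2 * (s + 2)) * a * (\<integral>x. QY r x \<partial>M)"
      unfolding QY_def SY_def
      by (rule exponential_martingale_bound[OF f Ymds _ a(3) _ u lr]) (use Ya QYC in \<open>auto simp: QY_def\<close>)
    also have "\<dots> \<le> 5 * \<bar>t\<bar> ^ 3 * exp (t\<^sup>2 / 2 * (s + 2)) * a * (s + 2)"
    proof (rule mult_left_mono)
      have "integrable M (QY r)" by (rule integrable_const_bound[where B="s+2"]) (use QYC QY0 in auto)
      then have "(\<integral>x. QY r x \<partial>M) \<le> (\<integral>x. s + 2 \<partial>M)" by (rule integral_mono) (use QYC in auto)
      then show "(\<integral>x. QY r x \<partial>M) \<le> s + 2" by (simp add: prob_space)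
    qed (use a0 in auto)
    finally have *: "norm (?E2 - (\<integral>x. u x \<partial>M)) \<le> 5 * \<bar>t\<bar> ^ 3 * exp (t\<^sup>2 / 2 * (s + 2)) * a * (s + 2)" .
    have "exp (- t\<^sup>2 * s / 2) \<le> 1" using s by simp
    have "norm (exp (- t\<^sup>2 * s / 2) * ?E2 - exp (- t\<^sup>2 * s / 2) * (\<integral>x. u x \<partial>M)) = exp (- t\<^sup>2 * s / 2) * norm (?E2 - (\<integral>x. u x \<partial>M))"
      by (simp only: right_diff_distrib[symmetric] of_real_mult norm_mult norm_of_real) simp
    also have "\<dots> \<le> 1 * norm (?E2 - (\<integral>x. u x \<partial>M))"
      using \<open>exp (- t\<^sup>2 * s / 2) \<le> 1\<close> by (intro mult_right_mono) auto
    finally show ?thesis using * by (simp add: mult_ac)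
  qed
  have tri: "norm (a - d) \<le> norm (a - b) + norm (b - c) + norm (c - d)" for a b c d :: complex
    using norm_triangle_ineq[of "a - b" "b - c"] norm_triangle_ineq[of "a - c" "c - d"] by simp
  have "norm (?E0 - exp (- t\<^sup>2 * s / 2) * (\<integral>x. u x \<partial>M)) \<le> norm (?E0 - ?E1) + norm (?E1 - exp (- t\<^sup>2 * s / 2) * ?E2)
     + norm (exp (- t\<^sup>2 * s / 2) * ?E2 - exp (- t\<^sup>2 * s / 2) * (\<integral>x. u x \<partial>M))"
    by (rule tri)
  also have "\<dots> \<le> 2 * I + t\<^sup>2 / 2 * exp (t\<^sup>2 * (s + 2) / 2) * I + 5 * \<bar>t\<bar> ^ 3 * exp (t\<^sup>2 / 2 * (s + 2)) * (s + 2) * a"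
    using A Bd Cd by linarith
  finally show ?thesis by (simp add: S_def I_def Q_def distrib_right)
qed

section \<open>Truncation\<close>

text \<open>The recentring is clipped so that the bound holds everywhere and not only almost
  everywhere.\<close>

definition trunc_center :: "'a measure \<Rightarrow> (nat \<Rightarrow> 'a measure) \<Rightarrow> real \<Rightarrow> (nat \<Rightarrow> 'a \<Rightarrow> real) \<Rightarrow> nat \<Rightarrow> 'a \<Rightarrow> real" where
  "trunc_center M G a X n x = (if n = 0 then 0 else
     X n x * indicator {x. \<bar>X n x\<bar> \<le> a} x
     - max (- a) (min a (real_cond_exp M (G (n - 1)) (\<lambda>x. X n x * indicator {x. \<bar>X n x\<bar> \<le> a} x) x)))"

text \<open>The Lindeberg term: the part of the second moment carried by large values.\<close>

definition exceed2 :: "'a measure \<Rightarrow> real \<Rightarrow> ('a \<Rightarrow> real) \<Rightarrow> real" where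
  "exceed2 M a f = (\<integral>x. (f x)\<^sup>2 * indicator {x. a < \<bar>f x\<bar>} x \<partial>M)"

context prob_space
begin

text \<open>On the discarded tail |X| \<le> X^2 / a, so cutting costs \<open>exceed2 / a\<close> in
  L1. The conditional mean of X is zero, so that of the kept part is minus that of the tail and
  costs no more; this gives the factor 2. For the squares, X^2 - Y^2 is the tail plus (2 T - p) p
  with |2 T - p| \<le> 3 a, and 1 + 3 gives the factor 4.\<close>

lemma trunc_center:
  assumes f: "filtration_on M G" and X: "mds M G X"
    and X2: "\<And>i. integrable M (\<lambda>x. (X (Suc i) x)\<^sup>2)" and a: "0 < a"
  defines "Y \<equiv> trunc_center M G a X"
  shows trunc_center_mds: "mds M G Y"
    and trunc_center_bound: "\<bar>Y n x\<bar> \<le> 2 * a"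
    and trunc_center_diff: "integrable M (\<lambda>x. X (Suc i) x - Y (Suc i) x)"
       "(\<integral>x. \<bar>X (Suc i) x - Y (Suc i) x\<bar> \<partial>M) \<le> 2 * exceed2 M a (X (Suc i)) / a"
    and trunc_center_diff2: "integrable M (\<lambda>x. (X (Suc i) x)\<^sup>2 - (Y (Suc i) x)\<^sup>2)"
      "(\<integral>x. \<bar>(X (Suc i) x)\<^sup>2 - (Y (Suc i) x)\<^sup>2\<bar> \<partial>M) \<le> 4 * exceed2 M a (X (Suc i))"
proof -
  define T where "T i x = X (Suc i) x * indicator {x. \<bar>X (Suc i) x\<bar> \<le> a} x" for i x
  define q where "q i = real_cond_exp M (G i) (T i)" for i
  define p where "p i x = max (- a) (min a (q i x))" for i x
  have YS: "Y (Suc i) x = T i x - p i x" for i x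
    by (simp add: Y_def trunc_center_def T_def[abs_def] q_def p_def)
  note [measurable] = mdsD(1)[OF X]
  have XM[measurable]: "X (Suc m) \<in> borel_measurable M" for m using mdsD(2)[OF X] by auto
  have TG[measurable]: "T i \<in> borel_measurable (G (Suc i))" for i unfolding T_def by measurable
  have TM[measurable]: "T i \<in> borel_measurable M" for i unfolding T_def by measurable
  have qG[measurable]: "q i \<in> borel_measurable (G i)" for i unfolding q_def by measurable
  have qM[measurable]: "q i \<in> borel_measurable M" for i by (rule filtration_measurable(1)[OF f qG])
  have pG[measurable]: "p i \<in> borel_measurable (G i)" for i unfolding p_def by measurable
  have pM[measurable]: "p i \<in> borel_measurable M" for i by (rule filtration_measurable(1)[OF f pG])
  have Tb: "\<bar>T i x\<bar> \<le> a" for i x using a by (auto simp: T_def indicator_def)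
  have pb: "\<bar>p i x\<bar> \<le> a" for i x using a by (auto simp: p_def)
  show Yb: "\<bar>Y n x\<bar> \<le> 2 * a" for n x
  proof (cases n)
    case 0 then show ?thesis using a by (simp add: Y_def trunc_center_def)
  next
    case (Suc i) then show ?thesis using Tb[of i x] pb[of i x] unfolding Suc YS by linarith
  qed
  have iT: "integrable M (T i)" for i by (rule integrable_const_bound[where B=a]) (use Tb in auto)
  have ip: "integrable M (p i)" for i by (rule integrable_const_bound[where B=a]) (use pb in auto)
  have cond: "sigma_finite_subalgebra M (G i)" for i
    by (rule finite_measure_subalgebra_is_sigma_finite)
       (simp add: finite_measure_subalgebra_def finite_measure_axioms finite_measure_subalgebra_axioms_def filtration_onD[OF f])
  have pq: "AE x in M. p i x = q i x" for i
  proof -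
    interpret sigma_finite_subalgebra M "G i" by (rule cond)
    have "AE x in M. q i x \<le> a" unfolding q_def
      by (rule real_cond_exp_le_c[OF iT]) (use Tb in \<open>auto simp: abs_le_iff\<close>)
    moreover have "AE x in M. - a \<le> q i x" unfolding q_def
      by (rule real_cond_exp_ge_c[OF iT]) (use Tb in \<open>auto simp: abs_le_iff minus_le_iff\<close>)
    ultimately show ?thesis by eventually_elim (auto simp: p_def)
  qed
  have orth: "integrable M (\<lambda>x. w x * q i x)" "(\<integral>x. w x * q i x \<partial>M) = (\<integral>x. w x * T i x \<partial>M)"
    if w: "w \<in> borel_measurable (G i)" and B: "\<And>x. x \<in> space M \<Longrightarrow> \<bar>w x\<bar> \<le> B" for w B i
  proof -
    interpret sigma_finite_subalgebra M "G i" by (rule cond)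
    have wM[measurable]: "w \<in> borel_measurable M" by (rule filtration_measurable(1)[OF f w])
    have "integrable M (\<lambda>x. w x * T i x)"
    proof (rule integrable_const_bound[where B="B * a"])
      show "AE x in M. norm (w x * T i x) \<le> B * a"
      proof (rule AE_I2)
        fix x assume x: "x \<in> space M"
        have "0 \<le> B" using B[OF x] by linarith
        then show "norm (w x * T i x) \<le> B * a" unfolding real_norm_def abs_mult using B[OF x] Tb by (intro mult_mono) auto
      qed
    qed measurable
    from real_cond_exp_intg[OF this w TM]
    show "integrable M (\<lambda>x. w x * q i x)" "(\<integral>x. w x * q i x \<partial>M) = (\<integral>x. w x * T i x \<partial>M)"
      by (simp_all add: q_def)
  qed
  show Ym: "mds M G Y"
    unfolding mds_def
  proof (intro allI conjI impI)
    fix i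
    have [measurable]: "p i \<in> borel_measurable (G (Suc i))" by (rule filtration_measurable(2)[OF f pG]) simp
    show "Y (Suc i) \<in> borel_measurable (G (Suc i))" unfolding YS by measurable
    show "integrable M (Y (Suc i))" unfolding YS using iT ip by auto
    fix w B assume w[measurable]: "w \<in> borel_measurable (G i)" and B: "\<forall>x\<in>space M. \<bar>w x\<bar> \<le> (B::real)"
    have wM[measurable]: "w \<in> borel_measurable M" by (rule filtration_measurable(1)[OF f w])
    have iw: "integrable M (\<lambda>x. w x * g x)" if "integrable M g" for g :: "'a \<Rightarrow> real"
    proof (rule Bochner_Integration.integrable_bound)
      show "integrable M (\<lambda>x. B * g x)" using that by auto
      show "(\<lambda>x. w x * g x) \<in> borel_measurable M" using that by measurable
      show "AE x in M. norm (w x * g x) \<le> norm (B * g x)"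
      proof (rule AE_I2)
        fix x assume "x \<in> space M"
        then have "\<bar>w x\<bar> \<le> \<bar>B\<bar>" using B by fastforce
        then show "norm (w x * g x) \<le> norm (B * g x)" by (simp add: abs_mult mult_right_mono)
      qed
    qed
    have "(\<integral>x. w x * Y (Suc i) x \<partial>M) = (\<integral>x. w x * T i x \<partial>M) - (\<integral>x. w x * p i x \<partial>M)"
      unfolding YS right_diff_distrib using iw iT ip by simp
    also have "(\<integral>x. w x * p i x \<partial>M) = (\<integral>x. w x * q i x \<partial>M)"
      by (rule integral_cong_AE) (use pq[of i] in auto)
    also have "\<dots> = (\<integral>x. w x * T i x \<partial>M)" using orth(2)[OF w, of B] B by simp
    finally show "(\<integral>x. w x * Y (Suc i) x \<partial>M) = 0" by simp
  qed
  have ie: "integrable M (\<lambda>x. (X (Suc i) x)\<^sup>2 * indicator {x. a < \<bar>X (Suc i) x\<bar>} x)" for i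
    by (rule Bochner_Integration.integrable_bound[OF X2[of i]]) (auto simp: indicator_def)
  have XT: "\<bar>X (Suc i) x - T i x\<bar> \<le> (X (Suc i) x)\<^sup>2 * indicator {x. a < \<bar>X (Suc i) x\<bar>} x / a" for i x
  proof (cases "a < \<bar>X (Suc i) x\<bar>")
    case True
    have "a * \<bar>X (Suc i) x\<bar> \<le> \<bar>X (Suc i) x\<bar> * \<bar>X (Suc i) x\<bar>" using True by (intro mult_right_mono) auto
    then show ?thesis using True a by (simp add: T_def field_simps power2_eq_square)
  qed (auto simp: T_def)
  have iX: "integrable M (X (Suc i))" for i by (rule mdsD(2)[OF X])
  have e1: "(\<integral>x. \<bar>X (Suc i) x - T i x\<bar> \<partial>M) \<le> exceed2 M a (X (Suc i)) / a" for i
  proof -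
    have "(\<integral>x. \<bar>X (Suc i) x - T i x\<bar> \<partial>M) \<le> (\<integral>x. (X (Suc i) x)\<^sup>2 * indicator {x. a < \<bar>X (Suc i) x\<bar>} x / a \<partial>M)"
      using ie iX iT by (intro integral_mono XT) auto
    then show ?thesis by (simp add: exceed2_def)
  qed
  have e2: "(\<integral>x. \<bar>p i x\<bar> \<partial>M) \<le> exceed2 M a (X (Suc i)) / a" for i
  proof -
    \<comment> \<open>The sign of q is a bounded weight from the past. Against it q may be replaced
      by T, and X integrates to zero, so E|q| becomes an integral of T - X.\<close>
    have sg: "(\<lambda>x. sgn (q i x)) \<in> borel_measurable (G i)" by measurable
    have b1: "\<bar>sgn (q i x)\<bar> \<le> 1" for x by (simp add: sgn_if)
    note o = orth[OF sg b1]
    have qs: "\<bar>q i x\<bar> = sgn (q i x) * q i x" for x by (simp add: sgn_if)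
    have iq: "integrable M (\<lambda>x. \<bar>q i x\<bar>)" unfolding qs by (rule o)
    have [measurable]: "(\<lambda>x. sgn (q i x)) \<in> borel_measurable M" by measurable
    have isX: "integrable M (\<lambda>x. sgn (q i x) * X (Suc i) x)" "integrable M (\<lambda>x. sgn (q i x) * T i x)"
      by (rule Bochner_Integration.integrable_bound[OF iX[of i]], auto simp: abs_mult sgn_if)
         (rule Bochner_Integration.integrable_bound[OF iT[of i]], auto simp: abs_mult sgn_if)
    have "(\<integral>x. \<bar>p i x\<bar> \<partial>M) \<le> (\<integral>x. \<bar>q i x\<bar> \<partial>M)"
    proof (rule integral_mono)
      show "\<bar>p i x\<bar> \<le> \<bar>q i x\<bar>" for x using a by (auto simp: p_def)
    qed (use ip[of i] iq in auto)
    also have "\<dots> = (\<integral>x. sgn (q i x) * T i x \<partial>M)" unfolding qs by (rule o(2))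
    also have "\<dots> = (\<integral>x. sgn (q i x) * T i x \<partial>M) - (\<integral>x. sgn (q i x) * X (Suc i) x \<partial>M)"
      using mdsD(3)[OF X sg b1] by simp
    also have "\<dots> = (\<integral>x. sgn (q i x) * T i x - sgn (q i x) * X (Suc i) x \<partial>M)" using isX by simp
    also have "\<dots> \<le> (\<integral>x. \<bar>X (Suc i) x - T i x\<bar> \<partial>M)"
      by (rule integral_mono) (use isX iX[of i] iT[of i] in \<open>auto simp: sgn_if\<close>)
    also note e1
    finally show ?thesis .
  qed
  show id: "integrable M (\<lambda>x. X (Suc i) x - Y (Suc i) x)" for i unfolding YS using iX iT ip by auto
  show "(\<integral>x. \<bar>X (Suc i) x - Y (Suc i) x\<bar> \<partial>M) \<le> 2 * exceed2 M a (X (Suc i)) / a" for i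
  proof -
    have "(\<integral>x. \<bar>X (Suc i) x - Y (Suc i) x\<bar> \<partial>M) \<le> (\<integral>x. \<bar>X (Suc i) x - T i x\<bar> + \<bar>p i x\<bar> \<partial>M)"
      by (rule integral_mono) (use id[of i] iX[of i] iT[of i] ip[of i] in \<open>auto simp: YS\<close>)
    also have "\<dots> = (\<integral>x. \<bar>X (Suc i) x - T i x\<bar> \<partial>M) + (\<integral>x. \<bar>p i x\<bar> \<partial>M)"
      using iX[of i] iT[of i] ip[of i] by simp
    finally show ?thesis using e1[of i] e2[of i] by (simp add: field_simps)
  qed
  have iY2: "integrable M (\<lambda>x. (Y (Suc i) x)\<^sup>2)" for i
  proof (rule integrable_const_bound[where B="(2 * a)\<^sup>2"])
    have "(Y (Suc i) x)\<^sup>2 \<le> (2*a)\<^sup>2" for x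
      using Yb[of "Suc i" x] a by (subst abs_le_square_iff[symmetric]) auto
    then show "AE x in M. norm ((Y (Suc i) x)\<^sup>2) \<le> (2*a)\<^sup>2"
      by (auto intro!: AE_I2)
  qed (use mdsD(2)[OF Ym] in auto)
  show id2: "integrable M (\<lambda>x. (X (Suc i) x)\<^sup>2 - (Y (Suc i) x)\<^sup>2)" for i using X2 iY2 by auto
  show "(\<integral>x. \<bar>(X (Suc i) x)\<^sup>2 - (Y (Suc i) x)\<^sup>2\<bar> \<partial>M) \<le> 4 * exceed2 M a (X (Suc i))" for i
  proof -
    have "(\<integral>x. \<bar>(X (Suc i) x)\<^sup>2 - (Y (Suc i) x)\<^sup>2\<bar> \<partial>M)
       \<le> (\<integral>x. (X (Suc i) x)\<^sup>2 * indicator {x. a < \<bar>X (Suc i) x\<bar>} x + 3 * a * \<bar>p i x\<bar> \<partial>M)"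
    proof (rule integral_mono)
      fix x
      have "(X (Suc i) x)\<^sup>2 - (Y (Suc i) x)\<^sup>2 = (X (Suc i) x)\<^sup>2 * indicator {x. a < \<bar>X (Suc i) x\<bar>} x + (2 * T i x - p i x) * p i x"
        by (auto simp: YS T_def indicator_def power2_eq_square algebra_simps)
      also have "\<bar>\<dots>\<bar> \<le> (X (Suc i) x)\<^sup>2 * indicator {x. a < \<bar>X (Suc i) x\<bar>} x + \<bar>2 * T i x - p i x\<bar> * \<bar>p i x\<bar>"
        by (rule order_trans[OF abs_triangle_ineq]) (simp add: abs_mult)
      also have "\<dots> \<le> (X (Suc i) x)\<^sup>2 * indicator {x. a < \<bar>X (Suc i) x\<bar>} x + 3 * a * \<bar>p i x\<bar>"
        using Tb[of i x] pb[of i x] by (intro add_left_mono mult_right_mono) auto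
      finally show "\<bar>(X (Suc i) x)\<^sup>2 - (Y (Suc i) x)\<^sup>2\<bar> \<le> (X (Suc i) x)\<^sup>2 * indicator {x. a < \<bar>X (Suc i) x\<bar>} x + 3 * a * \<bar>p i x\<bar>" .
    qed (use id2[of i] ie[of i] ip[of i] in auto)
    also have "\<dots> = exceed2 M a (X (Suc i)) + 3 * a * (\<integral>x. \<bar>p i x\<bar> \<partial>M)"
      using ie[of i] ip[of i] by (simp add: exceed2_def)
    also have "\<dots> \<le> exceed2 M a (X (Suc i)) + 3 * a * (exceed2 M a (X (Suc i)) / a)"
      using a by (intro add_left_mono mult_left_mono e2) auto
    finally show ?thesis using a by simp
  qed
qed

end

section \<open>A maximal inequality\<close>

lemma exp_quadratic_le: "exp (y - 2 * y\<^sup>2) \<le> 1 + y" if "\<bar>y\<bar> \<le> 1/2" for y :: real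
proof -
  have "y - 2 * y\<^sup>2 \<le> ln (1 + y)" using abs_ln_one_plus_x_minus_x_bound[OF that] by linarith
  then show ?thesis using that by (subst ln_ge_iff[symmetric]) auto
qed

context prob_space
begin

text \<open>By \<open>exp_quadratic_le\<close> each factor is at most 1 + t X, so the process is a
  supermartingale; the coefficient 2 comes from ln (1 + y) \<ge> y - 2 y^2 for |y| \<le> 1/2.
  Freezing it at \<open>K\<close> on first passage keeps the expectation at most 1, and the maximum
  is then read off the final time by Markov's inequality.\<close>

lemma exp_supermartingale_max:
  fixes X :: "nat \<Rightarrow> 'a \<Rightarrow> real"
  assumes f: "filtration_on M G" and X: "mds M G X"
    and a: "\<And>n x. x \<in> space M \<Longrightarrow> \<bar>X n x\<bar> \<le> a" "\<bar>t\<bar> * a \<le> 1/2" and K: "0 < K"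
    and lr: "l \<le> r"
  shows "prob {x\<in>space M. \<exists>m\<in>{l..r}. K \<le> exp (t * (\<Sum>n\<in>{Suc l..m}. X n x) - 2 * t\<^sup>2 * (\<Sum>n\<in>{Suc l..m}. (X n x)\<^sup>2))} \<le> 1 / K"
proof -
  define Z where "Z m x = exp (t * (\<Sum>n\<in>{Suc l..m}. X n x) - 2 * t\<^sup>2 * (\<Sum>n\<in>{Suc l..m}. (X n x)\<^sup>2))" for m x
  define V where "V m x = (if \<forall>j\<in>{l..m}. Z j x < K then Z m x else K)" for m x
  have ZG: "Z m \<in> borel_measurable (G m')" if "m \<le> m'" for m m'
  proof -
    note [measurable] = filtration_sum_measurable[OF f X _ that, of "\<lambda>x. x" l, simplified]
      filtration_sum_measurable[OF f X _ that, of "\<lambda>x. x\<^sup>2" l, simplified]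
    show ?thesis unfolding Z_def by measurable
  qed
  have ZM[measurable]: "Z m \<in> borel_measurable M" for m by (rule filtration_measurable(1)[OF f ZG[OF order_refl]])
  have VM[measurable]: "V m \<in> borel_measurable M" for m unfolding V_def by measurable
  have a0: "0 \<le> a" using a(1) not_empty by (meson abs_ge_zero ex_in_conv order_trans)
  define B where "B m = exp (\<bar>t\<bar> * (real m * a))" for m
  have ZB: "Z m x \<le> B m" if "x \<in> space M" for m x
  proof -
    have "\<bar>\<Sum>n\<in>{Suc l..m}. X n x\<bar> \<le> (\<Sum>n\<in>{Suc l..m}. a)"
      by (rule order_trans[OF sum_abs sum_mono]) (rule a(1)[OF that])
    also have "\<dots> \<le> real m * a" using a0 by (auto intro!: mult_right_mono)
    finally have "\<bar>t * (\<Sum>n\<in>{Suc l..m}. X n x)\<bar> \<le> \<bar>t\<bar> * (real m * a)" by (auto simp: abs_mult intro: mult_left_mono)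
    moreover have "0 \<le> 2 * t\<^sup>2 * (\<Sum>n\<in>{Suc l..m}. (X n x)\<^sup>2)" by (simp add: sum_nonneg)
    ultimately show ?thesis unfolding Z_def B_def by auto
  qed
  have Zpos: "0 < Z m x" for m x by (simp add: Z_def)
  have iV: "integrable M (V m)" for m
  proof (rule integrable_const_bound[where B="max K (B m)"])
    show "AE x in M. norm (V m x) \<le> max K (B m)"
      using ZB K Zpos by (auto intro!: AE_I2 simp: V_def less_imp_le le_max_iff_disj)
  qed measurable
  have XM[measurable]: "X (Suc m) \<in> borel_measurable M" for m using mdsD(2)[OF X] by auto
  have "(\<integral>x. V m x \<partial>M) \<le> 1" if "l \<le> m" for m
    using that
  proof (induction m rule: dec_induct)
    case base
    have "(\<integral>x. V l x \<partial>M) \<le> (\<integral>x. 1 \<partial>M)"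
      by (rule integral_mono[OF iV]) (auto simp: V_def Z_def)
    then show ?case by (simp add: prob_space)
  next
    case (step m)
    let ?w = "\<lambda>x. if \<forall>j\<in>{l..m}. Z j x < K then Z m x else 0"
    let ?X = "X (Suc m)"
    have wG: "?w \<in> borel_measurable (G m)"
    proof -
      have [measurable]: "Z j \<in> borel_measurable (G m)" if "j \<in> {l..m}" for j using ZG that by auto
      have [measurable]: "Z m \<in> borel_measurable (G m)" using ZG by auto
      show ?thesis by measurable
    qed
    have o: "(\<integral>x. ?w x * ?X x \<partial>M) = 0"
      by (rule mdsD(3)[OF X wG, where B="B m"]) (use ZB Zpos in \<open>auto simp: B_def less_imp_le\<close>)
    have io: "integrable M (\<lambda>x. ?w x * ?X x)"
    proof (rule integrable_const_bound[where B="B m * a"])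
      show "AE x in M. norm (?w x * ?X x) \<le> B m * a"
        using ZB Zpos a(1) a0 by (auto intro!: AE_I2 mult_mono simp: norm_mult abs_mult B_def less_imp_le)
    qed (use filtration_measurable(1)[OF f wG] in measurable)
    have "(\<integral>x. V (Suc m) x \<partial>M) \<le> (\<integral>x. V m x + t * (?w x * ?X x) \<partial>M)"
    proof (rule integral_mono[OF iV])
      fix x assume x: "x \<in> space M"
      have "\<bar>t * ?X x\<bar> \<le> \<bar>t\<bar> * a" using a(1)[OF x] by (auto simp: abs_mult intro: mult_left_mono)
      then have t1: "\<bar>t * ?X x\<bar> \<le> 1/2" using a(2) by linarith
      have "Z (Suc m) x = Z m x * exp (t * ?X x - 2 * (t * ?X x)\<^sup>2)"
        using step by (simp add: Z_def algebra_simps power_mult_distrib flip: exp_add)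
      also have "\<dots> \<le> Z m x * (1 + t * ?X x)"
        using exp_quadratic_le[OF t1] Zpos by (intro mult_left_mono) (auto simp: less_imp_le)
      finally have Z: "Z (Suc m) x \<le> Z m x + t * (Z m x * ?X x)" by (simp add: algebra_simps)
      show "V (Suc m) x \<le> V m x + t * (?w x * ?X x)"
      proof (cases "\<forall>j\<in>{l..m}. Z j x < K")
        case True
        \<comment> \<open>A passage at this very step replaces the value by \<open>K\<close>, which
          is no larger than the process itself.\<close>
        then have "V (Suc m) x = min K (Z (Suc m) x) \<or> V (Suc m) x \<le> Z (Suc m) x"
          by (auto simp: V_def not_less atLeastAtMostSuc_conv le_SucI step)
        then have "V (Suc m) x \<le> Z (Suc m) x" by auto
        then show ?thesis using Z True by (simp add: V_def)
      next
        case False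
        then have "\<not> (\<forall>j\<in>{l..Suc m}. Z j x < K)" by fastforce
        then have "V (Suc m) x = K" "V m x = K" "?w x = 0" using False unfolding V_def by (simp_all only: if_False)
        then show ?thesis by simp
      qed
    qed (use iV io in auto)
    also have "\<dots> = (\<integral>x. V m x \<partial>M)" using iV[of m] io o by simp
    finally show ?case using step by simp
  qed
  from this[OF lr] have V1: "(\<integral>x. V r x \<partial>M) \<le> 1" .
  have "prob {x\<in>space M. \<exists>m\<in>{l..r}. K \<le> Z m x} \<le> prob {x\<in>space M. K \<le> V r x}"
    by (rule finite_measure_mono) (auto simp: V_def not_less[symmetric])
  also have "\<dots> \<le> (\<integral>x. V r x \<partial>M) / K"
    by (rule integral_Markov_inequality_measure[OF iV]) (use Zpos K in \<open>auto simp: V_def less_imp_le\<close>)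
  also have "\<dots> \<le> 1 / K" using V1 K by (simp add: divide_right_mono)
  finally show ?thesis by (simp add: Z_def)
qed

text \<open>Where the variation is at most q, a deviation e forces the exponential with parameter t
  or - t above exp (t e - 2 t^2 q). The choice t = e / (4 q) maximises this exponent, at e^2 / (8
  q); the factor 2 counts the two signs.\<close>

lemma mds_max_bound:
  fixes X :: "nat \<Rightarrow> 'a \<Rightarrow> real"
  assumes f: "filtration_on M G" and X: "mds M G X"
    and a: "\<And>n x. x \<in> space M \<Longrightarrow> \<bar>X n x\<bar> \<le> a" "e / (4 * q) * a \<le> 1/2" and eq: "0 < e" "0 < q"
    and lr: "l \<le> r"
  shows "prob {x\<in>space M. \<exists>m\<in>{l..r}. e \<le> \<bar>\<Sum>n\<in>{Suc l..m}. X n x\<bar>}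
     \<le> prob {x\<in>space M. q < (\<Sum>n\<in>{Suc l..r}. (X n x)\<^sup>2)} + 2 * exp (- e\<^sup>2 / (8 * q))"
proof -
  define t where "t = e / (4 * q)"
  define K where "K = exp (e\<^sup>2 / (8 * q))"
  have Kt: "K = exp (t * e - 2 * t\<^sup>2 * q)"
    using eq by (simp add: K_def t_def field_simps power2_eq_square)
  let ?S = "\<lambda>m x. \<Sum>n\<in>{Suc l..m}. X n x" let ?Q = "\<lambda>m x. \<Sum>n\<in>{Suc l..m}. (X n x)\<^sup>2"
  have t0: "0 < t" using eq by (simp add: t_def)
  have SM: "?S m \<in> borel_measurable M" for m
    using filtration_measurable(1)[OF f filtration_sum_measurable[OF f X, of "\<lambda>x. x" m m l]] by simp
  have QM: "?Q m \<in> borel_measurable M" for m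
    using filtration_measurable(1)[OF f filtration_sum_measurable[OF f X, of "\<lambda>x. x\<^sup>2" m m l]] by simp
  note [measurable] = SM QM
  let ?A = "\<lambda>t. {x\<in>space M. \<exists>m\<in>{l..r}. K \<le> exp (t * ?S m x - 2 * t\<^sup>2 * ?Q m x)}"
  let ?B = "{x\<in>space M. q < ?Q r x}"
  have A: "prob (?A t') \<le> 1 / K" if "\<bar>t'\<bar> * a \<le> 1/2" for t'
    by (rule exp_supermartingale_max[OF f X a(1) that _ lr]) (auto simp: K_def)
  have sub: "{x\<in>space M. \<exists>m\<in>{l..r}. e \<le> \<bar>?S m x\<bar>} \<subseteq> ?B \<union> (?A t \<union> ?A (-t))"
  proof (clarsimp, goal_cases)
    case (1 x m)
    have Q: "?Q m x \<le> ?Q r x" by (rule sum_mono2) (use 1 in auto)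
    have "t * e - 2 * t\<^sup>2 * q \<le> t * \<bar>?S m x\<bar> - 2 * t\<^sup>2 * ?Q m x"
      using Q 1 t0 by (intro diff_mono mult_left_mono) auto
    then have K: "K \<le> exp (t * \<bar>?S m x\<bar> - 2 * t\<^sup>2 * ?Q m x)" by (simp add: Kt)
    show ?case
    proof (cases "0 \<le> ?S m x")
      case True
      then show ?thesis using K 1 by auto
    next
      case False
      then have "K \<le> exp (- (t * ?S m x) - 2 * t\<^sup>2 * ?Q m x)" using K by simp
      then show ?thesis using 1 by auto
    qed
  qed
  have "prob {x\<in>space M. \<exists>m\<in>{l..r}. e \<le> \<bar>?S m x\<bar>} \<le> prob (?B \<union> (?A t \<union> ?A (-t)))"
    by (rule finite_measure_mono[OF sub]) measurable
  also have "\<dots> \<le> prob ?B + prob (?A t \<union> ?A (-t))" by (rule measure_Un_le) measurable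
  also have "\<dots> \<le> prob ?B + (prob (?A t) + prob (?A (-t)))"
    by (intro add_left_mono measure_Un_le) measurable
  also have "\<dots> \<le> prob ?B + (1 / K + 1 / K)"
    using a(2) t0 by (intro add_left_mono add_mono A) (auto simp: t_def[symmetric])
  also have "1 / K = exp (- e\<^sup>2 / (8 * q))" by (simp add: K_def exp_minus inverse_eq_divide)
  finally show ?thesis by simp
qed

end

section \<open>The martingale decomposition\<close>

lemma (in prob_space) integrable_of_square:
  assumes [measurable]: "f \<in> borel_measurable M" and "integrable M (\<lambda>x. (f x)\<^sup>2)"
  shows "integrable M (f :: 'a \<Rightarrow> real)"
proof (rule Bochner_Integration.integrable_bound)
  show "integrable M (\<lambda>x. 1 + (f x)\<^sup>2)" using assms(2) by simp
  have "\<bar>y\<bar> \<le> 1 + y\<^sup>2" for y :: real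
    using sum_squares_bound[of 1 "\<bar>y\<bar>"] by simp
  then show "AE x in M. norm (f x) \<le> norm (1 + (f x)\<^sup>2)" by (auto intro!: AE_I2)
qed simp

lemma (in prob_space) L2_norm_leD:
  assumes [measurable]: "f \<in> borel_measurable M" and "L2_norm_le M f c"
  shows "integrable M (\<lambda>x. (f x)\<^sup>2)" "(\<integral>x. (f x)\<^sup>2 \<partial>M) \<le> c\<^sup>2"
proof -
  have le: "(\<integral>\<^sup>+x. ennreal ((f x)\<^sup>2) \<partial>M) \<le> ennreal (c\<^sup>2)" using assms(2) by (simp add: L2_norm_le_def)
  show i: "integrable M (\<lambda>x. (f x)\<^sup>2)"
    by (rule integrableI_bounded) (use le in \<open>auto intro: le_less_trans\<close>)
  have "ennreal (\<integral>x. (f x)\<^sup>2 \<partial>M) \<le> ennreal (c\<^sup>2)"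
    using le nn_integral_eq_integral[OF i] by simp
  then show "(\<integral>x. (f x)\<^sup>2 \<partial>M) \<le> c\<^sup>2" by (simp add: ennreal_le_iff)
qed

lemma (in prob_space) cond_exp_L2:
  assumes [measurable]: "f \<in> borel_measurable M" and f2: "integrable M (\<lambda>x. (f x)\<^sup>2)" and F: "subalgebra M F"
  shows "integrable M (\<lambda>x. (real_cond_exp M F f x)\<^sup>2)"
    and "(\<integral>x. (real_cond_exp M F f x)\<^sup>2 \<partial>M) \<le> (\<integral>x. (f x)\<^sup>2 \<partial>M)"
proof -
  interpret sigma_finite_subalgebra M F
    by (rule finite_measure_subalgebra_is_sigma_finite)
       (simp add: finite_measure_subalgebra_def finite_measure_axioms finite_measure_subalgebra_axioms_def F)
  have i: "integrable M f" by (rule integrable_of_square[OF _ f2]) simp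
  have J: "AE x in M. (real_cond_exp M F f x)\<^sup>2 \<le> real_cond_exp M F (\<lambda>x. (f x)\<^sup>2) x"
    using real_cond_exp_jensens_inequality(2)[where q="\<lambda>x. x\<^sup>2" and I=UNIV, OF i _ _ f2] convex_power2 by auto
  have ic: "integrable M (real_cond_exp M F (\<lambda>x. (f x)\<^sup>2))" by (rule real_cond_exp_int(1)[OF f2])
  have "AE x in M. norm ((real_cond_exp M F f x)\<^sup>2) \<le> norm (real_cond_exp M F (\<lambda>x. (f x)\<^sup>2) x)"
    using J by eventually_elim auto
  then show ii: "integrable M (\<lambda>x. (real_cond_exp M F f x)\<^sup>2)"
    by (rule Bochner_Integration.integrable_bound[OF ic, rotated]) simp
  have "(\<integral>x. (real_cond_exp M F f x)\<^sup>2 \<partial>M) \<le> (\<integral>x. real_cond_exp M F (\<lambda>x. (f x)\<^sup>2) x \<partial>M)"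
    by (rule integral_mono_AE[OF ii ic J])
  also have "\<dots> = (\<integral>x. (f x)\<^sup>2 \<partial>M)" by (rule real_cond_exp_int(2)[OF f2])
  finally show "(\<integral>x. (real_cond_exp M F f x)\<^sup>2 \<partial>M) \<le> (\<integral>x. (f x)\<^sup>2 \<partial>M)" .
qed

text \<open>Minkowski's inequality for infinite series, by the weighted Cauchy-Schwarz inequality:
  the square of the sum of the f_j is at most (sum of c_j) times (sum of f_j^2 / c_j), and each
  f_j^2 / c_j has expectation at most c_j. The division is why the \<open>c j\<close> are taken
  strictly positive.\<close>

lemma (in prob_space) L2_series:
  fixes f :: "nat \<Rightarrow> 'a \<Rightarrow> real"
  assumes [measurable]: "\<And>j. f j \<in> borel_measurable M"
    and c: "\<And>j. 0 < c j" "summable c"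
    and i2: "\<And>j. integrable M (\<lambda>x. (f j x)\<^sup>2)" and f2: "\<And>j. (\<integral>x. (f j x)\<^sup>2 \<partial>M) \<le> (c j)\<^sup>2"
  shows L2_series_summable: "AE x in M. summable (\<lambda>j. \<bar>f j x\<bar>)"
    and L2_series_integrable: "integrable M (\<lambda>x. (\<Sum>j. f j x)\<^sup>2)"
    and L2_series_bound: "(\<integral>x. (\<Sum>j. f j x)\<^sup>2 \<partial>M) \<le> (\<Sum>j. c j)\<^sup>2"
    and L2_series_L1: "summable (\<lambda>j. \<integral>x. \<bar>f j x\<bar> \<partial>M)"
proof -
  let ?g = "\<lambda>j x. (f j x)\<^sup>2 / c j"
  have gi: "integrable M (?g j)" for j using i2 by auto
  have gle: "(\<integral>x. ?g j x \<partial>M) \<le> c j" for j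
    using f2[of j] c(1)[of j] by (simp add: divide_le_eq power2_eq_square)
  have "(\<integral>\<^sup>+x. (\<Sum>j. ennreal (?g j x)) \<partial>M) = (\<Sum>j. \<integral>\<^sup>+x. ennreal (?g j x) \<partial>M)"
    by (rule nn_integral_suminf) simp
  also have "\<dots> = (\<Sum>j. ennreal (\<integral>x. ?g j x \<partial>M))"
    using gi c(1) by (intro suminf_cong nn_integral_eq_integral) (auto simp: less_imp_le)
  also have "\<dots> \<le> (\<Sum>j. ennreal (c j))"
    by (intro suminf_le ennreal_leI gle) auto
  also have "\<dots> < \<infinity>"
  proof -
    have "(\<Sum>j. ennreal (c j)) \<noteq> top"
      by (rule ennreal_suminf_neq_top[OF c(2)]) (rule less_imp_le[OF c(1)])
    then show ?thesis by (simp add: less_top[symmetric])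
  qed
  finally have fin: "(\<integral>\<^sup>+x. (\<Sum>j. ennreal (?g j x)) \<partial>M) < \<infinity>" .
  have "AE x in M. (\<Sum>j. ennreal (?g j x)) \<noteq> \<infinity>"
    by (rule nn_integral_PInf_AE) (use fin in auto)
  then have gs: "AE x in M. summable (\<lambda>j. ?g j x)"
    by eventually_elim (rule summable_suminf_not_top, use c(1) in \<open>auto simp: less_imp_le\<close>)
  \<comment> \<open>One inequality serves twice: pointwise for absolute summability, and integrated
    for summability of the L1 norms.\<close>
  have amgm: "\<bar>f j x\<bar> \<le> c j + ?g j x" for j x
  proof -
    have "2 * \<bar>f j x\<bar> * c j \<le> (c j)\<^sup>2 + (f j x)\<^sup>2"
      using sum_squares_bound[of "\<bar>f j x\<bar>" "c j"] by simp
    moreover have "\<bar>f j x\<bar> * c j \<le> 2 * \<bar>f j x\<bar> * c j" using c(1)[of j] by simp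
    ultimately have "\<bar>f j x\<bar> * c j \<le> (c j)\<^sup>2 + (f j x)\<^sup>2" by linarith
    then show ?thesis using c(1)[of j] by (simp add: field_simps power2_eq_square)
  qed
  show as: "AE x in M. summable (\<lambda>j. \<bar>f j x\<bar>)"
    using gs
  proof eventually_elim
    case (elim x)
    show ?case by (rule summable_comparison_test[OF _ summable_add[OF c(2) elim]]) (use amgm in auto)
  qed
  define s where "s = (\<Sum>j. c j)"
  have gsum: "summable (\<lambda>j. \<integral>x. norm (?g j x) \<partial>M)"
    by (rule summable_comparison_test[OF _ c(2)])
       (use gle c(1) in \<open>auto simp: less_imp_le abs_of_nonneg integral_nonneg_AE\<close>)
  have gs': "AE x in M. summable (\<lambda>j. norm (?g j x))" using gs c(1) by (simp add: less_imp_le)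
  have iG: "integrable M (\<lambda>x. \<Sum>j. ?g j x)" by (rule integrable_suminf[OF gi gs' gsum])
  have IG: "(\<integral>x. (\<Sum>j. ?g j x) \<partial>M) \<le> s"
  proof -
    have "(\<integral>x. (\<Sum>j. ?g j x) \<partial>M) = (\<Sum>j. \<integral>x. ?g j x \<partial>M)" by (rule integral_suminf[OF gi gs' gsum])
    also have "\<dots> \<le> s" unfolding s_def by (rule suminf_le[OF gle summable_integral[OF gi gs' gsum] c(2)])
    finally show ?thesis .
  qed
  have s0: "0 \<le> s" unfolding s_def by (rule suminf_nonneg[OF c(2)]) (use c(1) in \<open>auto simp: less_imp_le\<close>)
  have cs: "AE x in M. (\<Sum>j. f j x)\<^sup>2 \<le> s * (\<Sum>j. ?g j x)"
    using gs as
  proof eventually_elim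
    case (elim x)
    have fin: "(\<Sum>j<n. f j x)\<^sup>2 \<le> s * (\<Sum>j. ?g j x)" for n
    proof -
      have "(\<Sum>j<n. f j x) = (\<Sum>j<n. sqrt (c j) * (f j x / sqrt (c j)))"
        using c(1) by (intro sum.cong) (auto simp: less_imp_neq[symmetric])
      then have "(\<Sum>j<n. f j x)\<^sup>2 \<le> (\<Sum>j<n. (sqrt (c j))\<^sup>2) * (\<Sum>j<n. (f j x / sqrt (c j))\<^sup>2)"
        using Cauchy_Schwarz_ineq_sum by metis
      also have "\<dots> = (\<Sum>j<n. c j) * (\<Sum>j<n. ?g j x)"
        using c(1) by (simp add: power_divide less_imp_le)
      also have "\<dots> \<le> s * (\<Sum>j. ?g j x)"
        unfolding s_def using c elim(1) s0[unfolded s_def]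
        by (intro mult_mono sum_le_suminf sum_nonneg) (auto simp: less_imp_le)
      finally show ?thesis .
    qed
    have "(\<lambda>n. (\<Sum>j<n. f j x)\<^sup>2) \<longlonglongrightarrow> (\<Sum>j. f j x)\<^sup>2"
      by (intro tendsto_power summable_LIMSEQ summable_rabs_cancel[OF elim(2)])
    then show ?case by (rule LIMSEQ_le_const2) (use fin in auto)
  qed
  show ii: "integrable M (\<lambda>x. (\<Sum>j. f j x)\<^sup>2)"
  proof (rule Bochner_Integration.integrable_bound)
    show "integrable M (\<lambda>x. s * (\<Sum>j. ?g j x))" using iG by simp
    show "AE x in M. norm ((\<Sum>j. f j x)\<^sup>2) \<le> norm (s * (\<Sum>j. ?g j x))"
      using cs by eventually_elim auto
  qed measurable
  have "(\<integral>x. (\<Sum>j. f j x)\<^sup>2 \<partial>M) \<le> (\<integral>x. s * (\<Sum>j. ?g j x) \<partial>M)"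
    by (rule integral_mono_AE[OF ii _ cs]) (use iG in simp)
  also have "\<dots> = s * (\<integral>x. (\<Sum>j. ?g j x) \<partial>M)" by simp
  also have "\<dots> \<le> s * s" using IG s0 by (rule mult_left_mono)
  finally show "(\<integral>x. (\<Sum>j. f j x)\<^sup>2 \<partial>M) \<le> (\<Sum>j. c j)\<^sup>2" by (simp add: s_def power2_eq_square)
  have fi: "integrable M (f j)" for j by (rule integrable_of_square[OF _ i2]) simp
  show "summable (\<lambda>j. \<integral>x. \<bar>f j x\<bar> \<partial>M)"
  proof (rule summable_comparison_test[OF _ summable_add[OF c(2) c(2)]])
    have "(\<integral>x. \<bar>f j x\<bar> \<partial>M) \<le> c j + c j" for j
    proof -
      have "(\<integral>x. \<bar>f j x\<bar> \<partial>M) \<le> (\<integral>x. c j + ?g j x \<partial>M)"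
        by (rule integral_mono) (use fi gi amgm in auto)
      also have "\<dots> \<le> c j + c j" using gi gle[of j] by (simp add: prob_space)
      finally show ?thesis .
    qed
    then show "\<exists>N. \<forall>n\<ge>N. norm (\<integral>x. \<bar>f n x\<bar> \<partial>M) \<le> c n + c n"
      by (auto simp: abs_of_nonneg integral_nonneg_AE)
  qed
qed

text \<open>Uniform integrability of the squares, in a form visibly stable under sums,
  \<open>L\<^sup>2\<close>-limits and conditional expectations.\<close>

definition ui2 :: "('i \<Rightarrow> 'a measure) \<Rightarrow> 'i set \<Rightarrow> ('i \<Rightarrow> 'a \<Rightarrow> real) \<Rightarrow> bool" where
  "ui2 P I f \<longleftrightarrow> (\<forall>i\<in>I. f i \<in> borel_measurable (P i)) \<and>
    (\<forall>e>0. \<exists>K. \<forall>i\<in>I. \<exists>g. g \<in> borel_measurable (P i) \<and> (\<forall>x\<in>space (P i). \<bar>g x\<bar> \<le> K) \<and>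
       integrable (P i) (\<lambda>x. (f i x - g x)\<^sup>2) \<and> (\<integral>x. (f i x - g x)\<^sup>2 \<partial>P i) \<le> e)"

lemma square_sum_le: "(a + b)\<^sup>2 \<le> 2 * a\<^sup>2 + 2 * b\<^sup>2" for a b :: real
  using zero_le_power2[of "a - b"] by (simp add: power2_eq_square algebra_simps)

lemma integrable_square_add:
  fixes f g :: "'a \<Rightarrow> real"
  assumes [measurable]: "f \<in> borel_measurable M" "g \<in> borel_measurable M"
    and i: "integrable M (\<lambda>x. (f x)\<^sup>2)" "integrable M (\<lambda>x. (g x)\<^sup>2)"
  shows "integrable M (\<lambda>x. (f x + g x)\<^sup>2)"
    "(\<integral>x. (f x + g x)\<^sup>2 \<partial>M) \<le> 2 * (\<integral>x. (f x)\<^sup>2 \<partial>M) + 2 * (\<integral>x. (g x)\<^sup>2 \<partial>M)"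
proof -
  show ii: "integrable M (\<lambda>x. (f x + g x)\<^sup>2)"
  proof (rule Bochner_Integration.integrable_bound)
    show "integrable M (\<lambda>x. 2 * (f x)\<^sup>2 + 2 * (g x)\<^sup>2)" using i by auto
    show "AE x in M. norm ((f x + g x)\<^sup>2) \<le> norm (2 * (f x)\<^sup>2 + 2 * (g x)\<^sup>2)"
      using square_sum_le by (auto intro!: AE_I2)
  qed measurable
  have "(\<integral>x. (f x + g x)\<^sup>2 \<partial>M) \<le> (\<integral>x. 2 * (f x)\<^sup>2 + 2 * (g x)\<^sup>2 \<partial>M)"
    by (rule integral_mono[OF ii]) (use i square_sum_le in auto)
  then show "(\<integral>x. (f x + g x)\<^sup>2 \<partial>M) \<le> 2 * (\<integral>x. (f x)\<^sup>2 \<partial>M) + 2 * (\<integral>x. (g x)\<^sup>2 \<partial>M)"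
    using i by simp
qed

lemma exceed2_antimono:
  assumes [measurable]: "f \<in> borel_measurable M" and "integrable M (\<lambda>x. (f x)\<^sup>2)" and "a \<le> b"
  shows "exceed2 M b f \<le> exceed2 M a f"
  unfolding exceed2_def
proof (rule integral_mono)
  show "integrable M (\<lambda>x. (f x)\<^sup>2 * indicator {x. b < \<bar>f x\<bar>} x)" for b
    by (rule Bochner_Integration.integrable_bound[OF assms(2)]) (auto simp: indicator_def)
  then show "integrable M (\<lambda>x. (f x)\<^sup>2 * indicator {x. a < \<bar>f x\<bar>} x)" .
  show "(f x)\<^sup>2 * indicator {x. b < \<bar>f x\<bar>} x \<le> (f x)\<^sup>2 * indicator {x. a < \<bar>f x\<bar>} x" for x
    using assms(3) by (auto simp: indicator_def)
qed

context
  fixes P :: "'i \<Rightarrow> 'a measure" and I :: "'i set"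
  assumes prob: "\<And>i. i \<in> I \<Longrightarrow> prob_space (P i)"
begin

text \<open>The budgets of e/4, here and in \<open>ui2_add\<close>, match the factor 2 + 2 lost in
  \<open>square_sum_le\<close>.\<close>

lemma ui2_limit:
  assumes m: "\<And>i. i \<in> I \<Longrightarrow> f i \<in> borel_measurable (P i)"
    and lim: "\<And>e. e > 0 \<Longrightarrow> \<exists>h. ui2 P I h \<and> (\<forall>i\<in>I. integrable (P i) (\<lambda>x. (f i x - h i x)\<^sup>2) \<and> (\<integral>x. (f i x - h i x)\<^sup>2 \<partial>P i) \<le> e)"
  shows "ui2 P I f"
  unfolding ui2_def
proof (intro conjI ballI allI impI m)
  fix e :: real assume "0 < e"
  then have e4: "0 < e/4" by simp
  obtain h where h: "ui2 P I h" and hf: "\<And>i. i\<in>I \<Longrightarrow> integrable (P i) (\<lambda>x. (f i x - h i x)\<^sup>2)"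
      "\<And>i. i\<in>I \<Longrightarrow> (\<integral>x. (f i x - h i x)\<^sup>2 \<partial>P i) \<le> e/4"
    using lim[OF e4] by blast
  obtain K where K: "\<And>i. i\<in>I \<Longrightarrow> \<exists>g. g \<in> borel_measurable (P i) \<and> (\<forall>x\<in>space (P i). \<bar>g x\<bar> \<le> K) \<and>
       integrable (P i) (\<lambda>x. (h i x - g x)\<^sup>2) \<and> (\<integral>x. (h i x - g x)\<^sup>2 \<partial>P i) \<le> e/4"
    using h e4 unfolding ui2_def by blast
  show "\<exists>K. \<forall>i\<in>I. \<exists>g. g \<in> borel_measurable (P i) \<and> (\<forall>x\<in>space (P i). \<bar>g x\<bar> \<le> K) \<and>
       integrable (P i) (\<lambda>x. (f i x - g x)\<^sup>2) \<and> (\<integral>x. (f i x - g x)\<^sup>2 \<partial>P i) \<le> e"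
  proof (intro exI[of _ K] ballI)
    fix i assume i: "i \<in> I"
    obtain g where g: "g \<in> borel_measurable (P i)" "\<forall>x\<in>space (P i). \<bar>g x\<bar> \<le> K"
       "integrable (P i) (\<lambda>x. (h i x - g x)\<^sup>2)" "(\<integral>x. (h i x - g x)\<^sup>2 \<partial>P i) \<le> e/4"
      using K[OF i] by blast
    have hm: "h i \<in> borel_measurable (P i)" using h i by (auto simp: ui2_def)
    note sq = integrable_square_add[of "\<lambda>x. f i x - h i x" "P i" "\<lambda>x. h i x - g x", OF _ _ hf(1)[OF i] g(3)]
    show "\<exists>g. g \<in> borel_measurable (P i) \<and> (\<forall>x\<in>space (P i). \<bar>g x\<bar> \<le> K) \<and>
       integrable (P i) (\<lambda>x. (f i x - g x)\<^sup>2) \<and> (\<integral>x. (f i x - g x)\<^sup>2 \<partial>P i) \<le> e"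
      using sq g hf(2)[OF i] m[OF i] hm by (intro exI[of _ g]) auto
  qed
qed

lemma ui2_add:
  assumes f: "ui2 P I f" and h: "ui2 P I h"
  shows "ui2 P I (\<lambda>i x. f i x + h i x)"
  unfolding ui2_def
proof (intro conjI ballI allI impI)
  show "(\<lambda>x. f i x + h i x) \<in> borel_measurable (P i)" if "i \<in> I" for i
    using f h that unfolding ui2_def by (intro borel_measurable_add) blast+
  fix e :: real assume "0 < e"
  then have e4: "0 < e/4" by simp
  obtain K where K: "\<And>i. i\<in>I \<Longrightarrow> \<exists>g. g \<in> borel_measurable (P i) \<and> (\<forall>x\<in>space (P i). \<bar>g x\<bar> \<le> K) \<and>
       integrable (P i) (\<lambda>x. (f i x - g x)\<^sup>2) \<and> (\<integral>x. (f i x - g x)\<^sup>2 \<partial>P i) \<le> e/4"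
    using f e4 unfolding ui2_def by blast
  obtain L where L: "\<And>i. i\<in>I \<Longrightarrow> \<exists>g. g \<in> borel_measurable (P i) \<and> (\<forall>x\<in>space (P i). \<bar>g x\<bar> \<le> L) \<and>
       integrable (P i) (\<lambda>x. (h i x - g x)\<^sup>2) \<and> (\<integral>x. (h i x - g x)\<^sup>2 \<partial>P i) \<le> e/4"
    using h e4 unfolding ui2_def by blast
  show "\<exists>K. \<forall>i\<in>I. \<exists>g. g \<in> borel_measurable (P i) \<and> (\<forall>x\<in>space (P i). \<bar>g x\<bar> \<le> K) \<and>
       integrable (P i) (\<lambda>x. (f i x + h i x - g x)\<^sup>2) \<and> (\<integral>x. (f i x + h i x - g x)\<^sup>2 \<partial>P i) \<le> e"
  proof (intro exI[of _ "K + L"] ballI)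
    fix i assume i: "i \<in> I"
    obtain g where g: "g \<in> borel_measurable (P i)" "\<forall>x\<in>space (P i). \<bar>g x\<bar> \<le> K"
       "integrable (P i) (\<lambda>x. (f i x - g x)\<^sup>2)" "(\<integral>x. (f i x - g x)\<^sup>2 \<partial>P i) \<le> e/4"
      using K[OF i] by blast
    obtain k where k: "k \<in> borel_measurable (P i)" "\<forall>x\<in>space (P i). \<bar>k x\<bar> \<le> L"
       "integrable (P i) (\<lambda>x. (h i x - k x)\<^sup>2)" "(\<integral>x. (h i x - k x)\<^sup>2 \<partial>P i) \<le> e/4"
      using L[OF i] by blast
    have fm: "f i \<in> borel_measurable (P i)" "h i \<in> borel_measurable (P i)" using f h i by (auto simp: ui2_def)
    note sq = integrable_square_add[of "\<lambda>x. f i x - g x" "P i" "\<lambda>x. h i x - k x", OF _ _ g(3) k(3)]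
    have eq: "f i x - g x + (h i x - k x) = f i x + h i x - (g x + k x)" for x by simp
    have "\<bar>g x + k x\<bar> \<le> K + L" if "x \<in> space (P i)" for x
      using abs_triangle_ineq[of "g x" "k x"] g(2)[rule_format, OF that] k(2)[rule_format, OF that] by linarith
    then show "\<exists>g. g \<in> borel_measurable (P i) \<and> (\<forall>x\<in>space (P i). \<bar>g x\<bar> \<le> K + L) \<and>
       integrable (P i) (\<lambda>x. (f i x + h i x - g x)\<^sup>2) \<and> (\<integral>x. (f i x + h i x - g x)\<^sup>2 \<partial>P i) \<le> e"
      using sq[unfolded eq] g(1,4) k(1,4) fm by (intro exI[of _ "\<lambda>x. g x + k x"]) auto
  qed
qed

lemma ui2_uminus:
  assumes f: "ui2 P I f"
  shows "ui2 P I (\<lambda>i x. - f i x)"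
  unfolding ui2_def
proof (intro conjI ballI allI impI)
  show "(\<lambda>x. - f i x) \<in> borel_measurable (P i)" if "i \<in> I" for i
    using f that unfolding ui2_def by (intro borel_measurable_uminus) blast
  fix e :: real assume e: "0 < e"
  obtain K where K: "\<And>i. i\<in>I \<Longrightarrow> \<exists>g. g \<in> borel_measurable (P i) \<and> (\<forall>x\<in>space (P i). \<bar>g x\<bar> \<le> K) \<and>
       integrable (P i) (\<lambda>x. (f i x - g x)\<^sup>2) \<and> (\<integral>x. (f i x - g x)\<^sup>2 \<partial>P i) \<le> e"
    using f e unfolding ui2_def by blast
  show "\<exists>K. \<forall>i\<in>I. \<exists>g. g \<in> borel_measurable (P i) \<and> (\<forall>x\<in>space (P i). \<bar>g x\<bar> \<le> K) \<and>
       integrable (P i) (\<lambda>x. (- f i x - g x)\<^sup>2) \<and> (\<integral>x. (- f i x - g x)\<^sup>2 \<partial>P i) \<le> e"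
  proof (intro exI[of _ K] ballI)
    fix i assume i: "i \<in> I"
    obtain g where g: "g \<in> borel_measurable (P i)" "\<forall>x\<in>space (P i). \<bar>g x\<bar> \<le> K"
       "integrable (P i) (\<lambda>x. (f i x - g x)\<^sup>2)" "(\<integral>x. (f i x - g x)\<^sup>2 \<partial>P i) \<le> e"
      using K[OF i] by blast
    have eq: "(- f i x - - g x)\<^sup>2 = (f i x - g x)\<^sup>2" for x by (simp add: power2_commute)
    show "\<exists>g. g \<in> borel_measurable (P i) \<and> (\<forall>x\<in>space (P i). \<bar>g x\<bar> \<le> K) \<and>
       integrable (P i) (\<lambda>x. (- f i x - g x)\<^sup>2) \<and> (\<integral>x. (- f i x - g x)\<^sup>2 \<partial>P i) \<le> e"
      by (rule exI[of _ "\<lambda>x. - g x"], unfold eq) (use g in simp)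
  qed
qed

lemma ui2_zero: "ui2 P I (\<lambda>i x. 0)"
  unfolding ui2_def by (auto intro!: exI[of _ "0::real"] exI[of _ "\<lambda>x. 0::real"])

lemma ui2_sum: "(\<And>j. j < (n::nat) \<Longrightarrow> ui2 P I (f j)) \<Longrightarrow> ui2 P I (\<lambda>i x. \<Sum>j<n. f j i x)"
  by (induction n) (auto simp: ui2_zero intro!: ui2_add)

text \<open>Conditional expectation contracts L2, so projecting a bounded approximant of f
  approximates the projection of f. The projected approximant is bounded only almost everywhere;
  clipping it at \<open>K\<close> restores the bound at every point.\<close>

lemma ui2_cond_exp:
  assumes f: "ui2 P I f" and H: "\<And>i. i \<in> I \<Longrightarrow> subalgebra (P i) (H i)"
    and i1: "\<And>i. i \<in> I \<Longrightarrow> integrable (P i) (f i)"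
  shows "ui2 P I (\<lambda>i. real_cond_exp (P i) (H i) (f i))"
  unfolding ui2_def
proof (intro conjI ballI allI impI)
  fix e :: real assume e: "0 < e"
  obtain K where K: "\<And>i. i\<in>I \<Longrightarrow> \<exists>g. g \<in> borel_measurable (P i) \<and> (\<forall>x\<in>space (P i). \<bar>g x\<bar> \<le> K) \<and>
       integrable (P i) (\<lambda>x. (f i x - g x)\<^sup>2) \<and> (\<integral>x. (f i x - g x)\<^sup>2 \<partial>P i) \<le> e"
    using f e unfolding ui2_def by blast
  show "\<exists>K. \<forall>i\<in>I. \<exists>g. g \<in> borel_measurable (P i) \<and> (\<forall>x\<in>space (P i). \<bar>g x\<bar> \<le> K) \<and>
       integrable (P i) (\<lambda>x. (real_cond_exp (P i) (H i) (f i) x - g x)\<^sup>2) \<and> (\<integral>x. (real_cond_exp (P i) (H i) (f i) x - g x)\<^sup>2 \<partial>P i) \<le> e"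
  proof (intro exI[of _ K] ballI)
    fix i assume i: "i \<in> I"
    interpret prob_space "P i" by (rule prob[OF i])
    interpret sigma_finite_subalgebra "P i" "H i"
      by (rule finite_measure_subalgebra_is_sigma_finite)
         (simp add: finite_measure_subalgebra_def finite_measure_axioms finite_measure_subalgebra_axioms_def H[OF i])
    obtain g where g[measurable]: "g \<in> borel_measurable (P i)" and gK: "\<forall>x\<in>space (P i). \<bar>g x\<bar> \<le> K" and
       g2: "integrable (P i) (\<lambda>x. (f i x - g x)\<^sup>2)" and ge: "(\<integral>x. (f i x - g x)\<^sup>2 \<partial>P i) \<le> e"
      using K[OF i] by blast
    have [measurable]: "f i \<in> borel_measurable (P i)" using i1[OF i] by auto
    have K0: "0 \<le> K" using gK not_empty by (meson abs_ge_zero ex_in_conv order_trans)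
    have ig: "integrable (P i) g" by (rule integrable_const_bound[where B=K]) (use gK in auto)
    let ?E = "real_cond_exp (P i) (H i)"
    let ?k = "\<lambda>x. max (- K) (min K (?E g x))"
    have gK': "AE x in P i. g x \<le> K" "AE x in P i. - K \<le> g x" using gK by (auto simp: abs_le_iff minus_le_iff)
    have "AE x in P i. ?E g x \<le> K" "AE x in P i. - K \<le> ?E g x"
      using real_cond_exp_le_c[OF ig gK'(1)] real_cond_exp_ge_c[OF ig gK'(2)] by auto
    moreover have "AE x in P i. ?E (\<lambda>x. f i x - g x) x = ?E (f i) x - ?E g x"
      by (rule real_cond_exp_diff[OF i1[OF i] ig])
    ultimately have AE: "AE x in P i. (?E (\<lambda>x. f i x - g x) x)\<^sup>2 = (?E (f i) x - ?k x)\<^sup>2"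
      by eventually_elim auto
    have "integrable (P i) (\<lambda>x. (?E (\<lambda>x. f i x - g x) x)\<^sup>2)"
         "(\<integral>x. (?E (\<lambda>x. f i x - g x) x)\<^sup>2 \<partial>P i) \<le> (\<integral>x. (f i x - g x)\<^sup>2 \<partial>P i)"
      using cond_exp_L2[OF _ g2 H[OF i]] by auto
    moreover have "integrable (P i) (\<lambda>x. (?E (\<lambda>x. f i x - g x) x)\<^sup>2) = integrable (P i) (\<lambda>x. (?E (f i) x - ?k x)\<^sup>2)"
      by (rule integrable_cong_AE[OF _ _ AE]) measurable
    moreover have "(\<integral>x. (?E (\<lambda>x. f i x - g x) x)\<^sup>2 \<partial>P i) = (\<integral>x. (?E (f i) x - ?k x)\<^sup>2 \<partial>P i)"
      by (rule integral_cong_AE[OF _ _ AE]) measurable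
    ultimately show "\<exists>g. g \<in> borel_measurable (P i) \<and> (\<forall>x\<in>space (P i). \<bar>g x\<bar> \<le> K) \<and>
       integrable (P i) (\<lambda>x. (?E (f i) x - g x)\<^sup>2) \<and> (\<integral>x. (?E (f i) x - g x)\<^sup>2 \<partial>P i) \<le> e"
      using ge K0 by (intro exI[of _ ?k]) auto
  qed
qed simp

lemma ui2_moment:
  assumes f: "ui2 P I f"
  obtains C where "0 \<le> C" "\<And>i. i \<in> I \<Longrightarrow> integrable (P i) (\<lambda>x. (f i x)\<^sup>2)" "\<And>i. i \<in> I \<Longrightarrow> (\<integral>x. (f i x)\<^sup>2 \<partial>P i) \<le> C"
proof -
  obtain K where K: "\<And>i. i\<in>I \<Longrightarrow> \<exists>g. g \<in> borel_measurable (P i) \<and> (\<forall>x\<in>space (P i). \<bar>g x\<bar> \<le> K) \<and>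
       integrable (P i) (\<lambda>x. (f i x - g x)\<^sup>2) \<and> (\<integral>x. (f i x - g x)\<^sup>2 \<partial>P i) \<le> 1"
    using f zero_less_one unfolding ui2_def by blast
  have "integrable (P i) (\<lambda>x. (f i x)\<^sup>2) \<and> (\<integral>x. (f i x)\<^sup>2 \<partial>P i) \<le> 2 * 1 + 2 * K\<^sup>2" if i: "i \<in> I" for i
  proof -
    interpret prob_space "P i" by (rule prob[OF i])
    obtain g where g[measurable]: "g \<in> borel_measurable (P i)" and gK: "\<forall>x\<in>space (P i). \<bar>g x\<bar> \<le> K" and
       g2: "integrable (P i) (\<lambda>x. (f i x - g x)\<^sup>2)" and ge: "(\<integral>x. (f i x - g x)\<^sup>2 \<partial>P i) \<le> 1"
      using K[OF i] by blast
    have fm: "f i \<in> borel_measurable (P i)" using f i by (auto simp: ui2_def)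
    have gs: "(g x)\<^sup>2 \<le> K\<^sup>2" if "x \<in> space (P i)" for x
      using gK that by (subst abs_le_square_iff[symmetric]) fastforce
    have ig: "integrable (P i) (\<lambda>x. (g x)\<^sup>2)"
      by (rule integrable_const_bound[where B="K\<^sup>2"]) (use gs in auto)
    have "(\<integral>x. (g x)\<^sup>2 \<partial>P i) \<le> (\<integral>x. K\<^sup>2 \<partial>P i)" by (rule integral_mono[OF ig]) (use gs in auto)
    then have "(\<integral>x. (g x)\<^sup>2 \<partial>P i) \<le> K\<^sup>2" by (simp add: prob_space)
    then show ?thesis
      using integrable_square_add[of "\<lambda>x. f i x - g x" "P i" g, OF _ g g2 ig] fm ge by auto
  qed
  then show ?thesis by (intro that[of "2 * 1 + 2 * K\<^sup>2"]) auto
qed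

text \<open>Where |f| > 2 K \<ge> 2 |g| one has |f| \<le> 2 |f - g|, so the tail of f^2 lies below 4
  (f - g)^2.\<close>

lemma ui2_exceed:
  assumes f: "ui2 P I f" and e: "0 < e"
  obtains K where "0 < K" "\<And>i K'. i \<in> I \<Longrightarrow> K \<le> K' \<Longrightarrow> exceed2 (P i) K' (f i) \<le> e"
proof -
  have e4: "0 < e/4" using e by simp
  obtain K where K: "\<And>i. i\<in>I \<Longrightarrow> \<exists>g. g \<in> borel_measurable (P i) \<and> (\<forall>x\<in>space (P i). \<bar>g x\<bar> \<le> K) \<and>
       integrable (P i) (\<lambda>x. (f i x - g x)\<^sup>2) \<and> (\<integral>x. (f i x - g x)\<^sup>2 \<partial>P i) \<le> e/4"
    using f e4 unfolding ui2_def by blast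
  show thesis
  proof (rule that[of "max 1 (2 * K)"])
    fix i K' assume i: "i \<in> I" and K': "max 1 (2 * K) \<le> K'"
    obtain g where g[measurable]: "g \<in> borel_measurable (P i)" and gK: "\<forall>x\<in>space (P i). \<bar>g x\<bar> \<le> K" and
       g2: "integrable (P i) (\<lambda>x. (f i x - g x)\<^sup>2)" and ge: "(\<integral>x. (f i x - g x)\<^sup>2 \<partial>P i) \<le> e/4"
      using K[OF i] by blast
    have fm[measurable]: "f i \<in> borel_measurable (P i)" using f i by (auto simp: ui2_def)
    have pt: "(f i x)\<^sup>2 * indicator {x. K' < \<bar>f i x\<bar>} x \<le> 4 * (f i x - g x)\<^sup>2" if x: "x \<in> space (P i)" for x
    proof (cases "K' < \<bar>f i x\<bar>")
      case True
      have "\<bar>g x\<bar> \<le> K" using gK x by auto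
      then have "\<bar>f i x\<bar> \<le> 2 * \<bar>f i x - g x\<bar>"
        using True K' abs_triangle_ineq2[of "f i x" "g x"] by simp
      then have "\<bar>f i x\<bar> \<le> \<bar>2 * (f i x - g x)\<bar>" unfolding abs_mult by simp
      then have "(f i x)\<^sup>2 \<le> (2 * (f i x - g x))\<^sup>2" by (simp only: abs_le_square_iff)
      then have "(f i x)\<^sup>2 \<le> 4 * (f i x - g x)\<^sup>2" unfolding power_mult_distrib by simp
      then show ?thesis using True by simp
    qed auto
    have i4: "integrable (P i) (\<lambda>x. 4 * (f i x - g x)\<^sup>2)" using g2 by simp
    have "exceed2 (P i) K' (f i) \<le> (\<integral>x. 4 * (f i x - g x)\<^sup>2 \<partial>P i)"
      unfolding exceed2_def
    proof (rule integral_mono[OF _ i4 pt])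
      show "integrable (P i) (\<lambda>x. (f i x)\<^sup>2 * indicator {x. K' < \<bar>f i x\<bar>} x)"
        by (rule Bochner_Integration.integrable_bound[OF i4]) (use pt in auto)
    qed
    then show "exceed2 (P i) K' (f i) \<le> e" using ge by simp
  qed auto
qed

end

section \<open>Gordin's corrector and the martingale differences it produces\<close>

definition remainder :: "(nat \<Rightarrow> 'a measure) \<Rightarrow> (nat \<Rightarrow> nat \<Rightarrow> 'a measure) \<Rightarrow> (nat \<Rightarrow> nat \<Rightarrow> 'a \<Rightarrow> real)
      \<Rightarrow> nat \<Rightarrow> nat \<Rightarrow> 'a \<Rightarrow> real" where
  "remainder M G U N n x = (\<Sum>j. real_cond_exp (M N) (G N n) (U N (n + 1 + j)) x)"

lemma Wmart_Suc: "Wmart M G U N (Suc n) x = U N (Suc n) x + remainder M G U N (Suc n) x - remainder M G U N n x"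
  by (simp add: Wmart_def remainder_def)

lemma sum_eq_sum_Wmart:
  assumes "l \<le> r"
  shows "(\<Sum>n\<in>{Suc l..r}. U N n x) = (\<Sum>n\<in>{Suc l..r}. Wmart M G U N n x) - remainder M G U N r x + remainder M G U N l x"
  using assms by (induction r rule: dec_induct) (simp_all add: Wmart_Suc)

lemma ui2_reindex:
  assumes "ui2 P I f" "\<And>i. i \<in> I \<Longrightarrow> \<phi> i \<in> I \<and> P (\<phi> i) = P i"
  shows "ui2 P I (\<lambda>i. f (\<phi> i))"
  unfolding ui2_def
proof (intro conjI ballI allI impI)
  show "f (\<phi> i) \<in> borel_measurable (P i)" if "i \<in> I" for i
    using assms(1) assms(2)[OF that] unfolding ui2_def by fastforce
  fix e :: real assume e: "0 < e"
  obtain K where K: "\<And>i. i\<in>I \<Longrightarrow> \<exists>g. g \<in> borel_measurable (P i) \<and> (\<forall>x\<in>space (P i). \<bar>g x\<bar> \<le> K) \<and>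
       integrable (P i) (\<lambda>x. (f i x - g x)\<^sup>2) \<and> (\<integral>x. (f i x - g x)\<^sup>2 \<partial>P i) \<le> e"
    using assms(1) e unfolding ui2_def by blast
  show "\<exists>K. \<forall>i\<in>I. \<exists>g. g \<in> borel_measurable (P i) \<and> (\<forall>x\<in>space (P i). \<bar>g x\<bar> \<le> K) \<and>
       integrable (P i) (\<lambda>x. (f (\<phi> i) x - g x)\<^sup>2) \<and> (\<integral>x. (f (\<phi> i) x - g x)\<^sup>2 \<partial>P i) \<le> e"
  proof (intro exI[of _ K] ballI)
    fix i assume i: "i \<in> I"
    have "\<phi> i \<in> I" "P (\<phi> i) = P i" using assms(2)[OF i] by auto
    then show "\<exists>g. g \<in> borel_measurable (P i) \<and> (\<forall>x\<in>space (P i). \<bar>g x\<bar> \<le> K) \<and>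
       integrable (P i) (\<lambda>x. (f (\<phi> i) x - g x)\<^sup>2) \<and> (\<integral>x. (f (\<phi> i) x - g x)\<^sup>2 \<partial>P i) \<le> e"
      using K[of "\<phi> i"] by simp
  qed
qed

text \<open>Conditions B1 to B3 only. Convergence of the variance enters later as a hypothesis on
  one window of times, so that the same argument serves windows starting at 0 and at
  \<open>k N\<close>.\<close>

locale mixingale_array =
  fixes M :: "nat \<Rightarrow> 'a measure" and G :: "nat \<Rightarrow> nat \<Rightarrow> 'a measure"
    and U :: "nat \<Rightarrow> nat \<Rightarrow> 'a \<Rightarrow> real" and c :: "nat \<Rightarrow> real"
  assumes prob: "\<And>N. N \<ge> 1 \<Longrightarrow> prob_space (M N)"
    and filt: "\<And>N. N \<ge> 1 \<Longrightarrow> filtration_on (M N) (G N)"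
    and B1: "\<And>N n. N \<ge> 1 \<Longrightarrow> n \<ge> 1 \<Longrightarrow> U N n \<in> borel_measurable (G N n)"
    and B2: "UI_squares M U"
    and B3_c: "\<And>j. 0 \<le> c j" "summable c"
    and B3: "\<And>N n m. N \<ge> 1 \<Longrightarrow> m \<ge> 1 \<Longrightarrow> n \<le> m \<Longrightarrow>
               L2_norm_le (M N) (real_cond_exp (M N) (G N n) (U N m)) (c (m - n))"
begin

abbreviation "W \<equiv> Wmart M G U"
abbreviation "R \<equiv> remainder M G U"
text \<open>Pairs of a row and a time: one index set makes uniform integrability uniform over both
  at once.\<close>

abbreviation "Idx \<equiv> {i :: nat \<times> nat. 1 \<le> fst i}"
abbreviation "P \<equiv> (\<lambda>i :: nat \<times> nat. M (fst i))"

lemma probP: "i \<in> Idx \<Longrightarrow> prob_space (P i)" using prob by auto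

lemma U_measurable: "N \<ge> 1 \<Longrightarrow> n \<ge> 1 \<Longrightarrow> U N n \<in> borel_measurable (M N)"
  using filtration_measurable(1)[OF filt B1] by auto

lemma ui2_U: "ui2 P Idx (\<lambda>i. U (fst i) (snd i + 1 + j))"
  unfolding ui2_def
proof (intro conjI ballI allI impI)
  show "U (fst i) (snd i + 1 + j) \<in> borel_measurable (P i)" if "i \<in> Idx" for i
    using that by (intro U_measurable) auto
  fix e :: real assume e: "0 < e"
  obtain K where K: "\<And>N n. N \<ge> 1 \<Longrightarrow> n \<ge> 1 \<Longrightarrow> (\<integral>\<^sup>+x. ennreal ((U N n x)\<^sup>2 * indicator {x. (U N n x)\<^sup>2 > K} x) \<partial>M N) \<le> ennreal e"
    using B2 e unfolding UI_squares_def by blast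
  show "\<exists>K. \<forall>i\<in>Idx. \<exists>g. g \<in> borel_measurable (P i) \<and> (\<forall>x\<in>space (P i). \<bar>g x\<bar> \<le> K) \<and>
       integrable (P i) (\<lambda>x. (U (fst i) (snd i + 1 + j) x - g x)\<^sup>2) \<and> (\<integral>x. (U (fst i) (snd i + 1 + j) x - g x)\<^sup>2 \<partial>P i) \<le> e"
  \<comment> \<open>B2 cuts at the level \<open>K\<close> of the square, hence the root; the
    absolute value covers a negative \<open>K\<close>.\<close>
  proof (intro exI[of _ "sqrt \<bar>K\<bar>"] ballI)
    fix i assume i: "i \<in> Idx"
    define f where "f = U (fst i) (snd i + 1 + j)"
    have fm[measurable]: "f \<in> borel_measurable (P i)" unfolding f_def using i by (intro U_measurable) auto
    have fe: "(\<integral>\<^sup>+x. ennreal ((f x)\<^sup>2 * indicator {x. (f x)\<^sup>2 > K} x) \<partial>P i) \<le> ennreal e"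
      unfolding f_def using i by (intro K) auto
    define g where "g x = f x * indicator {x. (f x)\<^sup>2 \<le> K} x" for x
    have [measurable]: "g \<in> borel_measurable (P i)" unfolding g_def by measurable
    have gb: "\<bar>g x\<bar> \<le> sqrt \<bar>K\<bar>" for x
    proof (cases "(f x)\<^sup>2 \<le> K")
      case True
      then have "sqrt ((f x)\<^sup>2) \<le> sqrt \<bar>K\<bar>" by (intro real_sqrt_le_mono) auto
      then show ?thesis by (simp add: g_def indicator_def)
    qed (simp add: g_def)
    have eq: "(f x - g x)\<^sup>2 = (f x)\<^sup>2 * indicator {x. (f x)\<^sup>2 > K} x" for x
      by (auto simp: g_def indicator_def)
    have ii: "integrable (P i) (\<lambda>x. (f x - g x)\<^sup>2)"
      by (rule integrableI_bounded) (use fe in \<open>auto simp: eq abs_mult intro: le_less_trans\<close>)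
    have "ennreal (\<integral>x. (f x - g x)\<^sup>2 \<partial>P i) \<le> ennreal e"
      using fe nn_integral_eq_integral[OF ii] by (simp add: eq)
    then have "(\<integral>x. (f x - g x)\<^sup>2 \<partial>P i) \<le> e" using e by simp
    then show "\<exists>g. g \<in> borel_measurable (P i) \<and> (\<forall>x\<in>space (P i). \<bar>g x\<bar> \<le> sqrt \<bar>K\<bar>) \<and>
       integrable (P i) (\<lambda>x. (U (fst i) (snd i + 1 + j) x - g x)\<^sup>2) \<and> (\<integral>x. (U (fst i) (snd i + 1 + j) x - g x)\<^sup>2 \<partial>P i) \<le> e"
      unfolding f_def[symmetric] using ii gb by (intro exI[of _ g]) auto
  qed
qed

lemma U_integrable: "N \<ge> 1 \<Longrightarrow> integrable (M N) (U N (n + 1 + j))"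
proof -
  assume N: "N \<ge> 1"
  interpret prob_space "M N" by (rule prob[OF N])
  obtain C where "\<And>i. i \<in> Idx \<Longrightarrow> integrable (P i) (\<lambda>x. (U (fst i) (snd i + 1 + j) x)\<^sup>2)"
    using ui2_moment[OF probP ui2_U[of j]] by metis
  from this[of "(N, n)"] N have "integrable (M N) (\<lambda>x. (U N (n + 1 + j) x)\<^sup>2)" by simp
  then show ?thesis by (rule integrable_of_square[rotated]) (use U_measurable N in auto)
qed

text \<open>A bound \<open>c\<close> may vanish; the geometric term makes the weights of
  \<open>L2_series\<close> strictly positive and keeps them summable.\<close>

definition cc :: "nat \<Rightarrow> real" where "cc j = c (1 + j) + (1/2)^j"

lemma cc: "0 < cc j" "summable cc"
proof -
  show "0 < cc j" using B3_c(1)[of "1 + j"] by (simp add: cc_def add_nonneg_pos)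
  show "summable cc" unfolding cc_def[abs_def]
    using summable_add[OF summable_ignore_initial_segment[OF B3_c(2), of 1] summable_geometric[of "1/2::real"]]
    by (simp add: add.commute)
qed

lemma series:
  fixes n J :: nat
  assumes N: "N \<ge> 1"
  defines "f \<equiv> \<lambda>j. real_cond_exp (M N) (G N n) (U N (n + 1 + j))"
  shows "AE x in M N. summable (\<lambda>j. \<bar>f j x\<bar>)"
    "integrable (M N) (\<lambda>x. (\<Sum>j. f (j + J) x)\<^sup>2)" "(\<integral>x. (\<Sum>j. f (j + J) x)\<^sup>2 \<partial>M N) \<le> (\<Sum>j. cc (j + J))\<^sup>2"
    "summable (\<lambda>j. \<integral>x. \<bar>f j x\<bar> \<partial>M N)" "integrable (M N) (f j)"
proof -
  interpret prob_space "M N" by (rule prob[OF N])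
  have fm[measurable]: "f j \<in> borel_measurable (M N)" for j unfolding f_def by measurable
  have L: "integrable (M N) (\<lambda>x. (f j x)\<^sup>2)" "(\<integral>x. (f j x)\<^sup>2 \<partial>M N) \<le> (cc j)\<^sup>2" for j
  proof -
    have "L2_norm_le (M N) (f j) (c ((n + 1 + j) - n))" unfolding f_def by (rule B3[OF N]) auto
    then have L: "L2_norm_le (M N) (f j) (c (1 + j))" by simp
    show "integrable (M N) (\<lambda>x. (f j x)\<^sup>2)" by (rule L2_norm_leD(1)[OF fm L])
    have "(\<integral>x. (f j x)\<^sup>2 \<partial>M N) \<le> (c (1 + j))\<^sup>2" by (rule L2_norm_leD(2)[OF fm L])
    also have "\<dots> \<le> (cc j)\<^sup>2" using B3_c(1)[of "1+j"] by (intro power_mono) (auto simp: cc_def)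
    finally show "(\<integral>x. (f j x)\<^sup>2 \<partial>M N) \<le> (cc j)\<^sup>2" .
  qed
  have sJ: "summable (\<lambda>j. cc (j + J))" for J by (rule summable_ignore_initial_segment[OF cc(2)])
  show "AE x in M N. summable (\<lambda>j. \<bar>f j x\<bar>)" by (rule L2_series_summable[OF fm cc L])
  show "integrable (M N) (\<lambda>x. (\<Sum>j. f (j + J) x)\<^sup>2)" "(\<integral>x. (\<Sum>j. f (j + J) x)\<^sup>2 \<partial>M N) \<le> (\<Sum>j. cc (j + J))\<^sup>2"
    by (rule L2_series_integrable[OF fm cc(1) sJ L] L2_series_bound[OF fm cc(1) sJ L])+
  show "summable (\<lambda>j. \<integral>x. \<bar>f j x\<bar> \<partial>M N)" by (rule L2_series_L1[OF fm cc L])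
  show "integrable (M N) (f j)" by (rule integrable_of_square[OF fm L(1)])
qed

lemma R_measurable: "N \<ge> 1 \<Longrightarrow> R N n \<in> borel_measurable (G N n)"
  unfolding remainder_def[abs_def] by measurable

lemma R_measurable_M: "N \<ge> 1 \<Longrightarrow> R N n \<in> borel_measurable (M N)"
  unfolding remainder_def[abs_def] by measurable

text \<open>Finite partial sums are conditional expectations of a uniformly square-integrable
  family. By B3 the tails are small in L2 at a rate that depends neither on the row nor on the time,
  so the whole series is a uniform L2 limit.\<close>

lemma ui2_R: "ui2 P Idx (\<lambda>i. R (fst i) (snd i))"
proof (rule ui2_limit[OF probP])
  show "R (fst i) (snd i) \<in> borel_measurable (P i)" if "i \<in> Idx" for i using that R_measurable_M by auto
  fix e :: real assume e: "0 < e"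
  let ?f = "\<lambda>i j. real_cond_exp (M (fst i)) (G (fst i) (snd i)) (U (fst i) (snd i + 1 + j))"
  have "(\<lambda>J. (\<Sum>j. cc (j + J))\<^sup>2) \<longlonglongrightarrow> 0\<^sup>2"
    by (intro tendsto_power suminf_exist_split2[OF cc(2)])
  then have "eventually (\<lambda>J. (\<Sum>j. cc (j + J))\<^sup>2 < e) sequentially"
    by (rule order_tendstoD(2)) (use e in simp)
  then obtain J where J: "(\<Sum>j. cc (j + J))\<^sup>2 < e" by (auto simp: eventually_sequentially)
  have h: "ui2 P Idx (\<lambda>i x. \<Sum>j<J. ?f i j x)"
  proof (rule ui2_sum[OF probP], simp)
    fix j
    show "ui2 P Idx (\<lambda>i. ?f i j)"
      by (rule ui2_cond_exp[OF probP ui2_U]) (use filtration_onD(1)[OF filt] U_integrable in auto)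
  qed
  have "integrable (P i) (\<lambda>x. (R (fst i) (snd i) x - (\<Sum>j<J. ?f i j x))\<^sup>2) \<and>
        (\<integral>x. (R (fst i) (snd i) x - (\<Sum>j<J. ?f i j x))\<^sup>2 \<partial>P i) \<le> e" if i: "i \<in> Idx" for i
  proof -
    have N: "fst i \<ge> 1" using i by simp
    have AE: "AE x in P i. (\<Sum>j. ?f i (j + J) x)\<^sup>2 = (R (fst i) (snd i) x - (\<Sum>j<J. ?f i j x))\<^sup>2"
      using series(1)[OF N, of "snd i"]
    proof eventually_elim
      case (elim x)
      have "(\<Sum>j. ?f i (j + J) x) = R (fst i) (snd i) x - (\<Sum>j<J. ?f i j x)"
        unfolding remainder_def by (rule suminf_minus_initial_segment[OF summable_rabs_cancel[OF elim]])
      then show ?case by simp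
    qed
    have [measurable]: "R (fst i) (snd i) \<in> borel_measurable (P i)" using N R_measurable_M by auto
    have "integrable (P i) (\<lambda>x. (\<Sum>j. ?f i (j + J) x)\<^sup>2) = integrable (P i) (\<lambda>x. (R (fst i) (snd i) x - (\<Sum>j<J. ?f i j x))\<^sup>2)"
      by (rule integrable_cong_AE[OF _ _ AE]) measurable
    moreover have "(\<integral>x. (\<Sum>j. ?f i (j + J) x)\<^sup>2 \<partial>P i) = (\<integral>x. (R (fst i) (snd i) x - (\<Sum>j<J. ?f i j x))\<^sup>2 \<partial>P i)"
      by (rule integral_cong_AE[OF _ _ AE]) measurable
    ultimately show ?thesis using series(2,3)[OF N, of "snd i" J] J by linarith
  qed
  with h show "\<exists>h. ui2 P Idx h \<and> (\<forall>i\<in>Idx. integrable (P i) (\<lambda>x. (R (fst i) (snd i) x - h i x)\<^sup>2) \<and>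
     (\<integral>x. (R (fst i) (snd i) x - h i x)\<^sup>2 \<partial>P i) \<le> e)"
    by (intro exI[of _ "\<lambda>i x. \<Sum>j<J. ?f i j x"]) blast
qed

lemma ui2_W: "ui2 P Idx (\<lambda>i. W (fst i) (Suc (snd i)))"
proof -
  have "ui2 P Idx (\<lambda>i. R (fst i) (Suc (snd i)))"
    using ui2_reindex[OF ui2_R, of "\<lambda>i. (fst i, Suc (snd i))"] by simp
  then have "ui2 P Idx (\<lambda>i x. (U (fst i) (snd i + 1 + 0) x + R (fst i) (Suc (snd i)) x) + - R (fst i) (snd i) x)"
    by (intro ui2_add[OF probP] ui2_uminus[OF probP] ui2_R ui2_U) auto
  also have "(\<lambda>i x. (U (fst i) (snd i + 1 + 0) x + R (fst i) (Suc (snd i)) x) + - R (fst i) (snd i) x)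
     = (\<lambda>i. W (fst i) (Suc (snd i)))"
    by (auto simp: Wmart_Suc fun_eq_iff)
  finally show ?thesis .
qed

text \<open>Against a weight from time n each conditional expectation may be replaced by the
  variable \<open>U\<close> itself. The corrector then appears as a numerical series of integrals,
  with no conditional expectation left.\<close>

lemma R_integral:
  assumes N: "N \<ge> 1" and w: "w \<in> borel_measurable (G N n)" and B: "\<And>x. x \<in> space (M N) \<Longrightarrow> \<bar>w x\<bar> \<le> B"
  shows "integrable (M N) (R N n)" "(\<lambda>j. \<integral>x. w x * U N (n + 1 + j) x \<partial>M N) sums (\<integral>x. w x * R N n x \<partial>M N)"
proof -
  interpret prob_space "M N" by (rule prob[OF N])
  interpret sigma_finite_subalgebra "M N" "G N n"
      by (rule finite_measure_subalgebra_is_sigma_finite)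
         (simp add: finite_measure_subalgebra_def finite_measure_axioms finite_measure_subalgebra_axioms_def filtration_onD[OF filt[OF N]])
  have wM[measurable]: "w \<in> borel_measurable (M N)" by (rule filtration_measurable(1)[OF filt[OF N] w])
  let ?f = "\<lambda>j. real_cond_exp (M N) (G N n) (U N (n + 1 + j))"
  have iw: "integrable (M N) (\<lambda>x. w x * g x)" if "integrable (M N) g" for g :: "'a \<Rightarrow> real"
  proof (rule Bochner_Integration.integrable_bound)
    show "integrable (M N) (\<lambda>x. B * g x)" using that by auto
    show "AE x in M N. norm (w x * g x) \<le> norm (B * g x)"
    proof (rule AE_I2)
      fix x assume "x \<in> space (M N)"
      then have "\<bar>w x\<bar> \<le> \<bar>B\<bar>" using B by fastforce
      then show "norm (w x * g x) \<le> norm (B * g x)" by (simp add: abs_mult mult_right_mono)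
    qed
  qed (use that in measurable)
  have s1: "AE x in M N. summable (\<lambda>j. norm (?f j x))" using series(1)[OF N] by simp
  have "integrable (M N) (\<lambda>x. \<Sum>j. ?f j x)"
    by (rule integrable_suminf[OF series(5)[OF N] s1]) (use series(4)[OF N] in simp)
  then show "integrable (M N) (R N n)" by (simp add: remainder_def[abs_def])
  have s2: "AE x in M N. summable (\<lambda>j. norm (w x * ?f j x))"
    using s1 by eventually_elim (auto simp: abs_mult intro: summable_mult)
  have s3: "summable (\<lambda>j. \<integral>x. norm (w x * ?f j x) \<partial>M N)"
  \<comment> \<open>Termwise integration rests on the summable L1 norms from \<open>series\<close>;
    the bounded weight multiplies them by at most \<open>B\<close>.\<close>
  proof (rule summable_comparison_test[OF _ summable_mult[OF series(4)[OF N, of n], of B]])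
    have "(\<integral>x. norm (w x * ?f j x) \<partial>M N) \<le> (\<integral>x. B * \<bar>?f j x\<bar> \<partial>M N)" for j
    proof (rule integral_mono)
      show "integrable (M N) (\<lambda>x. norm (w x * ?f j x))" using iw[OF series(5)[OF N]] by (rule integrable_norm)
      show "integrable (M N) (\<lambda>x. B * \<bar>?f j x\<bar>)" using series(5)[OF N] by auto
      show "norm (w x * ?f j x) \<le> B * \<bar>?f j x\<bar>" if "x \<in> space (M N)" for x
        unfolding real_norm_def abs_mult using B[OF that] by (intro mult_right_mono) auto
    qed
    then show "\<exists>N'. \<forall>j\<ge>N'. norm (\<integral>x. norm (w x * ?f j x) \<partial>M N) \<le> B * (\<integral>x. \<bar>?f j x\<bar> \<partial>M N)"
      by (auto simp: abs_of_nonneg integral_nonneg_AE)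
  qed
  have "(\<lambda>j. \<integral>x. w x * ?f j x \<partial>M N) sums (\<integral>x. (\<Sum>j. w x * ?f j x) \<partial>M N)"
    by (rule sums_integral[OF iw[OF series(5)[OF N]] s2 s3])
  also have "(\<integral>x. (\<Sum>j. w x * ?f j x) \<partial>M N) = (\<integral>x. w x * R N n x \<partial>M N)"
  proof (rule integral_cong_AE)
    show "AE x in M N. (\<Sum>j. w x * ?f j x) = w x * R N n x"
      using s1 by eventually_elim (auto simp: remainder_def summable_rabs_cancel intro!: suminf_mult)
  qed (use R_measurable_M[OF N, of n] in measurable)
  also have "(\<lambda>j. \<integral>x. w x * ?f j x \<partial>M N) = (\<lambda>j. \<integral>x. w x * U N (n + 1 + j) x \<partial>M N)"
  proof
    fix j
    show "(\<integral>x. w x * ?f j x \<partial>M N) = (\<integral>x. w x * U N (n + 1 + j) x \<partial>M N)"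
      by (rule real_cond_exp_intg(2)[OF iw[OF U_integrable[OF N]] w]) (rule U_measurable[OF N], simp)
  qed
  finally show "(\<lambda>j. \<integral>x. w x * U N (n + 1 + j) x \<partial>M N) sums (\<integral>x. w x * R N n x \<partial>M N)" .
qed

text \<open>A weight from time i is also a weight from time i + 1. Both correctors therefore become
  numerical series, and the later one is the earlier one with its first term removed. That first
  term is the integral of w * U at time i + 1, so everything cancels; the tower property is never
  invoked.\<close>

lemma mds_W:
  assumes N: "N \<ge> 1"
  shows "mds (M N) (G N) (W N)"
  unfolding mds_def
proof (intro allI conjI impI)
  fix i
  have WS: "W N (Suc i) = (\<lambda>x. U N (Suc i) x + R N (Suc i) x - R N i x)" by (rule ext) (rule Wmart_Suc)
  have [measurable]: "R N i \<in> borel_measurable (G N (Suc i))"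
    by (rule filtration_measurable(2)[OF filt[OF N] R_measurable[OF N]]) simp
  have [measurable]: "R N (Suc i) \<in> borel_measurable (G N (Suc i))" "U N (Suc i) \<in> borel_measurable (G N (Suc i))"
    using R_measurable[OF N] B1[OF N] by auto
  show "W N (Suc i) \<in> borel_measurable (G N (Suc i))" unfolding WS by measurable
  have iR: "integrable (M N) (R N n)" for n by (rule R_integral(1)[OF N, of "\<lambda>_. 0" n 0]) auto
  have iU: "integrable (M N) (U N (Suc i))" using U_integrable[OF N, of i 0] by simp
  show "integrable (M N) (W N (Suc i))" unfolding WS using iR iU by auto
  fix w B assume w: "w \<in> borel_measurable (G N i)" and B: "\<forall>x\<in>space (M N). \<bar>w x\<bar> \<le> (B::real)"
  have w': "w \<in> borel_measurable (G N (Suc i))" by (rule filtration_measurable(2)[OF filt[OF N] w]) simp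
  have wM[measurable]: "w \<in> borel_measurable (M N)" by (rule filtration_measurable(1)[OF filt[OF N] w])
  have iw: "integrable (M N) (\<lambda>x. w x * g x)" if "integrable (M N) g" for g :: "'a \<Rightarrow> real"
  proof (rule Bochner_Integration.integrable_bound)
    show "integrable (M N) (\<lambda>x. B * g x)" using that by auto
    show "AE x in M N. norm (w x * g x) \<le> norm (B * g x)"
    proof (rule AE_I2)
      fix x assume "x \<in> space (M N)"
      then have "\<bar>w x\<bar> \<le> \<bar>B\<bar>" using B by fastforce
      then show "norm (w x * g x) \<le> norm (B * g x)" by (simp add: abs_mult mult_right_mono)
    qed
  qed (use that in measurable)
  define a where "a j = (\<integral>x. w x * U N (i + 1 + j) x \<partial>M N)" for j
  have s1: "a sums (\<integral>x. w x * R N i x \<partial>M N)"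
    unfolding a_def by (rule R_integral(2)[OF N w]) (use B in auto)
  have s2: "(\<lambda>j. a (Suc j)) sums (\<integral>x. w x * R N (Suc i) x \<partial>M N)"
    using R_integral(2)[OF N w', of B] B by (simp add: a_def)
  have "(\<integral>x. w x * R N (Suc i) x \<partial>M N) = (\<integral>x. w x * R N i x \<partial>M N) - a 0"
    using sums_unique2[OF s1 s2[unfolded sums_Suc_iff]] by simp
  moreover have "(\<integral>x. w x * W N (Suc i) x \<partial>M N) = a 0 + (\<integral>x. w x * R N (Suc i) x \<partial>M N) - (\<integral>x. w x * R N i x \<partial>M N)"
    unfolding WS a_def using iw[OF iU] iw[OF iR[of i]] iw[OF iR[of "Suc i"]] by (simp add: algebra_simps)
  ultimately show "(\<integral>x. w x * W N (Suc i) x \<partial>M N) = 0" by simp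
qed

end

section \<open>The Gaussian limit law\<close>

text \<open>A signed weight cannot be a density, but 2 + u is at least 1. Under the normalised
  density (2 + u) / \<kappa> the variable X has the same characteristic function as without it,
  hence the same law by Levy's uniqueness theorem; subtracting the untilted part isolates u.\<close>

lemma (in prob_space) char_tilt_indicator:
  fixes X u :: "'a \<Rightarrow> real"
  assumes X[measurable]: "X \<in> borel_measurable M" and u[measurable]: "u \<in> borel_measurable M"
    and u1: "\<And>x. x \<in> space M \<Longrightarrow> \<bar>u x\<bar> \<le> 1" and \<nu>: "real_distribution \<nu>"
    and ch: "\<And>t. (\<integral>x. iexp (t * X x) \<partial>M) = char \<nu> t"
    and chu: "\<And>t. (\<integral>x. complex_of_real (u x) * iexp (t * X x) \<partial>M) = char \<nu> t * (\<integral>x. u x \<partial>M)"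
    and B[measurable]: "B \<in> sets borel"
  shows "(\<integral>x. u x * indicator B (X x) \<partial>M) = (\<integral>x. u x \<partial>M) * measure \<nu> B"
proof -
  interpret \<nu>: real_distribution \<nu> by fact
  have iu: "integrable M u" by (rule integrable_const_bound[where B=1]) (use u1 in auto)
  have eu: "\<bar>\<integral>x. u x \<partial>M\<bar> \<le> 1"
  proof -
    have "norm (\<integral>x. u x \<partial>M) \<le> (\<integral>x. 1 \<partial>M)" by (rule norm_integral_le[OF iu]) (use u1 in auto)
    then show ?thesis by (simp add: prob_space)
  qed
  define \<kappa> where "\<kappa> = 2 + (\<integral>x. u x \<partial>M)"
  have \<kappa>: "1 \<le> \<kappa>" using eu by (auto simp: \<kappa>_def)
  define v where "v x = (2 + u x) / \<kappa>" for x
  have [measurable]: "v \<in> borel_measurable M" unfolding v_def by measurable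
  have v0: "0 \<le> v x" if "x \<in> space M" for x
    unfolding v_def using u1[OF that] \<kappa> by (auto simp: abs_le_iff)
  have v0': "AE x in M. 0 \<le> v x" using v0 by auto
  have iv: "integrable M v" unfolding v_def using iu by auto
  have Ev: "(\<integral>x. v x \<partial>M) = 1"
    unfolding v_def using iu \<kappa> by (simp add: \<kappa>_def[symmetric] prob_space)
  define L where "L = distr (density M (\<lambda>x. ennreal (v x))) borel X"
  have Lr: "real_distribution L"
  proof -
    have "(\<integral>\<^sup>+x. ennreal (v x) \<partial>M) = 1"
      using nn_integral_eq_integral[OF iv v0'] Ev by simp
    then have "prob_space (density M (\<lambda>x. ennreal (v x)))"
      by (auto intro!: prob_spaceI simp: emeasure_density cong: nn_integral_cong)
    then have "prob_space L" unfolding L_def by (rule prob_space.prob_space_distr) measurable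
    then show ?thesis by (auto simp: real_distribution_def real_distribution_axioms_def L_def)
  qed
  interpret L: real_distribution L by fact
  have Lint: "(\<integral>y. f y \<partial>L) = (\<integral>x. v x *\<^sub>R f (X x) \<partial>M)" if [measurable]: "f \<in> borel_measurable borel"
    for f :: "real \<Rightarrow> 'z::{banach,second_countable_topology}"
    unfolding L_def using v0' by (simp add: integral_distr integral_density)
  have ie: "integrable M (\<lambda>x. iexp (t * X x))" for t
    by (rule integrable_const_bound[where B=1]) auto
  have iue: "integrable M (\<lambda>x. complex_of_real (u x) * iexp (t * X x))" for t
    by (rule integrable_const_bound[where B=1]) (use u1 in \<open>auto simp: norm_mult\<close>)
  have "char L = char \<nu>"
  proof
    fix t
    have "char L t = (\<integral>x. v x *\<^sub>R iexp (t * X x) \<partial>M)"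
      unfolding char_def by (rule Lint) measurable
    also have "\<dots> = (\<integral>x. (2 * iexp (t * X x) + complex_of_real (u x) * iexp (t * X x)) / complex_of_real \<kappa> \<partial>M)"
      by (intro Bochner_Integration.integral_cong) (auto simp: v_def scaleR_conv_of_real field_simps)
    also have "\<dots> = (2 * (\<integral>x. iexp (t * X x) \<partial>M) + (\<integral>x. complex_of_real (u x) * iexp (t * X x) \<partial>M)) / complex_of_real \<kappa>"
      using ie iue by simp
    also have "\<dots> = char \<nu> t * (2 + complex_of_real (\<integral>x. u x \<partial>M)) / complex_of_real \<kappa>"
      unfolding ch chu by (simp add: algebra_simps)
    also have "2 + complex_of_real (\<integral>x. u x \<partial>M) = complex_of_real \<kappa>" by (simp add: \<kappa>_def)
    finally show "char L t = char \<nu> t" using \<kappa> by simp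
  qed
  then have L\<nu>: "L = \<nu>" by (rule Levy_uniqueness[OF Lr \<nu>])
  have "distr M borel X = \<nu>"
    by (rule Levy_uniqueness) (use \<nu> ch in \<open>auto simp: char_def integral_distr fun_eq_iff intro!: real_distribution_distr\<close>)
  then have p: "(\<integral>x. indicator B (X x) \<partial>M) = measure \<nu> B"
    using integral_distr[OF X, of "indicator B :: real \<Rightarrow> real"] by simp
  have ib: "integrable M (\<lambda>x. indicator B (X x) :: real)" "integrable M (\<lambda>x. u x * indicator B (X x))"
    by (rule integrable_const_bound[where B=1], auto simp: indicator_def)
       (rule integrable_const_bound[where B=1], use u1 in \<open>auto simp: indicator_def\<close>)
  have "measure \<nu> B = (\<integral>y. indicator B y \<partial>L)" by (simp add: L\<nu>)
  also have "\<dots> = (\<integral>x. (2 * indicator B (X x) + u x * indicator B (X x)) / \<kappa> \<partial>M)"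
    by (subst Lint) (auto simp: v_def field_simps intro!: Bochner_Integration.integral_cong)
  also have "\<dots> = (2 * measure \<nu> B + (\<integral>x. u x * indicator B (X x) \<partial>M)) / \<kappa>"
    using ib p by simp
  finally have "measure \<nu> B * \<kappa> = 2 * measure \<nu> B + (\<integral>x. u x * indicator B (X x) \<partial>M)"
    using \<kappa> by (simp add: field_simps)
  then show ?thesis by (simp add: \<kappa>_def algebra_simps)
qed

text \<open>Kac's theorem: the factors \<open>iexp (\<theta> j * X j)\<close> are replaced by indicators one at a time.\<close>

lemma (in prob_space) joint_char_imp_indep:
  fixes X :: "nat \<Rightarrow> 'a \<Rightarrow> real"
  assumes X[measurable]: "\<And>j. j < n \<Longrightarrow> X j \<in> borel_measurable M"
    and \<nu>: "\<And>j. j < n \<Longrightarrow> real_distribution (\<nu> j)"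
    and ch: "\<And>\<theta>. (\<integral>x. iexp (\<Sum>j<n. \<theta> j * X j x) \<partial>M) = (\<Prod>j<n. char (\<nu> j) (\<theta> j))"
  shows joint_char_distr: "\<And>j. j < n \<Longrightarrow> distr M borel (X j) = \<nu> j"
    and joint_char_indep: "indep_vars (\<lambda>_. borel) X {..<n}"
proof -
  have char0: "j < n \<Longrightarrow> char (\<nu> j) 0 = 1" for j by (rule real_distribution.char_zero[OF \<nu>])
  have single: "(\<integral>x. iexp (t * X j x) \<partial>M) = char (\<nu> j) t" if j: "j < n" for j t
  proof -
    have "(\<Sum>i<n. (if i = j then t else 0) * X i x) = t * X j x" for x
      using j by (subst sum.remove[of _ j]) auto
    moreover have "(\<Prod>i<n. char (\<nu> i) (if i = j then t else 0)) = char (\<nu> j) t"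
      using j char0 by (subst prod.remove[of _ j]) (auto intro!: prod.neutral)
    ultimately show ?thesis using ch[of "\<lambda>i. if i = j then t else 0"] by simp
  qed
  show d: "distr M borel (X j) = \<nu> j" if j: "j < n" for j
    by (rule Levy_uniqueness) (use \<nu>[OF j] single[OF j] X[OF j] in \<open>auto simp: char_def integral_distr fun_eq_iff intro!: real_distribution_distr\<close>)
  have claim: "(\<integral>x. complex_of_real (\<Prod>j<r. indicator (B j) (X j x)) * iexp (\<Sum>j\<in>{r..<n}. \<theta> j * X j x) \<partial>M)
     = complex_of_real (\<Prod>j<r. measure (\<nu> j) (B j)) * (\<Prod>j\<in>{r..<n}. char (\<nu> j) (\<theta> j))"
    if "r \<le> n" and B: "\<And>j. B j \<in> sets borel" for r \<theta> and B :: "nat \<Rightarrow> real set"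
    using that(1)
  proof (induction r arbitrary: \<theta>)
    case 0
    then show ?case using ch[of \<theta>] by (simp add: atLeast0LessThan)
  next
    case (Suc r)
    note [measurable] = B
    have rn: "r < n" and rn': "r \<le> n" using Suc by auto
    define P where "P x = (\<Prod>j<r. indicator (B j) (X j x) :: real)" for x
    define p where "p = (\<Prod>j<r. measure (\<nu> j) (B j))"
    define a where "a x = (\<Sum>j\<in>{Suc r..<n}. \<theta> j * X j x)" for x
    define c where "c s = (\<Prod>j\<in>{Suc r..<n}. char (\<nu> j) (s * \<theta> j))" for s :: real
    have [measurable]: "P \<in> borel_measurable M" unfolding P_def
    proof (rule borel_measurable_prod)
      fix j assume "j \<in> {..<r}"
      then have [measurable]: "X j \<in> borel_measurable M" using rn by auto
      show "(\<lambda>x. indicator (B j) (X j x) :: real) \<in> borel_measurable M" by measurable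
    qed
    have [measurable]: "a \<in> borel_measurable M" unfolding a_def by measurable
    have Xr[measurable]: "X r \<in> borel_measurable M" using rn by auto
    have P01: "0 \<le> P x" "P x \<le> 1" for x unfolding P_def
      by (auto intro!: prod_nonneg prod_le_1 simp: indicator_def)
    \<comment> \<open>The remaining phase carries a free factor s, so that the induction hypothesis
      covers both frequencies 1 and -1. Their combinations are the cosine and the sine of that
      phase, and these are real weights as the tilting lemma demands.\<close>
    have IH: "(\<integral>x. complex_of_real (P x) * iexp (s * a x + t * X r x) \<partial>M) = complex_of_real p * (char (\<nu> r) t * c s)" for s t
    proof -
      have "(\<Sum>j\<in>{r..<n}. (if j = r then t else s * \<theta> j) * X j x) = s * a x + t * X r x" for x
      proof -
        have "(\<Sum>j\<in>{r..<n}. (if j = r then t else s * \<theta> j) * X j x) = t * X r x + (\<Sum>j\<in>{Suc r..<n}. (if j = r then t else s * \<theta> j) * X j x)"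
          using rn by (subst sum.atLeast_Suc_lessThan) auto
        also have "(\<Sum>j\<in>{Suc r..<n}. (if j = r then t else s * \<theta> j) * X j x) = s * a x"
          unfolding a_def sum_distrib_left by (intro sum.cong) auto
        finally show ?thesis by simp
      qed
      moreover have "(\<Prod>j\<in>{r..<n}. char (\<nu> j) (if j = r then t else s * \<theta> j)) = char (\<nu> r) t * c s"
        using rn by (subst prod.atLeast_Suc_lessThan) (auto simp: c_def intro!: prod.cong)
      ultimately show ?thesis using Suc.IH[OF rn', of "\<lambda>j. if j = r then t else s * \<theta> j"] by (simp add: P_def p_def)
    qed
    have iP: "integrable M (\<lambda>x. complex_of_real (P x) * iexp (s * a x + t * X r x))" for s t
      by (rule integrable_const_bound[where B=1]) (use P01 in \<open>auto simp: norm_mult\<close>)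
    have c0: "char (\<nu> r) 0 = 1" by (rule char0[OF rn])
    have main: "(\<integral>x. g x * indicator (B r) (X r x) \<partial>M) = (\<integral>x. g x \<partial>M) * measure (\<nu> r) (B r)"
      if g[measurable]: "g \<in> borel_measurable M" and g1: "\<And>x. \<bar>g x\<bar> \<le> 1"
        and gg: "\<And>x t. complex_of_real (g x) * iexp (t * X r x)
           = aa * (complex_of_real (P x) * iexp (1 * a x + t * X r x)) + bb * (complex_of_real (P x) * iexp ((-1) * a x + t * X r x))"
      for g :: "'a \<Rightarrow> real" and aa bb
    proof (rule char_tilt_indicator[OF Xr g g1 \<nu>[OF rn] single[OF rn] _ B])
      fix t
      have e: "(\<integral>x. complex_of_real (g x) * iexp (t * X r x) \<partial>M) = char (\<nu> r) t * (complex_of_real p * (aa * c 1 + bb * c (-1)))" for t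
        unfolding gg using iP[of 1 t] iP[of "-1" t] IH[of 1 t] IH[of "-1" t] by (simp add: algebra_simps)
      have "complex_of_real (\<integral>x. g x \<partial>M) = (\<integral>x. complex_of_real (g x) * iexp (0 * X r x) \<partial>M)" by simp
      also have "\<dots> = complex_of_real p * (aa * c 1 + bb * c (-1))" unfolding e by (simp add: c0)
      finally show "(\<integral>x. complex_of_real (g x) * iexp (t * X r x) \<partial>M) = char (\<nu> r) t * (\<integral>x. g x \<partial>M)"
        unfolding e by simp
    qed
    have b1: "\<bar>P x * cos (a x)\<bar> \<le> 1" "\<bar>P x * sin (a x)\<bar> \<le> 1" for x
      using P01[of x] by (auto simp: abs_mult intro!: mult_le_one)
    have E: "iexp (1 * a x + y) = iexp (a x) * iexp y" "iexp (-1 * a x + y) = exp (- (\<i> * complex_of_real (a x))) * iexp y" for x y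
      by (simp_all add: algebra_simps flip: exp_add)
    have C: "(\<integral>x. P x * cos (a x) * indicator (B r) (X r x) \<partial>M) = (\<integral>x. P x * cos (a x) \<partial>M) * measure (\<nu> r) (B r)"
    proof -
      have gg: "complex_of_real (P x * cos (a x)) * iexp (t * X r x)
           = 1/2 * (complex_of_real (P x) * iexp (1 * a x + t * X r x)) + 1/2 * (complex_of_real (P x) * iexp ((-1) * a x + t * X r x))" for x t
        unfolding E of_real_mult cos_of_real[symmetric] cos_exp_eq by (simp add: algebra_simps)
      show ?thesis by (rule main[OF _ _ gg]) (use b1 in auto)
    qed
    have S: "(\<integral>x. P x * sin (a x) * indicator (B r) (X r x) \<partial>M) = (\<integral>x. P x * sin (a x) \<partial>M) * measure (\<nu> r) (B r)"
    proof -
      have gg: "complex_of_real (P x * sin (a x)) * iexp (t * X r x)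
           = 1/(2*\<i>) * (complex_of_real (P x) * iexp (1 * a x + t * X r x)) + -1/(2*\<i>) * (complex_of_real (P x) * iexp ((-1) * a x + t * X r x))" for x t
        unfolding E of_real_mult sin_of_real[symmetric] sin_exp_eq by (simp add: field_simps)
      show ?thesis by (rule main[OF _ _ gg]) (use b1 in auto)
    qed
    have ci: "integrable M (\<lambda>x. P x * cos (a x))" "integrable M (\<lambda>x. P x * sin (a x))"
      by (rule integrable_const_bound[where B=1]; use b1 in auto)+
    have ci2: "integrable M (\<lambda>x. P x * cos (a x) * indicator (B r) (X r x))" "integrable M (\<lambda>x. P x * sin (a x) * indicator (B r) (X r x))"
      by (rule integrable_const_bound[where B=1]; use b1 in \<open>auto simp: indicator_def\<close>)+
    have ie: "iexp y = complex_of_real (cos y) + \<i> * complex_of_real (sin y)" for y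
      by (simp add: cis_conv_exp[symmetric] cis.code Complex_eq)
    have "(\<integral>x. complex_of_real (P x * indicator (B r) (X r x)) * iexp (a x) \<partial>M)
      = (\<integral>x. complex_of_real (P x * cos (a x) * indicator (B r) (X r x)) + \<i> * complex_of_real (P x * sin (a x) * indicator (B r) (X r x)) \<partial>M)"
      by (intro Bochner_Integration.integral_cong) (auto simp: ie algebra_simps)
    also have "\<dots> = complex_of_real (\<integral>x. P x * cos (a x) * indicator (B r) (X r x) \<partial>M) + \<i> * complex_of_real (\<integral>x. P x * sin (a x) * indicator (B r) (X r x) \<partial>M)"
      using ci2 by (simp del: of_real_mult)
    also have "\<dots> = complex_of_real (measure (\<nu> r) (B r)) * (complex_of_real (\<integral>x. P x * cos (a x) \<partial>M) + \<i> * complex_of_real (\<integral>x. P x * sin (a x) \<partial>M))"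
      unfolding C S by (simp add: algebra_simps)
    also have "complex_of_real (\<integral>x. P x * cos (a x) \<partial>M) + \<i> * complex_of_real (\<integral>x. P x * sin (a x) \<partial>M)
       = (\<integral>x. complex_of_real (P x * cos (a x)) + \<i> * complex_of_real (P x * sin (a x)) \<partial>M)"
      using ci by (simp del: of_real_mult)
    also have "\<dots> = (\<integral>x. complex_of_real (P x) * iexp (1 * a x + 0 * X r x) \<partial>M)"
      by (intro Bochner_Integration.integral_cong) (auto simp: ie algebra_simps)
    also have "\<dots> = complex_of_real p * c 1" unfolding IH c0 by simp
    finally show ?case by (simp add: P_def p_def a_def c_def)
  qed
  show "indep_vars (\<lambda>_. borel) X {..<n}"
  proof (cases "n = 0")
    case True
    then show ?thesis by (auto simp: indep_vars_def indep_sets_def)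
  next
    case False
    show ?thesis
    proof (rule indep_vars_finite[where E="\<lambda>_. sets borel" and X=X and I="{..<n}" and M'="\<lambda>_. borel", THEN iffD2])
      show "sets (borel::real measure) = sigma_sets (space (borel :: real measure)) (sets borel)" if "i \<in> {..<n}" for i
        using sets.sigma_sets_eq[of "borel::real measure"] by simp
      show "\<forall>A\<in>(\<Pi> i\<in>{..<n}. sets (borel :: real measure)). prob (\<Inter>j\<in>{..<n}. X j -` A j \<inter> space M) = (\<Prod>j\<in>{..<n}. prob (X j -` A j \<inter> space M))"
      proof
        fix A :: "nat \<Rightarrow> real set" assume A: "A \<in> {..<n} \<rightarrow> sets borel"
        \<comment> \<open>\<open>claim\<close> wants a Borel set at every index; those from n on
          never enter the product.\<close>
        define B where "B j = (if j < n then A j else {})" for j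
        have B: "B j \<in> sets borel" for j using A by (auto simp: B_def)
        have "complex_of_real (\<integral>x. (\<Prod>j<n. indicator (B j) (X j x)) \<partial>M) = complex_of_real (\<Prod>j<n. measure (\<nu> j) (B j))"
          using claim[OF order_refl, of B "\<lambda>_. 0", OF B] by (simp del: of_real_prod)
        then have 1: "(\<integral>x. (\<Prod>j<n. indicator (B j) (X j x)) \<partial>M) = (\<Prod>j<n. measure (\<nu> j) (B j))"
          by (simp only: of_real_eq_iff)
        have "(\<integral>x. (\<Prod>j<n. indicator (B j) (X j x) :: real) \<partial>M) = (\<integral>x. indicator (\<Inter>j\<in>{..<n}. X j -` A j \<inter> space M) x \<partial>M)"
        proof (rule Bochner_Integration.integral_cong[OF refl])
          fix x assume "x \<in> space M"
          then show "(\<Prod>j<n. indicator (B j) (X j x)) = (indicator (\<Inter>j\<in>{..<n}. X j -` A j \<inter> space M) x :: real)"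
            using False by (auto simp: indicator_def B_def prod_zero_iff)
        qed
        also have "\<dots> = prob (\<Inter>j\<in>{..<n}. X j -` A j \<inter> space M)"
          using False by (auto intro!: arg_cong[where f=prob])
        finally have 2: "prob (\<Inter>j\<in>{..<n}. X j -` A j \<inter> space M) = (\<Prod>j<n. measure (\<nu> j) (B j))" using 1 by simp
        have "measure (\<nu> j) (B j) = prob (X j -` A j \<inter> space M)" if "j < n" for j
          unfolding d[OF that, symmetric] using that A X[OF that] by (subst measure_distr) (auto simp: B_def)
        then show "prob (\<Inter>j\<in>{..<n}. X j -` A j \<inter> space M) = (\<Prod>j\<in>{..<n}. prob (X j -` A j \<inter> space M))"
          using 2 by simp
      qed
    qed (use False X in \<open>auto simp: Int_stable_def\<close>)
  qed
qed

section \<open>Independent standard normals and Brownian motion on the unit interval\<close>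

abbreviation "gauss_seq \<equiv> PiM (UNIV :: nat set) (\<lambda>_. std_normal_distribution)"

lemma prob_space_gauss_seq: "prob_space gauss_seq"
  by (rule prob_space_PiM) (use real_dist_normal_dist in \<open>simp add: real_distribution_def\<close>)

lemma gauss_seq_component[measurable]: "(\<lambda>\<omega>. \<omega> i) \<in> borel_measurable gauss_seq"
proof -
  have "(\<lambda>\<omega>. \<omega> i) \<in> measurable gauss_seq std_normal_distribution" by (rule measurable_component_singleton) simp
  then show ?thesis by simp
qed

lemma gauss_seq_distr: "distr gauss_seq borel (\<lambda>\<omega>. \<omega> i) = std_normal_distribution"
proof -
  have "distr gauss_seq std_normal_distribution (\<lambda>\<omega>. \<omega> i) = std_normal_distribution"
    by (rule distr_PiM_component) (use real_dist_normal_dist in \<open>auto simp: real_distribution_def\<close>)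
  then show ?thesis by (simp cong: distr_cong)
qed

lemma gauss_seq_indep: "prob_space.indep_vars gauss_seq (\<lambda>_. borel) (\<lambda>i \<omega>. \<omega> i) UNIV"
proof -
  interpret prob_space gauss_seq by (rule prob_space_gauss_seq)
  have s: "sets (PiM UNIV (\<lambda>_::nat. borel :: real measure)) = sets gauss_seq" by (intro sets_PiM_cong) auto
  have "distr gauss_seq (PiM UNIV (\<lambda>_. borel)) (\<lambda>x. \<lambda>i\<in>UNIV. x i) = distr gauss_seq gauss_seq (\<lambda>x. x)"
    by (intro distr_cong s) auto
  also have "\<dots> = gauss_seq" by (rule distr_id)
  finally show ?thesis
    by (subst indep_vars_iff_distr_eq_PiM) (auto simp: gauss_seq_distr)
qed

lemma gauss_seq_char:
  "(\<integral>\<omega>. iexp (\<Sum>k<K. a k * \<omega> k) \<partial>gauss_seq) = complex_of_real (exp (- (\<Sum>k<K. (a k)\<^sup>2) / 2))"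
proof -
  interpret prob_space gauss_seq by (rule prob_space_gauss_seq)
  have "indep_vars (\<lambda>_. borel) (\<lambda>k \<omega>. a k * \<omega> k) UNIV"
    using indep_vars_compose2[OF gauss_seq_indep, of "\<lambda>k x. a k * x" "\<lambda>_. borel"] by simp
  then have "indep_vars (\<lambda>_. borel) (\<lambda>k \<omega>. a k * \<omega> k) {..<K}" by (rule indep_vars_subset) auto
  from char_distr_sum[OF this, of 1]
  have "(\<integral>\<omega>. iexp (\<Sum>k<K. a k * \<omega> k) \<partial>gauss_seq) = (\<Prod>k<K. char (distr gauss_seq borel (\<lambda>\<omega>. a k * \<omega> k)) 1)"
    by (simp add: char_def integral_distr)
  also have "\<dots> = (\<Prod>k<K. complex_of_real (exp (- (a k)\<^sup>2 / 2)))"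
  proof (rule prod.cong[OF refl])
    fix k
    have "char (distr gauss_seq borel (\<lambda>\<omega>. a k * \<omega> k)) 1 = char (distr gauss_seq borel (\<lambda>\<omega>. \<omega> k)) (a k)"
      by (simp add: char_def integral_distr)
    then show "char (distr gauss_seq borel (\<lambda>\<omega>. a k * \<omega> k)) 1 = complex_of_real (exp (- (a k)\<^sup>2 / 2))"
      by (simp add: gauss_seq_distr char_std_normal_distribution)
  qed
  also have "(\<Prod>k<K. complex_of_real (exp (- (a k)\<^sup>2 / 2))) = complex_of_real (exp (- (\<Sum>k<K. (a k)\<^sup>2) / 2))"
    unfolding of_real_prod[symmetric] sum_negf[symmetric] sum_divide_distrib by (simp add: exp_sum)
  finally show ?thesis .
qed

lemma gauss_seq_fourth: "integrable gauss_seq (\<lambda>\<omega>. (\<omega> k)^4)" "(\<integral>\<omega>. (\<omega> k)^4 \<partial>gauss_seq) = 3"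
proof -
  have "integrable (distr gauss_seq borel (\<lambda>\<omega>. \<omega> k)) (\<lambda>x. x ^ 4)"
    unfolding gauss_seq_distr by (rule integrable_std_normal_distribution_moment)
  then show "integrable gauss_seq (\<lambda>\<omega>. (\<omega> k)^4)" by (subst (asm) integrable_distr_eq) auto
  have "(\<integral>x. x ^ 4 \<partial>distr gauss_seq borel (\<lambda>\<omega>. \<omega> k)) = 3"
    unfolding gauss_seq_distr using std_normal_distribution_even_moments(1)[of 2] by (simp add: fact_numeral)
  then show "(\<integral>\<omega>. (\<omega> k)^4 \<partial>gauss_seq) = 3" by (subst (asm) integral_distr) auto
qed

text \<open>Levy's construction of Brownian motion on \<open>[0, 1]\<close>; coordinate \<open>2^n + i\<close> is the
  coefficient of the \<open>i\<close>-th tent function of generation \<open>n\<close>, and coordinate \<open>0\<close> that of the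
  linear function.\<close>

definition tent :: "real \<Rightarrow> real" where "tent x = max 0 (1 - \<bar>2 * x - 1\<bar>)"

text \<open>Given the values at the ends of an interval of length 1/2^n, the midpoint of a Brownian
  path has variance 1 / (4 * 2^n). The divisor is the reciprocal of its standard deviation, since
  the tent has height 1.\<close>

definition level :: "nat \<Rightarrow> (nat \<Rightarrow> real) \<Rightarrow> real \<Rightarrow> real" where
  "level n \<omega> t = (\<Sum>i<2^n. \<omega> (2^n + i) * tent (2^n * t - real i)) / (2 * sqrt (2^n))"

definition levels :: "nat \<Rightarrow> (nat \<Rightarrow> real) \<Rightarrow> real \<Rightarrow> real" where
  "levels n \<omega> t = \<omega> 0 * t + (\<Sum>m<n. level m \<omega> t)"

definition bm :: "(nat \<Rightarrow> real) \<Rightarrow> real \<Rightarrow> real" where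
  "bm \<omega> t = \<omega> 0 * t + (\<Sum>m. level m \<omega> t)"

text \<open>Taken from the partial sum \<open>levels n\<close>, which already agrees with
  \<open>bm\<close> at the dyadic points of order n; an increment thus involves finitely many
  coordinates and admits induction on n.\<close>

definition dyadic_inc :: "nat \<Rightarrow> (nat \<Rightarrow> real) \<Rightarrow> nat \<Rightarrow> real" where
  "dyadic_inc n \<omega> i = levels n \<omega> (real (Suc i) / 2^n) - levels n \<omega> (real i / 2^n)"

lemma tent_nonneg: "0 \<le> tent x" and tent_le_1: "tent x \<le> 1" by (auto simp: tent_def)

lemma tent_int: "tent (of_int k) = 0"
proof -
  have "1 \<le> \<bar>2 * k - 1\<bar>" by presburger
  then have "1 \<le> \<bar>of_int (2 * k - 1) :: real\<bar>" by linarith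
  then show ?thesis by (simp add: tent_def)
qed

lemma tent_half: "tent (of_int k + 1/2) = (if k = 0 then 1 else 0)"
proof (cases "k = 0")
  case False
  then have "1 \<le> \<bar>2 * k\<bar>" by presburger
  then have "1 \<le> \<bar>of_int (2 * k) :: real\<bar>" by linarith
  then show ?thesis using False by (simp add: tent_def)
qed (simp add: tent_def)

text \<open>The kinks lie at 0, 1/2 and 1, so the tent is affine on every interval
  [k/2, (k+1)/2].\<close>

lemma tent_midpoint:
  assumes "of_int k \<le> 2 * x" "2 * x \<le> of_int k + 1" "of_int k \<le> 2 * y" "2 * y \<le> of_int k + 1"
  shows "tent ((x + y) / 2) = (tent x + tent y) / 2"
proof -
  consider "k \<le> - 1" | "k = 0" | "k = 1" | "k \<ge> 2" by linarith
  then show ?thesis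
  proof cases
    case 1
    then have "real_of_int k \<le> -1" by simp
    then have "x \<le> 0" "y \<le> 0" using assms by linarith+
    then show ?thesis by (simp add: tent_def)
  next
    case 2
    then have "0 \<le> x" "2 * x \<le> 1" "0 \<le> y" "2 * y \<le> 1" using assms by auto
    then show ?thesis by (simp add: tent_def field_simps)
  next
    case 3
    then have "1 \<le> 2 * x" "x \<le> 1" "1 \<le> 2 * y" "y \<le> 1" using assms by auto
    then show ?thesis by (simp add: tent_def field_simps)
  next
    case 4
    then have "2 \<le> real_of_int k" by simp
    then have "1 \<le> x" "1 \<le> y" using assms by linarith+
    then show ?thesis by (simp add: tent_def)
  qed
qed

text \<open>Generation m < n has its kinks at multiples of 1/2^(m+1), hence none strictly between
  neighbouring points of mesh 1/2^n.\<close>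

lemma levels_midpoint:
  "levels n \<omega> (real (2 * j + 1) / 2^Suc n) = (levels n \<omega> (real j / 2^n) + levels n \<omega> (real (Suc j) / 2^n)) / 2"
proof -
  let ?x = "real j / 2^n" let ?y = "real (Suc j) / 2^n"
  have mid: "real (2 * j + 1) / 2^Suc n = (?x + ?y) / 2" by (simp add: field_simps)
  have lev: "level m \<omega> ((?x + ?y) / 2) = (level m \<omega> ?x + level m \<omega> ?y) / 2" if "m < n" for m
  proof -
    from that obtain d where d': "n = Suc (m + d)" by (rule less_natE)
    then have d: "n = Suc m + d" by simp
    have tm: "tent (2^m * ((?x + ?y) / 2) - real i) = (tent (2^m * ?x - real i) + tent (2^m * ?y - real i)) / 2" for i
    proof -
      \<comment> \<open>The cell of mesh 1/2^(m+1), counted from 0, that contains the interval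
        between the two neighbouring points.\<close>
      define q where "q = j div 2^d"
      have q: "q * 2^d \<le> j" "Suc j \<le> q * 2^d + 2^d"
        unfolding q_def using div_mult_mod_eq[of j "2^d"] mod_less_divisor[of "2^d" j] by (simp_all add: Suc_le_eq)
         (metis add.commute add_less_cancel_left div_mult_mod_eq mult.commute mod_less_divisor pos2 zero_less_power)
      have x2: "2 * (2^m * ?x) = real j / 2^d" "2 * (2^m * ?y) = real (Suc j) / 2^d"
        by (simp_all add: d power_add field_simps)
      have "real (q * 2^d) \<le> real j" "real (Suc j) \<le> real (q * 2^d + 2^d)" using q by (simp_all only: of_nat_le_iff)
      then have "real q \<le> real j / 2^d" "real (Suc j) / 2^d \<le> real q + 1" "real j / 2^d \<le> real (Suc j) / 2^d"
        by (simp_all add: field_simps)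
      then have "of_int (int q - 2 * int i) \<le> 2 * (2^m * ?x - real i)" "2 * (2^m * ?x - real i) \<le> of_int (int q - 2 * int i) + 1"
        "of_int (int q - 2 * int i) \<le> 2 * (2^m * ?y - real i)" "2 * (2^m * ?y - real i) \<le> of_int (int q - 2 * int i) + 1"
        unfolding right_diff_distrib x2 by simp_all
      note hyps = this
      have avg: "c * ((u + v) / 2) - w = ((c * u - w) + (c * v - w)) / 2" for c u v w :: real
        by (simp add: field_simps)
      show ?thesis unfolding avg by (rule tent_midpoint[OF hyps])
    qed
    have gen: "(\<Sum>i\<in>I. w i * ((a i + b i) / 2)) / D = ((\<Sum>i\<in>I. w i * a i) / D + (\<Sum>i\<in>I. w i * b i) / D) / 2"
      for I :: "nat set" and w a b :: "nat \<Rightarrow> real" and D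
    proof -
      have "(\<Sum>i\<in>I. w i * ((a i + b i) / 2)) = ((\<Sum>i\<in>I. w i * a i) + (\<Sum>i\<in>I. w i * b i)) / 2"
        unfolding sum.distrib[symmetric] sum_divide_distrib by (rule sum.cong) (auto simp: distrib_left)
      then show ?thesis by (simp add: add_divide_distrib)
    qed
    show ?thesis unfolding level_def tm by (rule gen)
  qed
  show ?thesis
  proof -
    have "(\<Sum>m<n. level m \<omega> ((?x + ?y) / 2)) = (\<Sum>m<n. (level m \<omega> ?x + level m \<omega> ?y) / 2)"
      by (rule sum.cong[OF refl], rule lev) simp
    also have "\<dots> = ((\<Sum>m<n. level m \<omega> ?x) + (\<Sum>m<n. level m \<omega> ?y)) / 2"
      by (simp only: sum.distrib sum_divide_distrib[symmetric])
    finally have e: "(\<Sum>m<n. level m \<omega> ((?x + ?y) / 2)) = \<dots>" .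
    have "w * ((u + v) / 2) + (p + q) / 2 = ((w * u + p) + (w * v + q)) / 2" for w u v p q :: real
      by (simp add: field_simps)
    then show ?thesis unfolding mid levels_def e by blast
  qed
qed

lemma level_dyadic: "m \<ge> n \<Longrightarrow> level m \<omega> (real j / 2^n) = 0"
proof -
  assume "m \<ge> n"
  then obtain d where d: "m = n + d" using le_iff_add by auto
  have "tent (2^m * (real j / 2^n) - real i) = 0" for i
  proof -
    have "2^m * (real j / 2^n) - real i = of_int (2^d * int j - int i)" by (simp add: d power_add)
    then show ?thesis by (simp only: tent_int)
  qed
  then show ?thesis by (simp add: level_def)
qed

lemma level_dyadic_mid: "j < 2^n \<Longrightarrow> level n \<omega> (real (2 * j + 1) / 2^Suc n) = \<omega> (2^n + j) / (2 * sqrt (2^n))"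
proof -
  assume j: "j < 2^n"
  have "tent (2^n * (real (2 * j + 1) / 2^Suc n) - real i) = (if i = j then 1 else 0)" for i
  proof -
    have "2^n * (real (2 * j + 1) / 2^Suc n) - real i = of_int (int j - int i) + 1/2" by (simp add: field_simps)
    then show ?thesis by (simp only: tent_half) auto
  qed
  then have "level n \<omega> (real (2 * j + 1) / 2^Suc n) = (\<Sum>i<2^n. if i = j then \<omega> (2^n + i) else 0) / (2 * sqrt (2^n))"
    unfolding level_def by (intro arg_cong2[where f="(/)"] sum.cong) auto
  then show ?thesis using j by simp
qed

lemma bm_dyadic: "bm \<omega> (real j / 2^n) = levels n \<omega> (real j / 2^n)"
  unfolding bm_def levels_def by (subst suminf_finite[of "{..<n}"]) (auto intro: level_dyadic)

text \<open>Midpoint displacement: each coarse increment is halved, and one fresh normal is added to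
  the left half and subtracted from the right half.\<close>

lemma dyadic_inc_even: "j < 2^n \<Longrightarrow> dyadic_inc (Suc n) \<omega> (2 * j) = dyadic_inc n \<omega> j / 2 + \<omega> (2^n + j) / (2 * sqrt (2^n))"
  and dyadic_inc_odd: "j < 2^n \<Longrightarrow> dyadic_inc (Suc n) \<omega> (2 * j + 1) = dyadic_inc n \<omega> j / 2 - \<omega> (2^n + j) / (2 * sqrt (2^n))"
proof -
  assume j: "j < 2^n"
  have S: "levels (Suc n) \<omega> t = levels n \<omega> t + level n \<omega> t" for t by (simp add: levels_def)
  have e: "real (2 * j) / 2^Suc n = real j / 2^n" "real (Suc (2 * j + 1)) / 2^Suc n = real (Suc j) / 2^n"
    by (simp_all add: field_simps)
  have m: "real (Suc (2 * j)) / 2^Suc n = real (2 * j + 1) / 2^Suc n" by simp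
  show "dyadic_inc (Suc n) \<omega> (2 * j) = dyadic_inc n \<omega> j / 2 + \<omega> (2^n + j) / (2 * sqrt (2^n))"
    unfolding dyadic_inc_def e m S levels_midpoint level_dyadic_mid[OF j] level_dyadic[OF order_refl] by (simp add: field_simps)
  show "dyadic_inc (Suc n) \<omega> (2 * j + 1) = dyadic_inc n \<omega> j / 2 - \<omega> (2^n + j) / (2 * sqrt (2^n))"
    unfolding dyadic_inc_def e S levels_midpoint level_dyadic_mid[OF j] level_dyadic[OF order_refl] by (simp add: field_simps)
qed

lemma sum_lessThan_double: "(\<Sum>i<2 * (m::nat). f i) = (\<Sum>j<m. f (2 * j) + f (2 * j + 1) :: real)"
  by (induction m) simp_all

text \<open>Coordinates not yet used are carried along, because the next refinement draws its fresh
  normals from them. Refining is then a linear change of the frequencies: half sums stay with the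
  coarse increments, scaled half differences go to the fresh normals. The quadratic form is
  preserved by (p + q)^2 + (p - q)^2 = 2 (p^2 + q^2).\<close>

lemma dyadic_inc_char:
  "(\<integral>\<omega>. iexp ((\<Sum>i<2^n. \<theta> i * dyadic_inc n \<omega> i) + (\<Sum>k<K. a k * \<omega> (2^n + k))) \<partial>gauss_seq)
   = complex_of_real (exp (- ((\<Sum>i<2^n. (\<theta> i)\<^sup>2) / 2^n + (\<Sum>k<K. (a k)\<^sup>2)) / 2))"
proof (induction n arbitrary: \<theta> K a)
  case 0
  have "dyadic_inc 0 \<omega> 0 = \<omega> 0" for \<omega> by (simp add: dyadic_inc_def levels_def)
  then show ?case
    using gauss_seq_char[of "\<lambda>k. case k of 0 \<Rightarrow> \<theta> 0 | Suc k \<Rightarrow> a k" "Suc K"]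
    by (simp add: sum.lessThan_Suc_shift del: sum.lessThan_Suc)
next
  case (Suc n)
  define \<theta>' where "\<theta>' j = (\<theta> (2 * j) + \<theta> (2 * j + 1)) / 2" for j :: nat
  define a' where "a' k = (if k < 2^n then (\<theta> (2 * k) - \<theta> (2 * k + 1)) / (2 * sqrt (2^n)) else a (k - 2^n))" for k :: nat
  have split: "(\<Sum>k<2^n + K. f k) = (\<Sum>k<2^n. f k) + (\<Sum>k<K. f (2^n + k))" for f :: "nat \<Rightarrow> real"
    using sum.nat_group[of f] by (induction K) simp_all
  have lin: "(\<Sum>i<2^Suc n. \<theta> i * dyadic_inc (Suc n) \<omega> i) + (\<Sum>k<K. a k * \<omega> (2^Suc n + k))
      = (\<Sum>i<2^n. \<theta>' i * dyadic_inc n \<omega> i) + (\<Sum>k<2^n + K. a' k * \<omega> (2^n + k))" for \<omega>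
  proof -
    have "(\<Sum>i<2^Suc n. \<theta> i * dyadic_inc (Suc n) \<omega> i) = (\<Sum>j<2^n. \<theta> (2 * j) * dyadic_inc (Suc n) \<omega> (2 * j) + \<theta> (2 * j + 1) * dyadic_inc (Suc n) \<omega> (2 * j + 1))"
      unfolding power_Suc by (rule sum_lessThan_double)
    also have "\<dots> = (\<Sum>j<2^n. \<theta>' j * dyadic_inc n \<omega> j + a' j * \<omega> (2^n + j))"
    proof (rule sum.cong[OF refl])
      fix j :: nat assume "j \<in> {..<2^n}"
      then have j: "j < 2^n" by simp
      show "\<theta> (2 * j) * dyadic_inc (Suc n) \<omega> (2 * j) + \<theta> (2 * j + 1) * dyadic_inc (Suc n) \<omega> (2 * j + 1) = \<theta>' j * dyadic_inc n \<omega> j + a' j * \<omega> (2^n + j)"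
        unfolding dyadic_inc_even[OF j] dyadic_inc_odd[OF j] using j
        by (simp add: \<theta>'_def a'_def add_divide_distrib diff_divide_distrib algebra_simps)
    qed
    also have "\<dots> = (\<Sum>i<2^n. \<theta>' i * dyadic_inc n \<omega> i) + (\<Sum>k<2^n. a' k * \<omega> (2^n + k))" by (rule sum.distrib)
    finally have "(\<Sum>i<2^Suc n. \<theta> i * dyadic_inc (Suc n) \<omega> i) = \<dots>" .
    moreover have "(\<Sum>k<K. a k * \<omega> (2^Suc n + k)) = (\<Sum>k<K. a' (2^n + k) * \<omega> (2^n + (2^n + k)))"
    proof (rule sum.cong[OF refl])
      fix k
      have "(2::nat) ^ Suc n + k = 2 ^ n + (2 ^ n + k)" by simp
      then show "a k * \<omega> (2^Suc n + k) = a' (2^n + k) * \<omega> (2^n + (2^n + k))" by (simp only: a'_def) simp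
    qed
    ultimately show ?thesis unfolding split by simp
  qed
  have sq: "(\<Sum>i<2^n. (\<theta>' i)\<^sup>2) / 2^n + (\<Sum>k<2^n + K. (a' k)\<^sup>2) = (\<Sum>i<2^Suc n. (\<theta> i)\<^sup>2) / 2^Suc n + (\<Sum>k<K. (a k)\<^sup>2)"
  proof -
    have "(\<Sum>i<2^n. (\<theta>' i)\<^sup>2) / 2^n + (\<Sum>k<2^n. (a' k)\<^sup>2) = (\<Sum>k<2^n. (\<theta>' k)\<^sup>2 / 2^n + (a' k)\<^sup>2)"
      by (simp add: sum.distrib sum_divide_distrib)
    also have "\<dots> = (\<Sum>k<2^n. ((\<theta> (2 * k))\<^sup>2 + (\<theta> (2 * k + 1))\<^sup>2) / 2^Suc n)"
      by (intro sum.cong) (auto simp: \<theta>'_def a'_def power_divide power_mult_distrib power2_eq_square field_simps)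
    also have "\<dots> = (\<Sum>i<2^Suc n. (\<theta> i)\<^sup>2) / 2^Suc n"
      unfolding power_Suc sum_lessThan_double by (simp add: sum_divide_distrib)
    finally show ?thesis unfolding split by (simp add: a'_def)
  qed
  show ?case unfolding lin Suc.IH sq ..
qed

lemma sum_tent_le_1: "(\<Sum>i<n. tent (x - real i)) \<le> 1"
proof (cases "\<exists>i0<n. tent (x - real i0) \<noteq> 0")
  case True
  then obtain i0 where i0: "i0 < n" "tent (x - real i0) \<noteq> 0" by auto
  then have "0 < x - real i0" "x - real i0 < 1" by (auto simp: tent_def split: if_splits)
  then have "tent (x - real i) = 0" if "i \<noteq> i0" for i
  proof -
    have "real i \<le> real i0 - 1 \<or> real i0 + 1 \<le> real i" using that by linarith
    then show ?thesis using \<open>0 < x - real i0\<close> \<open>x - real i0 < 1\<close> by (auto simp: tent_def)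
  qed
  then have "(\<Sum>i<n. tent (x - real i)) = tent (x - real i0)"
    using i0 by (subst sum.remove[of _ i0]) auto
  then show ?thesis using tent_le_1 by simp
qed auto

text \<open>The fourth root of 2. With threshold r^n for the normals of generation n, the typical
  part of a level has size (r / sqrt 2)^n and the expected excess has size (sqrt 2 / r^3)^n; r^4 = 2
  makes the two rates equal, both to 1 / r.\<close>

definition ratio :: real where "ratio = sqrt (sqrt 2)"

lemma ratio: "1 < ratio" "ratio ^ 4 = 2" "ratio ^ 2 = sqrt 2"
proof -
  show "1 < ratio" by (simp add: ratio_def)
  show 2: "ratio ^ 2 = sqrt 2" by (simp add: ratio_def)
  have "ratio ^ 4 = (ratio ^ 2) ^ 2" by (simp flip: power_mult)
  then show "ratio ^ 4 = 2" by (simp add: 2)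
qed

definition fourth_sum :: "nat \<Rightarrow> (nat \<Rightarrow> real) \<Rightarrow> real" where
  "fourth_sum n \<omega> = (\<Sum>i<2^n. (\<omega> (2^n + i))^4)"

text \<open>With a = \<open>ratio ^ n\<close> the terms are 1 / a and the fourth powers divided by
  a^5, of which a^3 comes from the threshold and a^2 = sqrt (2^n) from the scaling of the
  level.\<close>

definition level_bound :: "nat \<Rightarrow> (nat \<Rightarrow> real) \<Rightarrow> real" where
  "level_bound n \<omega> = (1 / ratio)^n + fourth_sum n \<omega> * (1 / ratio)^(5 * n)"

text \<open>The fourth moments replace the usual maximal bound on the normals of one level:
  \<open>z \<le> a + z\<^sup>4 / a\<^sup>3\<close> with \<open>a = 2\<^bsup>n/4\<^esup>\<close>.\<close>

lemma level_le: "\<bar>level n \<omega> t\<bar> \<le> level_bound n \<omega>"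
proof -
  define a where "a = ratio ^ n"
  have a: "1 \<le> a" using ratio(1) by (simp add: a_def)
  have zb: "\<bar>z\<bar> \<le> a + z^4 / a^3" for z :: real
  proof (cases "\<bar>z\<bar> \<le> a")
    case True
    have "0 \<le> z^4 / a^3" using a by simp
    then show ?thesis using True by linarith
  next
    case False
    have "a^3 \<le> \<bar>z\<bar>^3" using False a by (intro power_mono) auto
    then have "\<bar>z\<bar> * a^3 \<le> \<bar>z\<bar> * \<bar>z\<bar>^3" by (intro mult_left_mono) auto
    also have "\<bar>z\<bar> * \<bar>z\<bar>^3 = z^4" using power_Suc[of "\<bar>z\<bar>" 3] by simp
    finally have "\<bar>z\<bar> \<le> z^4 / a^3" using a by (simp add: field_simps)
    then show ?thesis using a by linarith
  qed
  let ?T = "\<lambda>i. tent (2^n * t - real i)"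
  have "\<bar>\<Sum>i<2^n. \<omega> (2^n + i) * ?T i\<bar> \<le> (\<Sum>i<2^n. a * ?T i + (\<omega> (2^n + i))^4 / a^3)"
  proof (rule order_trans[OF sum_abs sum_mono])
    fix i
    have "\<bar>\<omega> (2^n + i) * ?T i\<bar> \<le> (a + (\<omega> (2^n + i))^4 / a^3) * ?T i"
      using zb[of "\<omega> (2^n + i)"] tent_nonneg by (simp add: abs_mult mult_right_mono)
    also have "\<dots> \<le> a * ?T i + (\<omega> (2^n + i))^4 / a^3"
      using a tent_le_1 mult_left_le[of "?T i" "(\<omega> (2^n + i))^4 / a^3"] by (simp add: distrib_right)
    finally show "\<bar>\<omega> (2^n + i) * ?T i\<bar> \<le> a * ?T i + (\<omega> (2^n + i))^4 / a^3" .
  qed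
  also have "\<dots> = a * (\<Sum>i<2^n. ?T i) + fourth_sum n \<omega> / a^3"
    by (simp add: sum.distrib sum_distrib_left fourth_sum_def sum_divide_distrib)
  also have "\<dots> \<le> a * 1 + fourth_sum n \<omega> / a^3"
    using a sum_tent_le_1 by (intro add_right_mono mult_left_mono) auto
  finally have 1: "\<bar>\<Sum>i<2^n. \<omega> (2^n + i) * ?T i\<bar> \<le> a + fourth_sum n \<omega> / a^3" by simp
  have sq: "sqrt (2^n) = a^2"
    by (simp add: real_sqrt_power a_def ratio(3)[symmetric] power_mult[symmetric] mult.commute)
  have f0: "0 \<le> fourth_sum n \<omega>" by (simp add: fourth_sum_def sum_nonneg)
  have "\<bar>level n \<omega> t\<bar> \<le> (a + fourth_sum n \<omega> / a^3) / (2 * a^2)"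
    unfolding level_def sq abs_divide using 1 a by (intro frac_le) auto
  also have "\<dots> \<le> (a + fourth_sum n \<omega> / a^3) / a^2"
    using a f0 by (intro divide_left_mono) auto
  also have "\<dots> = 1 / a + fourth_sum n \<omega> / a^5"
    using a by (simp add: field_simps eval_nat_numeral)
  also have "\<dots> = level_bound n \<omega>"
    by (simp add: level_bound_def a_def power_divide power_mult[symmetric] mult.commute)
  finally show ?thesis .
qed

lemma fourth_sum_measurable[measurable]: "fourth_sum n \<in> borel_measurable gauss_seq"
  unfolding fourth_sum_def[abs_def] by measurable

text \<open>The 2^n fourth moments sum to 3 * 2^n and 2^n = \<open>ratio ^ (4 * n)\<close>, so the
  bound has expectation 4 * (1 / ratio)^n: a convergent geometric series, hence almost sure
  summability.\<close>

lemma level_bound_summable_AE: "AE \<omega> in gauss_seq. summable (\<lambda>n. level_bound n \<omega>)"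
proof -
  interpret prob_space gauss_seq by (rule prob_space_gauss_seq)
  have nn: "0 \<le> level_bound n \<omega>" for n \<omega>
    using ratio(1) by (simp add: level_bound_def fourth_sum_def sum_nonneg)
  have [measurable]: "level_bound n \<in> borel_measurable gauss_seq" for n unfolding level_bound_def[abs_def] by measurable
  have i4: "integrable gauss_seq (fourth_sum n)" "(\<integral>\<omega>. fourth_sum n \<omega> \<partial>gauss_seq) = 3 * 2^n" for n
    unfolding fourth_sum_def[abs_def] using gauss_seq_fourth by simp_all
  have ib: "integrable gauss_seq (level_bound n)" for n unfolding level_bound_def[abs_def] using i4 by auto
  have eb: "(\<integral>\<omega>. level_bound n \<omega> \<partial>gauss_seq) = 4 * (1 / ratio)^n" for n
  proof -
    have "(2::real)^n = ratio^(4 * n)" by (simp add: power_mult ratio(2))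
    moreover have "(1 / ratio)^(5 * n) = (1/ratio)^n * (1 / ratio)^(4 * n)" by (simp flip: power_add)
    ultimately have "2^n * (1 / ratio)^(5 * n) = (1/ratio)^n"
      using ratio(1) by (simp add: power_divide)
    then show ?thesis unfolding level_bound_def[abs_def] using i4 by (simp add: prob_space)
  qed
  have sg: "summable (\<lambda>n. 4 * (1 / ratio)^n)" using ratio(1) by (intro summable_mult summable_geometric) auto
  have "(\<integral>\<^sup>+\<omega>. (\<Sum>n. ennreal (level_bound n \<omega>)) \<partial>gauss_seq) = (\<Sum>n. \<integral>\<^sup>+\<omega>. ennreal (level_bound n \<omega>) \<partial>gauss_seq)"
    by (rule nn_integral_suminf) simp
  also have "\<dots> = (\<Sum>n. ennreal (4 * (1 / ratio)^n))"
    using nn_integral_eq_integral[OF ib] nn eb by simp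
  also have "\<dots> \<noteq> \<infinity>"
  proof -
    have "0 \<le> 4 * (1 / ratio)^n" for n using ratio(1) by simp
    then show ?thesis unfolding infinity_ennreal_def by (rule ennreal_suminf_neq_top[OF sg])
  qed
  finally have "AE \<omega> in gauss_seq. (\<Sum>n. ennreal (level_bound n \<omega>)) \<noteq> \<infinity>"
    by (intro nn_integral_PInf_AE) (auto simp: top.not_eq_extremum)
  then show ?thesis
    by eventually_elim (rule summable_suminf_not_top, use nn in auto)
qed

lemma continuous_level: "continuous_on A (level n \<omega>)"
  unfolding level_def[abs_def] tent_def divide_inverse by (intro continuous_intros)

lemma continuous_bm:
  assumes "summable (\<lambda>n. level_bound n \<omega>)"
  shows "continuous_on A (bm \<omega>)"
proof -
  have "uniform_limit A (\<lambda>n t. \<Sum>m<n. level m \<omega> t) (\<lambda>t. \<Sum>m. level m \<omega> t) sequentially"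
    by (rule Weierstrass_m_test[OF _ assms]) (simp add: level_le)
  then have "continuous_on A (\<lambda>t. \<Sum>m. level m \<omega> t)"
    by (rule uniform_limit_theorem[rotated]) (auto intro!: always_eventually continuous_on_sum continuous_level)
  then show ?thesis unfolding bm_def[abs_def] by (intro continuous_intros)
qed

lemma bm_measurable[measurable]: "(\<lambda>\<omega>. bm \<omega> t) \<in> borel_measurable gauss_seq"
  unfolding bm_def level_def by measurable

lemma bm_dyadic_increment:
  assumes "p \<le> q"
  shows "bm \<omega> (real q / 2^n) - bm \<omega> (real p / 2^n) = (\<Sum>i\<in>{p..<q}. dyadic_inc n \<omega> i)"
  using assms unfolding bm_dyadic dyadic_inc_def
  by (induction q rule: dec_induct) (simp_all)

lemma bm_dyadic_char:
  fixes p :: "nat \<Rightarrow> nat"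
  assumes p: "\<And>j. j < m \<Longrightarrow> p j \<le> p (Suc j)" "p m \<le> 2^n"
  shows "(\<integral>\<omega>. iexp (\<Sum>j<m. \<theta> j * (bm \<omega> (real (p (Suc j)) / 2^n) - bm \<omega> (real (p j) / 2^n))) \<partial>gauss_seq)
    = complex_of_real (exp (- (\<Sum>j<m. (\<theta> j)\<^sup>2 * (real (p (Suc j)) / 2^n - real (p j) / 2^n)) / 2))"
proof -
  \<comment> \<open>The step function equal to \<open>\<theta> j\<close> on the j-th block of dyadic
    cells. Blocks are disjoint, so its square is the sum of the squares; the claim that it vanishes
    from \<open>p r\<close> on is what carries this through the induction.\<close>
  define \<eta> where "\<eta> r i = (\<Sum>j<r. \<theta> j * indicator {p j..<p (Suc j)} i)" for r i
  have mono: "p j \<le> p r" if "j \<le> r" "r \<le> m" for j r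
    using that by (induction r rule: dec_induct) (use p(1) in \<open>auto intro: order_trans\<close>)
  have ind: "(\<Sum>i<2^n. indicator {a..<b} i * f i) = (\<Sum>i\<in>{a..<b}. f i)" if "b \<le> 2^n" for a b and f :: "nat \<Rightarrow> real"
    using that by (intro sum.mono_neutral_cong_right) (auto simp: indicator_def)
  have pm: "p (Suc j) \<le> 2^n" if "j < m" for j using mono[of "Suc j" m] that p(2) by simp
  have lin: "(\<Sum>j<m. \<theta> j * (bm \<omega> (real (p (Suc j)) / 2^n) - bm \<omega> (real (p j) / 2^n))) = (\<Sum>i<2^n. \<eta> m i * dyadic_inc n \<omega> i)" for \<omega>
  proof -
    have "(\<Sum>i<2^n. \<eta> m i * dyadic_inc n \<omega> i) = (\<Sum>j<m. \<theta> j * (\<Sum>i<2^n. indicator {p j..<p (Suc j)} i * dyadic_inc n \<omega> i))"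
      unfolding \<eta>_def sum_distrib_right sum_distrib_left by (subst sum.swap) (simp add: mult.assoc)
    also have "\<dots> = (\<Sum>j<m. \<theta> j * (bm \<omega> (real (p (Suc j)) / 2^n) - bm \<omega> (real (p j) / 2^n)))"
    proof (rule sum.cong[OF refl])
      fix j assume "j \<in> {..<m}"
      then have j: "j < m" by simp
      show "\<theta> j * (\<Sum>i<2^n. indicator {p j..<p (Suc j)} i * dyadic_inc n \<omega> i)
        = \<theta> j * (bm \<omega> (real (p (Suc j)) / 2^n) - bm \<omega> (real (p j) / 2^n))"
        unfolding ind[OF pm[OF j]] bm_dyadic_increment[OF p(1)[OF j]] ..
    qed
    finally show ?thesis by simp
  qed
  have sq: "(\<eta> r i)\<^sup>2 = (\<Sum>j<r. (\<theta> j)\<^sup>2 * indicator {p j..<p (Suc j)} i) \<and> (p r \<le> i \<longrightarrow> \<eta> r i = 0)" if "r \<le> m" for r i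
    using that
  proof (induction r)
    case (Suc r)
    then have IH: "(\<eta> r i)\<^sup>2 = (\<Sum>j<r. (\<theta> j)\<^sup>2 * indicator {p j..<p (Suc j)} i)" "p r \<le> i \<Longrightarrow> \<eta> r i = 0" by auto
    have e: "\<eta> (Suc r) i = \<eta> r i + \<theta> r * indicator {p r..<p (Suc r)} i" by (simp add: \<eta>_def)
    have z: "\<eta> r i * indicator {p r..<p (Suc r)} i = 0" using IH(2) by (auto simp: indicator_def)
    have "(\<eta> (Suc r) i)\<^sup>2 = (\<eta> r i)\<^sup>2 + (\<theta> r)\<^sup>2 * indicator {p r..<p (Suc r)} i"
      unfolding e using z by (auto simp: power2_eq_square indicator_def algebra_simps)
    moreover have "\<eta> (Suc r) i = 0" if "p (Suc r) \<le> i"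
    proof -
      have "p r \<le> p (Suc r)" using p(1) Suc by auto
      then show ?thesis using that IH(2) unfolding e by auto
    qed
    ultimately show ?case using IH(1) by simp
  qed (simp add: \<eta>_def)
  have "(\<Sum>i<2^n. (\<eta> m i)\<^sup>2) = (\<Sum>j<m. (\<theta> j)\<^sup>2 * (\<Sum>i<2^n. indicator {p j..<p (Suc j)} i * 1))"
    unfolding conjunct1[OF sq[OF order_refl]] sum_distrib_left by (subst sum.swap) simp
  also have "\<dots> = (\<Sum>j<m. (\<theta> j)\<^sup>2 * (real (p (Suc j)) - real (p j)))"
  proof (rule sum.cong[OF refl])
    fix j assume "j \<in> {..<m}"
    then have j: "j < m" by simp
    show "(\<theta> j)\<^sup>2 * (\<Sum>i<2^n. indicator {p j..<p (Suc j)} i * 1) = (\<theta> j)\<^sup>2 * (real (p (Suc j)) - real (p j))"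
      unfolding ind[OF pm[OF j]] using p(1)[OF j] by (simp add: of_nat_diff)
  qed
  finally have s2: "(\<Sum>i<2^n. (\<eta> m i)\<^sup>2) / 2^n = (\<Sum>j<m. (\<theta> j)\<^sup>2 * (real (p (Suc j)) / 2^n - real (p j) / 2^n))"
    by (simp add: sum_divide_distrib flip: diff_divide_distrib)
  show ?thesis
    unfolding lin s2[symmetric] using dyadic_inc_char[where K=0 and n=n and \<theta>="\<eta> m"] by simp
qed

text \<open>Times are rounded down to dyadic ones, which keeps them ordered and inside the unit
  interval. Path continuity and dominated convergence then pass to the limit.\<close>

lemma bm_char:
  fixes s :: "nat \<Rightarrow> real"
  assumes s: "0 \<le> s 0" "s m \<le> 1" "\<And>j. j < m \<Longrightarrow> s j \<le> s (Suc j)"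
  shows "(\<integral>\<omega>. iexp (\<Sum>j<m. \<theta> j * (bm \<omega> (s (Suc j)) - bm \<omega> (s j))) \<partial>gauss_seq)
    = complex_of_real (exp (- (\<Sum>j<m. (\<theta> j)\<^sup>2 * (s (Suc j) - s j)) / 2))"
proof -
  interpret prob_space gauss_seq by (rule prob_space_gauss_seq)
  define p where "p n j = nat \<lfloor>2^n * s j\<rfloor>" for n j
  define d where "d n j = real (p n j) / 2^n" for n j
  have s0: "0 \<le> s j" if "j \<le> m" for j
    using that
  proof (induction j)
    case (Suc j) then show ?case using s(3)[of j] by simp
  qed (use s in auto)
  have d: "(\<lambda>n. d n j) \<longlonglongrightarrow> s j" if "j \<le> m" for j
  proof (rule real_tendsto_sandwich)
    have p: "real (p n j) = of_int \<lfloor>2^n * s j\<rfloor>" for n using s0[OF that] by (simp add: p_def)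
    show "\<forall>\<^sub>F n in sequentially. d n j \<le> s j"
      by (intro always_eventually allI) (simp add: d_def p divide_le_eq mult.commute)
    show "\<forall>\<^sub>F n in sequentially. s j - (1/2)^n \<le> d n j"
    proof (intro always_eventually allI)
      fix n
      have "2^n * s j - 1 \<le> real (p n j)" unfolding p by linarith
      then have "(2^n * s j - 1) / 2^n \<le> real (p n j) / 2^n" by (rule divide_right_mono) simp
      then show "s j - (1/2)^n \<le> d n j" by (simp add: d_def diff_divide_distrib power_divide)
    qed
    have "(\<lambda>n. s j - (1/2)^n) \<longlonglongrightarrow> s j - 0" by (intro tendsto_intros) (auto intro: LIMSEQ_power_zero)
    then show "(\<lambda>n. s j - (1/2)^n) \<longlonglongrightarrow> s j" by simp
  qed auto
  have eq: "(\<integral>\<omega>. iexp (\<Sum>j<m. \<theta> j * (bm \<omega> (d n (Suc j)) - bm \<omega> (d n j))) \<partial>gauss_seq)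
    = complex_of_real (exp (- (\<Sum>j<m. (\<theta> j)\<^sup>2 * (d n (Suc j) - d n j)) / 2))" for n
    unfolding d_def
  proof (rule bm_dyadic_char)
    show "p n j \<le> p n (Suc j)" if "j < m" for j
      unfolding p_def using s(3)[OF that] by (intro nat_mono floor_mono) auto
    have "2^n * s m \<le> 2^n" using s(2) by simp
    moreover have "real (p n m) \<le> 2^n * s m" unfolding p_def by (rule of_nat_floor) (use s0[of m] in simp)
    ultimately have "real (p n m) \<le> 2^n" by (rule order_trans[rotated])
    then have "real (p n m) \<le> real (2^n)" by simp
    then show "p n m \<le> 2^n" by (simp only: of_nat_le_iff)
  qed
  have "(\<lambda>n. \<integral>\<omega>. iexp (\<Sum>j<m. \<theta> j * (bm \<omega> (d n (Suc j)) - bm \<omega> (d n j))) \<partial>gauss_seq)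
     \<longlonglongrightarrow> (\<integral>\<omega>. iexp (\<Sum>j<m. \<theta> j * (bm \<omega> (s (Suc j)) - bm \<omega> (s j))) \<partial>gauss_seq)"
  proof (rule integral_dominated_convergence[where w="\<lambda>_. 1"])
    show "AE \<omega> in gauss_seq. (\<lambda>n. iexp (\<Sum>j<m. \<theta> j * (bm \<omega> (d n (Suc j)) - bm \<omega> (d n j))))
       \<longlonglongrightarrow> iexp (\<Sum>j<m. \<theta> j * (bm \<omega> (s (Suc j)) - bm \<omega> (s j)))"
      using level_bound_summable_AE
    proof eventually_elim
      case (elim \<omega>)
      have "isCont (bm \<omega>) x" for x using continuous_bm[OF elim, of UNIV] by (simp add: continuous_on_eq_continuous_at)
      then have "(\<lambda>n. bm \<omega> (d n j)) \<longlonglongrightarrow> bm \<omega> (s j)" if "j \<le> m" for j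
        using isCont_tendsto_compose[OF _ d[OF that]] by blast
      then show ?case by (intro tendsto_intros) auto
    qed
  qed auto
  moreover have "(\<lambda>n. complex_of_real (exp (- (\<Sum>j<m. (\<theta> j)\<^sup>2 * (d n (Suc j) - d n j)) / 2)))
     \<longlonglongrightarrow> complex_of_real (exp (- (\<Sum>j<m. (\<theta> j)\<^sup>2 * (s (Suc j) - s j)) / 2))"
    by (intro tendsto_intros d) auto
  ultimately show ?thesis unfolding eq by (rule LIMSEQ_unique)
qed

section \<open>Continuous paths, degenerate Gaussians and the time-changed Brownian motion\<close>

definition cont_paths :: "real \<Rightarrow> (real \<Rightarrow> real) set" where
  "cont_paths T = {f. continuous_on {0..T} f \<and> (\<forall>t. t \<notin> {0..T} \<longrightarrow> f t = 0)}"

definition path_algebra :: "real \<Rightarrow> (real \<Rightarrow> real) measure" where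
  "path_algebra T = sigma (cont_paths T) {{f\<in>cont_paths T. f t \<in> B} | t B. t \<in> {0..T} \<and> B \<in> sets borel}"

text \<open>The path is set to zero on the null set where the level bounds are not summable, so
  every path is continuous and the law lives on \<open>cont_paths\<close>. If V T = 0 the prefactor
  makes the path zero, whatever the quotient is.\<close>

definition bm_path :: "real \<Rightarrow> (real \<Rightarrow> real) \<Rightarrow> (nat \<Rightarrow> real) \<Rightarrow> real \<Rightarrow> real" where
  "bm_path T V \<omega> = (\<lambda>t. if t \<in> {0..T} \<and> summable (\<lambda>n. level_bound n \<omega>) then sqrt (V T) * bm \<omega> (V t / V T) else 0)"

lemma space_path_algebra: "space (path_algebra T) = cont_paths T"
  unfolding path_algebra_def by (rule space_measure_of) auto

lemma sets_path_algebra: "sets (path_algebra T) =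
   sigma_sets (cont_paths T) {{f\<in>cont_paths T. f t \<in> B} | t B. t \<in> {0..T} \<and> B \<in> sets borel}"
  unfolding path_algebra_def by (rule sets_measure_of) auto

lemma eval_measurable: "t \<in> {0..T} \<Longrightarrow> (\<lambda>f. f t) \<in> borel_measurable (path_algebra T)"
proof (rule measurableI)
  fix B :: "real set" assume t: "t \<in> {0..T}" and B: "B \<in> sets borel"
  have "(\<lambda>f. f t) -` B \<inter> space (path_algebra T) = {f\<in>cont_paths T. f t \<in> B}"
    by (auto simp: space_path_algebra)
  then show "(\<lambda>f. f t) -` B \<inter> space (path_algebra T) \<in> sets (path_algebra T)"
    unfolding sets_path_algebra using t B by (auto intro!: sigma_sets.Basic)
qed auto

lemma cont_paths_subset_Dspace: "cont_paths T \<subseteq> Dspace T"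
proof
  fix f assume f: "f \<in> cont_paths T"
  then have c: "continuous_on {0..T} f" by (simp add: cont_paths_def)
  show "f \<in> Dspace T"
    unfolding Dspace_def
  proof (intro CollectI conjI ballI allI impI)
    fix t assume t: "t \<in> {0..<T}"
    have "continuous_on {t..T} f" by (rule continuous_on_subset[OF c]) (use t in auto)
    then show "(f \<longlongrightarrow> f t) (at_right t)" using t by (intro continuous_on_Icc_at_rightD[of t T]) auto
  next
    fix t assume t: "t \<in> {0<..T}"
    have "continuous_on {0..t} f" by (rule continuous_on_subset[OF c]) (use t in auto)
    then show "\<exists>l. (f \<longlongrightarrow> l) (at_left t)" using t continuous_on_Icc_at_leftD[of 0 t f] by auto
  qed (use f in \<open>auto simp: cont_paths_def\<close>)
qed

text \<open>A scaled image of the standard normal law, so variance 0 gives the point mass at 0 and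
  no separate case arises in the characteristic functions.\<close>

definition gauss_measure :: "real \<Rightarrow> real measure" where
  "gauss_measure v = distr std_normal_distribution borel (\<lambda>x. sqrt v * x)"

lemma real_distribution_gauss: "real_distribution (gauss_measure v)"
  unfolding gauss_measure_def using real_dist_normal_dist
  by (intro prob_space.real_distribution_distr) (auto simp: real_distribution_def)

lemma char_gauss: "0 \<le> v \<Longrightarrow> char (gauss_measure v) t = complex_of_real (exp (- t\<^sup>2 * v / 2))"
proof -
  assume v: "0 \<le> v"
  have "char (gauss_measure v) t = char std_normal_distribution (t * sqrt v)"
    by (simp add: char_def gauss_measure_def integral_distr mult.assoc)
  then show ?thesis using v by (simp add: char_std_normal_distribution power_mult_distrib)
qed

lemma gauss_measure_density:
  assumes v: "0 < v"
  shows "gauss_measure v = density lborel (normal_density 0 (sqrt v))"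
proof -
  have "distributed std_normal_distribution lborel (\<lambda>x. 0 + sqrt v * x) (normal_density (0 + sqrt v * 0) (\<bar>sqrt v\<bar> * 1))"
  proof (rule prob_space.normal_density_affine)
    show "prob_space std_normal_distribution" using real_dist_normal_dist by (simp add: real_distribution_def)
    show "distributed std_normal_distribution lborel (\<lambda>x. x) std_normal_density"
      by (auto simp: distributed_def distr_id2 normal_density_nonneg)
  qed (use v in auto)
  then have "distr std_normal_distribution lborel (\<lambda>x. sqrt v * x) = density lborel (normal_density 0 (sqrt v))"
    using v by (simp add: distributed_def)
  moreover have "distr std_normal_distribution lborel (\<lambda>x. sqrt v * x) = gauss_measure v"
    unfolding gauss_measure_def by (rule distr_cong) auto
  ultimately show ?thesis by simp
qed

lemma centered_gaussianI:
  assumes "prob_space Q" and X: "X \<in> borel_measurable Q" and v: "0 \<le> v" and d: "distr Q borel X = gauss_measure v"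
  shows "centered_gaussian Q X v"
proof (cases "v = 0")
  case True
  interpret S: prob_space std_normal_distribution using real_dist_normal_dist by (simp add: real_distribution_def)
  have g0: "gauss_measure 0 = return borel 0"
  proof -
    have z: "(\<lambda>x::real. sqrt 0 * x) = (\<lambda>x. 0)" by auto
    show ?thesis unfolding gauss_measure_def z by (rule S.distr_const) simp
  qed
  have "AE x in return borel (0::real). x = 0" by (subst AE_return) auto
  then have "AE x in distr Q borel X. x = 0" unfolding d True g0 .
  then have "AE q in Q. X q = 0" by (subst (asm) AE_distr_iff) (use X in auto)
  then show ?thesis using X v True by (simp add: centered_gaussian_def)
next
  case False
  then show ?thesis using X v d gauss_measure_density[of v] by (simp add: centered_gaussian_def)
qed

lemma centered_gaussianD:
  assumes "prob_space Q" "centered_gaussian Q X v"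
  shows "distr Q borel X = gauss_measure v"
proof -
  interpret prob_space Q by fact
  have X: "X \<in> borel_measurable Q" and v: "0 \<le> v" using assms(2) by (auto simp: centered_gaussian_def)
  show ?thesis
  proof (cases "v = 0")
    case True
    interpret S: prob_space std_normal_distribution using real_dist_normal_dist by (simp add: real_distribution_def)
    have z: "(\<lambda>x::real. sqrt 0 * x) = (\<lambda>x. 0)" by auto
    have "distr Q borel X = distr Q borel (\<lambda>_. 0)"
      by (rule distr_cong_AE) (use assms(2) True X in \<open>auto simp: centered_gaussian_def\<close>)
    also have "\<dots> = return borel 0" by (rule distr_const) simp
    also have "\<dots> = gauss_measure 0" unfolding gauss_measure_def z by (rule S.distr_const[symmetric]) simp
    finally show ?thesis using True by simp
  next
    case False
    then show ?thesis using assms(2) v gauss_measure_density[of v] by (simp add: centered_gaussian_def)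
  qed
qed

text \<open>The factor sqrt (V T) turns the Brownian variance (V t - V s) / V T into V t - V s;
  independence and the marginal laws are both read off the joint characteristic function. That the
  law lives on continuous paths is recorded separately, since \<open>gaussian_ii_law\<close> speaks
  only of \<open>Dspace\<close> and later steps use the continuity.\<close>

lemma gaussian_ii_law_exists:
  fixes V :: "real \<Rightarrow> real"
  assumes T: "0 < T" and V0: "V 0 = 0" and mono: "mono_on {0..T} V" and cont: "continuous_on {0..T} V"
  obtains \<gamma> where "gaussian_ii_law T V \<gamma>" "space \<gamma> = cont_paths T"
proof -
  interpret prob_space gauss_seq by (rule prob_space_gauss_seq)
  let ?path = "bm_path T V"
  have Vm: "V s \<le> V t" if "0 \<le> s" "s \<le> t" "t \<le> T" for s t
    using mono_onD[OF mono, of s t] that by auto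
  have Vpos: "0 \<le> V t" if "0 \<le> t" "t \<le> T" for t using Vm[of 0 t] that V0 by simp
  have frac: "0 \<le> V t / V T" "V t / V T \<le> 1" if "0 \<le> t" "t \<le> T" for t
    using Vpos[OF that] Vm[of t T] that T by (auto simp: divide_le_eq_1)
  have pc: "?path \<omega> \<in> cont_paths T" for \<omega>
    unfolding cont_paths_def
  proof (intro CollectI conjI allI impI)
    show "continuous_on {0..T} (?path \<omega>)"
    proof (cases "summable (\<lambda>n. level_bound n \<omega>)")
      case True
      have "continuous_on {0..T} (\<lambda>t. sqrt (V T) * bm \<omega> (V t / V T))"
        unfolding divide_inverse
        by (intro continuous_intros continuous_on_compose2[OF continuous_bm[OF True, of UNIV]] cont) auto
      then show ?thesis
        by (rule continuous_on_eq) (use True in \<open>auto simp: bm_path_def\<close>)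
    qed (simp add: bm_path_def)
  qed (auto simp: bm_path_def)
  have [measurable]: "level_bound n \<in> borel_measurable gauss_seq" for n unfolding level_bound_def[abs_def] by measurable
  have evm: "(\<lambda>\<omega>. ?path \<omega> t) \<in> borel_measurable gauss_seq" for t
  proof -
    have nn: "0 \<le> level_bound n \<omega>" for n \<omega>
      using ratio(1) by (simp add: level_bound_def fourth_sum_def sum_nonneg)
    \<comment> \<open>Finiteness of the extended sum is visibly a measurable condition on
      \<omega>.\<close>
    have "summable (\<lambda>n. level_bound n \<omega>) \<longleftrightarrow> (\<Sum>n. ennreal (level_bound n \<omega>)) < top" for \<omega>
    proof
      assume "summable (\<lambda>n. level_bound n \<omega>)"
      from ennreal_suminf_neq_top[OF this nn] show "(\<Sum>n. ennreal (level_bound n \<omega>)) < top"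
        by (simp add: less_top[symmetric])
    next
      assume "(\<Sum>n. ennreal (level_bound n \<omega>)) < top"
      then have "(\<Sum>n. ennreal (level_bound n \<omega>)) \<noteq> top" by (rule less_imp_neq)
      then show "summable (\<lambda>n. level_bound n \<omega>)" by (rule summable_suminf_not_top[OF nn])
    qed
    moreover have "{\<omega> \<in> space gauss_seq. (\<Sum>n. ennreal (level_bound n \<omega>)) < top} \<in> sets gauss_seq" by measurable
    ultimately have S: "{\<omega> \<in> space gauss_seq. t \<in> {0..T} \<and> summable (\<lambda>n. level_bound n \<omega>)} \<in> sets gauss_seq"
      by (cases "t \<in> {0..T}") simp_all
    show ?thesis
      unfolding bm_path_def by (rule measurable_If[OF _ _ S]) (intro borel_measurable_times borel_measurable_const bm_measurable)+
  qed
  have pm: "?path \<in> measurable gauss_seq (path_algebra T)"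
    unfolding path_algebra_def
  proof (rule measurable_measure_of)
    fix A assume "A \<in> {{f\<in>cont_paths T. f t \<in> B} | t B. t \<in> {0..T} \<and> B \<in> sets borel}"
    then obtain t B where A: "A = {f\<in>cont_paths T. f t \<in> B}" and B: "B \<in> sets borel" by auto
    have "?path -` A \<inter> space gauss_seq = (\<lambda>\<omega>. ?path \<omega> t) -` B \<inter> space gauss_seq" using pc by (auto simp: A)
    then show "?path -` A \<inter> space gauss_seq \<in> sets gauss_seq" using measurable_sets[OF evm B] by simp
  qed (use pc in auto)
  define \<gamma> where "\<gamma> = distr gauss_seq (path_algebra T) ?path"
  have sp: "space \<gamma> = cont_paths T" by (simp add: \<gamma>_def space_path_algebra)
  interpret g: prob_space \<gamma> unfolding \<gamma>_def by (rule prob_space_distr[OF pm])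
  have em[measurable]: "t \<in> {0..T} \<Longrightarrow> (\<lambda>f. f t) \<in> borel_measurable \<gamma>" for t
    unfolding \<gamma>_def using eval_measurable by simp
  have joint: "g.indep_vars (\<lambda>_. borel) (\<lambda>i f. f (ts (Suc i)) - f (ts i)) {..<n} \<and>
      (\<forall>j<n. distr \<gamma> borel (\<lambda>f. f (ts (Suc j)) - f (ts j)) = gauss_measure (V (ts (Suc j)) - V (ts j)))"
    if ts: "0 \<le> ts 0" "ts n \<le> T" "\<forall>i<n. ts i \<le> ts (Suc i)" for n and ts :: "nat \<Rightarrow> real"
  proof -
    have tsm: "ts i \<le> ts j" if "i \<le> j" "j \<le> n" for i j
      using that by (induction j rule: dec_induct) (use ts(3) in \<open>auto intro: order_trans\<close>)
    have tb: "0 \<le> ts j" "ts j \<le> T" if "j \<le> n" for j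
      using tsm[of 0 j] tsm[of j n] that ts by auto
    have dV: "0 \<le> V (ts (Suc j)) - V (ts j)" if "j < n" for j
      using Vm[of "ts j" "ts (Suc j)"] tb[of j] tb[of "Suc j"] ts(3) that by simp
    have mX: "(\<lambda>f. f (ts (Suc j)) - f (ts j)) \<in> borel_measurable \<gamma>" if "j < n" for j
      by (intro borel_measurable_diff em) (use tb that in auto)
    have ch: "(\<integral>f. iexp (\<Sum>j<n. \<theta> j * (f (ts (Suc j)) - f (ts j))) \<partial>\<gamma>) = (\<Prod>j<n. char (gauss_measure (V (ts (Suc j)) - V (ts j))) (\<theta> j))" for \<theta>
    proof -
      have "(\<lambda>f. \<Sum>j<n. \<theta> j * (f (ts (Suc j)) - f (ts j))) \<in> borel_measurable \<gamma>"
        using mX by (intro borel_measurable_sum borel_measurable_times borel_measurable_const) auto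
      then have "(\<lambda>f. iexp (\<Sum>j<n. \<theta> j * (f (ts (Suc j)) - f (ts j)))) \<in> borel_measurable \<gamma>"
        by (rule measurable_compose) measurable
      then have "(\<integral>f. iexp (\<Sum>j<n. \<theta> j * (f (ts (Suc j)) - f (ts j))) \<partial>\<gamma>)
        = (\<integral>\<omega>. iexp (\<Sum>j<n. \<theta> j * (?path \<omega> (ts (Suc j)) - ?path \<omega> (ts j))) \<partial>gauss_seq)"
        unfolding \<gamma>_def by (subst integral_distr[OF pm]) auto
      also have "\<dots> = (\<integral>\<omega>. iexp (\<Sum>j<n. (\<theta> j * sqrt (V T)) * (bm \<omega> (V (ts (Suc j)) / V T) - bm \<omega> (V (ts j) / V T))) \<partial>gauss_seq)"
      proof (rule integral_cong_AE)
        show "AE \<omega> in gauss_seq. iexp (\<Sum>j<n. \<theta> j * (?path \<omega> (ts (Suc j)) - ?path \<omega> (ts j)))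
          = iexp (\<Sum>j<n. (\<theta> j * sqrt (V T)) * (bm \<omega> (V (ts (Suc j)) / V T) - bm \<omega> (V (ts j) / V T)))"
          using level_bound_summable_AE
        proof eventually_elim
          case (elim \<omega>)
          have "(\<Sum>j<n. \<theta> j * (?path \<omega> (ts (Suc j)) - ?path \<omega> (ts j)))
             = (\<Sum>j<n. (\<theta> j * sqrt (V T)) * (bm \<omega> (V (ts (Suc j)) / V T) - bm \<omega> (V (ts j) / V T)))"
            using tb elim by (intro sum.cong) (auto simp: bm_path_def algebra_simps Suc_le_eq)
          then show ?case by simp
        qed
      qed (use evm in measurable)
      also have "\<dots> = complex_of_real (exp (- (\<Sum>j<n. (\<theta> j * sqrt (V T))\<^sup>2 * (V (ts (Suc j)) / V T - V (ts j) / V T)) / 2))"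
      proof (rule bm_char[where s="\<lambda>j. V (ts j) / V T" and m=n])
        show "V (ts j) / V T \<le> V (ts (Suc j)) / V T" if "j < n" for j
          using dV[OF that] Vpos[of T] T by (intro divide_right_mono) auto
      qed (use frac tb in auto)
      also have "(\<Sum>j<n. (\<theta> j * sqrt (V T))\<^sup>2 * (V (ts (Suc j)) / V T - V (ts j) / V T)) = (\<Sum>j<n. (\<theta> j)\<^sup>2 * (V (ts (Suc j)) - V (ts j)))"
      proof (rule sum.cong[OF refl])
        fix j assume "j \<in> {..<n}"
        then have j: "j < n" by simp
        show "(\<theta> j * sqrt (V T))\<^sup>2 * (V (ts (Suc j)) / V T - V (ts j) / V T) = (\<theta> j)\<^sup>2 * (V (ts (Suc j)) - V (ts j))"
        proof (cases "V T = 0")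
          \<comment> \<open>All increments of V vanish, so both sides are 0 although the division by
            V T is void.\<close>
          case True
          then have "V (ts i) = 0" if "i \<le> n" for i using Vm[of "ts i" T] Vpos[of "ts i"] tb[OF that] by simp
          then show ?thesis using j by simp
        next
          case False
          then show ?thesis using Vpos[of T] T by (simp add: power_mult_distrib diff_divide_distrib[symmetric])
        qed
      qed
      also have "complex_of_real (exp (- (\<Sum>j<n. (\<theta> j)\<^sup>2 * (V (ts (Suc j)) - V (ts j))) / 2)) = (\<Prod>j<n. char (gauss_measure (V (ts (Suc j)) - V (ts j))) (\<theta> j))"
      proof -
        have "(\<Prod>j<n. char (gauss_measure (V (ts (Suc j)) - V (ts j))) (\<theta> j)) = (\<Prod>j<n. complex_of_real (exp (- (\<theta> j)\<^sup>2 * (V (ts (Suc j)) - V (ts j)) / 2)))"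
          by (rule prod.cong) (use dV in \<open>auto simp: char_gauss\<close>)
        also have "\<dots> = complex_of_real (exp (\<Sum>j<n. - (\<theta> j)\<^sup>2 * (V (ts (Suc j)) - V (ts j)) / 2))"
          by (simp only: exp_sum[OF finite_lessThan] of_real_prod)
        finally show ?thesis by (simp add: sum_negf sum_divide_distrib)
      qed
      finally show ?thesis .
    qed
    show ?thesis
      using g.joint_char_indep[OF mX real_distribution_gauss ch] g.joint_char_distr[OF mX real_distribution_gauss ch] by blast
  qed
  have "gaussian_ii_law T V \<gamma>"
    unfolding gaussian_ii_law_def
  proof (intro conjI allI impI)
    show "prob_space \<gamma>" by (rule g.prob_space_axioms)
    show "space \<gamma> \<subseteq> Dspace T" unfolding sp by (rule cont_paths_subset_Dspace)
    show "sets \<gamma> = sigma_sets (space \<gamma>) {{f \<in> space \<gamma>. f t \<in> B} |t B. t \<in> {0..T} \<and> B \<in> sets borel}"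
      unfolding sp by (simp add: \<gamma>_def sets_path_algebra)
    show "AE f in \<gamma>. f 0 = 0"
    proof -
      have "bm \<omega> 0 = 0" for \<omega> using bm_dyadic[of \<omega> 0 0] by (simp add: levels_def)
      then have "AE \<omega> in gauss_seq. ?path \<omega> 0 = 0" by (simp add: bm_path_def V0)
      moreover have "{f \<in> space (path_algebra T). f 0 = 0} \<in> sets (path_algebra T)"
      proof -
        have [measurable]: "(\<lambda>f. f 0) \<in> borel_measurable (path_algebra T)" using T by (intro eval_measurable) auto
        show ?thesis by measurable
      qed
      ultimately show ?thesis unfolding \<gamma>_def by (subst AE_distr_iff[OF pm]) auto
    qed
  next
    fix s t assume st: "0 \<le> s \<and> s \<le> t \<and> t \<le> T"
    have "distr \<gamma> borel (\<lambda>f. f t - f s) = gauss_measure (V t - V s)"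
      using joint[of "\<lambda>i. if i = 0 then s else t" 1] st by auto
    then show "centered_gaussian \<gamma> (\<lambda>f. f t - f s) (V t - V s)"
      using st Vm[of s t] by (intro centered_gaussianI g.prob_space_axioms borel_measurable_diff em) auto
  next
    fix n and ts :: "nat \<Rightarrow> real" assume "0 \<le> ts 0 \<and> ts n \<le> T \<and> (\<forall>i<n. ts i \<le> ts (Suc i))"
    then show "g.indep_vars (\<lambda>_. borel) (\<lambda>i f. f (ts (Suc i)) - f (ts i)) {..<n}" using joint[of ts n] by blast
  qed
  then show thesis by (rule that[OF _ sp])
qed

section \<open>Asymptotic independence of the past\<close>

lemma (in prob_space) bounded_pair_integrable:
  fixes f g :: "'a \<Rightarrow> real"
  assumes "f \<in> borel_measurable M" "g \<in> borel_measurable M" "\<And>x. x \<in> space M \<Longrightarrow> \<bar>f x\<bar> \<le> a" "\<And>x. x \<in> space M \<Longrightarrow> \<bar>g x\<bar> \<le> b"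
  shows "integrable M (\<lambda>x. f x * g x)"
proof (rule integrable_const_bound[where B="\<bar>a\<bar> * \<bar>b\<bar>"])
  show "AE x in M. norm (f x * g x) \<le> \<bar>a\<bar> * \<bar>b\<bar>"
  proof (rule AE_I2)
    fix x assume x: "x \<in> space M"
    have "\<bar>f x\<bar> \<le> \<bar>a\<bar>" "\<bar>g x\<bar> \<le> \<bar>b\<bar>" using assms(3,4)[OF x] by linarith+
    then show "norm (f x * g x) \<le> \<bar>a\<bar> * \<bar>b\<bar>" by (simp add: abs_mult mult_mono)
  qed
qed (use assms(1,2) in measurable)

text \<open>Tilting by the density \<open>2 + u\<close> reduces asymptotic independence of \<open>u\<close> and \<open>D\<close> to the
  one-dimensional continuity theorem.\<close>

lemma tilted_char_convergence:
  fixes M :: "nat \<Rightarrow> 'a measure" and D u :: "nat \<Rightarrow> 'a \<Rightarrow> real"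
  assumes prob: "\<And>N. prob_space (M N)" and D[measurable]: "\<And>N. D N \<in> borel_measurable (M N)"
    and u[measurable]: "\<And>N. u N \<in> borel_measurable (M N)" and u1: "\<And>N x. x \<in> space (M N) \<Longrightarrow> \<bar>u N x\<bar> \<le> 1"
    and \<nu>: "real_distribution \<nu>"
    and ch: "\<And>t. (\<lambda>N. \<integral>x. iexp (t * D N x) \<partial>M N) \<longlonglongrightarrow> char \<nu> t"
    and chu: "\<And>t. (\<lambda>N. (\<integral>x. complex_of_real (u N x) * iexp (t * D N x) \<partial>M N) - char \<nu> t * (\<integral>x. u N x \<partial>M N)) \<longlonglongrightarrow> 0"
    and \<psi>: "\<And>x. isCont \<psi> x" "\<And>x. \<bar>\<psi> x\<bar> \<le> (B::real)"
  shows "(\<lambda>N. (\<integral>x. u N x * \<psi> (D N x) \<partial>M N) - (\<integral>x. u N x \<partial>M N) * (\<integral>y. \<psi> y \<partial>\<nu>)) \<longlonglongrightarrow> 0"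
proof -
  interpret prob_space "M N" for N by (rule prob)
  interpret \<nu>: real_distribution \<nu> by fact
  define \<kappa> where "\<kappa> N = 2 + (\<integral>x. u N x \<partial>M N)" for N
  have iu: "integrable (M N) (u N)" for N by (rule integrable_const_bound[where B=1]) (use u1 in auto)
  have eu: "\<bar>\<integral>x. u N x \<partial>M N\<bar> \<le> 1" for N
  proof -
    have "norm (\<integral>x. u N x \<partial>M N) \<le> (\<integral>x. 1 \<partial>M N)" by (rule norm_integral_le[OF iu]) (use u1 in auto)
    then show ?thesis by (simp add: prob_space)
  qed
  \<comment> \<open>The normalising constants stay within fixed bounds away from 0, so multiplying
    or dividing by them preserves null sequences.\<close>
  have \<kappa>: "1 \<le> \<kappa> N" "\<kappa> N \<le> 3" for N using eu[of N] by (auto simp: \<kappa>_def)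
  have [measurable]: "\<psi> \<in> borel_measurable borel"
    using \<psi>(1) by (intro borel_measurable_continuous_onI continuous_at_imp_continuous_on) auto
  define v where "v N x = (2 + u N x) / \<kappa> N" for N x
  have [measurable]: "v N \<in> borel_measurable (M N)" for N unfolding v_def by measurable
  have v0: "0 \<le> v N x" if "x \<in> space (M N)" for N x
    unfolding v_def using u1[OF that] \<kappa>(1)[of N] by (auto simp: abs_le_iff)
  have v0': "AE x in M N. 0 \<le> v N x" for N using v0 by auto
  have iv: "integrable (M N) (v N)" for N unfolding v_def using iu by auto
  have Ev: "(\<integral>x. v N x \<partial>M N) = 1" for N
    unfolding v_def using iu \<kappa>(1)[of N] by (simp add: \<kappa>_def[symmetric] prob_space)
  define L where "L N = distr (density (M N) (\<lambda>x. ennreal (v N x))) borel (D N)" for N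
  have Lr: "real_distribution (L N)" for N
  proof -
    have "(\<integral>\<^sup>+x. ennreal (v N x) \<partial>M N) = 1"
      using nn_integral_eq_integral[OF iv v0'] Ev by simp
    then have "prob_space (density (M N) (\<lambda>x. ennreal (v N x)))"
      by (auto intro!: prob_spaceI simp: emeasure_density cong: nn_integral_cong)
    then have "prob_space (L N)" unfolding L_def by (rule prob_space.prob_space_distr) measurable
    then show ?thesis by (auto simp: real_distribution_def real_distribution_axioms_def L_def)
  qed
  have Lint: "(\<integral>y. f y \<partial>L N) = (\<integral>x. v N x *\<^sub>R f (D N x) \<partial>M N)" if [measurable]: "f \<in> borel_measurable borel"
    for f :: "real \<Rightarrow> 'z::{banach,second_countable_topology}" and N
    unfolding L_def using v0' by (simp add: integral_distr integral_density)
  have ie: "integrable (M N) (\<lambda>x. iexp (t * D N x))" for t N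
    by (rule integrable_const_bound[where B=1]) auto
  have iue: "integrable (M N) (\<lambda>x. complex_of_real (u N x) * iexp (t * D N x))" for t N
    by (rule integrable_const_bound[where B=1]) (use u1 in \<open>auto simp: norm_mult\<close>)
  have conv: "weak_conv_m L \<nu>"
  proof (rule levy_continuity[OF Lr \<nu>])
    fix t
    have eq: "char (L N) t - char \<nu> t = (2 * ((\<integral>x. iexp (t * D N x) \<partial>M N) - char \<nu> t)
       + ((\<integral>x. complex_of_real (u N x) * iexp (t * D N x) \<partial>M N) - char \<nu> t * (\<integral>x. u N x \<partial>M N))) / complex_of_real (\<kappa> N)" for N
    proof -
      have "char (L N) t = (\<integral>x. v N x *\<^sub>R iexp (t * D N x) \<partial>M N)"
        unfolding char_def by (rule Lint) measurable
      also have "\<dots> = (\<integral>x. (2 * iexp (t * D N x) + complex_of_real (u N x) * iexp (t * D N x)) / complex_of_real (\<kappa> N) \<partial>M N)"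
        by (intro Bochner_Integration.integral_cong) (auto simp: v_def scaleR_conv_of_real field_simps)
      also have "\<dots> = (2 * (\<integral>x. iexp (t * D N x) \<partial>M N) + (\<integral>x. complex_of_real (u N x) * iexp (t * D N x) \<partial>M N)) / complex_of_real (\<kappa> N)"
        using ie iue by simp
      finally have cl: "char (L N) t = \<dots>" .
      have ke: "complex_of_real (\<kappa> N) = 2 + complex_of_real (\<integral>x. u N x \<partial>M N)" by (simp add: \<kappa>_def)
      have kn: "complex_of_real (\<kappa> N) \<noteq> 0" using \<kappa>(1)[of N] by simp
      have "char (L N) t - char \<nu> t = ((2 * (\<integral>x. iexp (t * D N x) \<partial>M N) + (\<integral>x. complex_of_real (u N x) * iexp (t * D N x) \<partial>M N))
         - char \<nu> t * complex_of_real (\<kappa> N)) / complex_of_real (\<kappa> N)"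
        unfolding cl diff_divide_distrib using kn by simp
      then show ?thesis unfolding ke by (simp add: algebra_simps)
    qed
    have "(\<lambda>N. char (L N) t - char \<nu> t) \<longlonglongrightarrow> 0"
    proof (rule Lim_null_comparison)
      show "\<forall>\<^sub>F N in sequentially. norm (char (L N) t - char \<nu> t) \<le> norm (2 * ((\<integral>x. iexp (t * D N x) \<partial>M N) - char \<nu> t)
       + ((\<integral>x. complex_of_real (u N x) * iexp (t * D N x) \<partial>M N) - char \<nu> t * (\<integral>x. u N x \<partial>M N)))"
      proof (rule always_eventually, rule allI)
        fix N
        have "z / \<kappa> N \<le> z" if "0 \<le> z" for z using that \<kappa>(1)[of N] mult_left_mono[of 1 "\<kappa> N" z] by (simp add: divide_le_eq)
        then show "norm (char (L N) t - char \<nu> t) \<le> norm (2 * ((\<integral>x. iexp (t * D N x) \<partial>M N) - char \<nu> t)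
       + ((\<integral>x. complex_of_real (u N x) * iexp (t * D N x) \<partial>M N) - char \<nu> t * (\<integral>x. u N x \<partial>M N)))"
          unfolding eq norm_divide using \<kappa>(1)[of N] by simp
      qed
      show "(\<lambda>N. norm (2 * ((\<integral>x. iexp (t * D N x) \<partial>M N) - char \<nu> t)
       + ((\<integral>x. complex_of_real (u N x) * iexp (t * D N x) \<partial>M N) - char \<nu> t * (\<integral>x. u N x \<partial>M N)))) \<longlonglongrightarrow> 0"
        by (intro tendsto_norm_zero tendsto_add_zero chu tendsto_mult_right_zero) (use ch[of t] in \<open>simp add: LIM_zero\<close>)
    qed
    then show "(\<lambda>N. char (L N) t) \<longlonglongrightarrow> char \<nu> t" by (rule LIM_zero_cancel)
  qed
  have plain: "(\<lambda>N. \<integral>x. \<psi> (D N x) \<partial>M N) \<longlonglongrightarrow> (\<integral>y. \<psi> y \<partial>\<nu>)"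
  proof -
    have "weak_conv_m (\<lambda>N. distr (M N) borel (D N)) \<nu>"
      by (rule levy_continuity) (use ch in \<open>auto simp: char_def integral_distr \<nu> intro!: real_distribution_distr\<close>)
    from weak_conv_imp_integral_bdd_continuous_conv[OF _ _ this, of \<psi> B] show ?thesis
      using \<psi> \<nu> by (auto simp: integral_distr intro!: real_distribution_distr)
  qed
  have ip: "integrable (M N) (\<lambda>x. \<psi> (D N x))" "integrable (M N) (\<lambda>x. u N x * \<psi> (D N x))" for N
    using bounded_pair_integrable[of "u N" N "\<lambda>x. \<psi> (D N x)" 1 B] u1 \<psi>(2)
    by (auto intro!: integrable_const_bound[where B=B])
  have "(\<lambda>N. \<integral>y. \<psi> y \<partial>L N) \<longlonglongrightarrow> (\<integral>y. \<psi> y \<partial>\<nu>)"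
    by (rule weak_conv_imp_integral_bdd_continuous_conv[OF Lr \<nu> conv]) (use \<psi> in auto)
  then have "(\<lambda>N. (\<integral>y. \<psi> y \<partial>L N) - (\<integral>y. \<psi> y \<partial>\<nu>)) \<longlonglongrightarrow> 0" by (simp add: LIM_zero)
  then have t: "(\<lambda>N. (\<integral>y. \<psi> y \<partial>L N) * \<kappa> N - \<kappa> N * (\<integral>y. \<psi> y \<partial>\<nu>)) \<longlonglongrightarrow> 0"
  proof (rule Lim_null_comparison[rotated, OF tendsto_mult_right_zero[of _ _ 3, OF tendsto_norm_zero]])
    show "\<forall>\<^sub>F N in sequentially. norm ((\<integral>y. \<psi> y \<partial>L N) * \<kappa> N - \<kappa> N * (\<integral>y. \<psi> y \<partial>\<nu>))
      \<le> 3 * norm ((\<integral>y. \<psi> y \<partial>L N) - (\<integral>y. \<psi> y \<partial>\<nu>))"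
    proof (rule always_eventually, rule allI)
      fix N
      have "norm ((\<integral>y. \<psi> y \<partial>L N) * \<kappa> N - \<kappa> N * (\<integral>y. \<psi> y \<partial>\<nu>)) = \<kappa> N * norm ((\<integral>y. \<psi> y \<partial>L N) - (\<integral>y. \<psi> y \<partial>\<nu>))"
        using \<kappa>(1)[of N] by (simp add: mult.commute[of _ "\<kappa> N"] right_diff_distrib[symmetric] abs_mult)
      also have "\<dots> \<le> 3 * norm ((\<integral>y. \<psi> y \<partial>L N) - (\<integral>y. \<psi> y \<partial>\<nu>))"
        using \<kappa>(2)[of N] by (intro mult_right_mono) auto
      finally show "norm ((\<integral>y. \<psi> y \<partial>L N) * \<kappa> N - \<kappa> N * (\<integral>y. \<psi> y \<partial>\<nu>))
      \<le> 3 * norm ((\<integral>y. \<psi> y \<partial>L N) - (\<integral>y. \<psi> y \<partial>\<nu>))" .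
    qed
  qed
  \<comment> \<open>Undoing the normalisation leaves twice the untilted expectation, whose limit is
    \<open>plain\<close>, plus the product wanted.\<close>
  have eq: "(\<integral>y. \<psi> y \<partial>L N) * \<kappa> N = 2 * (\<integral>x. \<psi> (D N x) \<partial>M N) + (\<integral>x. u N x * \<psi> (D N x) \<partial>M N)" for N
  proof -
    have "(\<integral>y. \<psi> y \<partial>L N) = (\<integral>x. (2 * \<psi> (D N x) + u N x * \<psi> (D N x)) / \<kappa> N \<partial>M N)"
      unfolding Lint[OF \<open>\<psi> \<in> borel_measurable borel\<close>]
      by (intro Bochner_Integration.integral_cong) (auto simp: v_def field_simps)
    then show ?thesis using ip \<kappa>(1)[of N] by simp
  qed
  have "(\<lambda>N. ((\<integral>y. \<psi> y \<partial>L N) * \<kappa> N - \<kappa> N * (\<integral>y. \<psi> y \<partial>\<nu>)) - 2 * ((\<integral>x. \<psi> (D N x) \<partial>M N) - (\<integral>y. \<psi> y \<partial>\<nu>))) \<longlonglongrightarrow> 0 - 2 * 0"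
    by (intro tendsto_intros t) (use plain in \<open>simp add: LIM_zero\<close>)
  then show ?thesis unfolding eq by (simp add: \<kappa>_def algebra_simps)
qed

section \<open>Product approximation of test functions and appending one increment\<close>

definition clamp01 :: "real \<Rightarrow> real" where "clamp01 x = max 0 (min 1 x)"

text \<open>The hat function of width h around \<open>node h K i\<close>. As a difference of two
  shifted clamps it makes the sum over i telescope, which yields a partition of unity away from the
  ends of the grid.\<close>

definition bump :: "real \<Rightarrow> nat \<Rightarrow> nat \<Rightarrow> real \<Rightarrow> real" where
  "bump h K i y = clamp01 (y / h + real K + 1 - real i) - clamp01 (y / h + real K - real i)"

definition node :: "real \<Rightarrow> nat \<Rightarrow> nat \<Rightarrow> real" where "node h K i = (real i - real K) * h"

lemma sum_bump: "(\<Sum>i<n. bump h K i y) = clamp01 (y / h + real K + 1) - clamp01 (y / h + real K + 1 - real n)"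
proof -
  have "bump h K i y = clamp01 (y / h + real K + 1 - real i) - clamp01 (y / h + real K + 1 - real (Suc i))" for i
    by (simp add: bump_def algebra_simps)
  then show ?thesis using sum_lessThan_telescope'[of "\<lambda>i. clamp01 (y / h + real K + 1 - real i)" n] by simp
qed

lemma bump_bounds: "0 \<le> bump h K i y" "bump h K i y \<le> 1"
  by (auto simp: bump_def clamp01_def)

lemma bump_support: "h > 0 \<Longrightarrow> bump h K i y \<noteq> 0 \<Longrightarrow> \<bar>y - node h K i\<bar> \<le> h"
proof -
  assume h: "h > 0" and "bump h K i y \<noteq> 0"
  then have "\<bar>y / h + real K - real i\<bar> \<le> 1" by (auto simp: bump_def clamp01_def split: if_splits)
  then have "\<bar>y / h + real K - real i\<bar> * h \<le> 1 * h" using h by (intro mult_right_mono) auto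
  also have "\<bar>y / h + real K - real i\<bar> * h = \<bar>(y / h + real K - real i) * h\<bar>" using h by (simp add: abs_mult)
  also have "(y / h + real K - real i) * h = y - node h K i" using h by (simp add: node_def field_simps)
  finally show ?thesis by simp
qed

lemma isCont_bump: "isCont (bump h K i) y"
proof -
  have "isCont (\<lambda>y. max 0 (min 1 (y / h + real K + 1 - real i)) - max 0 (min 1 (y / h + real K - real i))) y"
    unfolding divide_inverse by (intro continuous_intros)
  then show ?thesis by (simp add: bump_def[abs_def] clamp01_def)
qed

lemma sum_bump_tendsto: "h > 0 \<Longrightarrow> (\<lambda>K. \<Sum>i<2 * K + 1. bump h K i y) \<longlonglongrightarrow> 1"
proof -
  assume h: "h > 0"
  obtain K0 :: nat where K0: "\<bar>y / h\<bar> \<le> real K0" using real_arch_simple by blast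
  have "(\<Sum>i<2 * K + 1. bump h K i y) = 1" if "K \<ge> K0" for K
  proof -
    have "real K0 \<le> real K" using that by simp
    then have "y / h \<le> real K" "- real K \<le> y / h"
      using K0 abs_ge_self[of "y / h"] abs_ge_minus_self[of "y / h"] by linarith+
    then show ?thesis unfolding sum_bump clamp01_def by (simp add: max_def min_def)
  qed
  then have "eventually (\<lambda>K. (\<Sum>i<2 * K + 1. bump h K i y) = 1) sequentially"
    by (auto simp: eventually_sequentially)
  then show ?thesis by (rule tendsto_eventually)
qed

text \<open>Where a hat is nonzero its node is within h of y, which costs L * h. The second term is
  the mass that the finite grid misses.\<close>

lemma bump_approx:
  fixes \<phi> :: "real \<Rightarrow> real"
  assumes "h > 0" "\<And>y. \<bar>\<phi> y\<bar> \<le> B" "\<And>x y. \<bar>\<phi> x - \<phi> y\<bar> \<le> L * \<bar>x - y\<bar>" "0 \<le> L"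
  shows "\<bar>\<phi> y - (\<Sum>i<n. \<phi> (node h K i) * bump h K i y)\<bar> \<le> L * h + B * (1 - (\<Sum>i<n. bump h K i y))"
proof -
  let ?s = "\<Sum>i<n. bump h K i y"
  have s: "0 \<le> ?s" "?s \<le> 1"
    by (simp add: sum_nonneg bump_bounds) (simp add: sum_bump clamp01_def)
  have B0: "0 \<le> B" using assms(2)[of 0] by linarith
  have "\<phi> y - (\<Sum>i<n. \<phi> (node h K i) * bump h K i y) = (\<Sum>i<n. (\<phi> y - \<phi> (node h K i)) * bump h K i y) + \<phi> y * (1 - ?s)"
    by (simp add: left_diff_distrib sum_subtractf sum_distrib_left right_diff_distrib)
  also have "\<bar>\<dots>\<bar> \<le> (\<Sum>i<n. L * h * bump h K i y) + B * (1 - ?s)"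
  proof (rule order_trans[OF abs_triangle_ineq add_mono])
    show "\<bar>\<Sum>i<n. (\<phi> y - \<phi> (node h K i)) * bump h K i y\<bar> \<le> (\<Sum>i<n. L * h * bump h K i y)"
    proof (rule order_trans[OF sum_abs sum_mono])
      fix i
      show "\<bar>(\<phi> y - \<phi> (node h K i)) * bump h K i y\<bar> \<le> L * h * bump h K i y"
      proof (cases "bump h K i y = 0")
        case False
        have "\<bar>\<phi> y - \<phi> (node h K i)\<bar> \<le> L * h"
          by (rule order_trans[OF assms(3) mult_left_mono[OF bump_support[OF assms(1) False] assms(4)]])
        then show ?thesis using bump_bounds(1)[of h K i y] by (simp add: abs_mult mult_right_mono)
      qed simp
    qed
    show "\<bar>\<phi> y * (1 - ?s)\<bar> \<le> B * (1 - ?s)" using s assms(2)[of y] by (simp add: abs_mult mult_right_mono)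
  qed
  also have "(\<Sum>i<n. L * h * bump h K i y) = L * h * ?s" by (simp add: sum_distrib_left)
  also have "L * h * ?s \<le> L * h" using s assms(1,4) by (simp add: mult_left_le)
  finally show ?thesis by simp
qed

lemma dcont_UNIV_iff: "dcont UNIV dist h \<longleftrightarrow> continuous_on UNIV (h :: 'b::metric_space \<Rightarrow> real)"
  unfolding dcont_def continuous_on_iff by (simp add: dist_commute dist_real_def)

lemma pseudometric_dist: "pseudometric_on UNIV (dist :: 'b::metric_space \<Rightarrow> _)"
  by (auto simp: pseudometric_on_def dist_commute dist_triangle)

text \<open>A Lipschitz test function of the pair is replaced by a finite sum of products of a
  function of \<open>Z\<close> and a hat in \<open>D\<close>. Each product converges by tilting with
  the function of \<open>Z\<close>. The mass missed by the hats is small under \<nu>, hence also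
  under the law of \<open>D N\<close> for large N, so no separate tightness estimate is
  made.\<close>

lemma weak_convergence_append:
  fixes M :: "nat \<Rightarrow> 'a measure" and D :: "nat \<Rightarrow> 'a \<Rightarrow> real"
    and Z :: "nat \<Rightarrow> 'a \<Rightarrow> 'y::{metric_space, second_countable_topology}" and \<phi> :: "'y \<times> real \<Rightarrow> real"
  assumes prob: "\<And>N. prob_space (M N)" and D[measurable]: "\<And>N. D N \<in> borel_measurable (M N)"
    and Z[measurable]: "\<And>N. Z N \<in> borel_measurable (M N)"
    and \<mu>: "prob_space \<mu>" "sets \<mu> = sets borel" and \<nu>: "real_distribution \<nu>"
    and weak: "\<And>(g :: 'y \<Rightarrow> real) B. continuous_on UNIV g \<Longrightarrow> (\<And>z. \<bar>g z\<bar> \<le> B) \<Longrightarrow>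
        (\<lambda>N. \<integral>x. g (Z N x) \<partial>M N) \<longlonglongrightarrow> (\<integral>z. g z \<partial>\<mu>)"
    and chr: "\<And>(g :: 'y \<Rightarrow> real) t. continuous_on UNIV g \<Longrightarrow> (\<And>z. \<bar>g z\<bar> \<le> 1) \<Longrightarrow>
        (\<lambda>N. (\<integral>x. complex_of_real (g (Z N x)) * iexp (t * D N x) \<partial>M N) - char \<nu> t * (\<integral>x. g (Z N x) \<partial>M N)) \<longlonglongrightarrow> 0"
    and c: "continuous_on UNIV \<phi>" and b: "\<And>p. \<bar>\<phi> p\<bar> \<le> B"
  shows "(\<lambda>N. \<integral>x. \<phi> (Z N x, D N x) \<partial>M N) \<longlonglongrightarrow> (\<integral>p. \<phi> p \<partial>(\<mu> \<Otimes>\<^sub>M \<nu>))"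
proof -
  interpret prob_space "M N" for N by (rule prob)
  interpret \<nu>: real_distribution \<nu> by fact
  interpret \<mu>: prob_space \<mu> by fact
  interpret pp: pair_prob_space \<mu> \<nu> ..
  note [measurable_cong] = \<mu>(2)
  have sp: "space \<mu> = UNIV" using sets_eq_imp_space_eq[OF \<mu>(2)] by simp
  have pm: "(\<lambda>x. g (Z N x, D N x)) \<in> borel_measurable (M N)" "g \<in> borel_measurable (\<mu> \<Otimes>\<^sub>M \<nu>)"
    if "continuous_on UNIV g" for g :: "'y \<times> real \<Rightarrow> real" and N
  proof -
    have g[measurable]: "g \<in> borel_measurable borel" by (rule borel_measurable_continuous_onI[OF that])
    show "(\<lambda>x. g (Z N x, D N x)) \<in> borel_measurable (M N)" by measurable
    have "sets (\<mu> \<Otimes>\<^sub>M \<nu>) = sets (borel \<Otimes>\<^sub>M borel)" by (rule sets_pair_measure_cong[OF \<mu>(2) \<nu>.events_eq_borel])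
    also have "borel \<Otimes>\<^sub>M borel = (borel :: ('y \<times> real) measure)" by (rule borel_prod)
    finally have "sets (\<mu> \<Otimes>\<^sub>M \<nu>) = sets borel" .
    then show "g \<in> borel_measurable (\<mu> \<Otimes>\<^sub>M \<nu>)" using g by (simp cong: measurable_cong_sets)
  qed
  have gm: "g \<in> borel_measurable \<mu>" "(\<lambda>x. g (Z N x)) \<in> borel_measurable (M N)" if "continuous_on UNIV g" for g :: "'y \<Rightarrow> real" and N
  proof -
    have g[measurable]: "g \<in> borel_measurable borel" by (rule borel_measurable_continuous_onI[OF that])
    show "g \<in> borel_measurable \<mu>" "(\<lambda>x. g (Z N x)) \<in> borel_measurable (M N)" by measurable
  qed
  have bm[measurable]: "bump h K i \<in> borel_measurable borel" for h K i
    using isCont_bump by (intro borel_measurable_continuous_onI continuous_at_imp_continuous_on) auto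
  show ?thesis
  proof (rule weak_limit_from_lipschitz[where S=UNIV and d=dist and h=\<phi> and B=B and Y="\<lambda>p. p" and Z="\<lambda>N x. (Z N x, D N x)"])
    fix \<phi> :: "'y \<times> real \<Rightarrow> real" and L B :: real
    assume b0: "\<And>p. p \<in> UNIV \<Longrightarrow> \<bar>\<phi> p\<bar> \<le> B" and L0: "0 \<le> L" and Lip0: "\<And>p q. p \<in> UNIV \<Longrightarrow> q \<in> UNIV \<Longrightarrow> \<bar>\<phi> p - \<phi> q\<bar> \<le> L * dist p q"
    have b: "\<bar>\<phi> p\<bar> \<le> B" for p using b0 by simp
    have Lip: "\<bar>\<phi> p - \<phi> q\<bar> \<le> L * dist p q" for p q using Lip0 by simp
    have c: "continuous_on UNIV \<phi>" using dcont_lipschitz[of UNIV \<phi> L dist] Lip L0 by (simp add: dcont_UNIV_iff)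
    have cy: "continuous_on UNIV (\<lambda>z. \<phi> (z, y))" for y
      by (rule continuous_on_compose2[OF c]) (auto intro!: continuous_intros)
    have B0: "0 \<le> B" using b[of undefined] by linarith
    have Lip1: "\<bar>\<phi> (z, x) - \<phi> (z, y)\<bar> \<le> L * \<bar>x - y\<bar>" for z x y
      using Lip[of "(z, x)" "(z, y)"] by (simp add: dist_Pair_Pair dist_real_def)
    define A where "A h n K z y = (\<Sum>i<n. \<phi> (z, node h K i) * bump h K i y)" for h n K z y
    define V where "V h n K y = 1 - (\<Sum>i<n. bump h K i y)" for h n K and y :: real
    have ap: "\<bar>\<phi> (z, y) - A h n K z y\<bar> \<le> L * h + B * V h n K y" if "h > 0" for h n K z y
      unfolding A_def V_def by (rule bump_approx[OF that b Lip1 L0])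
    have Vb: "0 \<le> V h n K y" "V h n K y \<le> 1" for h n K y
      by (simp add: V_def sum_bump clamp01_def) (simp add: V_def sum_nonneg bump_bounds)
    have [measurable]: "V h n K \<in> borel_measurable borel" for h n K unfolding V_def by measurable
    have Vc: "isCont (V h n K) y" for h n K y
      unfolding V_def by (intro continuous_intros isCont_bump)
    have iVM: "integrable (M N) (\<lambda>x. V h n K (D N x))" for N h n K
      by (rule integrable_const_bound[where B=1]) (use Vb in auto)
    have iVn: "integrable \<nu> (V h n K)" for h n K
      by (rule \<nu>.integrable_const_bound[where B=1]) (use Vb in auto)
    have iphi: "integrable (M N) (\<lambda>x. \<phi> (Z N x, D N x))" for N
      by (rule integrable_const_bound[where B=B]) (use b pm[OF c] in auto)
    have iphi2: "integrable (\<mu> \<Otimes>\<^sub>M \<nu>) \<phi>"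
      by (rule pp.integrable_const_bound[where B=B]) (use b pm[OF c] in auto)
    have iterm: "integrable (M N) (\<lambda>x. \<phi> (Z N x, y) * bump h K i (D N x))" for N y h K i
      by (rule bounded_pair_integrable[where a=B and b=1]) (use b bump_bounds gm[OF cy] in auto)
    have iA: "integrable (M N) (\<lambda>x. A h n K (Z N x) (D N x))" for N h n K
      unfolding A_def using iterm by auto
    have im: "integrable \<mu> (\<lambda>z. \<phi> (z, y))" for y
      by (rule \<mu>.integrable_const_bound[where B=B]) (use b gm[OF cy] in auto)
    have ib: "integrable \<nu> (bump h K i)" for h K i
      by (rule \<nu>.integrable_const_bound[where B=1]) (use bump_bounds in auto)
    have iterm2: "integrable (\<mu> \<Otimes>\<^sub>M \<nu>) (\<lambda>p. \<phi> (fst p, y) * bump h K i (snd p))" for y h K i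
    proof (rule pp.bounded_pair_integrable[where a=B and b=1])
      show "(\<lambda>p. \<phi> (fst p, y)) \<in> borel_measurable (\<mu> \<Otimes>\<^sub>M \<nu>)"
        using measurable_compose[OF measurable_fst gm(1)[OF cy]] .
    qed (use b bump_bounds in auto)
    have eterm2: "(\<integral>p. \<phi> (fst p, y) * bump h K i (snd p) \<partial>(\<mu> \<Otimes>\<^sub>M \<nu>)) = (\<integral>z. \<phi> (z, y) \<partial>\<mu>) * (\<integral>y. bump h K i y \<partial>\<nu>)" for y h K i
      using pp.integral_fst'[OF iterm2[of y h K i]] im[of y] ib[of h K i] by simp
    have eA2: "integrable (\<mu> \<Otimes>\<^sub>M \<nu>) (\<lambda>p. A h n K (fst p) (snd p))"
      "(\<integral>p. A h n K (fst p) (snd p) \<partial>(\<mu> \<Otimes>\<^sub>M \<nu>)) = (\<Sum>i<n. (\<integral>z. \<phi> (z, node h K i) \<partial>\<mu>) * (\<integral>y. bump h K i y \<partial>\<nu>))" for h n K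
      unfolding A_def using iterm2 eterm2 by auto
    have iV2: "integrable (\<mu> \<Otimes>\<^sub>M \<nu>) (\<lambda>p. V h n K (snd p))" for h n K
      by (rule pp.integrable_const_bound[where B=1]) (use Vb in auto)
    have eV2: "(\<integral>p. V h n K (snd p) \<partial>(\<mu> \<Otimes>\<^sub>M \<nu>)) = (\<integral>y. V h n K y \<partial>\<nu>)" for h n K
      using pp.integral_fst'[OF iV2[of h n K]] by (simp add: \<mu>.prob_space)
    have ch: "(\<lambda>N. \<integral>x. iexp (t * D N x) \<partial>M N) \<longlonglongrightarrow> char \<nu> t" for t
    proof -
      have "(\<lambda>N. (\<integral>x. iexp (t * D N x) \<partial>M N) - char \<nu> t) \<longlonglongrightarrow> 0"
        using chr[of "\<lambda>_. 1" t] by (simp add: prob_space)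
      then show ?thesis by (rule LIM_zero_cancel)
    qed
    have tilt: "(\<lambda>N. (\<integral>x. g (Z N x) * \<psi> (D N x) \<partial>M N) - (\<integral>x. g (Z N x) \<partial>M N) * (\<integral>y. \<psi> y \<partial>\<nu>)) \<longlonglongrightarrow> 0"
      if g: "continuous_on UNIV g" "\<And>z. \<bar>g z\<bar> \<le> 1" and \<psi>: "\<And>x. isCont \<psi> x" "\<And>x. \<bar>\<psi> x\<bar> \<le> 1" for g :: "'y \<Rightarrow> real" and \<psi>
      by (rule tilted_char_convergence[OF prob D gm(2)[OF g(1)] g(2) \<nu> ch chr[OF g] \<psi>])
    have termlim: "(\<lambda>N. \<integral>x. \<phi> (Z N x, y) * bump h K i (D N x) \<partial>M N) \<longlonglongrightarrow> (\<integral>z. \<phi> (z, y) \<partial>\<mu>) * (\<integral>y. bump h K i y \<partial>\<nu>)" for y h K i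
    proof -
      \<comment> \<open>The tilting lemma wants weights bounded by 1; adding 1 to the bound rules
        out division by zero.\<close>
      define B1 where "B1 = B + 1"
      have B1: "B1 > 0" using B0 by (simp add: B1_def)
      have "(\<lambda>N. (\<integral>x. \<phi> (Z N x, y) / B1 * bump h K i (D N x) \<partial>M N) - (\<integral>x. \<phi> (Z N x, y) / B1 \<partial>M N) * (\<integral>y. bump h K i y \<partial>\<nu>)) \<longlonglongrightarrow> 0"
      proof (rule tilt)
        show "continuous_on UNIV (\<lambda>z. \<phi> (z, y) / B1)" using B1 by (intro continuous_intros cy) auto
        have "\<bar>\<phi> (z, y)\<bar> \<le> B1" for z using b[of "(z, y)"] by (simp add: B1_def)
        then show "\<bar>\<phi> (z, y) / B1\<bar> \<le> 1" for z using B1 by (simp add: abs_divide)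
      qed (use isCont_bump bump_bounds in auto)
      then have "(\<lambda>N. B1 * ((\<integral>x. \<phi> (Z N x, y) / B1 * bump h K i (D N x) \<partial>M N) - (\<integral>x. \<phi> (Z N x, y) / B1 \<partial>M N) * (\<integral>y. bump h K i y \<partial>\<nu>))) \<longlonglongrightarrow> 0"
        by (rule tendsto_mult_right_zero)
      then have 1: "(\<lambda>N. (\<integral>x. \<phi> (Z N x, y) * bump h K i (D N x) \<partial>M N) - (\<integral>x. \<phi> (Z N x, y) \<partial>M N) * (\<integral>y. bump h K i y \<partial>\<nu>)) \<longlonglongrightarrow> 0"
        using B1 by (simp add: right_diff_distrib)
      have 2: "(\<lambda>N. (\<integral>x. \<phi> (Z N x, y) \<partial>M N) * (\<integral>y. bump h K i y \<partial>\<nu>)) \<longlonglongrightarrow> (\<integral>z. \<phi> (z, y) \<partial>\<mu>) * (\<integral>y. bump h K i y \<partial>\<nu>)"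
        by (intro tendsto_intros weak[OF cy]) (rule b)
      show ?thesis using tendsto_add[OF 1 2] by simp
    qed
    have Alim: "(\<lambda>N. \<integral>x. A h n K (Z N x) (D N x) \<partial>M N) \<longlonglongrightarrow> (\<integral>p. A h n K (fst p) (snd p) \<partial>(\<mu> \<Otimes>\<^sub>M \<nu>))" for h n K
      unfolding eA2 using tendsto_sum[OF termlim] iterm by (simp add: A_def)
    have Vlim: "(\<lambda>N. \<integral>x. V h n K (D N x) \<partial>M N) \<longlonglongrightarrow> (\<integral>y. V h n K y \<partial>\<nu>)" for h n K
    proof -
      have "(\<lambda>N. (\<integral>x. 1 * V h n K (D N x) \<partial>M N) - (\<integral>x. 1 \<partial>M N) * (\<integral>y. V h n K y \<partial>\<nu>)) \<longlonglongrightarrow> 0"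
        using tilt[of "\<lambda>_. 1" "V h n K"] Vc Vb by auto
      then show ?thesis by (simp add: prob_space LIM_zero_cancel)
    qed
    show "(\<lambda>N. \<integral>x. \<phi> (Z N x, D N x) \<partial>M N) \<longlonglongrightarrow> (\<integral>p. \<phi> p \<partial>(\<mu> \<Otimes>\<^sub>M \<nu>))"
    proof (rule LIMSEQ_I)
      fix e :: real assume e: "0 < e"
      \<comment> \<open>Five errors of size e/5: mesh and missing mass, each once for the array and
        once for the limit, and the convergence of the product sums.\<close>
      define h where "h = e / (5 * (L + 1))"
      have h: "h > 0" using e L0 by (simp add: h_def)
      have Lh: "L * h \<le> e / 5" using e L0 by (simp add: h_def field_simps)
      have "(\<lambda>K. \<integral>y. V h (2 * K + 1) K y \<partial>\<nu>) \<longlonglongrightarrow> (\<integral>y. 1 - 1 \<partial>\<nu>)"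
      proof (rule integral_dominated_convergence[where w="\<lambda>_. 1"])
        show "AE y in \<nu>. (\<lambda>K. V h (2 * K + 1) K y) \<longlonglongrightarrow> 1 - 1"
          unfolding V_def by (intro AE_I2 tendsto_intros sum_bump_tendsto h)
      qed (use Vb in auto)
      then have "(\<lambda>K. B * (\<integral>y. V h (2 * K + 1) K y \<partial>\<nu>)) \<longlonglongrightarrow> B * 0" by (intro tendsto_intros) simp
      then have "eventually (\<lambda>K. B * (\<integral>y. V h (2 * K + 1) K y \<partial>\<nu>) < e / 5) sequentially"
        by (rule order_tendstoD(2)) (use e in simp)
      then obtain K where K: "B * (\<integral>y. V h (2 * K + 1) K y \<partial>\<nu>) < e / 5" by (auto simp: eventually_sequentially)
      let ?n = "2 * K + 1"
      have "(\<lambda>N. B * (\<integral>x. V h ?n K (D N x) \<partial>M N)) \<longlonglongrightarrow> B * (\<integral>y. V h ?n K y \<partial>\<nu>)" by (intro tendsto_intros Vlim)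
      from order_tendstoD(2)[OF this K]
      have ev1: "eventually (\<lambda>N. B * (\<integral>x. V h ?n K (D N x) \<partial>M N) < e / 5) sequentially" .
      have ev2: "eventually (\<lambda>N. \<bar>(\<integral>x. A h ?n K (Z N x) (D N x) \<partial>M N) - (\<integral>p. A h ?n K (fst p) (snd p) \<partial>(\<mu> \<Otimes>\<^sub>M \<nu>))\<bar> < e / 5) sequentially"
        using tendstoD[OF Alim, of "e/5" h ?n K] e by (simp add: dist_real_def)
      have lim: "\<bar>(\<integral>p. \<phi> p \<partial>(\<mu> \<Otimes>\<^sub>M \<nu>)) - (\<integral>p. A h ?n K (fst p) (snd p) \<partial>(\<mu> \<Otimes>\<^sub>M \<nu>))\<bar> \<le> L * h + B * (\<integral>y. V h ?n K y \<partial>\<nu>)"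
      proof -
        have "norm (\<integral>p. \<phi> p - A h ?n K (fst p) (snd p) \<partial>(\<mu> \<Otimes>\<^sub>M \<nu>)) \<le> (\<integral>p. L * h + B * V h ?n K (snd p) \<partial>(\<mu> \<Otimes>\<^sub>M \<nu>))"
        proof (rule norm_integral_le)
          show "norm (\<phi> p - A h ?n K (fst p) (snd p)) \<le> L * h + B * V h ?n K (snd p)" for p
            using ap[OF h, of "fst p" "snd p" ?n K] by simp
        qed (use iphi2 eA2 iV2 in auto)
        also have "\<dots> = L * h + B * (\<integral>y. V h ?n K y \<partial>\<nu>)" using iV2 eV2 by (simp add: pp.prob_space)
        finally show ?thesis using iphi2 eA2 by simp
      qed
      show "\<exists>no. \<forall>N\<ge>no. norm ((\<integral>x. \<phi> (Z N x, D N x) \<partial>M N) - (\<integral>p. \<phi> p \<partial>(\<mu> \<Otimes>\<^sub>M \<nu>))) < e"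
        unfolding eventually_sequentially[symmetric] using ev1 ev2
      proof eventually_elim
        case (elim N)
        have "norm (\<integral>x. \<phi> (Z N x, D N x) - A h ?n K (Z N x) (D N x) \<partial>M N) \<le> (\<integral>x. L * h + B * V h ?n K (D N x) \<partial>M N)"
          by (rule norm_integral_le) (use iphi iA iVM ap[OF h] in auto)
        also have "\<dots> = L * h + B * (\<integral>x. V h ?n K (D N x) \<partial>M N)" using iVM by (simp add: prob_space)
        finally have "\<bar>(\<integral>x. \<phi> (Z N x, D N x) \<partial>M N) - (\<integral>x. A h ?n K (Z N x) (D N x) \<partial>M N)\<bar> \<le> L * h + B * (\<integral>x. V h ?n K (D N x) \<partial>M N)"
          using iphi iA by simp
        with elim lim Lh K show ?case unfolding real_norm_def by linarith
      qed
    qed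
  qed (use pseudometric_dist prob pp.prob_space_axioms pm b c in \<open>auto simp: dcont_UNIV_iff\<close>)
qed

section \<open>Path functionals\<close>

text \<open>The cap at 1 makes the supremum exist for arbitrary functions, with no boundedness
  argument for the paths.\<close>

definition sup_dist :: "real \<Rightarrow> (real \<Rightarrow> real) \<Rightarrow> (real \<Rightarrow> real) \<Rightarrow> real" where
  "sup_dist T f g = (SUP t\<in>{0..T}. min 1 \<bar>f t - g t\<bar>)"

definition dist_XD :: "real \<Rightarrow> 'x::metric_space \<times> (real \<Rightarrow> real) \<Rightarrow> 'x \<times> (real \<Rightarrow> real) \<Rightarrow> real" where
  "dist_XD T p q = dist (fst p) (fst q) + sup_dist T (snd p) (snd q)"

abbreviation XD :: "real \<Rightarrow> ('x \<times> (real \<Rightarrow> real)) set" where "XD T \<equiv> UNIV \<times> Dspace T"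

lemma sup_dist_bdd: "bdd_above ((\<lambda>t. min 1 \<bar>f t - g t\<bar>) ` A)" for f g :: "real \<Rightarrow> real"
  by (rule bdd_aboveI2[where M=1]) auto

lemma sup_dist_upper: "t \<in> {0..T} \<Longrightarrow> min 1 \<bar>f t - g t\<bar> \<le> sup_dist T f g"
  unfolding sup_dist_def by (rule cSUP_upper[OF _ sup_dist_bdd])

lemma sup_dist_least: "0 \<le> T \<Longrightarrow> (\<And>t. t \<in> {0..T} \<Longrightarrow> min 1 \<bar>f t - g t\<bar> \<le> e) \<Longrightarrow> sup_dist T f g \<le> e"
  unfolding sup_dist_def by (rule cSUP_least) auto

lemma sup_dist_le: "0 \<le> T \<Longrightarrow> (\<And>t. t \<in> {0..T} \<Longrightarrow> \<bar>f t - g t\<bar> \<le> e) \<Longrightarrow> sup_dist T f g \<le> e"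
  by (rule sup_dist_least) (auto intro: min.coboundedI2)

lemma sup_dist_nonneg: "0 \<le> T \<Longrightarrow> 0 \<le> sup_dist T f g"
  using sup_dist_upper[of 0 T f g] by simp

lemma pseudometric_XD:
  fixes S :: "('x::metric_space \<times> (real \<Rightarrow> real)) set"
  assumes T: "0 \<le> T"
  shows "pseudometric_on S (dist_XD T)"
  unfolding pseudometric_on_def
proof (intro conjI ballI)
  fix x :: "'x \<times> (real \<Rightarrow> real)"
  show "dist_XD T x x = 0" using sup_dist_le[OF T, of "snd x" "snd x" 0] sup_dist_nonneg[OF T, of "snd x" "snd x"]
    by (simp add: dist_XD_def)
  fix y :: "'x \<times> (real \<Rightarrow> real)"
  show "0 \<le> dist_XD T x y" using sup_dist_nonneg[OF T] by (simp add: dist_XD_def)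
  show "dist_XD T x y = dist_XD T y x" by (simp add: dist_XD_def sup_dist_def dist_commute abs_minus_commute)
  fix z :: "'x \<times> (real \<Rightarrow> real)"
  have "sup_dist T (snd x) (snd z) \<le> sup_dist T (snd x) (snd y) + sup_dist T (snd y) (snd z)"
  proof (rule sup_dist_least[OF T])
    fix t assume t: "t \<in> {0..T}"
    show "min 1 \<bar>snd x t - snd z t\<bar> \<le> sup_dist T (snd x) (snd y) + sup_dist T (snd y) (snd z)"
      using sup_dist_upper[OF t, of "snd x" "snd y"] sup_dist_upper[OF t, of "snd y" "snd z"] by linarith
  qed
  then show "dist_XD T x z \<le> dist_XD T x y + dist_XD T y z"
    using dist_triangle[of "fst x" "fst z" "fst y"] by (simp add: dist_XD_def)
qed

text \<open>The identity is an admissible time change, and below the cap the capped and the true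
  uniform distance agree. Hence continuity for the Skorokhod distance implies continuity for
  \<open>sup_dist\<close>.\<close>

lemma sk_dist_le_sup_dist:
  assumes T: "0 \<le> T" and "sup_dist T f g < 1"
  shows "sk_dist T f g \<le> sup_dist T f g"
  unfolding sk_dist_def
proof (rule cInf_lower)
  have "(\<lambda>t. t) \<in> time_changes T" by (auto simp: time_changes_def strict_mono_on_def intro: bij_betw_byWitness)
  moreover have "\<bar>f t - g t\<bar> \<le> sup_dist T f g" if "t \<in> {0..T}" for t
    using sup_dist_upper[OF that, of f g] assms(2) by (auto simp: min_def split: if_splits)
  ultimately show "sup_dist T f g \<in> {e. 0 \<le> e \<and> (\<exists>r\<in>time_changes T. \<forall>t\<in>{0..T}. \<bar>r t - t\<bar> \<le> e \<and> \<bar>f t - g (r t)\<bar> \<le> e)}"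
    using sup_dist_nonneg[OF T] by (auto intro!: bexI[of _ "\<lambda>t. t"])
  show "bdd_below {e. 0 \<le> e \<and> (\<exists>r\<in>time_changes T. \<forall>t\<in>{0..T}. \<bar>r t - t\<bar> \<le> e \<and> \<bar>f t - g (r t)\<bar> \<le> e)}"
    by (rule bdd_belowI[of _ 0]) auto
qed

lemma bcont_XD_imp_dcont:
  fixes h :: "'x::metric_space \<Rightarrow> (real \<Rightarrow> real) \<Rightarrow> real"
  assumes T: "0 \<le> T" and h: "bcont_XD T h"
  shows "dcont (XD T) (dist_XD T) (\<lambda>p. h (fst p) (snd p))"
  unfolding dcont_def
proof (intro ballI allI impI)
  fix p :: "'x \<times> (real \<Rightarrow> real)" and e assume p: "p \<in> XD T" and e: "0 < (e::real)"
  then have "snd p \<in> Dspace T" by auto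
  then obtain d where d: "d > 0" "\<And>y g. g \<in> Dspace T \<Longrightarrow> dist (fst p) y + sk_dist T (snd p) g < d \<Longrightarrow> \<bar>h (fst p) (snd p) - h y g\<bar> < e"
    using h e unfolding bcont_XD_def by meson
  show "\<exists>\<delta>>0. \<forall>q\<in>XD T. dist_XD T p q < \<delta> \<longrightarrow> \<bar>h (fst p) (snd p) - h (fst q) (snd q)\<bar> < e"
  proof (intro exI[of _ "min 1 d"] conjI ballI impI)
    fix q assume q: "q \<in> XD T" "dist_XD T p q < min 1 d"
    then have "dist_XD T p q < 1" by simp
    then have "sup_dist T (snd p) (snd q) < 1"
      unfolding dist_XD_def using zero_le_dist[of "fst p" "fst q"] by linarith
    from sk_dist_le_sup_dist[OF T this] q d(2)[of "snd q" "fst q"]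
    show "\<bar>h (fst p) (snd p) - h (fst q) (snd q)\<bar> < e" by (auto simp: dist_XD_def)
  qed (use d in simp)
qed

lemma floor_path_in_Dspace:
  fixes g :: "nat \<Rightarrow> real"
  assumes c: "0 \<le> c" and T: "0 < T"
  shows "(\<lambda>t. if t \<in> {0..T} then g (nat \<lfloor>c * t\<rfloor>) else 0) \<in> Dspace T" (is "?f \<in> _")
  unfolding Dspace_def
proof (intro CollectI conjI ballI allI impI)
  fix t assume t: "t \<in> {0..<T}"
  have "((\<lambda>s. c * s) \<longlongrightarrow> c * t) (at_right t)" by (intro tendsto_intros)
  then have "eventually (\<lambda>s. c * s < of_int \<lfloor>c * t\<rfloor> + 1) (at_right t)"
    by (rule order_tendstoD(2)) linarith
  moreover have "eventually (\<lambda>s. s \<in> {t<..<T}) (at_right t)" using t by (intro eventually_at_rightI[of t T]) auto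
  ultimately have "eventually (\<lambda>s. ?f s = ?f t) (at_right t)"
  proof eventually_elim
    case (elim s)
    have "c * t \<le> c * s" using elim c by (intro mult_left_mono) auto
    then have "\<lfloor>c * s\<rfloor> = \<lfloor>c * t\<rfloor>" using elim(1) by (intro floor_unique) linarith+
    then show ?case using elim t by auto
  qed
  then show "(?f \<longlongrightarrow> ?f t) (at_right t)" by (rule tendsto_eventually)
next
  fix t assume t: "t \<in> {0<..T}"
  have "((\<lambda>s. c * s) \<longlongrightarrow> c * t) (at_left t)" by (intro tendsto_intros)
  \<comment> \<open>Just left of t the floor equals the ceiling at t minus 1, whether or not t is a
    jump time.\<close>
  then have 1: "eventually (\<lambda>s. of_int \<lceil>c * t\<rceil> - 1 < c * s) (at_left t)"
    by (rule order_tendstoD(1)) linarith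
  have 2: "eventually (\<lambda>s. s \<in> {0<..<t}) (at_left t)" using t by (intro eventually_at_leftI[of 0]) auto
  show "\<exists>l. (?f \<longlongrightarrow> l) (at_left t)"
  proof (cases "c = 0")
    case True
    have "eventually (\<lambda>s. ?f s = g 0) (at_left t)" using 2 by eventually_elim (use t True in auto)
    then show ?thesis by (intro exI tendsto_eventually)
  next
    case False
    have "eventually (\<lambda>s. ?f s = g (nat (\<lceil>c * t\<rceil> - 1))) (at_left t)" using 1 2
    proof eventually_elim
      case (elim s)
      have "c * s < c * t" using elim c False by (intro mult_strict_left_mono) auto
      then have "\<lfloor>c * s\<rfloor> = \<lceil>c * t\<rceil> - 1" using elim(1) by (intro floor_unique) (simp, linarith)
      then show ?case using elim t by auto
    qed
    then show ?thesis by (intro exI tendsto_eventually)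
  qed
qed auto

text \<open>The route from continuity to measurability: the paths depend on finitely many
  coordinates, so the functional becomes continuous for the product topology on sequences, where
  measurability is checked coordinate by coordinate.\<close>

lemma path_functional_continuous:
  fixes h :: "'x::metric_space \<times> (real \<Rightarrow> real) \<Rightarrow> real" and P :: "(nat \<Rightarrow> real) \<Rightarrow> real \<Rightarrow> real"
  assumes T: "0 \<le> T" and h: "dcont (XD T) (dist_XD T) h" and D: "\<And>v. P v \<in> Dspace T" and J: "finite J"
    and P: "\<And>v w t. t \<in> {0..T} \<Longrightarrow> \<bar>P v t - P w t\<bar> \<le> (\<Sum>n\<in>J. \<bar>v n - w n\<bar>)"
  shows "continuous_on UNIV (\<lambda>p. h (fst p, P (snd p)))"
proof -
  have "isCont (\<lambda>p. h (fst p, P (snd p))) p" for p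
    unfolding isCont_def
  proof (rule tendstoI)
    fix e :: real assume e: "0 < e"
    have pD: "(fst p, P (snd p)) \<in> XD T" using D by auto
    obtain \<delta> where \<delta>: "\<delta> > 0" "\<And>q. q \<in> XD T \<Longrightarrow> dist_XD T (fst p, P (snd p)) q < \<delta> \<Longrightarrow> \<bar>h (fst p, P (snd p)) - h q\<bar> < e"
      using h[unfolded dcont_def, rule_format, OF pD e] by auto
    have "((\<lambda>q. dist (fst p) (fst q) + (\<Sum>n\<in>J. \<bar>snd p n - snd q n\<bar>)) \<longlongrightarrow> dist (fst p) (fst p) + (\<Sum>n\<in>J. \<bar>snd p n - snd p n\<bar>)) (at p)"
    proof (intro tendsto_intros)
      fix n
      have "continuous_on UNIV (\<lambda>q :: 'x \<times> (nat \<Rightarrow> real). snd q n)"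
        using continuous_on_compose2[OF continuous_on_product_coordinates[of n] continuous_on_snd[OF continuous_on_id]]
        by auto
      then have "isCont (\<lambda>q. snd q n) p" using continuous_on_eq_continuous_at[OF open_UNIV] by blast
      then show "((\<lambda>q. snd q n) \<longlongrightarrow> snd p n) (at p)" by (simp add: isCont_def)
    qed
    then have "eventually (\<lambda>q. dist (fst p) (fst q) + (\<Sum>n\<in>J. \<bar>snd p n - snd q n\<bar>) < \<delta>) (at p)"
      by (rule order_tendstoD(2)) (use \<delta> in simp)
    then show "eventually (\<lambda>q. dist (h (fst q, P (snd q))) (h (fst p, P (snd p))) < e) (at p)"
    proof eventually_elim
      case (elim q)
      have "sup_dist T (P (snd p)) (P (snd q)) \<le> (\<Sum>n\<in>J. \<bar>snd p n - snd q n\<bar>)" by (rule sup_dist_le[OF T P])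
      then have "dist_XD T (fst p, P (snd p)) (fst q, P (snd q)) < \<delta>" using elim by (simp add: dist_XD_def)
      from \<delta>(2)[OF _ this] D show ?case by (simp add: dist_real_def abs_minus_commute)
    qed
  qed
  then show ?thesis by (simp add: continuous_at_imp_continuous_on)
qed

text \<open>The step path on m cells whose value on a cell is the entry at its left end. Entry m is
  read only at t = T, which is the source of the separate case j = m in
  \<open>floor_grid\<close>.\<close>

definition eval_path :: "real \<Rightarrow> nat \<Rightarrow> (nat \<Rightarrow> real) \<Rightarrow> real \<Rightarrow> real" where
  "eval_path T m v = (\<lambda>t. if t \<in> {0..T} then v (nat \<lfloor>real m / T * t\<rfloor>) else 0)"

definition grid :: "real \<Rightarrow> nat \<Rightarrow> nat \<Rightarrow> real" where "grid T m i = real i * T / real m"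

lemma floor_grid:
  assumes T: "0 < T" and m: "0 < m" and t: "t \<in> {0..T}"
  defines "j \<equiv> nat \<lfloor>real m / T * t\<rfloor>"
  shows "j \<le> m" "grid T m j \<le> t" "t < grid T m (Suc j)" "j = m \<Longrightarrow> t = T"
proof -
  have p: "0 \<le> real m / T * t" using T m t by auto
  have "real m / T * t \<le> real m" using T t mult_left_le[of "t / T" "real m"] by (simp add: divide_le_eq_1 field_simps)
  moreover have j: "real j \<le> real m / T * t" unfolding j_def by (rule of_nat_floor[OF p])
  moreover have j2: "real m / T * t < real j + 1" unfolding j_def using p by linarith
  ultimately show jm: "j \<le> m" by linarith
  show "grid T m j \<le> t" using j T m by (simp add: grid_def field_simps)
  show "t < grid T m (Suc j)" using j2 T m by (simp add: grid_def field_simps)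
  show "j = m \<Longrightarrow> t = T" using j T m t by (simp add: field_simps)
qed

lemma eval_path_Dspace: "0 < T \<Longrightarrow> eval_path T m v \<in> Dspace T"
  unfolding eval_path_def by (rule floor_path_in_Dspace) auto

lemma eval_path_approx:
  assumes T: "0 < T" and f: "f \<in> cont_paths T" and e: "0 < e"
  shows "eventually (\<lambda>m. sup_dist T f (eval_path T m (\<lambda>j. f (grid T m j))) \<le> e) sequentially"
proof -
  have "uniformly_continuous_on {0..T} f"
    using f by (intro compact_uniformly_continuous) (auto simp: cont_paths_def)
  then obtain d where d: "d > 0" "\<And>s t. s \<in> {0..T} \<Longrightarrow> t \<in> {0..T} \<Longrightarrow> dist s t < d \<Longrightarrow> dist (f s) (f t) < e"
    using e unfolding uniformly_continuous_on_def by meson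
  obtain m0 :: nat where m0: "T / d < real m0" using reals_Archimedean2 by blast
  have "sup_dist T f (eval_path T m (\<lambda>j. f (grid T m j))) \<le> e" if m: "m \<ge> max 1 m0" for m
  proof (rule sup_dist_le)
    fix t assume t: "t \<in> {0..T}"
    have m1: "0 < m" using m by simp
    define j where "j = nat \<lfloor>real m / T * t\<rfloor>"
    note g = floor_grid[OF T m1 t, folded j_def]
    have "T / d < real m" using m0 m by (meson less_le_trans max.boundedE of_nat_mono)
    then have "T / real m < d" using d(1) m1 by (simp add: field_simps)
    moreover have "grid T m (Suc j) = grid T m j + T / real m" by (simp add: grid_def field_simps add_divide_distrib)
    ultimately have "dist t (grid T m j) < d" using g by (simp add: dist_real_def)
    moreover have "grid T m j \<in> {0..T}" using g t T by (auto simp: grid_def)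
    ultimately have "dist (f t) (f (grid T m j)) < e" using d(2)[OF t] by blast
    then show "\<bar>f t - eval_path T m (\<lambda>j. f (grid T m j)) t\<bar> \<le> e"
      using t by (simp add: eval_path_def dist_real_def j_def)
  qed (use T in auto)
  then show ?thesis unfolding eventually_sequentially by (intro exI[of _ "max 1 m0"]) auto
qed

lemma eval_path_functional_continuous:
  fixes h :: "'x::metric_space \<times> (real \<Rightarrow> real) \<Rightarrow> real"
  assumes T: "0 < T" and m: "0 < m" and h: "dcont (XD T) (dist_XD T) h"
  shows "continuous_on UNIV (\<lambda>p. h (fst p, eval_path T m (snd p)))"
proof (rule path_functional_continuous[where J="{..m}", OF _ h])
  fix v w :: "nat \<Rightarrow> real" and t assume t: "t \<in> {0..T}"
  show "\<bar>eval_path T m v t - eval_path T m w t\<bar> \<le> (\<Sum>n\<in>{..m}. \<bar>v n - w n\<bar>)"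
    using t floor_grid(1)[OF T m t] by (auto simp: eval_path_def intro!: member_le_sum)
qed (use T eval_path_Dspace in auto)

text \<open>A continuous path is the uniform limit of the step paths through its grid values, so
  \<open>h\<close> is a pointwise limit of continuous functions of finitely many evaluations. This
  uses that the space of \<gamma> consists of continuous paths; a path with jumps need not be such a
  limit.\<close>

lemma measurable_XD_functional:
  fixes h :: "'x::polish_space \<times> (real \<Rightarrow> real) \<Rightarrow> real"
  assumes T: "0 < T" and h: "dcont (XD T) (dist_XD T) h"
    and \<gamma>: "space \<gamma> = cont_paths T" "\<And>t. t \<in> {0..T} \<Longrightarrow> (\<lambda>f. f t) \<in> borel_measurable \<gamma>"
    and lam: "sets lam = sets borel"
  shows "h \<in> borel_measurable (lam \<Otimes>\<^sub>M \<gamma>)"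
proof (rule borel_measurable_LIMSEQ_real)
  \<comment> \<open>Grid points with j > Suc m lie beyond T, where evaluation is not among the
    measurable coordinates; the padding by 0 makes every coordinate measurable without changing the
    step path.\<close>
  let ?e = "\<lambda>m p. eval_path T (Suc m) (\<lambda>j. if j \<le> Suc m then snd p (grid T (Suc m) j) else 0)"
  note [measurable_cong] = lam
  have sp: "snd p \<in> cont_paths T" if "p \<in> space (lam \<Otimes>\<^sub>M \<gamma>)" for p
    using that unfolding space_pair_measure \<gamma>(1) mem_Times_iff by (rule conjunct2)
  fix p assume p: "p \<in> space (lam \<Otimes>\<^sub>M \<gamma>)"
  have eq: "?e m p = eval_path T (Suc m) (\<lambda>j. snd p (grid T (Suc m) j))" for m
    using floor_grid(1)[OF T, of "Suc m"] by (auto simp: eval_path_def fun_eq_iff)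
  show "(\<lambda>m. h (fst p, ?e m p)) \<longlonglongrightarrow> h p"
  proof (rule LIMSEQ_I)
    fix r :: real assume r: "0 < r"
    have pX: "p \<in> XD T" using sp[OF p] cont_paths_subset_Dspace by (cases p) auto
    obtain \<delta> where \<delta>: "\<delta> > 0" "\<And>q. q \<in> XD T \<Longrightarrow> dist_XD T p q < \<delta> \<Longrightarrow> \<bar>h p - h q\<bar> < r"
      using h[unfolded dcont_def, rule_format, OF pX r] by auto
    have "eventually (\<lambda>m. sup_dist T (snd p) (eval_path T m (\<lambda>j. snd p (grid T m j))) \<le> \<delta> / 2) sequentially"
      by (rule eval_path_approx[OF T sp[OF p]]) (use \<delta> in simp)
    then have "eventually (\<lambda>m. sup_dist T (snd p) (eval_path T (Suc m) (\<lambda>j. snd p (grid T (Suc m) j))) \<le> \<delta> / 2) sequentially"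
      by (rule eventually_compose_filterlim[OF _ filterlim_Suc])
    then have "eventually (\<lambda>m. norm (h (fst p, ?e m p) - h p) < r) sequentially"
    proof eventually_elim
      case (elim m)
      then have "dist_XD T p (fst p, ?e m p) < \<delta>" unfolding eq using \<delta>(1) by (simp add: dist_XD_def)
      from \<delta>(2)[OF _ this] show ?case using eval_path_Dspace[OF T] by (simp add: abs_minus_commute)
    qed
    then show "\<exists>no. \<forall>m\<ge>no. norm (h (fst p, ?e m p) - h p) < r" by (simp add: eventually_sequentially)
  qed
next
  fix m
  note [measurable_cong] = lam
  let ?v = "\<lambda>p :: 'x \<times> (real \<Rightarrow> real). (\<lambda>j. if j \<le> Suc m then snd p (grid T (Suc m) j) else 0)"
  have c: "(\<lambda>q. h (fst q, eval_path T (Suc m) (snd q))) \<in> borel_measurable borel"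
    by (intro borel_measurable_continuous_onI eval_path_functional_continuous[OF T _ h]) simp
  have v: "?v \<in> borel_measurable (lam \<Otimes>\<^sub>M \<gamma>)"
  proof (rule measurable_coordinatewise_then_product)
    fix j
    show "(\<lambda>p. ?v p j) \<in> borel_measurable (lam \<Otimes>\<^sub>M \<gamma>)"
    proof (cases "j \<le> Suc m")
      case True
      then have "grid T (Suc m) j \<in> {0..T}" using T by (auto simp: grid_def field_simps simp del: of_nat_Suc)
      from measurable_compose[OF measurable_snd \<gamma>(2)[OF this]] show ?thesis using True by simp
    qed simp
  qed
  have f: "fst \<in> borel_measurable (lam \<Otimes>\<^sub>M \<gamma>)" by measurable
  have "(\<lambda>p. (fst p, ?v p)) \<in> borel_measurable (lam \<Otimes>\<^sub>M \<gamma>)" by (rule borel_measurable_Pair[OF f v])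
  from measurable_compose[OF this c]
  show "(\<lambda>p. h (fst p, eval_path T (Suc m) (?v p))) \<in> borel_measurable (lam \<Otimes>\<^sub>M \<gamma>)" by simp
qed

section \<open>The functional limit theorem for bounded arrays\<close>

text \<open>Independence of the restricted families gives the product form; the restrictions are
  then mapped to zero-padded sequences, the format in which past increments are recorded.\<close>

lemma indep_vars_split_last:
  assumes "prob_space Q" and ind: "prob_space.indep_vars Q (\<lambda>_. borel) Y {..<Suc r}"
  shows "distr Q (borel \<Otimes>\<^sub>M borel) (\<lambda>x. ((\<lambda>j. if j < r then Y j x else 0 :: real), Y r x :: real))
     = distr Q borel (\<lambda>x. (\<lambda>j :: nat. if j < r then Y j x else 0)) \<Otimes>\<^sub>M distr Q borel (Y r)"
proof -
  interpret prob_space Q by fact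
  have "indep_var (PiM {..<r} (\<lambda>_. borel)) (\<lambda>x. restrict (\<lambda>i. Y i x) {..<r}) (PiM {r} (\<lambda>_. borel)) (\<lambda>x. restrict (\<lambda>i. Y i x) {r})"
    by (rule indep_var_restrict[OF ind]) auto
  then have J: "distr Q (PiM {..<r} (\<lambda>_. borel) \<Otimes>\<^sub>M PiM {r} (\<lambda>_. borel)) (\<lambda>x. (restrict (\<lambda>i. Y i x) {..<r}, restrict (\<lambda>i. Y i x) {r}))
      = distr Q (PiM {..<r} (\<lambda>_. borel)) (\<lambda>x. restrict (\<lambda>i. Y i x) {..<r}) \<Otimes>\<^sub>M distr Q (PiM {r} (\<lambda>_. borel)) (\<lambda>x. restrict (\<lambda>i. Y i x) {r})"
    and rv: "(\<lambda>x. restrict (\<lambda>i. Y i x) {..<r}) \<in> measurable Q (PiM {..<r} (\<lambda>_. borel))" "(\<lambda>x. restrict (\<lambda>i. Y i x) {r}) \<in> measurable Q (PiM {r} (\<lambda>_. borel))"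
    by (simp_all only: indep_var_distribution_eq)
  let ?f = "\<lambda>v j. if j < r then v j else 0 :: real" let ?g = "\<lambda>v. v r :: real"
  have f: "?f \<in> measurable (PiM {..<r} (\<lambda>_. borel)) (borel :: (nat \<Rightarrow> real) measure)"
  proof (rule measurable_coordinatewise_then_product)
    fix j
    show "(\<lambda>v. if j < r then v j else 0) \<in> borel_measurable (PiM {..<r} (\<lambda>_. borel :: real measure))"
      by (cases "j < r") auto
  qed
  have g: "?g \<in> measurable (PiM {r} (\<lambda>_. borel)) borel" by (rule measurable_component_singleton) simp
  have fQ: "distr (distr Q (PiM {..<r} (\<lambda>_. borel)) (\<lambda>x. restrict (\<lambda>i. Y i x) {..<r})) borel ?f = distr Q borel (\<lambda>x. (\<lambda>j. if j < r then Y j x else 0))"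
    unfolding distr_distr[OF f rv(1)] by (rule distr_cong) (auto simp: fun_eq_iff)
  have gQ: "distr (distr Q (PiM {r} (\<lambda>_. borel)) (\<lambda>x. restrict (\<lambda>i. Y i x) {r})) borel ?g = distr Q borel (Y r)"
    unfolding distr_distr[OF g rv(2)] by (rule distr_cong) auto
  have Yr: "Y r \<in> borel_measurable Q" using ind by (simp add: indep_vars_def)
  have fg: "(\<lambda>(v, w). (?f v, ?g w)) \<in> measurable (PiM {..<r} (\<lambda>_. borel) \<Otimes>\<^sub>M PiM {r} (\<lambda>_. borel)) (borel \<Otimes>\<^sub>M borel)"
    unfolding split_beta'
    by (intro measurable_Pair measurable_compose[OF measurable_fst f] measurable_compose[OF measurable_snd g])
  have "distr Q (borel \<Otimes>\<^sub>M borel) (\<lambda>x. ((\<lambda>j. if j < r then Y j x else 0), Y r x))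
     = distr (distr Q (PiM {..<r} (\<lambda>_. borel) \<Otimes>\<^sub>M PiM {r} (\<lambda>_. borel)) (\<lambda>x. (restrict (\<lambda>i. Y i x) {..<r}, restrict (\<lambda>i. Y i x) {r})))
        (borel \<Otimes>\<^sub>M borel) (\<lambda>(v, w). (?f v, ?g w))"
    by (subst distr_distr[OF fg measurable_Pair[OF rv]]) (auto simp: fun_eq_iff intro!: distr_cong)
  also have "\<dots> = distr Q borel (\<lambda>x. (\<lambda>j. if j < r then Y j x else 0)) \<Otimes>\<^sub>M distr Q borel (Y r)"
  proof -
    have "sigma_finite_measure (distr Q borel (Y r))"
      by (intro prob_space_imp_sigma_finite prob_space_distr Yr)
    then have "distr (distr Q (PiM {..<r} (\<lambda>_. borel)) (\<lambda>x. restrict (\<lambda>i. Y i x) {..<r})) borel ?f \<Otimes>\<^sub>M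
         distr (distr Q (PiM {r} (\<lambda>_. borel)) (\<lambda>x. restrict (\<lambda>i. Y i x) {r})) borel ?g
       = distr (distr Q (PiM {..<r} (\<lambda>_. borel)) (\<lambda>x. restrict (\<lambda>i. Y i x) {..<r}) \<Otimes>\<^sub>M distr Q (PiM {r} (\<lambda>_. borel)) (\<lambda>x. restrict (\<lambda>i. Y i x) {r}))
        (borel \<Otimes>\<^sub>M borel) (\<lambda>(v, w). (?f v, ?g w))"
      by (intro pair_measure_distr) (use f g gQ in \<open>simp_all\<close>)
    then show ?thesis unfolding J fQ gQ by simp
  qed
  finally show ?thesis .
qed

definition inc_path :: "real \<Rightarrow> nat \<Rightarrow> (nat \<Rightarrow> real) \<Rightarrow> real \<Rightarrow> real" where
  "inc_path T m v = eval_path T m (\<lambda>j. \<Sum>i<j. v i)"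

lemma inc_path_functional_continuous:
  fixes h :: "'x::metric_space \<times> (real \<Rightarrow> real) \<Rightarrow> real"
  assumes T: "0 < T" and m: "0 < m" and h: "dcont (XD T) (dist_XD T) h"
  shows "continuous_on UNIV (\<lambda>p. h (fst p, inc_path T m (snd p)))"
proof (rule path_functional_continuous[where J="{..<m}", OF _ h])
  fix v w :: "nat \<Rightarrow> real" and t assume t: "t \<in> {0..T}"
  let ?j = "nat \<lfloor>real m / T * t\<rfloor>"
  have "\<bar>inc_path T m v t - inc_path T m w t\<bar> = \<bar>\<Sum>i<?j. v i - w i\<bar>"
    using t by (simp add: inc_path_def eval_path_def sum_subtractf)
  also have "\<dots> \<le> (\<Sum>i<?j. \<bar>v i - w i\<bar>)" by (rule sum_abs)
  also have "\<dots> \<le> (\<Sum>i<m. \<bar>v i - w i\<bar>)"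
    by (rule sum_mono2) (use floor_grid(1)[OF T m t] in auto)
  finally show "\<bar>inc_path T m v t - inc_path T m w t\<bar> \<le> (\<Sum>n\<in>{..<m}. \<bar>v n - w n\<bar>)" .
qed (use T in \<open>auto simp: inc_path_def eval_path_Dspace\<close>)

lemma gaussian_law_eval_measurable:
  assumes "gaussian_ii_law T V \<gamma>" "space \<gamma> = cont_paths T" "t \<in> {0..T}"
  shows "(\<lambda>f. f t) \<in> borel_measurable \<gamma>"
proof -
  have "sets \<gamma> = sets (path_algebra T)" using assms by (simp add: gaussian_ii_law_def sets_path_algebra)
  then show ?thesis using eval_measurable[OF assms(3)] by (simp cong: measurable_cong_sets)
qed

text \<open>Hypotheses are stated for every row, so an array starting at row 1 is fed in with
  shifted index; for this the time scale \<open>c N\<close> is separate from N. \<open>C\<close> is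
  a Lipschitz constant of the limiting variance, used to make all blocks of a grid small
  together.\<close>

locale bounded_mds_array =
  fixes M :: "nat \<Rightarrow> 'a measure" and G :: "nat \<Rightarrow> nat \<Rightarrow> 'a measure" and X :: "nat \<Rightarrow> nat \<Rightarrow> 'a \<Rightarrow> real"
    and a c :: "nat \<Rightarrow> real" and k :: "nat \<Rightarrow> nat" and T C :: real and V :: "real \<Rightarrow> real"
    and F :: "nat \<Rightarrow> 'a \<Rightarrow> 'x::polish_space" and lam :: "'x measure" and \<gamma> :: "(real \<Rightarrow> real) measure"
  assumes prob: "\<And>N. prob_space (M N)" and filt: "\<And>N. filtration_on (M N) (G N)"
    and mds: "\<And>N. mds (M N) (G N) (X N)"
    and bound: "\<And>N n x. x \<in> space (M N) \<Longrightarrow> \<bar>X N n x\<bar> \<le> a N" and a0: "a \<longlonglongrightarrow> 0"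
    and T: "0 < T" and c: "\<And>N. 0 \<le> c N" and C: "0 < C"
    and Q: "\<And>t. t \<in> {0..T} \<Longrightarrow> (\<lambda>N. \<integral>x. \<bar>(\<Sum>n\<in>{Suc (k N)..k N + nat \<lfloor>c N * t\<rfloor>}. (X N n x)\<^sup>2) - V t\<bar> \<partial>M N) \<longlonglongrightarrow> 0"
    and V: "\<And>s t. 0 \<le> s \<Longrightarrow> s \<le> t \<Longrightarrow> t \<le> T \<Longrightarrow> 0 \<le> V t - V s" "\<And>s t. 0 \<le> s \<Longrightarrow> s \<le> t \<Longrightarrow> t \<le> T \<Longrightarrow> V t - V s \<le> C * (t - s)"
    and F: "\<And>N. F N \<in> measurable (G N (k N)) borel"
    and lam: "prob_space lam" "sets lam = sets borel"
    and weak: "\<And>(g :: 'x \<Rightarrow> real) B. continuous_on UNIV g \<Longrightarrow> (\<And>x. \<bar>g x\<bar> \<le> B) \<Longrightarrow> (\<lambda>N. \<integral>x. g (F N x) \<partial>M N) \<longlonglongrightarrow> (\<integral>x. g x \<partial>lam)"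
    and \<gamma>: "gaussian_ii_law T V \<gamma>" "space \<gamma> = cont_paths T"
begin

definition "idx N t = k N + nat \<lfloor>c N * t\<rfloor>"
definition "S N x = (\<lambda>t. if t \<in> {0..T} then \<Sum>n\<in>{Suc (k N)..idx N t}. X N n x else 0)"

lemma idx_mono: "s \<le> t \<Longrightarrow> idx N s \<le> idx N t"
  unfolding idx_def using c by (intro add_left_mono nat_mono floor_mono mult_left_mono) auto

lemma k_le_idx: "k N \<le> idx N t" by (simp add: idx_def)

sublocale P: prob_space "M N" for N by (rule prob)
sublocale lam: prob_space lam by (rule lam)
sublocale \<gamma>: prob_space \<gamma> using \<gamma>(1) by (simp add: gaussian_ii_law_def)
sublocale lg: pair_prob_space lam \<gamma> ..

lemma X_measurable: "X N (Suc n) \<in> borel_measurable (M N)"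
  using mdsD(2)[OF mds] by auto

lemma sum_measurable:
  assumes "g \<in> borel_measurable borel" "r \<le> r'"
  shows "(\<lambda>x. \<Sum>n\<in>{Suc l..r}. (g (X N n x)::real)) \<in> borel_measurable (G N r')"
  by (rule filtration_sum_measurable[OF filt mds assms])

lemma sum_measurable_M: "(\<lambda>x. \<Sum>n\<in>{Suc l..r}. X N n x) \<in> borel_measurable (M N)"
  "(\<lambda>x. \<Sum>n\<in>{Suc l..r}. (X N n x)\<^sup>2) \<in> borel_measurable (M N)"
proof -
  have *: "(\<lambda>x. \<Sum>n\<in>{Suc l..r}. X N n x) \<in> borel_measurable (G N r)"
    "(\<lambda>x. \<Sum>n\<in>{Suc l..r}. (X N n x)\<^sup>2) \<in> borel_measurable (G N r)"
    by (rule sum_measurable[of "\<lambda>x. x"]; simp) (rule sum_measurable[of "\<lambda>x. x\<^sup>2"]; simp)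
  show "(\<lambda>x. \<Sum>n\<in>{Suc l..r}. X N n x) \<in> borel_measurable (M N)"
    "(\<lambda>x. \<Sum>n\<in>{Suc l..r}. (X N n x)\<^sup>2) \<in> borel_measurable (M N)"
    by (rule filtration_measurable(1)[OF filt *(1)] filtration_measurable(1)[OF filt *(2)])+
qed

lemma eval_meas: "t \<in> {0..T} \<Longrightarrow> (\<lambda>f. f t) \<in> borel_measurable \<gamma>"
  by (rule gaussian_law_eval_measurable[OF \<gamma>])

lemma sum_sq_integrable: "integrable (M N) (\<lambda>x. \<Sum>n\<in>{Suc l..r}. (X N n x)\<^sup>2)"
proof (rule P.integrable_const_bound[where B="\<Sum>n\<in>{Suc l..r}. (a N)\<^sup>2"])
  show "AE x in M N. norm (\<Sum>n\<in>{Suc l..r}. (X N n x)\<^sup>2) \<le> (\<Sum>n\<in>{Suc l..r}. (a N)\<^sup>2)"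
  proof (rule AE_I2)
    fix x assume x: "x \<in> space (M N)"
    have "(X N n x)\<^sup>2 \<le> (a N)\<^sup>2" for n
      using bound[OF x, of n] by (subst abs_le_square_iff[symmetric]) linarith
    then have "(\<Sum>n\<in>{Suc l..r}. (X N n x)\<^sup>2) \<le> (\<Sum>n\<in>{Suc l..r}. (a N)\<^sup>2)" by (rule sum_mono)
    then show "norm (\<Sum>n\<in>{Suc l..r}. (X N n x)\<^sup>2) \<le> (\<Sum>n\<in>{Suc l..r}. (a N)\<^sup>2)"
      by (simp add: sum_nonneg)
  qed
qed (rule sum_measurable_M)

lemma sum_split: "l \<le> m \<Longrightarrow> m \<le> r \<Longrightarrow> (\<Sum>n\<in>{Suc l..r}. f n) = (\<Sum>n\<in>{Suc l..m}. f n) + (\<Sum>n\<in>{Suc m..r}. f n :: real)"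
  by (subst sum.union_disjoint[symmetric]) (auto intro!: sum.cong)

lemma block_variation:
  assumes st: "0 \<le> s" "s \<le> t" "t \<le> T"
  shows "(\<lambda>N. \<integral>x. \<bar>(\<Sum>n\<in>{Suc (idx N s)..idx N t}. (X N n x)\<^sup>2) - (V t - V s)\<bar> \<partial>M N) \<longlonglongrightarrow> 0"
proof (rule Lim_null_comparison)
  let ?q = "\<lambda>N t x. \<bar>(\<Sum>n\<in>{Suc (k N)..idx N t}. (X N n x)\<^sup>2) - V t\<bar>"
  show "(\<lambda>N. (\<integral>x. ?q N t x \<partial>M N) + (\<integral>x. ?q N s x \<partial>M N)) \<longlonglongrightarrow> 0"
    by (rule tendsto_add_zero; unfold idx_def, rule Q) (use st in auto)
  show "\<forall>\<^sub>F N in sequentially. norm (\<integral>x. \<bar>(\<Sum>n\<in>{Suc (idx N s)..idx N t}. (X N n x)\<^sup>2) - (V t - V s)\<bar> \<partial>M N)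
     \<le> (\<integral>x. ?q N t x \<partial>M N) + (\<integral>x. ?q N s x \<partial>M N)"
  proof (intro always_eventually allI)
    fix N
    have i: "integrable (M N) (?q N t)" for t using sum_sq_integrable by auto
    have "norm (\<integral>x. \<bar>(\<Sum>n\<in>{Suc (idx N s)..idx N t}. (X N n x)\<^sup>2) - (V t - V s)\<bar> \<partial>M N) \<le> (\<integral>x. ?q N t x + ?q N s x \<partial>M N)"
    proof (rule norm_integral_le)
      fix x
      show "norm \<bar>(\<Sum>n\<in>{Suc (idx N s)..idx N t}. (X N n x)\<^sup>2) - (V t - V s)\<bar> \<le> ?q N t x + ?q N s x"
        using sum_split[OF k_le_idx[of N s] idx_mono[OF st(2)], of "\<lambda>n. (X N n x)\<^sup>2"] by simp
    qed (use sum_sq_integrable i in auto)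
    then show "norm (\<integral>x. \<bar>(\<Sum>n\<in>{Suc (idx N s)..idx N t}. (X N n x)\<^sup>2) - (V t - V s)\<bar> \<partial>M N)
     \<le> (\<integral>x. ?q N t x \<partial>M N) + (\<integral>x. ?q N s x \<partial>M N)" using i by simp
  qed
qed

definition "inc m N j x = (\<Sum>n\<in>{Suc (idx N (grid T m j))..idx N (grid T m (Suc j))}. X N n x)"
text \<open>Padding with zeros gives increment vectors of every length the same type, so the
  induction over the blocks runs in one space.\<close>

definition "incs m N r x = (\<lambda>j. if j < r then inc m N j x else 0)"
definition "gincs m r f = (\<lambda>j. if j < r then f (grid T m (Suc j)) - f (grid T m j) else (0::real))"

lemma grid_bounds: "i \<le> m \<Longrightarrow> 0 < m \<Longrightarrow> grid T m i \<in> {0..T}" "grid T m i \<le> grid T m (Suc i)" "grid T m 0 = 0"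
  using T by (auto simp: grid_def divide_le_eq mult.commute mult_left_mono intro!: divide_right_mono)

lemma incs_measurable:
  assumes "r \<le> m"
  shows "incs m N r \<in> borel_measurable (G N (idx N (grid T m r)))"
  unfolding incs_def[abs_def]
proof (rule measurable_coordinatewise_then_product)
  fix j
  show "(\<lambda>x. if j < r then inc m N j x else 0) \<in> borel_measurable (G N (idx N (grid T m r)))"
  proof (cases "j < r")
    case True
    have "grid T m (Suc j) \<le> grid T m r" using True T by (auto simp: grid_def intro!: divide_right_mono mult_right_mono)
    from sum_measurable[of "\<lambda>x. x", OF _ idx_mono[OF this]] True show ?thesis by (simp add: inc_def)
  qed simp
qed

text \<open>Both error terms of \<open>mds_char_bound\<close> vanish: the variation of the block
  converges in L1 and the bound \<open>a N\<close> tends to 0. The weight may be anything known at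
  the start of the block.\<close>

lemma char_block:
  assumes r: "r < m" and g: "\<And>N. u N \<in> borel_measurable (G N (idx N (grid T m r)))" "\<And>N x. \<bar>u N x\<bar> \<le> 1"
  shows "(\<lambda>N. (\<integral>x. complex_of_real (u N x) * iexp (t * inc m N r x) \<partial>M N)
     - char (gauss_measure (V (grid T m (Suc r)) - V (grid T m r))) t * (\<integral>x. u N x \<partial>M N)) \<longlonglongrightarrow> 0"
proof -
  let ?s = "V (grid T m (Suc r)) - V (grid T m r)"
  have m: "0 < m" using r by simp
  have gb: "0 \<le> grid T m r" "grid T m r \<le> grid T m (Suc r)" "grid T m (Suc r) \<le> T"
    using grid_bounds(1)[of r m] grid_bounds(1)[of "Suc r" m] grid_bounds(2)[of m r] r by auto
  have s0: "0 \<le> ?s" by (rule V(1)[OF gb])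
  let ?q = "\<lambda>N. \<integral>x. \<bar>(\<Sum>n\<in>{Suc (idx N (grid T m r))..idx N (grid T m (Suc r))}. (X N n x)\<^sup>2) - ?s\<bar> \<partial>M N"
  let ?K = "2 + t\<^sup>2 / 2 * exp (t\<^sup>2 * (?s + 2) / 2)" let ?L = "5 * \<bar>t\<bar> ^ 3 * exp (t\<^sup>2 / 2 * (?s + 2)) * (?s + 2)"
  have e1: "eventually (\<lambda>N. a N < 1) sequentially" by (rule order_tendstoD(2)[OF a0]) simp
  have "(\<lambda>N. \<bar>t\<bar> * a N) \<longlonglongrightarrow> \<bar>t\<bar> * 0" by (intro tendsto_intros a0)
  then have e2: "eventually (\<lambda>N. \<bar>t\<bar> * a N < 1) sequentially" by (rule order_tendstoD(2)) simp
  show ?thesis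
  proof (rule Lim_null_comparison)
    have "(\<lambda>N. ?K * ?q N + ?L * a N) \<longlonglongrightarrow> ?K * 0 + ?L * 0"
      by (intro tendsto_intros a0 block_variation gb)
    then show "(\<lambda>N. ?K * ?q N + ?L * a N) \<longlonglongrightarrow> 0" by simp
    show "\<forall>\<^sub>F N in sequentially. norm ((\<integral>x. complex_of_real (u N x) * iexp (t * inc m N r x) \<partial>M N)
     - char (gauss_measure ?s) t * (\<integral>x. u N x \<partial>M N)) \<le> ?K * ?q N + ?L * a N"
      using e1 e2
    proof eventually_elim
      case (elim N)
      show ?case
        unfolding char_gauss[OF s0] inc_def
        using P.mds_char_bound[OF filt mds bound _ _ g(1) g(2) idx_mono[OF gb(2)] s0, of N t] elim by simp
    qed
  qed
qed

text \<open>Induction over the blocks: \<open>F\<close> with the first r increments is the past, to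
  which \<open>weak_convergence_append\<close> adds the next increment. The base case is the weak
  convergence of \<open>F\<close>; the limit law is recognised by the independent increments of
  \<gamma>.\<close>

lemma fdd_convergence:
  fixes \<phi> :: "'x \<times> (nat \<Rightarrow> real) \<Rightarrow> real"
  assumes m: "0 < m" and "r \<le> m" and "continuous_on UNIV \<phi>" "\<And>p. \<bar>\<phi> p\<bar> \<le> B"
  shows "(\<lambda>N. \<integral>x. \<phi> (F N x, incs m N r x) \<partial>M N) \<longlonglongrightarrow> (\<integral>p. \<phi> (fst p, gincs m r (snd p)) \<partial>(lam \<Otimes>\<^sub>M \<gamma>))"
  using assms(2-)
proof (induction r arbitrary: \<phi> B)
  case 0
  have z: "incs m N 0 x = (\<lambda>_. 0)" "gincs m 0 f = (\<lambda>_. 0)" for N x f by (auto simp: incs_def gincs_def)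
  have cy: "continuous_on UNIV (\<lambda>z. \<phi> (z, \<lambda>_. 0))"
    by (rule continuous_on_compose2[OF 0(2)]) (auto intro!: continuous_intros)
  have mf: "(\<lambda>z. \<phi> (z, \<lambda>_. 0)) \<in> borel_measurable lam"
    using borel_measurable_continuous_onI[OF cy] lam(2) by (simp cong: measurable_cong_sets)
  have "integrable (lam \<Otimes>\<^sub>M \<gamma>) (\<lambda>p. \<phi> (fst p, \<lambda>_. 0))"
    by (rule lg.integrable_const_bound[where B=B]) (use 0(3) measurable_compose[OF measurable_fst mf] in auto)
  from lg.integral_fst'[OF this] have "(\<integral>p. \<phi> (fst p, \<lambda>_. 0) \<partial>(lam \<Otimes>\<^sub>M \<gamma>)) = (\<integral>z. \<phi> (z, \<lambda>_. 0) \<partial>lam)"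
    by (simp add: \<gamma>.prob_space)
  moreover have "(\<lambda>N. \<integral>x. \<phi> (F N x, \<lambda>_. 0) \<partial>M N) \<longlonglongrightarrow> (\<integral>z. \<phi> (z, \<lambda>_. 0) \<partial>lam)"
    by (rule weak[OF cy, of B]) (rule 0(3))
  ultimately show ?case unfolding z by simp
next
  case (Suc r)
  note [measurable_cong] = lam(2)
  have r: "r < m" and r': "r \<le> m" using Suc by auto
  let ?Z = "\<lambda>N x. (F N x, incs m N r x)"
  let ?v = "V (grid T m (Suc r)) - V (grid T m r)"
  let ?\<nu> = "gauss_measure ?v"
  interpret \<nu>: real_distribution ?\<nu> by (rule real_distribution_gauss)
  let ?d = "\<lambda>f. f (grid T m (Suc r)) - f (grid T m r)"
  have em: "i \<le> m \<Longrightarrow> (\<lambda>f. f (grid T m i)) \<in> borel_measurable \<gamma>" for i using eval_meas grid_bounds(1)[OF _ m] by auto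
  have dm: "?d \<in> borel_measurable \<gamma>" using em[of r] em[of "Suc r"] r by auto
  have gm: "gincs m r \<in> borel_measurable \<gamma>" unfolding gincs_def[abs_def]
  proof (rule measurable_coordinatewise_then_product)
    fix j
    show "(\<lambda>f. if j < r then f (grid T m (Suc j)) - f (grid T m j) else 0) \<in> borel_measurable \<gamma>"
      using em[of j] em[of "Suc j"] r by (cases "j < r") auto
  qed
  define pr where "pr p = (fst p, gincs m r (snd p))" for p :: "'x \<times> (real \<Rightarrow> real)"
  have prm: "pr \<in> borel_measurable (lam \<Otimes>\<^sub>M \<gamma>)" unfolding pr_def[abs_def]
    by (rule borel_measurable_Pair[OF _ measurable_compose[OF measurable_snd gm]]) measurable
  define \<mu> where "\<mu> = distr (lam \<Otimes>\<^sub>M \<gamma>) borel pr"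
  have \<mu>p: "prob_space \<mu>" unfolding \<mu>_def by (rule lg.prob_space_distr[OF prm])
  have \<mu>s: "sets \<mu> = sets borel" by (simp add: \<mu>_def)
  interpret \<mu>: prob_space \<mu> by fact
  interpret mn: pair_prob_space \<mu> ?\<nu> ..
  interpret gn: pair_prob_space "\<gamma>" ?\<nu> ..
  have Zm: "?Z N \<in> borel_measurable (G N (idx N (grid T m r)))" for N
    by (rule borel_measurable_Pair[OF filtration_measurable(2)[OF filt F k_le_idx] incs_measurable[OF r']])
  have ZM: "?Z N \<in> borel_measurable (M N)" for N by (rule filtration_measurable(1)[OF filt Zm])
  have DM: "inc m N r \<in> borel_measurable (M N)" for N unfolding inc_def[abs_def] by (rule sum_measurable_M)
  \<comment> \<open>Overwrites the padding zero at position r by the new increment, turning a pair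
    back into one vector.\<close>
  define \<psi> where "\<psi> q = \<phi> (fst (fst q), (snd (fst q))(r := snd q))" for q
  have c\<psi>: "continuous_on UNIV \<psi>"
    unfolding \<psi>_def
  proof (rule continuous_on_compose2[OF Suc.prems(2)])
    show "continuous_on UNIV (\<lambda>q :: ('x \<times> (nat \<Rightarrow> real)) \<times> real. (fst (fst q), (snd (fst q))(r := snd q)))"
    proof (intro continuous_on_Pair continuous_on_coordinatewise_then_product)
      fix i
      have "continuous_on UNIV (\<lambda>q :: ('x \<times> (nat \<Rightarrow> real)) \<times> real. snd (fst q) i)"
        using continuous_on_compose2[OF continuous_on_product_coordinates[of i] continuous_on_snd[OF continuous_on_fst[OF continuous_on_id]]] by auto
      then show "continuous_on UNIV (\<lambda>q :: ('x \<times> (nat \<Rightarrow> real)) \<times> real. ((snd (fst q))(r := snd q)) i)"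
        by (cases "i = r") (auto intro!: continuous_intros)
    qed (intro continuous_intros)
  qed auto
  have \<psi>m: "\<psi> \<in> borel_measurable borel" by (rule borel_measurable_continuous_onI[OF c\<psi>])
  have "(\<lambda>N. \<integral>x. \<psi> (?Z N x, inc m N r x) \<partial>M N) \<longlonglongrightarrow> (\<integral>q. \<psi> q \<partial>(\<mu> \<Otimes>\<^sub>M ?\<nu>))"
  proof (rule weak_convergence_append[OF prob DM ZM \<mu>p \<mu>s real_distribution_gauss _ _ c\<psi>])
    fix g :: "'x \<times> (nat \<Rightarrow> real) \<Rightarrow> real" and B assume g: "continuous_on UNIV g" "\<And>z. \<bar>g z\<bar> \<le> B"
    have "(\<integral>z. g z \<partial>\<mu>) = (\<integral>p. g (fst p, gincs m r (snd p)) \<partial>(lam \<Otimes>\<^sub>M \<gamma>))"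
      unfolding \<mu>_def by (subst integral_distr[OF prm borel_measurable_continuous_onI[OF g(1)]]) (simp add: pr_def)
    then show "(\<lambda>N. \<integral>x. g (?Z N x) \<partial>M N) \<longlonglongrightarrow> (\<integral>z. g z \<partial>\<mu>)"
      using Suc.IH[of g B, OF r' g(1)] g(2) by simp
  next
    fix g :: "'x \<times> (nat \<Rightarrow> real) \<Rightarrow> real" and t assume g: "continuous_on UNIV g" "\<And>z. \<bar>g z\<bar> \<le> 1"
    show "(\<lambda>N. (\<integral>x. complex_of_real (g (?Z N x)) * iexp (t * inc m N r x) \<partial>M N) - char ?\<nu> t * (\<integral>x. g (?Z N x) \<partial>M N)) \<longlonglongrightarrow> 0"
      by (rule char_block[OF r]) (use g measurable_compose[OF Zm borel_measurable_continuous_onI[OF g(1)]] in auto)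
  qed (use Suc.prems(3) in \<open>simp add: \<psi>_def\<close>)
  moreover have "\<psi> (?Z N x, inc m N r x) = \<phi> (F N x, incs m N (Suc r) x)" for N x
  proof -
    have "(incs m N r x)(r := inc m N r x) = incs m N (Suc r) x" by (auto simp: incs_def fun_eq_iff less_Suc_eq)
    then show ?thesis by (simp add: \<psi>_def)
  qed
  moreover have "(\<integral>q. \<psi> q \<partial>(\<mu> \<Otimes>\<^sub>M ?\<nu>)) = (\<integral>p. \<phi> (fst p, gincs m (Suc r) (snd p)) \<partial>(lam \<Otimes>\<^sub>M \<gamma>))"
  proof -
    have \<psi>b: "\<bar>\<psi> q\<bar> \<le> B" for q using Suc.prems(3) by (simp add: \<psi>_def)
    have setseq: "sets (\<mu> \<Otimes>\<^sub>M ?\<nu>) = sets (borel :: (('x \<times> (nat \<Rightarrow> real)) \<times> real) measure)"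
      using sets_pair_measure_cong[OF \<mu>s \<nu>.events_eq_borel] by (metis borel_prod)
    have \<psi>m2: "\<psi> \<in> borel_measurable (\<mu> \<Otimes>\<^sub>M ?\<nu>)" using \<psi>m setseq by (simp cong: measurable_cong_sets)
    have i1: "integrable (\<mu> \<Otimes>\<^sub>M ?\<nu>) \<psi>"
      by (rule mn.integrable_const_bound[where B=B]) (use \<psi>b \<psi>m2 in auto)
    have \<psi>z: "(\<lambda>y. \<psi> (z, y)) \<in> borel_measurable borel" for z
      by (rule measurable_compose[OF _ \<psi>m]) (rule borel_measurable_Pair, auto)
    have inner: "(\<lambda>z. \<integral>y. \<psi> (z, y) \<partial>?\<nu>) \<in> borel_measurable borel"
    proof -
      have "(\<lambda>z. \<integral>y. \<psi> (z, y) \<partial>?\<nu>) \<in> borel_measurable \<mu>"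
        by (rule \<nu>.borel_measurable_lebesgue_integral) (use \<psi>m2 in simp)
      then show ?thesis using \<mu>s by (simp cong: measurable_cong_sets)
    qed
    have "(\<integral>q. \<psi> q \<partial>(\<mu> \<Otimes>\<^sub>M ?\<nu>)) = (\<integral>z. (\<integral>y. \<psi> (z, y) \<partial>?\<nu>) \<partial>\<mu>)" using mn.integral_fst'[OF i1] by simp
    also have "\<dots> = (\<integral>p. (\<integral>y. \<psi> (pr p, y) \<partial>?\<nu>) \<partial>(lam \<Otimes>\<^sub>M \<gamma>))"
      unfolding \<mu>_def by (rule integral_distr[OF prm inner])
    also have "\<dots> = (\<integral>x. (\<integral>f. (\<integral>y. \<psi> ((x, gincs m r f), y) \<partial>?\<nu>) \<partial>\<gamma>) \<partial>lam)"
    proof -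
      have ib: "\<bar>\<integral>y. \<psi> (z, y) \<partial>?\<nu>\<bar> \<le> B" for z
      proof -
        have iz: "integrable ?\<nu> (\<lambda>y. \<psi> (z, y))"
        proof (rule \<nu>.integrable_const_bound[where B=B])
          show "AE y in ?\<nu>. norm (\<psi> (z, y)) \<le> B"
            by (rule AE_I2) (unfold real_norm_def, rule \<psi>b)
        qed (use \<psi>z[of z] in simp)
        have "norm (\<integral>y. \<psi> (z, y) \<partial>?\<nu>) \<le> (\<integral>y. B \<partial>?\<nu>)"
          by (rule norm_integral_le[OF iz]) (simp, unfold real_norm_def, rule \<psi>b)
        then show ?thesis using \<nu>.prob_space by simp
      qed
      have "integrable (lam \<Otimes>\<^sub>M \<gamma>) (\<lambda>p. \<integral>y. \<psi> (pr p, y) \<partial>?\<nu>)"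
        by (rule lg.integrable_const_bound[where B=B]) (use ib measurable_compose[OF prm inner] in auto)
      from lg.integral_fst'[OF this] show ?thesis by (simp add: pr_def)
    qed
    also have "\<dots> = (\<integral>x. (\<integral>f. \<psi> ((x, gincs m r f), ?d f) \<partial>\<gamma>) \<partial>lam)"
    proof (rule Bochner_Integration.integral_cong[OF refl])
      fix x
      let ?gi = "distr \<gamma> borel (gincs m r)"
      interpret gi: prob_space ?gi by (rule \<gamma>.prob_space_distr[OF gm])
      interpret gin: pair_prob_space ?gi ?\<nu> ..
      define \<rho> where "\<rho> q = \<psi> ((x, fst q), snd q)" for q
      have \<rho>m: "\<rho> \<in> borel_measurable borel" unfolding \<rho>_def
        by (rule measurable_compose[OF _ \<psi>m]) (intro borel_measurable_Pair borel_measurable_const borel_measurable_continuous_onI continuous_intros)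
      have sq: "sets (?gi \<Otimes>\<^sub>M ?\<nu>) = sets (borel :: ((nat \<Rightarrow> real) \<times> real) measure)"
        using sets_pair_measure_cong[of ?gi borel ?\<nu> borel] by (metis borel_prod sets_distr \<nu>.events_eq_borel)
      have \<rho>m2: "\<rho> \<in> borel_measurable (?gi \<Otimes>\<^sub>M ?\<nu>)" using \<rho>m sq by (simp cong: measurable_cong_sets)
      have \<rho>b: "\<bar>\<rho> q\<bar> \<le> B" for q using \<psi>b by (simp add: \<rho>_def)
      have i\<rho>: "integrable (?gi \<Otimes>\<^sub>M ?\<nu>) \<rho>" by (rule gin.integrable_const_bound[where B=B]) (use \<rho>b \<rho>m2 in auto)
      have \<rho>in: "(\<lambda>v. \<integral>y. \<rho> (v, y) \<partial>?\<nu>) \<in> borel_measurable borel"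
      proof -
        have "(\<lambda>v. \<integral>y. \<rho> (v, y) \<partial>?\<nu>) \<in> borel_measurable ?gi"
          by (rule \<nu>.borel_measurable_lebesgue_integral) (use \<rho>m2 in simp)
        then show ?thesis by simp
      qed
      have dd: "distr \<gamma> borel ?d = ?\<nu>"
      proof -
        have gb: "0 \<le> grid T m r" "grid T m r \<le> grid T m (Suc r)" "grid T m (Suc r) \<le> T"
          using grid_bounds(1)[of r m] grid_bounds(1)[of "Suc r" m] grid_bounds(2)[of m r] r by auto
        then have "centered_gaussian \<gamma> ?d ?v" using \<gamma>(1) unfolding gaussian_ii_law_def by blast
        then show ?thesis by (rule centered_gaussianD[OF \<gamma>.prob_space_axioms])
      qed
      \<comment> \<open>Here the independent increments of \<gamma> enter: past and new increment
        jointly have the product law that the append step produced.\<close>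
      have jd: "distr \<gamma> (borel \<Otimes>\<^sub>M borel) (\<lambda>f. (gincs m r f, ?d f)) = ?gi \<Otimes>\<^sub>M ?\<nu>"
      proof -
        have "\<gamma>.indep_vars (\<lambda>_. borel) (\<lambda>i f. f (grid T m (Suc i)) - f (grid T m i)) {..<Suc r}"
          using \<gamma>(1) grid_bounds(1)[of 0 m] grid_bounds(1)[of "Suc r" m] grid_bounds(2)[of m] r
          unfolding gaussian_ii_law_def by auto
        from indep_vars_split_last[OF \<gamma>.prob_space_axioms this] show ?thesis
          unfolding gincs_def[abs_def] dd .
      qed
      have jm: "(\<lambda>f. (gincs m r f, ?d f)) \<in> measurable \<gamma> (borel \<Otimes>\<^sub>M borel)" using gm dm by measurable
      have "(\<integral>f. (\<integral>y. \<psi> ((x, gincs m r f), y) \<partial>?\<nu>) \<partial>\<gamma>) = (\<integral>f. (\<integral>y. \<rho> (gincs m r f, y) \<partial>?\<nu>) \<partial>\<gamma>)" by (simp add: \<rho>_def)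
      also have "\<dots> = (\<integral>v. (\<integral>y. \<rho> (v, y) \<partial>?\<nu>) \<partial>?gi)" by (rule integral_distr[OF gm \<rho>in, symmetric])
      also have "\<dots> = (\<integral>q. \<rho> q \<partial>(?gi \<Otimes>\<^sub>M ?\<nu>))" using gin.integral_fst'[OF i\<rho>] by simp
      also have "\<dots> = (\<integral>f. \<rho> (gincs m r f, ?d f) \<partial>\<gamma>)"
        unfolding jd[symmetric] by (rule integral_distr[OF jm]) (use \<rho>m in \<open>simp add: borel_prod\<close>)
      finally show "(\<integral>f. (\<integral>y. \<psi> ((x, gincs m r f), y) \<partial>?\<nu>) \<partial>\<gamma>) = (\<integral>f. \<psi> ((x, gincs m r f), ?d f) \<partial>\<gamma>)" by (simp add: \<rho>_def)
    qed
    also have "\<dots> = (\<integral>p. \<psi> (pr p, ?d (snd p)) \<partial>(lam \<Otimes>\<^sub>M \<gamma>))"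
    proof -
      have "integrable (lam \<Otimes>\<^sub>M \<gamma>) (\<lambda>p. \<psi> (pr p, ?d (snd p)))"
        by (rule lg.integrable_const_bound[where B=B])
           (use \<psi>b measurable_compose[OF borel_measurable_Pair[OF prm measurable_compose[OF measurable_snd dm]] \<psi>m] in auto)
      from lg.integral_fst'[OF this] show ?thesis by (simp add: pr_def)
    qed
    also have "\<dots> = (\<integral>p. \<phi> (fst p, gincs m (Suc r) (snd p)) \<partial>(lam \<Otimes>\<^sub>M \<gamma>))"
    proof (rule Bochner_Integration.integral_cong[OF refl])
      fix p :: "'x \<times> (real \<Rightarrow> real)"
      have "(gincs m r (snd p))(r := ?d (snd p)) = gincs m (Suc r) (snd p)" by (auto simp: gincs_def fun_eq_iff less_Suc_eq)
      then show "\<psi> (pr p, ?d (snd p)) = \<phi> (fst p, gincs m (Suc r) (snd p))" by (simp add: \<psi>_def pr_def)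
    qed
    finally show ?thesis .
  qed
  ultimately show ?case by simp
qed

end

lemma floor_sum_functional_measurable:
  fixes h :: "'x::polish_space \<times> (real \<Rightarrow> real) \<Rightarrow> real" and X :: "nat \<Rightarrow> 'a \<Rightarrow> real"
  assumes T: "0 < T" and c: "0 \<le> c" and h: "dcont (XD T) (dist_XD T) h"
    and F: "F \<in> borel_measurable M" and X: "\<And>n. X (Suc n) \<in> borel_measurable M"
  shows "(\<lambda>x. h (F x, \<lambda>t. if t \<in> {0..T} then \<Sum>n\<in>{Suc k..k + nat \<lfloor>c * t\<rfloor>}. X n x else 0)) \<in> borel_measurable M"
proof -
  let ?P = "\<lambda>v t. if t \<in> {0..T} then \<Sum>n\<in>{Suc k..k + nat \<lfloor>c * t\<rfloor>}. v n else (0::real)"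
  let ?J = "{Suc k..k + nat \<lfloor>c * T\<rfloor>}"
  have c1: "continuous_on UNIV (\<lambda>p. h (fst p, ?P (snd p)))"
  proof (rule path_functional_continuous[where J="?J", OF _ h])
    show "?P v \<in> Dspace T" for v
      using floor_path_in_Dspace[OF c T, of "\<lambda>i. \<Sum>n\<in>{Suc k..k + i}. v n"] by simp
    fix v w :: "nat \<Rightarrow> real" and t assume t: "t \<in> {0..T}"
    have "nat \<lfloor>c * t\<rfloor> \<le> nat \<lfloor>c * T\<rfloor>" using t c by (intro nat_mono floor_mono mult_left_mono) auto
    then have sub: "{Suc k..k + nat \<lfloor>c * t\<rfloor>} \<subseteq> ?J" by auto
    have "\<bar>?P v t - ?P w t\<bar> = \<bar>\<Sum>n\<in>{Suc k..k + nat \<lfloor>c * t\<rfloor>}. v n - w n\<bar>" using t by (simp add: sum_subtractf)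
    also have "\<dots> \<le> (\<Sum>n\<in>{Suc k..k + nat \<lfloor>c * t\<rfloor>}. \<bar>v n - w n\<bar>)" by (rule sum_abs)
    also have "\<dots> \<le> (\<Sum>n\<in>?J. \<bar>v n - w n\<bar>)" by (rule sum_mono2[OF _ sub]) auto
    finally show "\<bar>?P v t - ?P w t\<bar> \<le> (\<Sum>n\<in>?J. \<bar>v n - w n\<bar>)" .
  qed (use T in auto)
  \<comment> \<open>\<open>X 0\<close> is not known to be measurable and never occurs in the sum, so
    it is replaced by 0.\<close>
  let ?v = "\<lambda>x n. if n = 0 then 0 else X n x"
  have v: "?v \<in> borel_measurable M"
  proof (rule measurable_coordinatewise_then_product)
    fix n
    show "(\<lambda>x. ?v x n) \<in> borel_measurable M" using X by (cases n) auto
  qed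
  have e: "?P (?v x) = (\<lambda>t. if t \<in> {0..T} then \<Sum>n\<in>{Suc k..k + nat \<lfloor>c * t\<rfloor>}. X n x else 0)" for x
    by (auto simp: fun_eq_iff intro!: sum.cong)
  from measurable_compose[OF borel_measurable_Pair[OF F v] borel_measurable_continuous_onI[OF c1]]
  show ?thesis by (simp only: fst_conv snd_conv e)
qed

text \<open>Since the limit process starts at 0, its increments telescope to its grid values; the
  rebuilt step path then converges uniformly to the continuous path.\<close>

lemma inc_path_gincs_limit:
  fixes h :: "'x::polish_space \<times> (real \<Rightarrow> real) \<Rightarrow> real"
  assumes arr: "bounded_mds_array M G X a c k T C V F lam \<gamma>"
    and h: "dcont (XD T) (dist_XD T) h" "\<And>p. p \<in> XD T \<Longrightarrow> \<bar>h p\<bar> \<le> B"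
  shows "(\<lambda>m. \<integral>p. h (fst p, inc_path T m (bounded_mds_array.gincs T m m (snd p))) \<partial>(lam \<Otimes>\<^sub>M \<gamma>)) \<longlonglongrightarrow> (\<integral>p. h p \<partial>(lam \<Otimes>\<^sub>M \<gamma>))"
proof -
  interpret bounded_mds_array M G X a c k T C V F lam \<gamma> by fact
  have hm: "h \<in> borel_measurable (lam \<Otimes>\<^sub>M \<gamma>)"
    by (rule measurable_XD_functional[OF T h(1) \<gamma>(2) eval_meas lam(2)])
  have ipD: "inc_path T m v \<in> Dspace T" for m v unfolding inc_path_def by (rule eval_path_Dspace[OF T])
  have meas: "(\<lambda>p. h (fst p, inc_path T m (gincs m m (snd p)))) \<in> borel_measurable (lam \<Otimes>\<^sub>M \<gamma>)" if m: "0 < m" for m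
  proof -
    note [measurable_cong] = lam(2)
    have "gincs m m \<in> borel_measurable \<gamma>" unfolding gincs_def[abs_def]
    proof (rule measurable_coordinatewise_then_product)
      fix j
      show "(\<lambda>f. if j < m then f (grid T m (Suc j)) - f (grid T m j) else 0) \<in> borel_measurable \<gamma>"
        using eval_meas[OF grid_bounds(1)[of j m]] eval_meas[OF grid_bounds(1)[of "Suc j" m]] by (cases "j < m") auto
    qed
    then have "(\<lambda>p. (fst p, gincs m m (snd p))) \<in> borel_measurable (lam \<Otimes>\<^sub>M \<gamma>)"
      by (intro borel_measurable_Pair measurable_compose[OF measurable_snd]) measurable
    from measurable_compose[OF this borel_measurable_continuous_onI[OF inc_path_functional_continuous[OF T m h(1)]]]
    show ?thesis by simp
  qed
  have AE0: "AE p in lam \<Otimes>\<^sub>M \<gamma>. snd p 0 = 0"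
  proof (rule lg.AE_pair_measure)
    have "(\<lambda>p. snd p 0) \<in> borel_measurable (lam \<Otimes>\<^sub>M \<gamma>)"
      by (rule measurable_compose[OF measurable_snd eval_meas]) (use T in simp)
    then show "{p \<in> space (lam \<Otimes>\<^sub>M \<gamma>). snd p 0 = 0} \<in> sets (lam \<Otimes>\<^sub>M \<gamma>)" by measurable
    have "AE f in \<gamma>. f 0 = 0" using \<gamma>(1) by (simp add: gaussian_ii_law_def)
    then show "AE x in lam. AE f in \<gamma>. snd (x, f) 0 = 0" by simp
  qed
  have spc: "snd p \<in> cont_paths T" if "p \<in> space (lam \<Otimes>\<^sub>M \<gamma>)" for p
    using that unfolding space_pair_measure \<gamma>(2) mem_Times_iff by (rule conjunct2)
  have "(\<lambda>m. \<integral>p. h (fst p, inc_path T (Suc m) (gincs (Suc m) (Suc m) (snd p))) \<partial>(lam \<Otimes>\<^sub>M \<gamma>)) \<longlonglongrightarrow> (\<integral>p. h p \<partial>(lam \<Otimes>\<^sub>M \<gamma>))"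
  proof (rule integral_dominated_convergence[where w="\<lambda>_. B"])
    show "AE p in lam \<Otimes>\<^sub>M \<gamma>. (\<lambda>m. h (fst p, inc_path T (Suc m) (gincs (Suc m) (Suc m) (snd p)))) \<longlonglongrightarrow> h p"
      using AE0 AE_space
    proof eventually_elim
      case (elim p)
      have eq: "inc_path T m (gincs m m (snd p)) = eval_path T m (\<lambda>j. snd p (grid T m j))" if m: "0 < m" for m
      proof -
        have s: "(\<Sum>i<j. gincs m m (snd p) i) = snd p (grid T m j)" if "j \<le> m" for j
        proof -
          have "(\<Sum>i<j. gincs m m (snd p) i) = (\<Sum>i<j. snd p (grid T m (Suc i)) - snd p (grid T m i))"
            by (rule sum.cong) (use that in \<open>auto simp: gincs_def\<close>)
          also have "\<dots> = snd p (grid T m j)" using elim(1) sum_lessThan_telescope[of "\<lambda>i. snd p (grid T m i)" j] by (simp add: grid_bounds(3))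
          finally show ?thesis .
        qed
        show ?thesis
          unfolding inc_path_def eval_path_def using s floor_grid(1)[OF T m] by (auto simp: fun_eq_iff)
      qed
      have pX: "p \<in> XD T" using spc[OF elim(2)] cont_paths_subset_Dspace by (cases p) auto
      show ?case
      proof (rule LIMSEQ_I)
        fix r :: real assume r: "0 < r"
        obtain \<delta> where \<delta>: "\<delta> > 0" "\<And>q. q \<in> XD T \<Longrightarrow> dist_XD T p q < \<delta> \<Longrightarrow> \<bar>h p - h q\<bar> < r"
          using h(1)[unfolded dcont_def, rule_format, OF pX r] by auto
        have "eventually (\<lambda>m. sup_dist T (snd p) (eval_path T m (\<lambda>j. snd p (grid T m j))) \<le> \<delta> / 2) sequentially"
          by (rule eval_path_approx[OF T spc[OF elim(2)]]) (use \<delta> in simp)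
        then have "eventually (\<lambda>m. sup_dist T (snd p) (eval_path T (Suc m) (\<lambda>j. snd p (grid T (Suc m) j))) \<le> \<delta> / 2) sequentially"
          by (rule eventually_compose_filterlim[OF _ filterlim_Suc])
        then have "eventually (\<lambda>m. norm (h (fst p, inc_path T (Suc m) (gincs (Suc m) (Suc m) (snd p))) - h p) < r) sequentially"
        proof eventually_elim
          case (elim m)
          then have "dist_XD T p (fst p, inc_path T (Suc m) (gincs (Suc m) (Suc m) (snd p))) < \<delta>"
            unfolding eq[OF zero_less_Suc] using \<delta>(1) by (simp add: dist_XD_def)
          from \<delta>(2)[OF _ this] show ?case using ipD by (simp add: abs_minus_commute)
        qed
        then show "\<exists>no. \<forall>m\<ge>no. norm (h (fst p, inc_path T (Suc m) (gincs (Suc m) (Suc m) (snd p))) - h p) < r"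
          by (simp add: eventually_sequentially)
      qed
    qed
    show "AE p in lam \<Otimes>\<^sub>M \<gamma>. norm (h (fst p, inc_path T (Suc m) (gincs (Suc m) (Suc m) (snd p)))) \<le> B" for m
      using h(2) ipD by auto
  qed (use hm meas in auto)
  then show ?thesis by (rule LIMSEQ_offset[where k=1, simplified Suc_eq_plus1[symmetric]])
qed

section \<open>Oscillation within blocks and passage from increments to paths\<close>

context bounded_mds_array
begin

definition "bad m e N = {x \<in> space (M N). \<exists>j<m. \<exists>r\<in>{idx N (grid T m j)..idx N (grid T m (Suc j))}.
    e \<le> \<bar>\<Sum>n\<in>{Suc (idx N (grid T m j))..r}. X N n x\<bar>}"

lemma bad_measurable: "bad m e N \<in> sets (M N)"
proof -
  have [measurable]: "(\<lambda>x. \<Sum>n\<in>{Suc l..r}. X N n x) \<in> borel_measurable (M N)" for l r by (rule sum_measurable_M)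
  show ?thesis unfolding bad_def by measurable
qed

text \<open>Each block has limiting variance at most C * T / m. The cut q is twice that, and the
  spare q/2 lets L1 convergence and Markov's inequality dispose of the event that the variation
  exceeds q. What remains is e^2 / (8 q) = e^2 m / (16 C T) in the exponent, m times over.\<close>

lemma bad_bound:
  assumes m: "0 < m" and e: "0 < e" and \<eta>: "0 < \<eta>"
  shows "eventually (\<lambda>N. P.prob N (bad m e N) \<le> 2 * real m * exp (- e\<^sup>2 * real m / (16 * C * T)) + \<eta>) sequentially"
proof -
  define q where "q = 2 * C * T / real m"
  have q: "0 < q" using C T m by (simp add: q_def)
  let ?s = "\<lambda>j. V (grid T m (Suc j)) - V (grid T m j)"
  let ?Q = "\<lambda>N j x. \<Sum>n\<in>{Suc (idx N (grid T m j))..idx N (grid T m (Suc j))}. (X N n x)\<^sup>2"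
  let ?d = "\<lambda>N j. \<integral>x. \<bar>?Q N j x - ?s j\<bar> \<partial>M N"
  have gb: "0 \<le> grid T m j" "grid T m j \<le> grid T m (Suc j)" "grid T m (Suc j) \<le> T" if "j < m" for j
    using grid_bounds(1)[of j m] grid_bounds(1)[of "Suc j" m] grid_bounds(2)[of m j] that by auto
  have sq: "?s j \<le> q / 2" if "j < m" for j
  proof -
    have "grid T m (Suc j) - grid T m j = T / real m" by (simp add: grid_def field_simps add_divide_distrib)
    then show ?thesis using V(2)[OF gb[OF that]] by (simp add: q_def)
  qed
  have "(\<lambda>N. \<Sum>j<m. ?d N j / (q / 2)) \<longlonglongrightarrow> (\<Sum>j<m. 0 / (q / 2))"
    by (intro tendsto_intros block_variation gb) (use q in auto)
  then have e1: "eventually (\<lambda>N. (\<Sum>j<m. ?d N j / (q / 2)) < \<eta>) sequentially"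
    by (rule order_tendstoD(2)) (use \<eta> in simp)
  have "(\<lambda>N. e / (4 * q) * a N) \<longlonglongrightarrow> e / (4 * q) * 0" by (intro tendsto_intros a0)
  then have e2: "eventually (\<lambda>N. e / (4 * q) * a N < 1 / 2) sequentially" by (rule order_tendstoD(2)) simp
  show ?thesis using e1 e2
  proof eventually_elim
    case (elim N)
    let ?A = "\<lambda>j. {x \<in> space (M N). \<exists>r\<in>{idx N (grid T m j)..idx N (grid T m (Suc j))}.
      e \<le> \<bar>\<Sum>n\<in>{Suc (idx N (grid T m j))..r}. X N n x\<bar>}"
    have [measurable]: "(\<lambda>x. \<Sum>n\<in>{Suc l..r}. X N n x) \<in> borel_measurable (M N)" for l r by (rule sum_measurable_M)
    have Qm[measurable]: "(\<lambda>x. ?Q N j x) \<in> borel_measurable (M N)" for j by (rule sum_measurable_M)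
    have Am: "?A j \<in> sets (M N)" for j by measurable
    have A: "P.prob N (?A j) \<le> ?d N j / (q / 2) + 2 * exp (- e\<^sup>2 / (8 * q))" if j: "j < m" for j
    proof -
      have "P.prob N (?A j) \<le> P.prob N {x \<in> space (M N). q < ?Q N j x} + 2 * exp (- e\<^sup>2 / (8 * q))"
        by (rule P.mds_max_bound[OF filt mds bound _ e q idx_mono[OF gb(2)[OF j]]]) (use elim(2) in auto)
      also have "P.prob N {x \<in> space (M N). q < ?Q N j x} \<le> P.prob N {x \<in> space (M N). q / 2 \<le> \<bar>?Q N j x - ?s j\<bar>}"
      proof (rule P.finite_measure_mono)
        show "{x \<in> space (M N). q < ?Q N j x} \<subseteq> {x \<in> space (M N). q / 2 \<le> \<bar>?Q N j x - ?s j\<bar>}"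
        proof
          fix x assume "x \<in> {x \<in> space (M N). q < ?Q N j x}"
          then have "x \<in> space (M N)" "q < ?Q N j x" by auto
          moreover have "q / 2 \<le> \<bar>?Q N j x - ?s j\<bar>"
            using calculation(2) sq[OF j] abs_ge_self[of "?Q N j x - ?s j"] by linarith
          ultimately show "x \<in> {x \<in> space (M N). q / 2 \<le> \<bar>?Q N j x - ?s j\<bar>}" by simp
        qed
      qed measurable
      also have "\<dots> \<le> ?d N j / (q / 2)"
        by (rule integral_Markov_inequality_measure[where A="space (M N)"]) (use q sum_sq_integrable in auto)
      finally show ?thesis by simp
    qed
    have "bad m e N = (\<Union>j\<in>{..<m}. ?A j)" by (auto simp: bad_def)
    then have "P.prob N (bad m e N) \<le> (\<Sum>j<m. P.prob N (?A j))"
      using measure_UNION_le[of "{..<m}" ?A "M N"] Am by simp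
    also have "\<dots> \<le> (\<Sum>j<m. ?d N j / (q / 2) + 2 * exp (- e\<^sup>2 / (8 * q)))" by (rule sum_mono) (use A in auto)
    also have "\<dots> = (\<Sum>j<m. ?d N j / (q / 2)) + 2 * real m * exp (- e\<^sup>2 / (8 * q))" by (simp add: sum.distrib)
    also have "- e\<^sup>2 / (8 * q) = - e\<^sup>2 * real m / (16 * C * T)" using m by (simp add: q_def)
    finally show ?case using elim(1) by linarith
  qed
qed

lemma S_inc_path_dist:
  assumes m: "0 < m" and e: "0 < e" and x: "x \<in> space (M N)" "x \<notin> bad m e N"
  shows "sup_dist T (S N x) (inc_path T m (incs m N m x)) \<le> e"
proof (rule sup_dist_le)
  fix t assume t: "t \<in> {0..T}"
  define j where "j = nat \<lfloor>real m / T * t\<rfloor>"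
  note g = floor_grid[OF T m t, folded j_def]
  have gm: "grid T m i \<le> grid T m i'" if "i \<le> i'" for i i'
    using that T by (auto simp: grid_def intro!: divide_right_mono mult_right_mono)
  have idx0: "idx N 0 = k N" by (simp add: idx_def)
  have s: "(\<Sum>i<r. incs m N m x i) = (\<Sum>n\<in>{Suc (k N)..idx N (grid T m r)}. X N n x)" if "r \<le> m" for r
    using that
  proof (induction r)
    case 0 then show ?case by (simp add: grid_bounds(3) idx0)
  next
    case (Suc r)
    have "(\<Sum>n\<in>{Suc (k N)..idx N (grid T m (Suc r))}. X N n x) = (\<Sum>n\<in>{Suc (k N)..idx N (grid T m r)}. X N n x) + inc m N r x"
      unfolding inc_def by (rule sum_split[OF k_le_idx idx_mono[OF grid_bounds(2)]])
    then show ?case using Suc by (simp add: incs_def)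
  qed
  have "S N x t = (\<Sum>n\<in>{Suc (k N)..idx N (grid T m j)}. X N n x) + (\<Sum>n\<in>{Suc (idx N (grid T m j))..idx N t}. X N n x)"
    using t sum_split[OF k_le_idx[of N "grid T m j"] idx_mono[OF g(2)], of "\<lambda>n. X N n x"] by (simp add: S_def)
  moreover have "inc_path T m (incs m N m x) t = (\<Sum>n\<in>{Suc (k N)..idx N (grid T m j)}. X N n x)"
    using t s[OF g(1)] by (simp add: inc_path_def eval_path_def j_def)
  ultimately have eq: "S N x t - inc_path T m (incs m N m x) t = (\<Sum>n\<in>{Suc (idx N (grid T m j))..idx N t}. X N n x)" by simp
  show "\<bar>S N x t - inc_path T m (incs m N m x) t\<bar> \<le> e"
  \<comment> \<open>Then t = T is itself a grid point and no partial block remains.\<close>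
  proof (cases "j = m")
    case True
    then have "grid T m j = t" using g(4) m T by (simp add: grid_def)
    then show ?thesis unfolding eq using e by simp
  next
    case False
    then have "j < m" using g(1) by simp
    moreover have "idx N t \<in> {idx N (grid T m j)..idx N (grid T m (Suc j))}" using g by (auto intro!: idx_mono)
    ultimately have "\<not> e \<le> \<bar>\<Sum>n\<in>{Suc (idx N (grid T m j))..idx N t}. X N n x\<bar>" using x unfolding bad_def by blast
    then show ?thesis unfolding eq by simp
  qed
qed (use T in simp)

lemma S_Dspace: "S N x \<in> Dspace T"
  using floor_path_in_Dspace[OF c T, of "\<lambda>i. \<Sum>n\<in>{Suc (k N)..k N + i}. X N n x" N] unfolding S_def idx_def by simp

lemma F_measurable_M: "F N \<in> borel_measurable (M N)" by (rule filtration_measurable(1)[OF filt F])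

lemma S_functional_measurable:
  fixes h :: "'x \<times> (real \<Rightarrow> real) \<Rightarrow> real"
  assumes h: "dcont (XD T) (dist_XD T) h"
  shows "(\<lambda>x. h (F N x, S N x)) \<in> borel_measurable (M N)"
  unfolding S_def idx_def
  by (rule floor_sum_functional_measurable[where X="X N" and F="F N" and M="M N", OF T c h F_measurable_M X_measurable])

text \<open>The order of the choices matters: the oscillation tolerance e first, then m so large
  that \<open>w m\<close> and the grid error in the limit are small, and only then N. Five errors of
  at most \<epsilon>/8 arise: tolerance, \<open>w m\<close>, \<eta>, convergence of the increments,
  and grid.\<close>

lemma lipschitz_limit:
  fixes h :: "'x \<times> (real \<Rightarrow> real) \<Rightarrow> real"
  assumes hB: "\<And>p. p \<in> XD T \<Longrightarrow> \<bar>h p\<bar> \<le> B" and L: "0 \<le> L"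
    and hL: "\<And>p q. p \<in> XD T \<Longrightarrow> q \<in> XD T \<Longrightarrow> \<bar>h p - h q\<bar> \<le> L * dist_XD T p q"
  shows "(\<lambda>N. \<integral>x. h (F N x, S N x) \<partial>M N) \<longlonglongrightarrow> (\<integral>p. h p \<partial>(lam \<Otimes>\<^sub>M \<gamma>))"
proof (rule LIMSEQ_I)
  fix \<epsilon> :: real assume \<epsilon>: "0 < \<epsilon>"
  have hc: "dcont (XD T) (dist_XD T) h" by (rule dcont_lipschitz[OF hL L])
  have "(undefined, inc_path T 1 undefined) \<in> XD T" unfolding inc_path_def using eval_path_Dspace[OF T] by auto
  from hB[OF this] have B0: "0 \<le> B" by linarith
  define e where "e = \<epsilon> / (8 * (L + 1))"
  have e: "0 < e" using \<epsilon> L by (simp add: e_def)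
  have Le: "L * e \<le> \<epsilon> / 8" using \<epsilon> L by (simp add: e_def field_simps)
  define w where "w m = 2 * real m * exp (- e\<^sup>2 * real m / (16 * C * T))" for m
  have "(\<lambda>m. real m * exp (- e\<^sup>2 / (16 * C * T)) ^ m) \<longlonglongrightarrow> 0"
    by (rule powser_times_n_limit_0) (use e C T in simp)
  then have "(\<lambda>m. 2 * B * (2 * (real m * exp (- e\<^sup>2 / (16 * C * T)) ^ m))) \<longlonglongrightarrow> 2 * B * (2 * 0)" by (intro tendsto_intros)
  moreover have weq: "2 * (real m * exp (- e\<^sup>2 / (16 * C * T)) ^ m) = w m" for m
    by (simp add: w_def exp_of_nat_mult[symmetric] mult.commute)
  ultimately have "(\<lambda>m. 2 * B * w m) \<longlonglongrightarrow> 2 * B * (2 * 0)" unfolding weq by blast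
  then have "(\<lambda>m. 2 * B * w m) \<longlonglongrightarrow> 0" by simp
  then have ev1: "eventually (\<lambda>m. 2 * B * w m < \<epsilon> / 8) sequentially" by (rule order_tendstoD(2)) (use \<epsilon> in simp)
  have lim: "(\<lambda>m. \<integral>p. h (fst p, inc_path T m (gincs m m (snd p))) \<partial>(lam \<Otimes>\<^sub>M \<gamma>)) \<longlonglongrightarrow> (\<integral>p. h p \<partial>(lam \<Otimes>\<^sub>M \<gamma>))"
    by (rule inc_path_gincs_limit[OF bounded_mds_array_axioms hc hB])
  have ev2: "eventually (\<lambda>m. \<bar>(\<integral>p. h (fst p, inc_path T m (gincs m m (snd p))) \<partial>(lam \<Otimes>\<^sub>M \<gamma>)) - (\<integral>p. h p \<partial>(lam \<Otimes>\<^sub>M \<gamma>))\<bar> < \<epsilon> / 8) sequentially"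
    using tendstoD[OF lim, of "\<epsilon>/8"] \<epsilon> by (simp add: dist_real_def)
  have "eventually (\<lambda>m. 0 < m) sequentially" by (rule eventually_gt_at_top)
  with ev1 ev2 have "eventually (\<lambda>m. 2 * B * w m < \<epsilon> / 8 \<and> \<bar>(\<integral>p. h (fst p, inc_path T m (gincs m m (snd p))) \<partial>(lam \<Otimes>\<^sub>M \<gamma>)) - (\<integral>p. h p \<partial>(lam \<Otimes>\<^sub>M \<gamma>))\<bar> < \<epsilon> / 8 \<and> 0 < m) sequentially"
    by eventually_elim auto
  then obtain m where m: "2 * B * w m < \<epsilon> / 8" "0 < m"
    "\<bar>(\<integral>p. h (fst p, inc_path T m (gincs m m (snd p))) \<partial>(lam \<Otimes>\<^sub>M \<gamma>)) - (\<integral>p. h p \<partial>(lam \<Otimes>\<^sub>M \<gamma>))\<bar> < \<epsilon> / 8"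
    by (auto simp: eventually_sequentially)
  define \<eta> where "\<eta> = \<epsilon> / (16 * (B + 1))"
  have \<eta>: "0 < \<eta>" "2 * B * \<eta> \<le> \<epsilon> / 8" using \<epsilon> B0 by (simp_all add: \<eta>_def field_simps)
  have c2: "continuous_on UNIV (\<lambda>p. h (fst p, inc_path T m (snd p)))" by (rule inc_path_functional_continuous[OF T m(2) hc])
  have ipD: "inc_path T m v \<in> Dspace T" for v unfolding inc_path_def by (rule eval_path_Dspace[OF T])
  have fdd: "(\<lambda>N. \<integral>x. h (F N x, inc_path T m (incs m N m x)) \<partial>M N) \<longlonglongrightarrow> (\<integral>p. h (fst p, inc_path T m (gincs m m (snd p))) \<partial>(lam \<Otimes>\<^sub>M \<gamma>))"
    using fdd_convergence[OF m(2) order_refl c2, of B] hB ipD by simp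
  have ev3: "eventually (\<lambda>N. \<bar>(\<integral>x. h (F N x, inc_path T m (incs m N m x)) \<partial>M N) - (\<integral>p. h (fst p, inc_path T m (gincs m m (snd p))) \<partial>(lam \<Otimes>\<^sub>M \<gamma>))\<bar> < \<epsilon> / 8) sequentially"
    using tendstoD[OF fdd, of "\<epsilon>/8"] \<epsilon> by (simp add: dist_real_def)
  show "\<exists>no. \<forall>N\<ge>no. norm ((\<integral>x. h (F N x, S N x) \<partial>M N) - (\<integral>p. h p \<partial>(lam \<Otimes>\<^sub>M \<gamma>))) < \<epsilon>"
    unfolding eventually_sequentially[symmetric] using bad_bound[OF m(2) e \<eta>(1)] ev3
  proof eventually_elim
    case (elim N)
    have m1: "(\<lambda>x. h (F N x, S N x)) \<in> borel_measurable (M N)" by (rule S_functional_measurable[OF hc])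
    have m2: "(\<lambda>x. h (F N x, inc_path T m (incs m N m x))) \<in> borel_measurable (M N)"
      using measurable_compose[OF borel_measurable_Pair[OF F_measurable_M filtration_measurable(1)[OF filt incs_measurable[OF order_refl]]] borel_measurable_continuous_onI[OF c2]]
      by simp
    have i1: "integrable (M N) (\<lambda>x. h (F N x, S N x))"
      by (rule P.integrable_const_bound[where B=B, OF _ m1]) (use hB S_Dspace in auto)
    have i2: "integrable (M N) (\<lambda>x. h (F N x, inc_path T m (incs m N m x)))"
      by (rule P.integrable_const_bound[where B=B, OF _ m2]) (use hB ipD in auto)
    have ib: "integrable (M N) (\<lambda>x. indicator (bad m e N) x :: real)"
      by (rule P.integrable_const_bound[where B=1]) (use bad_measurable in auto)
    have "norm (\<integral>x. h (F N x, S N x) - h (F N x, inc_path T m (incs m N m x)) \<partial>M N) \<le> (\<integral>x. L * e + 2 * B * indicator (bad m e N) x \<partial>M N)"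
    proof (rule norm_integral_le)
      fix x assume x: "x \<in> space (M N)"
      show "norm (h (F N x, S N x) - h (F N x, inc_path T m (incs m N m x))) \<le> L * e + 2 * B * indicator (bad m e N) x"
      proof (cases "x \<in> bad m e N")
        case True
        have "\<bar>h (F N x, S N x)\<bar> \<le> B" "\<bar>h (F N x, inc_path T m (incs m N m x))\<bar> \<le> B" using hB S_Dspace ipD by auto
        moreover have "0 \<le> L * e" using L e by simp
        ultimately show ?thesis using True by simp
      next
        case False
        have "\<bar>h (F N x, S N x) - h (F N x, inc_path T m (incs m N m x))\<bar> \<le> L * dist_XD T (F N x, S N x) (F N x, inc_path T m (incs m N m x))"
          by (rule hL) (use S_Dspace ipD in auto)
        also have "\<dots> \<le> L * e"
          using S_inc_path_dist[OF m(2) e x False] L by (intro mult_left_mono) (auto simp: dist_XD_def)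
        finally show ?thesis using False by simp
      qed
    qed (use i1 i2 ib in auto)
    also have "\<dots> = L * e + 2 * B * P.prob N (bad m e N)"
      using ib bad_measurable sets.sets_into_space[OF bad_measurable] by (simp add: P.prob_space Int_absorb2)
    also have "\<dots> \<le> L * e + 2 * B * (w m + \<eta>)"
      using elim(1) B0 by (intro add_left_mono mult_left_mono) (auto simp: w_def)
    also have "\<dots> \<le> \<epsilon> / 8 + \<epsilon> / 8 + \<epsilon> / 8"
      using Le m(1) \<eta>(2) by (simp add: distrib_left)
    finally have "\<bar>(\<integral>x. h (F N x, S N x) \<partial>M N) - (\<integral>x. h (F N x, inc_path T m (incs m N m x)) \<partial>M N)\<bar> \<le> \<epsilon> / 8 + \<epsilon> / 8 + \<epsilon> / 8"
      using i1 i2 by simp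
    then show ?case using elim(2) m(3) \<epsilon> unfolding real_norm_def by linarith
  qed
qed

end

section \<open>The functional limit theorem for mixingale arrays\<close>

text \<open>A diagonal choice of level: every fixed level b is eventually admissible, meaning L N b
  \<le> b^2, so the infimum of the admissible levels tends to 0. Adding 1 / (N + 1) puts
  \<open>a N\<close> strictly above that infimum, hence above some admissible b, and antitonicity
  carries the bound over to \<open>a N\<close>. Inserting 1 keeps the set nonempty.\<close>

lemma vanishing_level:
  fixes L :: "nat \<Rightarrow> real \<Rightarrow> real"
  assumes anti: "\<And>N a b. 0 < a \<Longrightarrow> a \<le> b \<Longrightarrow> L N b \<le> L N a"
    and lim: "\<And>a. 0 < a \<Longrightarrow> (\<lambda>N. L N a) \<longlonglongrightarrow> 0"
  obtains a where "\<And>N. 0 < a N" "a \<longlonglongrightarrow> 0" "eventually (\<lambda>N. L N (a N) \<le> (a N)\<^sup>2) sequentially"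
proof -
  define A where "A N = {b. 0 < b \<and> L N b \<le> b\<^sup>2}" for N
  define a where "a N = Inf (insert 1 (A N)) + 1 / real (Suc N)" for N
  have bdd: "bdd_below (insert 1 (A N))" for N by (rule bdd_belowI[of _ 0]) (auto simp: A_def)
  have I0: "0 \<le> Inf (insert 1 (A N))" for N by (rule cInf_greatest) (auto simp: A_def)
  have pos: "0 < a N" for N using I0[of N] by (simp add: a_def add_nonneg_pos)
  have ev: "eventually (\<lambda>N. b \<in> A N) sequentially" if b: "0 < b" for b
  proof -
    have "eventually (\<lambda>N. L N b < b\<^sup>2) sequentially" by (rule order_tendstoD(2)[OF lim[OF b]]) (use b in simp)
    then show ?thesis by eventually_elim (use b in \<open>auto simp: A_def\<close>)
  qed
  have "(\<lambda>N. Inf (insert 1 (A N))) \<longlonglongrightarrow> 0"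
  proof (rule LIMSEQ_I)
    fix r :: real assume r: "0 < r"
    have "eventually (\<lambda>N. r / 2 \<in> A N) sequentially" by (rule ev) (use r in simp)
    then have "eventually (\<lambda>N. norm (Inf (insert 1 (A N)) - 0) < r) sequentially"
    proof eventually_elim
      case (elim N)
      have "Inf (insert 1 (A N)) \<le> r / 2" by (rule cInf_lower[OF _ bdd]) (use elim in simp)
      then show ?case using I0[of N] r by simp
    qed
    then show "\<exists>no. \<forall>N\<ge>no. norm (Inf (insert 1 (A N)) - 0) < r" by (simp add: eventually_sequentially)
  qed
  from tendsto_add[OF this LIMSEQ_Suc[OF lim_1_over_n]] have a0: "a \<longlonglongrightarrow> 0" by (simp add: a_def[abs_def])
  have "eventually (\<lambda>N. a N < 1) sequentially" by (rule order_tendstoD(2)[OF a0]) simp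
  then have "eventually (\<lambda>N. L N (a N) \<le> (a N)\<^sup>2) sequentially"
  proof eventually_elim
    case (elim N)
    have "Inf (insert 1 (A N)) < a N" by (simp add: a_def)
    then obtain b where b: "b \<in> insert 1 (A N)" "b < a N" using cInf_lessD[of "insert 1 (A N)" "a N"] by auto
    then have bA: "0 < b" "L N b \<le> b\<^sup>2" using elim by (auto simp: A_def)
    have "L N (a N) \<le> L N b" by (rule anti) (use b bA in auto)
    also have "\<dots> \<le> b\<^sup>2" by fact
    also have "\<dots> \<le> (a N)\<^sup>2" using b bA by (intro power_mono) auto
    finally show ?case .
  qed
  with pos a0 show thesis by (rule that)
qed

lemma exceed2_divide:
  assumes s: "0 < s"
  shows "exceed2 M a (\<lambda>x. f x / s) = exceed2 M (a * s) f / s\<^sup>2"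
proof -
  have "(f x / s)\<^sup>2 * indicator {x. a < \<bar>f x / s\<bar>} x = (f x)\<^sup>2 * indicator {x. a * s < \<bar>f x\<bar>} x / s\<^sup>2" for x
    using s by (simp add: power_divide indicator_def pos_less_divide_eq)
  then show ?thesis by (simp add: exceed2_def)
qed

lemma exceed2_nonneg: "0 \<le> exceed2 M a f"
  unfolding exceed2_def by (intro integral_nonneg_AE) auto

text \<open>Chebyshev's inequality keeping only the tail of the second moment. The gain is what lets
  about N events at level e * sqrt N be summed to something small.\<close>

lemma (in prob_space) prob_exceed:
  assumes f[measurable]: "f \<in> borel_measurable M" and i: "integrable M (\<lambda>x. (f x)\<^sup>2)" and a: "0 < a"
  shows "prob {x \<in> space M. a < \<bar>f x\<bar>} \<le> exceed2 M a f / a\<^sup>2"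
proof -
  have ii: "integrable M (\<lambda>x. (f x)\<^sup>2 * indicator {x. a < \<bar>f x\<bar>} x)"
    by (rule Bochner_Integration.integrable_bound[OF i]) (auto simp: indicator_def)
  have "prob {x \<in> space M. a < \<bar>f x\<bar>} \<le> prob {x \<in> space M. a\<^sup>2 \<le> (f x)\<^sup>2 * indicator {x. a < \<bar>f x\<bar>} x}"
  proof (rule finite_measure_mono)
    show "{x \<in> space M. a < \<bar>f x\<bar>} \<subseteq> {x \<in> space M. a\<^sup>2 \<le> (f x)\<^sup>2 * indicator {x. a < \<bar>f x\<bar>} x}"
    proof
      fix x assume "x \<in> {x \<in> space M. a < \<bar>f x\<bar>}"
      then have "x \<in> space M" "a < \<bar>f x\<bar>" by auto
      moreover have "a\<^sup>2 \<le> (f x)\<^sup>2" using calculation(2) a by (subst abs_le_square_iff[symmetric]) auto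
      ultimately show "x \<in> {x \<in> space M. a\<^sup>2 \<le> (f x)\<^sup>2 * indicator {x. a < \<bar>f x\<bar>} x}" by simp
    qed
  qed measurable
  also have "\<dots> \<le> exceed2 M a f / a\<^sup>2"
    unfolding exceed2_def by (rule integral_Markov_inequality_measure[OF ii]) (use a in auto)
  finally show ?thesis .
qed

lemma L1_norm_tendsto_iff:
  assumes "\<And>N. N \<ge> 1 \<Longrightarrow> integrable (M N) (f N)"
  shows "(\<lambda>N. L1_norm (M N) (f N)) \<longlonglongrightarrow> 0 \<longleftrightarrow> (\<lambda>N. \<integral>x. \<bar>f N x\<bar> \<partial>M N) \<longlonglongrightarrow> 0"
proof -
  have eq: "L1_norm (M N) (f N) = ennreal (\<integral>x. \<bar>f N x\<bar> \<partial>M N)" if "N \<ge> 1" for N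
    unfolding L1_norm_def using assms[OF that] by (intro nn_integral_eq_integral) auto
  have "(\<lambda>N. L1_norm (M N) (f N)) \<longlonglongrightarrow> 0 \<longleftrightarrow> (\<lambda>N. ennreal (\<integral>x. \<bar>f N x\<bar> \<partial>M N)) \<longlonglongrightarrow> 0"
    by (rule tendsto_cong) (use eq in \<open>auto simp: eventually_sequentially intro!: exI[of _ 1]\<close>)
  also have "\<dots> \<longleftrightarrow> (\<lambda>N. \<integral>x. \<bar>f N x\<bar> \<partial>M N) \<longlonglongrightarrow> 0"
    by (subst ennreal_0[symmetric], subst tendsto_ennreal_iff) (auto intro!: always_eventually integral_nonneg_AE)
  finally show ?thesis .
qed

context mixingale_array
begin

lemma W_moments:
  obtains C where "0 < C" "\<And>N n. N \<ge> 1 \<Longrightarrow> integrable (M N) (\<lambda>x. (W N (Suc n) x)\<^sup>2)"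
    "\<And>N n. N \<ge> 1 \<Longrightarrow> (\<integral>x. (W N (Suc n) x)\<^sup>2 \<partial>M N) \<le> C"
proof -
  obtain C where C: "0 \<le> C" "\<And>i. i \<in> Idx \<Longrightarrow> integrable (P i) (\<lambda>x. (W (fst i) (Suc (snd i)) x)\<^sup>2)"
      "\<And>i. i \<in> Idx \<Longrightarrow> (\<integral>x. (W (fst i) (Suc (snd i)) x)\<^sup>2 \<partial>P i) \<le> C"
    using ui2_moment[OF probP ui2_W] by blast
  show thesis
  proof (rule that[of "C + 1"])
    fix N n :: nat assume N: "N \<ge> 1"
    show "integrable (M N) (\<lambda>x. (W N (Suc n) x)\<^sup>2)" using C(2)[of "(N, n)"] N by simp
    show "(\<integral>x. (W N (Suc n) x)\<^sup>2 \<partial>M N) \<le> C + 1" using C(3)[of "(N, n)"] N by simp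
  qed (use C in simp)
qed

lemma R_square_integrable: "N \<ge> 1 \<Longrightarrow> integrable (M N) (\<lambda>x. (R N n x)\<^sup>2)"
proof -
  assume N: "N \<ge> 1"
  obtain C where "\<And>i. i \<in> Idx \<Longrightarrow> integrable (P i) (\<lambda>x. (R (fst i) (snd i) x)\<^sup>2)"
    using ui2_moment[OF probP ui2_R] by blast
  from this[of "(N, n)"] N show ?thesis by simp
qed

lemma W_sum_integrable:
  assumes N: "N \<ge> 1"
  shows "integrable (M N) (\<lambda>x. \<Sum>n\<in>{Suc l..r}. (W N n x)\<^sup>2)"
proof -
  obtain C where C: "\<And>N n. N \<ge> 1 \<Longrightarrow> integrable (M N) (\<lambda>x. (W N (Suc n) x)\<^sup>2)" using W_moments by blast
  have "integrable (M N) (\<lambda>x. (W N n x)\<^sup>2)" if "n \<in> {Suc l..r}" for n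
    using C[OF N, of "n - 1"] that by (cases n) auto
  then show ?thesis by (intro Bochner_Integration.integrable_sum) auto
qed

lemma W_sum_integral_le:
  assumes N: "N \<ge> 1" and C: "\<And>n. (\<integral>x. (W N (Suc n) x)\<^sup>2 \<partial>M N) \<le> C" and lr: "l \<le> r"
  shows "(\<integral>x. (\<Sum>n\<in>{Suc l..r}. (W N n x)\<^sup>2) \<partial>M N) \<le> C * (real r - real l)"
  using lr
proof (induction r rule: dec_induct)
  case (step r)
  have "(\<integral>x. (\<Sum>n\<in>{Suc l..Suc r}. (W N n x)\<^sup>2) \<partial>M N) = (\<integral>x. (\<Sum>n\<in>{Suc l..r}. (W N n x)\<^sup>2) + (W N (Suc r) x)\<^sup>2 \<partial>M N)"
    using step by simp
  also have "\<dots> = (\<integral>x. (\<Sum>n\<in>{Suc l..r}. (W N n x)\<^sup>2) \<partial>M N) + (\<integral>x. (W N (Suc r) x)\<^sup>2 \<partial>M N)"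
    by (rule Bochner_Integration.integral_add[OF W_sum_integrable[OF N]]) (use W_sum_integrable[OF N, of r "Suc r"] in simp)
  also have "\<dots> \<le> C * (real r - real l) + C" using step.IH C[of r] by simp
  finally show ?case by (simp add: algebra_simps)
qed simp

definition "vari k N t x = (\<Sum>n\<in>{k + 1..k + nat \<lfloor>real N * t\<rfloor>}. (W N n x)\<^sup>2) / real N"

lemma vari_integrable: "N \<ge> 1 \<Longrightarrow> integrable (M N) (vari k N t)"
  using W_sum_integrable[of N k "k + nat \<lfloor>real N * t\<rfloor>"] by (simp add: vari_def[abs_def])

text \<open>The expected variance of a stretch of n steps is at most C * n, uniformly in row and
  position, so any L1 limit inherits monotonicity and the Lipschitz constant C. This is the source
  of the continuity of the limiting variance.\<close>

lemma limit_variance_increment: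
  fixes k :: "nat \<Rightarrow> nat"
  assumes C: "\<And>N n. N \<ge> 1 \<Longrightarrow> (\<integral>x. (W N (Suc n) x)\<^sup>2 \<partial>M N) \<le> C" "0 < C"
    and V: "\<And>t. 0 \<le> t \<Longrightarrow> (\<lambda>N. \<integral>x. \<bar>vari (k N) N t x - V t\<bar> \<partial>M N) \<longlonglongrightarrow> 0"
    and st: "0 \<le> s" "s \<le> t"
  shows "0 \<le> V t - V s" "V t - V s \<le> C * (t - s)"
proof -
  have E: "(\<lambda>N. \<integral>x. vari (k N) N t x \<partial>M N) \<longlonglongrightarrow> V t" if t: "0 \<le> t" for t
  proof -
    have "(\<lambda>N. (\<integral>x. vari (k N) N t x \<partial>M N) - V t) \<longlonglongrightarrow> 0"
    proof (rule Lim_null_comparison[OF _ V[OF t]])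
      show "eventually (\<lambda>N. norm ((\<integral>x. vari (k N) N t x \<partial>M N) - V t) \<le> (\<integral>x. \<bar>vari (k N) N t x - V t\<bar> \<partial>M N)) sequentially"
        using eventually_ge_at_top[of 1]
      proof eventually_elim
        case (elim N)
        interpret N: prob_space "M N" by (rule prob[OF elim])
        have "norm (\<integral>x. vari (k N) N t x - V t \<partial>M N) \<le> (\<integral>x. \<bar>vari (k N) N t x - V t\<bar> \<partial>M N)"
          by (rule norm_integral_le) (use vari_integrable[OF elim] in auto)
        then show ?case using vari_integrable[OF elim] by (simp add: N.prob_space)
      qed
    qed
    then show ?thesis by (rule LIM_zero_cancel)
  qed
  have d: "0 \<le> (\<integral>x. vari (k N) N t x \<partial>M N) - (\<integral>x. vari (k N) N s x \<partial>M N)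
      \<and> (\<integral>x. vari (k N) N t x \<partial>M N) - (\<integral>x. vari (k N) N s x \<partial>M N) \<le> C * (t - s + 1 / real N)" if N: "N \<ge> 1" for N
  proof -
    let ?a = "k N + nat \<lfloor>real N * s\<rfloor>" let ?b = "k N + nat \<lfloor>real N * t\<rfloor>"
    have ab: "?a \<le> ?b" using st by (intro add_left_mono nat_mono floor_mono mult_left_mono) auto
    let ?D = "\<integral>x. (\<Sum>n\<in>{Suc ?a..?b}. (W N n x)\<^sup>2) \<partial>M N"
    have "vari (k N) N t x = vari (k N) N s x + (\<Sum>n\<in>{Suc ?a..?b}. (W N n x)\<^sup>2) / real N" for x
    proof -
      have "{k N + 1..?b} = {k N + 1..?a} \<union> {Suc ?a..?b}" using ab by auto
      then have "(\<Sum>n\<in>{k N + 1..?b}. (W N n x)\<^sup>2) = (\<Sum>n\<in>{k N + 1..?a}. (W N n x)\<^sup>2) + (\<Sum>n\<in>{Suc ?a..?b}. (W N n x)\<^sup>2)"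
        by (simp only:) (rule sum.union_disjoint, auto)
      then show ?thesis by (simp add: vari_def add_divide_distrib)
    qed
    then have eq: "(\<integral>x. vari (k N) N t x \<partial>M N) - (\<integral>x. vari (k N) N s x \<partial>M N) = ?D / real N"
      using vari_integrable[OF N] W_sum_integrable[OF N, of ?a ?b] by simp
    have D0: "0 \<le> ?D" by (intro integral_nonneg_AE) (auto intro!: sum_nonneg)
    have "?D \<le> C * (real ?b - real ?a)" by (rule W_sum_integral_le[OF N C(1)[OF N] ab])
    \<comment> \<open>Rounding both endpoints down costs at most one summand, that is C / N after
      division.\<close>
    also have "\<dots> \<le> C * (real N * (t - s) + 1)"
    proof (rule mult_left_mono)
      have "real (nat \<lfloor>real N * t\<rfloor>) \<le> real N * t" using st by (intro of_nat_floor) auto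
      moreover have "real N * s - 1 \<le> real (nat \<lfloor>real N * s\<rfloor>)" by linarith
      ultimately show "real ?b - real ?a \<le> real N * (t - s) + 1" by (simp add: right_diff_distrib)
    qed (use C in simp)
    finally have "?D / real N \<le> C * (real N * (t - s) + 1) / real N" by (rule divide_right_mono) simp
    also have "\<dots> = C * (t - s + 1 / real N)" using N by (simp add: field_simps)
    finally show ?thesis unfolding eq using D0 by simp
  qed
  have lim: "(\<lambda>N. (\<integral>x. vari (k N) N t x \<partial>M N) - (\<integral>x. vari (k N) N s x \<partial>M N)) \<longlonglongrightarrow> V t - V s"
    by (intro tendsto_diff E) (use st in auto)
  show "0 \<le> V t - V s"
    by (rule tendsto_lowerbound[OF lim]) (use d in \<open>auto simp: eventually_sequentially intro!: exI[of _ 1]\<close>)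
  have lim2: "(\<lambda>N. C * (t - s + 1 / real N)) \<longlonglongrightarrow> C * (t - s + 0)"
    by (intro tendsto_intros lim_1_over_n)
  have "V t - V s \<le> C * (t - s + 0)"
    by (rule tendsto_le[OF _ lim2 lim]) (use d in \<open>auto simp: eventually_sequentially intro!: exI[of _ 1]\<close>)
  then show "V t - V s \<le> C * (t - s)" by simp
qed

text \<open>The common core of all claims: V is whatever the variance of the window starting at
  \<open>k N\<close> converges to, and no relation between \<open>k N\<close> and N is
  supposed.\<close>

lemma joint_functional_clt:
  fixes k :: "nat \<Rightarrow> nat" and V :: "real \<Rightarrow> real" and F :: "nat \<Rightarrow> 'a \<Rightarrow> 'x::polish_space"
  assumes T: "0 < T"
    and V: "\<And>t. 0 \<le> t \<Longrightarrow> (\<lambda>N. \<integral>x. \<bar>vari (k N) N t x - V t\<bar> \<partial>M N) \<longlonglongrightarrow> 0"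
    and F: "\<And>N. N \<ge> 1 \<Longrightarrow> F N \<in> measurable (G N (k N)) borel"
    and lam: "prob_space lam" "sets lam = sets borel"
    and weak: "weak_conv_meas (\<lambda>N. distr (M N) borel (F N)) lam"
  shows "\<exists>\<gamma>. gaussian_ii_law T V \<gamma> \<and> space \<gamma> = cont_paths T \<and> weak_conv_XD T M F (\<lambda>N. xi_proc T U N (k N)) (lam \<Otimes>\<^sub>M \<gamma>)"
proof -
  obtain C where C: "0 < C" "\<And>N n. N \<ge> 1 \<Longrightarrow> integrable (M N) (\<lambda>x. (W N (Suc n) x)\<^sup>2)"
    "\<And>N n. N \<ge> 1 \<Longrightarrow> (\<integral>x. (W N (Suc n) x)\<^sup>2 \<partial>M N) \<le> C" using W_moments by blast
  note Vinc = limit_variance_increment[OF C(3) C(1) V]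
  have V0: "V 0 = 0"
  proof -
    have "(\<lambda>N. \<integral>x. \<bar>vari (k N) N 0 x - V 0\<bar> \<partial>M N) \<longlonglongrightarrow> \<bar>V 0\<bar>"
    proof (rule tendsto_eventually)
      show "eventually (\<lambda>N. (\<integral>x. \<bar>vari (k N) N 0 x - V 0\<bar> \<partial>M N) = \<bar>V 0\<bar>) sequentially"
        using eventually_ge_at_top[of 1]
      proof eventually_elim
        case (elim N)
        interpret N: prob_space "M N" by (rule prob[OF elim])
        show ?case by (simp add: vari_def N.prob_space)
      qed
    qed
    from LIMSEQ_unique[OF this V[of 0]] show ?thesis by simp
  qed
  have "mono_on {0..T} V" by (rule mono_onI) (use Vinc(1) in fastforce)
  moreover have "continuous_on {0..T} V"
  proof (rule lipschitz_on_continuous_on)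
    show "C-lipschitz_on {0..T} V"
    proof (rule lipschitz_onI)
      fix x y assume "x \<in> {0..T}" "y \<in> {0..T}"
      then show "dist (V x) (V y) \<le> C * dist x y"
        using Vinc(1)[of x y] Vinc(2)[of x y] Vinc(1)[of y x] Vinc(2)[of y x]
        by (cases "x \<le> y") (auto simp: dist_real_def abs_if not_le)
    qed (use C in simp)
  qed
  ultimately obtain \<gamma> where \<gamma>: "gaussian_ii_law T V \<gamma>" "space \<gamma> = cont_paths T"
    using gaussian_ii_law_exists[of T V, OF T V0] by blast
  \<comment> \<open>Rows are renumbered by \<open>Suc\<close>, because the hypotheses on the array
    start at N = 1.\<close>
  define X0 where "X0 N n x = W (Suc N) n x / sqrt (real (Suc N))" for N n x
  define K where "K N = k (Suc N) + nat \<lfloor>real (Suc N) * T\<rfloor>" for N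
  \<comment> \<open>The Lindeberg sum over the whole window up to time T.\<close>
  define L where "L N a = (\<Sum>n\<in>{Suc (k (Suc N))..K N}. exceed2 (M (Suc N)) a (X0 N n))" for N a
  have Kk: "real (K N) - real (k (Suc N)) \<le> real (Suc N) * T" for N
    unfolding K_def using T of_nat_floor[of "real (Suc N) * T"] by simp
  have cardK: "card {Suc (k (Suc N))..K N} = K N - k (Suc N)" "k (Suc N) \<le> K N" for N by (auto simp: K_def)
  have sqN: "0 < sqrt (real (Suc N))" for N by simp
  have X0mds: "mds (M (Suc N)) (G (Suc N)) (X0 N)" for N
  proof -
    have m: "mds (M (Suc N)) (G (Suc N)) (W (Suc N))" by (rule mds_W) simp
    show ?thesis
      unfolding mds_def
    proof (intro allI conjI impI)
      fix i
      note [measurable] = mdsD(1)[OF m, of i]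
      show "X0 N (Suc i) \<in> borel_measurable (G (Suc N) (Suc i))" unfolding X0_def by measurable
      show "integrable (M (Suc N)) (X0 N (Suc i))" unfolding X0_def using mdsD(2)[OF m, of i] by simp
      fix w B assume "w \<in> borel_measurable (G (Suc N) i)" "\<forall>x\<in>space (M (Suc N)). \<bar>w x\<bar> \<le> (B::real)"
      then have "(\<integral>x. w x * W (Suc N) (Suc i) x \<partial>M (Suc N)) = 0" using mdsD(3)[OF m] by blast
      then show "(\<integral>x. w x * X0 N (Suc i) x \<partial>M (Suc N)) = 0" by (simp add: X0_def)
    qed
  qed
  have X0sq: "integrable (M (Suc N)) (\<lambda>x. (X0 N (Suc i) x)\<^sup>2)" for N i
    using C(2)[of "Suc N" i] by (simp add: X0_def power_divide)
  have X0m: "X0 N (Suc i) \<in> borel_measurable (M (Suc N))" for N i using mdsD(2)[OF X0mds] by auto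
  have exX0: "exceed2 (M (Suc N)) a (X0 N n) = exceed2 (M (Suc N)) (a * sqrt (real (Suc N))) (W (Suc N) n) / real (Suc N)" for N a n
    unfolding X0_def[abs_def] exceed2_divide[OF sqN] by simp
  have Lanti: "L N b \<le> L N a" if "0 < a" "a \<le> b" for N a b
    unfolding L_def
  proof (rule sum_mono)
    fix n assume "n \<in> {Suc (k (Suc N))..K N}"
    then obtain i where "n = Suc i" by (cases n) auto
    then show "exceed2 (M (Suc N)) b (X0 N n) \<le> exceed2 (M (Suc N)) a (X0 N n)"
      using exceed2_antimono[OF X0m X0sq that(2)] by simp
  qed
  have sqinf: "filterlim (\<lambda>N. b * sqrt (real (Suc N))) at_top sequentially" if "0 < b" for b
    by (rule filterlim_tendsto_pos_mult_at_top[OF tendsto_const that])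
       (intro filterlim_compose[OF sqrt_at_top] filterlim_compose[OF filterlim_real_sequentially filterlim_Suc])
  have Llim: "(\<lambda>N. L N a) \<longlonglongrightarrow> 0" if a: "0 < a" for a
  proof (rule LIMSEQ_I)
    fix e :: real assume e: "0 < e"
    have e': "0 < e / (2 * T)" using e T by simp
    obtain Kc where Kc: "0 < Kc" "\<And>i K'. i \<in> Idx \<Longrightarrow> Kc \<le> K' \<Longrightarrow> exceed2 (P i) K' (W (fst i) (Suc (snd i))) \<le> e / (2 * T)"
      using ui2_exceed[OF probP ui2_W e'] by blast
    have "eventually (\<lambda>N. Kc \<le> a * sqrt (real (Suc N))) sequentially"
      using sqinf[OF a] unfolding filterlim_at_top by blast
    then have "eventually (\<lambda>N. norm (L N a - 0) < e) sequentially"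
    proof eventually_elim
      case (elim N)
      \<comment> \<open>After rescaling, the level a becomes a * sqrt (N + 1) for W itself; there
        uniform integrability bounds every term at once, and at most (N + 1) * T terms carry the
        weight 1 / (N + 1).\<close>
      have "L N a \<le> (\<Sum>n\<in>{Suc (k (Suc N))..K N}. (e / (2 * T)) / real (Suc N))"
        unfolding L_def exX0
      proof (intro sum_mono divide_right_mono)
        fix n assume "n \<in> {Suc (k (Suc N))..K N}"
        then obtain i where "n = Suc i" by (cases n) auto
        then show "exceed2 (M (Suc N)) (a * sqrt (real (Suc N))) (W (Suc N) n) \<le> e / (2 * T)"
          using Kc(2)[of "(Suc N, i)", OF _ elim] by simp
      qed simp
      also have "\<dots> = (real (K N) - real (k (Suc N))) * (e / (2 * T) / real (Suc N))"
        using cardK[of N] by (simp add: of_nat_diff)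
      also have "\<dots> \<le> (real (Suc N) * T) * (e / (2 * T) / real (Suc N))"
        using e T by (intro mult_right_mono Kk) auto
      also have "\<dots> = e / 2" using T by simp
      finally have "L N a \<le> e / 2" .
      moreover have "0 \<le> L N a" unfolding L_def by (intro sum_nonneg exceed2_nonneg)
      ultimately show ?case using e by simp
    qed
    then show "\<exists>no. \<forall>N\<ge>no. norm (L N a - 0) < e" by (simp add: eventually_sequentially)
  qed
  \<comment> \<open>With the Lindeberg sum below a^2, truncation and recentring cost at most 2 * a
    in L1 and at most 4 * a^2 for the squares; both vanish although the level itself tends to
    0.\<close>
  obtain a where a: "\<And>N. 0 < a N" "a \<longlonglongrightarrow> 0" "eventually (\<lambda>N. L N (a N) \<le> (a N)\<^sup>2) sequentially"
    using vanishing_level[of L, OF Lanti Llim] by blast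
  define Y where "Y N = trunc_center (M (Suc N)) (G (Suc N)) (a N) (X0 N)" for N
  have prS: "prob_space (M (Suc N))" for N by (rule prob) simp
  have flS: "filtration_on (M (Suc N)) (G (Suc N))" for N by (rule filt) simp
  have tc: "mds (M (Suc N)) (G (Suc N)) (Y N)" "\<bar>Y N n x\<bar> \<le> 2 * a N"
    "integrable (M (Suc N)) (\<lambda>x. X0 N (Suc i) x - Y N (Suc i) x)"
    "(\<integral>x. \<bar>X0 N (Suc i) x - Y N (Suc i) x\<bar> \<partial>M (Suc N)) \<le> 2 * exceed2 (M (Suc N)) (a N) (X0 N (Suc i)) / a N"
    "integrable (M (Suc N)) (\<lambda>x. (X0 N (Suc i) x)\<^sup>2 - (Y N (Suc i) x)\<^sup>2)"
    "(\<integral>x. \<bar>(X0 N (Suc i) x)\<^sup>2 - (Y N (Suc i) x)\<^sup>2\<bar> \<partial>M (Suc N)) \<le> 4 * exceed2 (M (Suc N)) (a N) (X0 N (Suc i))"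
    for N n i x
    unfolding Y_def by (rule prob_space.trunc_center[OF prS flS X0mds X0sq a(1)])+
  \<comment> \<open>The total error over the window dominates the error of all partial sums at once,
    so no maximal inequality is spent on the truncation.\<close>
  define D1 where "D1 N x = (\<Sum>n\<in>{Suc (k (Suc N))..K N}. \<bar>X0 N n x - Y N n x\<bar>)" for N x
  have iD: "integrable (M (Suc N)) (\<lambda>x. \<bar>X0 N n x - Y N n x\<bar>)" "(\<integral>x. \<bar>X0 N n x - Y N n x\<bar> \<partial>M (Suc N)) \<le> 2 * exceed2 (M (Suc N)) (a N) (X0 N n) / a N"
    "integrable (M (Suc N)) (\<lambda>x. \<bar>(X0 N n x)\<^sup>2 - (Y N n x)\<^sup>2\<bar>)" "(\<integral>x. \<bar>(X0 N n x)\<^sup>2 - (Y N n x)\<^sup>2\<bar> \<partial>M (Suc N)) \<le> 4 * exceed2 (M (Suc N)) (a N) (X0 N n)"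
    if "n \<in> {Suc (k (Suc N))..K N}" for n N
  proof -
    from that obtain i where n: "n = Suc i" by (cases n) auto
    show "integrable (M (Suc N)) (\<lambda>x. \<bar>X0 N n x - Y N n x\<bar>)" "(\<integral>x. \<bar>X0 N n x - Y N n x\<bar> \<partial>M (Suc N)) \<le> 2 * exceed2 (M (Suc N)) (a N) (X0 N n) / a N"
    "integrable (M (Suc N)) (\<lambda>x. \<bar>(X0 N n x)\<^sup>2 - (Y N n x)\<^sup>2\<bar>)" "(\<integral>x. \<bar>(X0 N n x)\<^sup>2 - (Y N n x)\<^sup>2\<bar> \<partial>M (Suc N)) \<le> 4 * exceed2 (M (Suc N)) (a N) (X0 N n)"
      unfolding n by (rule integrable_abs tc)+
  qed
  have D1i: "integrable (M (Suc N)) (D1 N)" for N unfolding D1_def[abs_def] using iD(1) by (intro Bochner_Integration.integrable_sum) auto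
  have D1e: "eventually (\<lambda>N. (\<integral>x. D1 N x \<partial>M (Suc N)) \<le> 2 * a N) sequentially"
    using a(3)
  proof eventually_elim
    case (elim N)
    have "(\<integral>x. D1 N x \<partial>M (Suc N)) = (\<Sum>n\<in>{Suc (k (Suc N))..K N}. \<integral>x. \<bar>X0 N n x - Y N n x\<bar> \<partial>M (Suc N))"
      unfolding D1_def by (rule Bochner_Integration.integral_sum) (use iD(1) in auto)
    also have "\<dots> \<le> (\<Sum>n\<in>{Suc (k (Suc N))..K N}. 2 * exceed2 (M (Suc N)) (a N) (X0 N n) / a N)"
      by (rule sum_mono) (rule iD(2))
    also have "\<dots> = 2 * L N (a N) / a N" by (simp add: L_def sum_distrib_left sum_divide_distrib)
    also have "\<dots> \<le> 2 * (a N)\<^sup>2 / a N" using elim a(1)[of N] by (intro divide_right_mono) auto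
    also have "\<dots> = 2 * a N" using a(1)[of N] by (simp add: power2_eq_square)
    finally show ?case .
  qed
  have Q: "(\<lambda>N. \<integral>x. \<bar>(\<Sum>n\<in>{Suc (k (Suc N))..k (Suc N) + nat \<lfloor>real (Suc N) * t\<rfloor>}. (Y N n x)\<^sup>2) - V t\<bar> \<partial>M (Suc N)) \<longlonglongrightarrow> 0"
    if t: "t \<in> {0..T}" for t
  proof (rule Lim_null_comparison)
    let ?J = "\<lambda>N. {Suc (k (Suc N))..k (Suc N) + nat \<lfloor>real (Suc N) * t\<rfloor>}"
    have sub: "?J N \<subseteq> {Suc (k (Suc N))..K N}" for N
    proof -
      have "nat \<lfloor>real (Suc N) * t\<rfloor> \<le> nat \<lfloor>real (Suc N) * T\<rfloor>" using t by (intro nat_mono floor_mono mult_left_mono) auto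
      then show ?thesis by (auto simp: K_def)
    qed
    have "(\<lambda>N. (\<integral>x. \<bar>vari (k (Suc N)) (Suc N) t x - V t\<bar> \<partial>M (Suc N)) + 4 * (a N)\<^sup>2) \<longlonglongrightarrow> 0 + 4 * 0\<^sup>2"
      by (intro tendsto_intros a LIMSEQ_Suc[OF V]) (use t in simp)
    then show "(\<lambda>N. (\<integral>x. \<bar>vari (k (Suc N)) (Suc N) t x - V t\<bar> \<partial>M (Suc N)) + 4 * (a N)\<^sup>2) \<longlonglongrightarrow> 0" by simp
    show "eventually (\<lambda>N. norm (\<integral>x. \<bar>(\<Sum>n\<in>?J N. (Y N n x)\<^sup>2) - V t\<bar> \<partial>M (Suc N)) \<le> (\<integral>x. \<bar>vari (k (Suc N)) (Suc N) t x - V t\<bar> \<partial>M (Suc N)) + 4 * (a N)\<^sup>2) sequentially"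
      using a(3)
    proof eventually_elim
      case (elim N)
      interpret N: prob_space "M (Suc N)" by (rule prS)
      have vX: "vari (k (Suc N)) (Suc N) t x = (\<Sum>n\<in>?J N. (X0 N n x)\<^sup>2)" for x
        by (simp add: vari_def X0_def power_divide sum_divide_distrib)
      have iv: "integrable (M (Suc N)) (\<lambda>x. vari (k (Suc N)) (Suc N) t x)" by (rule vari_integrable) simp
      let ?d = "\<lambda>x. \<Sum>n\<in>{Suc (k (Suc N))..K N}. \<bar>(X0 N n x)\<^sup>2 - (Y N n x)\<^sup>2\<bar>"
      have id: "integrable (M (Suc N)) ?d" using iD(3) by (intro Bochner_Integration.integrable_sum) auto
      have iY: "integrable (M (Suc N)) (\<lambda>x. \<Sum>n\<in>?J N. (Y N n x)\<^sup>2)"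
      proof (rule Bochner_Integration.integrable_sum)
        fix n assume "n \<in> ?J N"
        then obtain i where n: "n = Suc i" by (cases n) auto
        have "integrable (M (Suc N)) (\<lambda>x. (X0 N n x)\<^sup>2 - ((X0 N n x)\<^sup>2 - (Y N n x)\<^sup>2))"
          unfolding n by (rule Bochner_Integration.integrable_diff[OF X0sq tc(5)])
        then show "integrable (M (Suc N)) (\<lambda>x. (Y N n x)\<^sup>2)" by simp
      qed
      have "norm (\<integral>x. \<bar>(\<Sum>n\<in>?J N. (Y N n x)\<^sup>2) - V t\<bar> \<partial>M (Suc N)) \<le> (\<integral>x. \<bar>vari (k (Suc N)) (Suc N) t x - V t\<bar> + ?d x \<partial>M (Suc N))"
      proof (rule norm_integral_le)
        fix x
        have "\<bar>(\<Sum>n\<in>?J N. (X0 N n x)\<^sup>2) - (\<Sum>n\<in>?J N. (Y N n x)\<^sup>2)\<bar> \<le> (\<Sum>n\<in>?J N. \<bar>(X0 N n x)\<^sup>2 - (Y N n x)\<^sup>2\<bar>)"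
          unfolding sum_subtractf[symmetric] by (rule sum_abs)
        also have "\<dots> \<le> ?d x" by (rule sum_mono2[OF _ sub]) auto
        finally show "norm \<bar>(\<Sum>n\<in>?J N. (Y N n x)\<^sup>2) - V t\<bar> \<le> \<bar>vari (k (Suc N)) (Suc N) t x - V t\<bar> + ?d x"
          unfolding vX real_norm_def by linarith
      qed (use iY iv id in auto)
      also have "\<dots> = (\<integral>x. \<bar>vari (k (Suc N)) (Suc N) t x - V t\<bar> \<partial>M (Suc N)) + (\<integral>x. ?d x \<partial>M (Suc N))"
        by (rule Bochner_Integration.integral_add) (use iv id in auto)
      also have "(\<integral>x. ?d x \<partial>M (Suc N)) = (\<Sum>n\<in>{Suc (k (Suc N))..K N}. \<integral>x. \<bar>(X0 N n x)\<^sup>2 - (Y N n x)\<^sup>2\<bar> \<partial>M (Suc N))"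
        by (rule Bochner_Integration.integral_sum) (use iD(3) in auto)
      also have "\<dots> \<le> (\<Sum>n\<in>{Suc (k (Suc N))..K N}. 4 * exceed2 (M (Suc N)) (a N) (X0 N n))"
        by (rule sum_mono) (rule iD(4))
      also have "\<dots> = 4 * L N (a N)" by (simp add: L_def sum_distrib_left)
      finally show ?case using elim by simp
    qed
  qed
  have weakS: "(\<lambda>N. \<integral>x. g (F (Suc N) x) \<partial>M (Suc N)) \<longlonglongrightarrow> (\<integral>x. g x \<partial>lam)"
    if g: "continuous_on UNIV g" "\<And>x. \<bar>g x\<bar> \<le> B" for g :: "'x \<Rightarrow> real" and B
  proof -
    have "bounded (range g)" using g(2) by (auto simp: bounded_iff)
    then have "(\<lambda>N. integral\<^sup>L (distr (M N) borel (F N)) g) \<longlonglongrightarrow> integral\<^sup>L lam g"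
      using weak g(1) unfolding weak_conv_meas_def by blast
    then have "(\<lambda>N. integral\<^sup>L (distr (M (Suc N)) borel (F (Suc N))) g) \<longlonglongrightarrow> integral\<^sup>L lam g" by (rule LIMSEQ_Suc)
    moreover have "integral\<^sup>L (distr (M (Suc N)) borel (F (Suc N))) g = (\<integral>x. g (F (Suc N) x) \<partial>M (Suc N))" for N
      by (rule integral_distr[OF filtration_measurable(1)[OF flS F] borel_measurable_continuous_onI[OF g(1)]]) simp
    ultimately show ?thesis by simp
  qed
  have a20: "(\<lambda>N. 2 * a N) \<longlonglongrightarrow> 0" using tendsto_mult_right_zero[OF a(2), of 2] by simp
  have arr: "bounded_mds_array (\<lambda>N. M (Suc N)) (\<lambda>N. G (Suc N)) Y (\<lambda>N. 2 * a N) (\<lambda>N. real (Suc N)) (\<lambda>N. k (Suc N)) T C V (\<lambda>N. F (Suc N)) lam \<gamma>"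
  proof (rule bounded_mds_array.intro)
    show "prob_space (M (Suc N))" "filtration_on (M (Suc N)) (G (Suc N))" "mds (M (Suc N)) (G (Suc N)) (Y N)" for N
      by (rule prS flS tc(1))+
    show "\<bar>Y N n x\<bar> \<le> 2 * a N" for N n x by (rule tc(2))
    show "(\<lambda>N. 2 * a N) \<longlonglongrightarrow> 0" "0 < T" "0 < C" "prob_space lam" "sets lam = sets borel"
      "gaussian_ii_law T V \<gamma>" "space \<gamma> = cont_paths T" by (rule a20 T C(1) lam \<gamma>)+
    show "0 \<le> real (Suc N)" for N by simp
    show "(\<lambda>N. \<integral>x. \<bar>(\<Sum>n\<in>{Suc (k (Suc N))..k (Suc N) + nat \<lfloor>real (Suc N) * t\<rfloor>}. (Y N n x)\<^sup>2) - V t\<bar> \<partial>M (Suc N)) \<longlonglongrightarrow> 0"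
      if "t \<in> {0..T}" for t by (rule Q[OF that])
    show "0 \<le> V t - V s" "V t - V s \<le> C * (t - s)" if "0 \<le> s" "s \<le> t" "t \<le> T" for s t
      using Vinc[of s t] that by auto
    show "F (Suc N) \<in> measurable (G (Suc N) (k (Suc N))) borel" for N by (rule F) simp
    show "(\<lambda>N. \<integral>x. g (F (Suc N) x) \<partial>M (Suc N)) \<longlonglongrightarrow> (\<integral>x. g x \<partial>lam)"
      if "continuous_on UNIV g" "\<And>x. \<bar>g x\<bar> \<le> B" for g :: "'x \<Rightarrow> real" and B by (rule weakS[OF that])
  qed
  interpret arr: bounded_mds_array "\<lambda>N. M (Suc N)" "\<lambda>N. G (Suc N)" Y "\<lambda>N. 2 * a N" "\<lambda>N. real (Suc N)" "\<lambda>N. k (Suc N)" T C V "\<lambda>N. F (Suc N)" lam \<gamma>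
    by (rule arr)
  define Xi where "Xi N x = xi_proc T U (Suc N) (k (Suc N)) x" for N x
  have Xi_eq: "Xi N x = (\<lambda>t. if t \<in> {0..T} then \<Sum>n\<in>{Suc (k (Suc N))..k (Suc N) + nat \<lfloor>real (Suc N) * t\<rfloor>}. U (Suc N) n x / sqrt (real (Suc N)) else 0)" for N x
    unfolding Xi_def xi_proc_def by (simp add: sum_divide_distrib fun_eq_iff)
  have Xi_D: "Xi N x \<in> Dspace T" for N x
    unfolding Xi_eq using floor_path_in_Dspace[of "real (Suc N)" T "\<lambda>i. \<Sum>n\<in>{Suc (k (Suc N))..k (Suc N) + i}. U (Suc N) n x / sqrt (real (Suc N))"] T
    by simp
  have Xi_meas: "(\<lambda>x. h (F (Suc N) x, Xi N x)) \<in> borel_measurable (M (Suc N))" if h: "dcont (XD T) (dist_XD T) h" for h :: "'x \<times> (real \<Rightarrow> real) \<Rightarrow> real" and N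
    unfolding Xi_eq
  proof (rule floor_sum_functional_measurable[where X="\<lambda>n x. U (Suc N) n x / sqrt (real (Suc N))", OF T _ h arr.F_measurable_M])
    show "(\<lambda>x. U (Suc N) (Suc n) x / sqrt (real (Suc N))) \<in> borel_measurable (M (Suc N))" for n
      using U_measurable[of "Suc N" "Suc n"] by simp
  qed simp
  have Rm[measurable]: "R (Suc N) n \<in> borel_measurable (M (Suc N))" for N n by (rule R_measurable_M) simp
  have R2: "integrable (M (Suc N)) (\<lambda>x. (R (Suc N) n x)\<^sup>2)" for N n by (rule R_square_integrable) simp
  have D1m[measurable]: "D1 N \<in> borel_measurable (M (Suc N))" for N using D1i by auto
  define bad where "bad e N = {x \<in> space (M (Suc N)). e < D1 N x} \<union>
      (\<Union>n\<in>{k (Suc N)..K N}. {x \<in> space (M (Suc N)). e * sqrt (real (Suc N)) < \<bar>R (Suc N) n x\<bar>})" for e N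
  have bad_sets: "bad e N \<in> sets (M (Suc N))" for e N unfolding bad_def by measurable
  \<comment> \<open>One e for the truncation and one for the corrector at each end of the
    sum.\<close>
  have close: "sup_dist T (Xi N x) (arr.S N x) \<le> 3 * e" if x: "x \<in> space (M (Suc N))" "x \<notin> bad e N" for e N x
  proof (rule sup_dist_le)
    fix t assume t: "t \<in> {0..T}"
    let ?k = "k (Suc N)" let ?r = "k (Suc N) + nat \<lfloor>real (Suc N) * t\<rfloor>" let ?s = "sqrt (real (Suc N))"
    have "nat \<lfloor>real (Suc N) * t\<rfloor> \<le> nat \<lfloor>real (Suc N) * T\<rfloor>" using t by (intro nat_mono floor_mono mult_left_mono) auto
    then have rK: "?r \<le> K N" by (simp add: K_def)
    have D: "D1 N x \<le> e" and Rb: "\<bar>R (Suc N) n x\<bar> \<le> e * ?s" if "n \<in> {?k..K N}" for n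
      using x that unfolding bad_def by (auto simp: not_less)
    have "Xi N x t = (\<Sum>n\<in>{Suc ?k..?r}. U (Suc N) n x) / ?s" using t by (simp add: Xi_eq sum_divide_distrib)
    also have "\<dots> = (\<Sum>n\<in>{Suc ?k..?r}. X0 N n x) + (R (Suc N) ?k x - R (Suc N) ?r x) / ?s"
      unfolding X0_def by (subst sum_eq_sum_Wmart[where M=M and G=G]) (simp_all add: sum_divide_distrib add_divide_distrib diff_divide_distrib)
    finally have XiN: "Xi N x t = (\<Sum>n\<in>{Suc ?k..?r}. X0 N n x) + (R (Suc N) ?k x - R (Suc N) ?r x) / ?s" .
    have arrS: "arr.S N x t = (\<Sum>n\<in>{Suc ?k..?r}. Y N n x)" using t unfolding arr.S_def arr.idx_def by simp
    have diff: "Xi N x t - arr.S N x t = (\<Sum>n\<in>{Suc ?k..?r}. X0 N n x - Y N n x) + (R (Suc N) ?k x - R (Suc N) ?r x) / ?s"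
      unfolding sum_subtractf arrS XiN by (simp only: diff_add_eq)
    have "\<bar>Xi N x t - arr.S N x t\<bar> \<le> \<bar>\<Sum>n\<in>{Suc ?k..?r}. X0 N n x - Y N n x\<bar> + \<bar>(R (Suc N) ?k x - R (Suc N) ?r x) / ?s\<bar>" unfolding diff by (rule abs_triangle_ineq)
    also have "\<dots> \<le> e + 2 * e"
    proof (rule add_mono)
      have "\<bar>\<Sum>n\<in>{Suc ?k..?r}. X0 N n x - Y N n x\<bar> \<le> (\<Sum>n\<in>{Suc ?k..?r}. \<bar>X0 N n x - Y N n x\<bar>)" by (rule sum_abs)
      also have "\<dots> \<le> D1 N x" unfolding D1_def by (rule sum_mono2) (use rK in auto)
      also have "\<dots> \<le> e" using D[of ?k] rK by simp
      finally show "\<bar>\<Sum>n\<in>{Suc ?k..?r}. X0 N n x - Y N n x\<bar> \<le> e" .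
      have "\<bar>R (Suc N) ?k x - R (Suc N) ?r x\<bar> \<le> \<bar>R (Suc N) ?k x\<bar> + \<bar>R (Suc N) ?r x\<bar>" by (rule abs_triangle_ineq4)
      also have "\<dots> \<le> e * ?s + e * ?s" by (rule add_mono; rule Rb) (use rK in auto)
      finally have "\<bar>R (Suc N) ?k x - R (Suc N) ?r x\<bar> \<le> 2 * e * ?s" by simp
      then show "\<bar>(R (Suc N) ?k x - R (Suc N) ?r x) / ?s\<bar> \<le> 2 * e"
        by (simp only: abs_divide abs_of_pos[OF sqN] pos_divide_le_eq[OF sqN])
    qed
    finally show "\<bar>Xi N x t - arr.S N x t\<bar> \<le> 3 * e" by simp
  qed (use T in simp)
  have bad_small: "eventually (\<lambda>N. measure (M (Suc N)) (bad e N) \<le> \<eta>) sequentially" if e: "0 < e" and \<eta>: "0 < \<eta>" for e \<eta> :: real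
  proof -
    \<comment> \<open>At most (N + 1) * (T + 1) corrector values are involved, each exceeding e *
      sqrt (N + 1) with probability at most \<kappa> / (e^2 (N + 1)); this \<kappa> makes the total
      \<eta> / 2.\<close>
    define \<kappa> where "\<kappa> = \<eta> * e\<^sup>2 / (2 * (T + 1))"
    have \<kappa>: "0 < \<kappa>" using \<eta> e T by (simp add: \<kappa>_def)
    obtain Kc where Kc: "0 < Kc" "\<And>i K'. i \<in> Idx \<Longrightarrow> Kc \<le> K' \<Longrightarrow> exceed2 (P i) K' (R (fst i) (snd i)) \<le> \<kappa>"
      using ui2_exceed[OF probP ui2_R \<kappa>] by blast
    have ev1: "eventually (\<lambda>N. Kc \<le> e * sqrt (real (Suc N))) sequentially"
      using sqinf[OF e] unfolding filterlim_at_top by blast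
    have ev2: "eventually (\<lambda>N. 2 * a N < e * \<eta> / 2) sequentially" by (rule order_tendstoD(2)[OF a20]) (use e \<eta> in simp)
    show ?thesis using ev1 ev2 D1e
    proof eventually_elim
      case (elim N)
      let ?s = "sqrt (real (Suc N))"
      let ?A = "\<lambda>n. {x \<in> space (M (Suc N)). e * ?s < \<bar>R (Suc N) n x\<bar>}"
      have "measure (M (Suc N)) {x \<in> space (M (Suc N)). e < D1 N x} \<le> measure (M (Suc N)) {x \<in> space (M (Suc N)). e \<le> D1 N x}"
        by (rule arr.P.finite_measure_mono) (auto intro!: measurable_sets)
      also have "\<dots> \<le> (\<integral>x. D1 N x \<partial>M (Suc N)) / e"
        by (rule integral_Markov_inequality_measure[OF D1i]) (use e in \<open>auto simp: D1_def sum_nonneg\<close>)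
      also have "\<dots> \<le> (e * \<eta> / 2) / e" using elim e by (intro divide_right_mono) auto
      also have "\<dots> = \<eta> / 2" using e by simp
      finally have 1: "measure (M (Suc N)) {x \<in> space (M (Suc N)). e < D1 N x} \<le> \<eta> / 2" .
      have A: "measure (M (Suc N)) (?A n) \<le> \<kappa> / (e * ?s)\<^sup>2" for n
      proof -
        have "measure (M (Suc N)) (?A n) \<le> exceed2 (M (Suc N)) (e * ?s) (R (Suc N) n) / (e * ?s)\<^sup>2"
          by (rule arr.P.prob_exceed[OF Rm R2]) (use e in simp)
        also have "\<dots> \<le> \<kappa> / (e * ?s)\<^sup>2" using Kc(2)[of "(Suc N, n)", OF _ elim(1)] by (intro divide_right_mono) auto
        finally show ?thesis .
      qed
      have D1s: "{x \<in> space (M (Suc N)). e < D1 N x} \<in> sets (M (Suc N))" by measurable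
      have Am: "?A n \<in> sets (M (Suc N))" for n by measurable
      have "measure (M (Suc N)) (\<Union>n\<in>{k (Suc N)..K N}. ?A n) \<le> (\<Sum>n\<in>{k (Suc N)..K N}. measure (M (Suc N)) (?A n))"
        by (rule measure_UNION_le) (use Am in auto)
      also have "\<dots> \<le> (\<Sum>n\<in>{k (Suc N)..K N}. \<kappa> / (e * ?s)\<^sup>2)" by (rule sum_mono) (rule A)
      also have "\<dots> = (real (K N) - real (k (Suc N)) + 1) * (\<kappa> / (e * ?s)\<^sup>2)"
        using cardK(2)[of N] by (simp add: of_nat_diff)
      also have "\<dots> \<le> (real (Suc N) * (T + 1)) * (\<kappa> / (e * ?s)\<^sup>2)"
      proof (rule mult_right_mono)
        show "real (K N) - real (k (Suc N)) + 1 \<le> real (Suc N) * (T + 1)" using Kk[of N] by (simp add: distrib_left)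
      qed (use \<kappa> in simp)
      also have "\<dots> = \<eta> / 2"
      proof -
        have sq: "(e * ?s)\<^sup>2 = e\<^sup>2 * real (Suc N)" by (simp add: power_mult_distrib)
        have "n * t * (\<eta> * e\<^sup>2 / (2 * t) / (e\<^sup>2 * n)) = \<eta> / 2" if "0 < n" "0 < t" for n t :: real
          using that e by (simp add: field_simps)
        from this[of "real (Suc N)" "T + 1"] T show ?thesis unfolding \<kappa>_def sq by linarith
      qed
      finally have 2: "measure (M (Suc N)) (\<Union>n\<in>{k (Suc N)..K N}. ?A n) \<le> \<eta> / 2" .
      have "measure (M (Suc N)) (bad e N) \<le> measure (M (Suc N)) {x \<in> space (M (Suc N)). e < D1 N x} + measure (M (Suc N)) (\<Union>n\<in>{k (Suc N)..K N}. ?A n)"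
        unfolding bad_def by (rule measure_Un_le) (rule D1s, rule sets.finite_UN[OF finite_atLeastAtMost Am])
      then show ?case using 1 2 by linarith
    qed
  qed
  have lip: "(\<lambda>N. \<integral>x. h (F (Suc N) x, Xi N x) \<partial>M (Suc N)) \<longlonglongrightarrow> (\<integral>p. h p \<partial>(lam \<Otimes>\<^sub>M \<gamma>))"
    if hB: "\<And>p. p \<in> XD T \<Longrightarrow> \<bar>h p\<bar> \<le> B" and Lp: "0 \<le> Lc"
      and hL: "\<And>p q. p \<in> XD T \<Longrightarrow> q \<in> XD T \<Longrightarrow> \<bar>h p - h q\<bar> \<le> Lc * dist_XD T p q"
    for h :: "'x \<times> (real \<Rightarrow> real) \<Rightarrow> real" and Lc B
  proof -
    have hc: "dcont (XD T) (dist_XD T) h" by (rule dcont_lipschitz[OF hL Lp])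
    have B0: "0 \<le> B" using hB[of "(undefined, Xi 0 undefined)"] Xi_D by fastforce
    \<comment> \<open>Off the exceptional event the two paths are uniformly close, so a Lipschitz
      functional cannot separate them; this transfers the limit from the truncated martingale to the
      original sums.\<close>
    have "(\<lambda>N. (\<integral>x. h (F (Suc N) x, Xi N x) \<partial>M (Suc N)) - (\<integral>x. h (F (Suc N) x, arr.S N x) \<partial>M (Suc N))) \<longlonglongrightarrow> 0"
    proof (rule LIMSEQ_I)
      fix \<epsilon> :: real assume \<epsilon>: "0 < \<epsilon>"
      define e where "e = \<epsilon> / (12 * (Lc + 1))"
      have e: "0 < e" "Lc * (3 * e) \<le> \<epsilon> / 4" using \<epsilon> Lp by (simp_all add: e_def field_simps)
      define \<eta> where "\<eta> = \<epsilon> / (8 * (B + 1))"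
      have \<eta>: "0 < \<eta>" "2 * B * \<eta> \<le> \<epsilon> / 4" using \<epsilon> B0 by (simp_all add: \<eta>_def field_simps)
      have "eventually (\<lambda>N. norm ((\<integral>x. h (F (Suc N) x, Xi N x) \<partial>M (Suc N)) - (\<integral>x. h (F (Suc N) x, arr.S N x) \<partial>M (Suc N)) - 0) < \<epsilon>) sequentially"
        using bad_small[OF e(1) \<eta>(1)]
      proof eventually_elim
        case (elim N)
          have i1: "integrable (M (Suc N)) (\<lambda>x. h (F (Suc N) x, Xi N x))"
          by (rule arr.P.integrable_const_bound[where B=B, OF _ Xi_meas[OF hc]]) (use hB Xi_D in auto)
        have i2: "integrable (M (Suc N)) (\<lambda>x. h (F (Suc N) x, arr.S N x))"
          by (rule arr.P.integrable_const_bound[where B=B, OF _ arr.S_functional_measurable[OF hc]]) (use hB arr.S_Dspace in auto)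
        have ib: "integrable (M (Suc N)) (\<lambda>x. indicator (bad e N) x :: real)"
          by (rule arr.P.integrable_const_bound[where B=1]) (use bad_sets in auto)
        have "norm (\<integral>x. h (F (Suc N) x, Xi N x) - h (F (Suc N) x, arr.S N x) \<partial>M (Suc N)) \<le> (\<integral>x. Lc * (3 * e) + 2 * B * indicator (bad e N) x \<partial>M (Suc N))"
        proof (rule norm_integral_le)
          fix x assume x: "x \<in> space (M (Suc N))"
          show "norm (h (F (Suc N) x, Xi N x) - h (F (Suc N) x, arr.S N x)) \<le> Lc * (3 * e) + 2 * B * indicator (bad e N) x"
          proof (cases "x \<in> bad e N")
            case True
            have "\<bar>h (F (Suc N) x, Xi N x)\<bar> \<le> B" "\<bar>h (F (Suc N) x, arr.S N x)\<bar> \<le> B" using hB Xi_D arr.S_Dspace by auto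
            moreover have "0 \<le> Lc * (3 * e)" using Lp e by simp
            ultimately show ?thesis using True by simp
          next
            case False
            have "\<bar>h (F (Suc N) x, Xi N x) - h (F (Suc N) x, arr.S N x)\<bar> \<le> Lc * dist_XD T (F (Suc N) x, Xi N x) (F (Suc N) x, arr.S N x)"
              by (rule hL) (use Xi_D arr.S_Dspace in auto)
            also have "\<dots> \<le> Lc * (3 * e)" using close[OF x False] Lp by (intro mult_left_mono) (auto simp: dist_XD_def)
            finally show ?thesis using False by simp
          qed
        qed (use i1 i2 ib in auto)
        also have "\<dots> = Lc * (3 * e) + 2 * B * measure (M (Suc N)) (bad e N)"
          using ib bad_sets sets.sets_into_space[OF bad_sets] by (simp add: arr.P.prob_space Int_absorb2)
        also have "\<dots> \<le> Lc * (3 * e) + 2 * B * \<eta>" using elim B0 by (intro add_left_mono mult_left_mono) auto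
        also have "\<dots> < \<epsilon>" using e(2) \<eta>(2) \<epsilon> by linarith
        finally show ?case using i1 i2 by simp
      qed
      then show "\<exists>no. \<forall>N\<ge>no. norm ((\<integral>x. h (F (Suc N) x, Xi N x) \<partial>M (Suc N)) - (\<integral>x. h (F (Suc N) x, arr.S N x) \<partial>M (Suc N)) - 0) < \<epsilon>"
        by (simp add: eventually_sequentially)
    qed
    from tendsto_add[OF this arr.lipschitz_limit[OF hB Lp hL]] show ?thesis by simp
  qed
  have "weak_conv_XD T M F (\<lambda>N. xi_proc T U N (k N)) (lam \<Otimes>\<^sub>M \<gamma>)"
    unfolding weak_conv_XD_def
  proof (intro allI impI)
    fix h :: "'x \<Rightarrow> (real \<Rightarrow> real) \<Rightarrow> real" assume h: "bcont_XD T h"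
    let ?h = "\<lambda>p. h (fst p) (snd p)"
    have T0: "0 \<le> T" using T by simp
    have hc: "dcont (XD T) (dist_XD T) ?h" by (rule bcont_XD_imp_dcont[OF T0 h])
    obtain B where B: "\<And>x f. f \<in> Dspace T \<Longrightarrow> \<bar>h x f\<bar> \<le> B" using h unfolding bcont_XD_def by blast
    have spc: "p \<in> XD T" if "p \<in> space (lam \<Otimes>\<^sub>M \<gamma>)" for p
    proof -
      have "snd p \<in> cont_paths T" using that unfolding space_pair_measure \<gamma>(2) mem_Times_iff by (rule conjunct2)
      then show ?thesis using cont_paths_subset_Dspace by (auto simp: mem_Times_iff)
    qed
    have "(\<lambda>N. \<integral>x. ?h (F (Suc N) x, Xi N x) \<partial>M (Suc N)) \<longlonglongrightarrow> (\<integral>p. ?h p \<partial>(lam \<Otimes>\<^sub>M \<gamma>))"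
    proof (rule weak_limit_from_lipschitz[where S="XD T" and d="dist_XD T" and h="?h" and B=B and Z="\<lambda>N x. (F (Suc N) x, Xi N x)" and Y="\<lambda>p. p"])
      show "pseudometric_on (XD T) (dist_XD T)" by (rule pseudometric_XD[OF T0])
      show "prob_space (lam \<Otimes>\<^sub>M \<gamma>)" by (rule arr.lg.prob_space_axioms)
      show "(\<lambda>w. g (F (Suc N) w, Xi N w)) \<in> borel_measurable (M (Suc N))" if "dcont (XD T) (dist_XD T) g" for g :: "'x \<times> (real \<Rightarrow> real) \<Rightarrow> real" and N
        by (rule Xi_meas[OF that])
      show "g \<in> borel_measurable (lam \<Otimes>\<^sub>M \<gamma>)" if "dcont (XD T) (dist_XD T) g" for g :: "'x \<times> (real \<Rightarrow> real) \<Rightarrow> real"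
        by (rule measurable_XD_functional[OF T that \<gamma>(2) arr.eval_meas lam(2)])
      show "\<bar>?h p\<bar> \<le> B" if "p \<in> XD T" for p using that B by auto
      show "(\<lambda>N. \<integral>w. g (F (Suc N) w, Xi N w) \<partial>M (Suc N)) \<longlonglongrightarrow> (\<integral>w. g w \<partial>(lam \<Otimes>\<^sub>M \<gamma>))"
        if "\<And>p. p \<in> XD T \<Longrightarrow> \<bar>g p\<bar> \<le> B'" "0 \<le> Lc"
          "\<And>p q. p \<in> XD T \<Longrightarrow> q \<in> XD T \<Longrightarrow> \<bar>g p - g q\<bar> \<le> Lc * dist_XD T p q"
        for g :: "'x \<times> (real \<Rightarrow> real) \<Rightarrow> real" and Lc B' by (rule lip[OF that])
    qed (use prS Xi_D spc hc in auto)
    then have "(\<lambda>N. \<integral>x. h (F (Suc N) x) (xi_proc T U (Suc N) (k (Suc N)) x) \<partial>M (Suc N)) \<longlonglongrightarrow> (\<integral>p. ?h p \<partial>(lam \<Otimes>\<^sub>M \<gamma>))"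
      by (simp add: Xi_def)
    then show "(\<lambda>N. \<integral>x. h (F N x) (xi_proc T U N (k N) x) \<partial>M N) \<longlonglongrightarrow> (\<integral>p. ?h p \<partial>(lam \<Otimes>\<^sub>M \<gamma>))"
      by (rule LIMSEQ_imp_Suc)
  qed
  with \<gamma> show ?thesis by blast
qed

end

section \<open>Marginal convergence, shifted windows and assembly\<close>

lemma weak_conv_meas_constant:
  assumes "\<And>N. N \<ge> 1 \<Longrightarrow> prob_space (M N)"
  shows "weak_conv_meas (\<lambda>N. distr (M N) borel (\<lambda>_. u)) (return borel (u :: 'x::metric_space))"
  unfolding weak_conv_meas_def
proof (intro allI impI)
  fix g :: "'x \<Rightarrow> real" assume g: "continuous_on UNIV g \<and> bounded (range g)"
  have gm[measurable]: "g \<in> borel_measurable borel" using g by (intro borel_measurable_continuous_onI) auto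
  have "eventually (\<lambda>N. integral\<^sup>L (distr (M N) borel (\<lambda>_. u)) g = g u) sequentially"
    using eventually_ge_at_top[of 1]
  proof eventually_elim
    case (elim N)
    interpret prob_space "M N" by (rule assms[OF elim])
    show ?case by (simp add: integral_return gm)
  qed
  then show "(\<lambda>N. integral\<^sup>L (distr (M N) borel (\<lambda>_. u)) g) \<longlonglongrightarrow> integral\<^sup>L (return borel u) g"
    by (simp add: integral_return gm tendsto_eventually)
qed

text \<open>Test functions that ignore the first coordinate, combined with Fubini's theorem for the
  product limit.\<close>

lemma weak_conv_D_of_XD:
  fixes \<gamma> :: "(real \<Rightarrow> real) measure" and lam :: "'x::polish_space measure"
  assumes T: "0 < T" and \<gamma>: "gaussian_ii_law T V \<gamma>" "space \<gamma> = cont_paths T"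
    and lam: "prob_space lam" "sets lam = sets borel"
    and conv: "weak_conv_XD T M F Xi (lam \<Otimes>\<^sub>M \<gamma>)"
  shows "weak_conv_D T M Xi \<gamma>"
  unfolding weak_conv_D_def
proof (intro allI impI)
  fix h assume h: "bcont_D T h"
  obtain B where B: "\<And>f. f \<in> Dspace T \<Longrightarrow> \<bar>h f\<bar> \<le> B" using h unfolding bcont_D_def by blast
  have h': "bcont_XD T (\<lambda>(x::'x) f. h f)"
    unfolding bcont_XD_def
  proof (intro conjI allI ballI impI)
    show "\<exists>B. \<forall>x::'x. \<forall>f\<in>Dspace T. \<bar>h f\<bar> \<le> B" using B by blast
    fix x :: 'x and f and e :: real assume "f \<in> Dspace T" "0 < e"
    then obtain d where d: "0 < d" "\<And>g. g \<in> Dspace T \<Longrightarrow> sk_dist T f g < d \<Longrightarrow> \<bar>h f - h g\<bar> < e"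
      using h unfolding bcont_D_def by blast
    show "\<exists>d>0. \<forall>y::'x. \<forall>g\<in>Dspace T. dist x y + sk_dist T f g < d \<longrightarrow> \<bar>h f - h g\<bar> < e"
    proof (intro exI conjI allI ballI impI)
      fix y :: 'x and g assume g: "g \<in> Dspace T" "dist x y + sk_dist T f g < d"
      have "sk_dist T f g < d" using g(2) zero_le_dist[of x y] by linarith
      then show "\<bar>h f - h g\<bar> < e" using d(2) g(1) by blast
    qed (rule d(1))
  qed
  interpret lam: prob_space lam by fact
  interpret \<gamma>: prob_space \<gamma> using \<gamma>(1) by (simp add: gaussian_ii_law_def)
  interpret lg: pair_prob_space lam \<gamma> ..
  have hm: "(\<lambda>p. h (snd p)) \<in> borel_measurable (lam \<Otimes>\<^sub>M \<gamma>)"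
    using measurable_XD_functional[OF T bcont_XD_imp_dcont[OF less_imp_le[OF T] h'] \<gamma>(2) gaussian_law_eval_measurable[OF \<gamma>] lam(2)]
    by simp
  have "integrable (lam \<Otimes>\<^sub>M \<gamma>) (\<lambda>p. h (snd p))"
  proof (rule lg.integrable_const_bound[OF AE_I2 hm])
    fix p assume "p \<in> space (lam \<Otimes>\<^sub>M \<gamma>)"
    then have "snd p \<in> cont_paths T" unfolding space_pair_measure \<gamma>(2) mem_Times_iff by (rule conjunct2)
    then show "norm (h (snd p)) \<le> B" using B cont_paths_subset_Dspace by auto
  qed
  from lg.integral_fst'[OF this] have "(\<integral>p. h (snd p) \<partial>(lam \<Otimes>\<^sub>M \<gamma>)) = (\<integral>f. h f \<partial>\<gamma>)"
    by (simp add: lam.prob_space)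
  then show "(\<lambda>N. \<integral>\<omega>. h (Xi N \<omega>) \<partial>M N) \<longlonglongrightarrow> (\<integral>f. h f \<partial>\<gamma>)"
    using conv h' unfolding weak_conv_XD_def by auto
qed

context mixingale_array
begin

lemma vari_limit_iff_L1_norm:
  "(\<lambda>N. L1_norm (M N) (\<lambda>\<omega>. (\<Sum>n\<in>{k N + 1..k N + nat \<lfloor>real N * t\<rfloor>}. (W N n \<omega>)\<^sup>2) / real N - v)) \<longlonglongrightarrow> 0
    \<longleftrightarrow> (\<lambda>N. \<integral>x. \<bar>vari (k N) N t x - v\<bar> \<partial>M N) \<longlonglongrightarrow> 0"
  unfolding vari_def[symmetric]
proof (rule L1_norm_tendsto_iff)
  fix N :: nat assume N: "N \<ge> 1"
  interpret N: prob_space "M N" by (rule prob[OF N])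
  show "integrable (M N) (\<lambda>x. vari (k N) N t x - v)" using vari_integrable[OF N] by simp
qed

text \<open>The variance over a shifted window is a difference of two sums from time 0. Moving their
  endpoints from \<open>k N\<close> and \<open>k N + \<lfloor>N * t\<rfloor>\<close> to the rounded
  times N * t0 and N * (t + t0) changes at most 2 * |k N - N * t0| + 3 summands in all, each of
  expectation at most \<open>C\<close>. The 3 collects the three roundings.\<close>

lemma vari_shift_limit:
  assumes k: "(\<lambda>N. real (k N) / real N) \<longlonglongrightarrow> t0" and t: "0 \<le> t"
    and A: "\<And>t. 0 \<le> t \<Longrightarrow> (\<lambda>N. \<integral>x. \<bar>vari 0 N t x - A t\<bar> \<partial>M N) \<longlonglongrightarrow> 0"
  shows "(\<lambda>N. \<integral>x. \<bar>vari (k N) N t x - (A (t + t0) - A t0)\<bar> \<partial>M N) \<longlonglongrightarrow> 0"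
proof -
  have t0: "0 \<le> t0" by (rule tendsto_lowerbound[OF k]) auto
  obtain C where C: "0 < C" "\<And>N n. N \<ge> 1 \<Longrightarrow> integrable (M N) (\<lambda>x. (W N (Suc n) x)\<^sup>2)"
    "\<And>N n. N \<ge> 1 \<Longrightarrow> (\<integral>x. (W N (Suc n) x)\<^sup>2 \<partial>M N) \<le> C"
    using W_moments by blast
  let ?b = "\<lambda>N. (\<integral>x. \<bar>vari 0 N (t + t0) x - A (t + t0)\<bar> \<partial>M N) + (\<integral>x. \<bar>vari 0 N t0 x - A t0\<bar> \<partial>M N)
      + C * (2 * \<bar>real (k N) / real N - t0\<bar> + 3 / real N)"
  have b0: "?b \<longlonglongrightarrow> 0 + 0 + C * (2 * \<bar>t0 - t0\<bar> + 0)"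
    by (intro tendsto_intros A k lim_const_over_n) (use t t0 in auto)
  define S where "S N l x = (\<Sum>n\<in>{Suc 0..l}. (W N n x)\<^sup>2)" for N l x
  have Si: "integrable (M N) (S N l)" if "N \<ge> 1" for N l
    using W_sum_integrable[OF that] by (simp add: S_def[abs_def])
  have Sd: "S N r x - S N l x = (\<Sum>n\<in>{Suc l..r}. (W N n x)\<^sup>2)" if "l \<le> r" for N l r x
  proof -
    have "{Suc 0..r} = {Suc 0..l} \<union> {Suc l..r}" using that by auto
    then show ?thesis unfolding S_def by (simp add: sum.union_disjoint)
  qed
  have Sle0: "(\<integral>x. \<bar>S N r x - S N l x\<bar> \<partial>M N) \<le> C * (real r - real l)" if "N \<ge> 1" "l \<le> r" for N l r
    unfolding Sd[OF that(2)] using W_sum_integral_le[OF that(1) C(3)[OF that(1)] that(2)] by (simp add: sum_nonneg)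
  have Sle: "(\<integral>x. \<bar>S N r x - S N l x\<bar> \<partial>M N) \<le> C * \<bar>real r - real l\<bar>" if "N \<ge> 1" for N l r
    using Sle0[OF that, of l r] Sle0[OF that, of r l] by (cases "l \<le> r") (auto simp: abs_minus_commute)
  have "eventually (\<lambda>N. norm (\<integral>x. \<bar>vari (k N) N t x - (A (t + t0) - A t0)\<bar> \<partial>M N) \<le> ?b N) sequentially"
    using eventually_ge_at_top[of 1]
  proof eventually_elim
    case (elim N)
    interpret N: prob_space "M N" by (rule prob[OF elim])
    let ?n = "real N"
    let ?p = "k N" and ?q = "k N + nat \<lfloor>?n * t\<rfloor>" and ?p' = "nat \<lfloor>?n * t0\<rfloor>" and ?q' = "nat \<lfloor>?n * (t + t0)\<rfloor>"
    have n: "0 < ?n" using elim by simp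
    have v: "vari 0 N s x = S N (nat \<lfloor>?n * s\<rfloor>) x / ?n" for s x by (simp add: vari_def S_def)
    have vk: "vari (k N) N t x = (S N ?q x - S N ?p x) / ?n" for x by (simp add: vari_def Sd)
    let ?f = "\<lambda>x. \<bar>vari 0 N (t + t0) x - A (t + t0)\<bar> + \<bar>vari 0 N t0 x - A t0\<bar> + (\<bar>S N ?q x - S N ?q' x\<bar> + \<bar>S N ?p x - S N ?p' x\<bar>) / ?n"
    have "norm (\<integral>x. \<bar>vari (k N) N t x - (A (t + t0) - A t0)\<bar> \<partial>M N) \<le> (\<integral>x. ?f x \<partial>M N)"
    proof (rule norm_integral_le)
      fix x
      have eq: "vari (k N) N t x - (A (t + t0) - A t0) = (vari 0 N (t + t0) x - A (t + t0)) - (vari 0 N t0 x - A t0)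
          + ((S N ?q x - S N ?q' x) - (S N ?p x - S N ?p' x)) / ?n"
        unfolding v vk by (simp add: diff_divide_distrib)
      have le: "\<bar>((S N ?q x - S N ?q' x) - (S N ?p x - S N ?p' x)) / ?n\<bar> \<le> (\<bar>S N ?q x - S N ?q' x\<bar> + \<bar>S N ?p x - S N ?p' x\<bar>) / ?n"
        unfolding abs_divide abs_of_pos[OF n] by (intro divide_right_mono abs_triangle_ineq4) simp
      have "\<bar>a - b + d\<bar> \<le> \<bar>a\<bar> + \<bar>b\<bar> + e" if "\<bar>d\<bar> \<le> e" for a b d e :: real
        using that by linarith
      from this[OF le] show "norm \<bar>vari (k N) N t x - (A (t + t0) - A t0)\<bar> \<le> ?f x"
        unfolding real_norm_def abs_idempotent eq .
    qed (intro integrable_abs integrable_divide_zero Bochner_Integration.integrable_add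
        Bochner_Integration.integrable_diff vari_integrable Si elim N.integrable_const)+
    also have "\<dots> = (\<integral>x. \<bar>vari 0 N (t + t0) x - A (t + t0)\<bar> \<partial>M N) + (\<integral>x. \<bar>vari 0 N t0 x - A t0\<bar> \<partial>M N)
        + ((\<integral>x. \<bar>S N ?q x - S N ?q' x\<bar> \<partial>M N) + (\<integral>x. \<bar>S N ?p x - S N ?p' x\<bar> \<partial>M N)) / ?n"
    proof -
      have lin: "(\<integral>x. f1 x + f2 x + (f3 x + f4 x) / ?n \<partial>M N)
          = (\<integral>x. f1 x \<partial>M N) + (\<integral>x. f2 x \<partial>M N) + ((\<integral>x. f3 x \<partial>M N) + (\<integral>x. f4 x \<partial>M N)) / ?n"
        if "integrable (M N) f1" "integrable (M N) f2" "integrable (M N) f3" "integrable (M N) f4"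
        for f1 f2 f3 f4 :: "'a \<Rightarrow> real" using that by simp
      show ?thesis
        by (rule lin; intro integrable_abs Bochner_Integration.integrable_diff vari_integrable Si elim N.integrable_const)
    qed
    also have "\<dots> \<le> (\<integral>x. \<bar>vari 0 N (t + t0) x - A (t + t0)\<bar> \<partial>M N) + (\<integral>x. \<bar>vari 0 N t0 x - A t0\<bar> \<partial>M N)
        + C * (2 * \<bar>real (k N) / ?n - t0\<bar> + 3 / ?n)"
    proof (rule add_left_mono)
      have fl: "\<bar>real (nat \<lfloor>?n * s\<rfloor>) - ?n * s\<bar> \<le> 1" if "0 \<le> s" for s
        using mult_nonneg_nonneg[OF less_imp_le[OF n] that] floor_correct[of "?n * s"] by (simp add: abs_le_iff) linarith
      have pp: "\<bar>real ?p - real ?p'\<bar> \<le> \<bar>real (k N) - ?n * t0\<bar> + 1" using fl[OF t0] by linarith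
      have qq: "\<bar>real ?q - real ?q'\<bar> \<le> \<bar>real (k N) - ?n * t0\<bar> + 2"
        using fl[OF t] fl[OF add_nonneg_nonneg[OF t t0]] unfolding of_nat_add distrib_left by linarith
      have "(\<integral>x. \<bar>S N ?q x - S N ?q' x\<bar> \<partial>M N) + (\<integral>x. \<bar>S N ?p x - S N ?p' x\<bar> \<partial>M N)
          \<le> C * \<bar>real ?q - real ?q'\<bar> + C * \<bar>real ?p - real ?p'\<bar>"
        by (intro add_mono Sle elim)
      also have "\<dots> \<le> C * (2 * \<bar>real (k N) - ?n * t0\<bar> + 3)"
        unfolding distrib_left[symmetric] by (rule mult_left_mono) (use pp qq C in linarith)+
      finally have "((\<integral>x. \<bar>S N ?q x - S N ?q' x\<bar> \<partial>M N) + (\<integral>x. \<bar>S N ?p x - S N ?p' x\<bar> \<partial>M N)) / ?n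
          \<le> C * (2 * \<bar>real (k N) - ?n * t0\<bar> + 3) / ?n" using n by (intro divide_right_mono) auto
      also have "\<dots> = C * (2 * (\<bar>real (k N) - ?n * t0\<bar> / ?n) + 3 / ?n)" by (simp add: add_divide_distrib ring_distribs)
      also have "\<bar>real (k N) - ?n * t0\<bar> / ?n = \<bar>real (k N) / ?n - t0\<bar>"
        using n by (simp add: abs_divide[symmetric, of _ ?n, simplified abs_of_pos[OF n]] diff_divide_distrib del: abs_divide)
      finally show "((\<integral>x. \<bar>S N ?q x - S N ?q' x\<bar> \<partial>M N) + (\<integral>x. \<bar>S N ?p x - S N ?p' x\<bar> \<partial>M N)) / ?n
          \<le> C * (2 * \<bar>real (k N) / ?n - t0\<bar> + 3 / ?n)" .
    qed
    finally show ?case .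
  qed
  then show ?thesis by (rule Lim_null_comparison) (use b0 in simp)
qed

end

theorem theorem5p6:
  fixes M :: "nat \<Rightarrow> 'a measure"
    and G :: "nat \<Rightarrow> nat \<Rightarrow> 'a measure"
    and U :: "nat \<Rightarrow> nat \<Rightarrow> 'a \<Rightarrow> real"
    and c :: "nat \<Rightarrow> real"
    and A :: "real \<Rightarrow> real"
    and T :: real
    and k :: "nat \<Rightarrow> nat"
    and F :: "nat \<Rightarrow> 'a \<Rightarrow> 'x::polish_space"
    and lam :: "'x measure"
  assumes T_pos: "0 < T"
    and prob: "\<And>N. N \<ge> 1 \<Longrightarrow> prob_space (M N)"
    and filt: "\<And>N. N \<ge> 1 \<Longrightarrow> filtration_on (M N) (G N)"
    and B1: "\<And>N n. N \<ge> 1 \<Longrightarrow> n \<ge> 1 \<Longrightarrow> U N n \<in> borel_measurable (G N n)"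
    and B2: "UI_squares M U"
    and B3_c: "\<And>j. 0 \<le> c j" "summable c"
    and B3: "\<And>N n m. N \<ge> 1 \<Longrightarrow> m \<ge> 1 \<Longrightarrow> n \<le> m \<Longrightarrow>
               L2_norm_le (M N) (real_cond_exp (M N) (G N n) (U N m)) (c (m - n))"
    and B4_mono: "mono_on {0..} A"
    and B4: "\<And>t. 0 \<le> t \<Longrightarrow>
       (\<lambda>N. L1_norm (M N) (\<lambda>\<omega>. (\<Sum>n\<in>{1..nat \<lfloor>real N * t\<rfloor>}. (Wmart M G U N n \<omega>)\<^sup>2) / real N - A t))
         \<longlonglongrightarrow> 0"
    and F_meas: "\<And>N. N \<ge> 1 \<Longrightarrow> F N \<in> measurable (G N (k N)) borel"
    and lam_prob: "prob_space lam" and lam_sets: "sets lam = sets borel"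
    and F_weak: "weak_conv_meas (\<lambda>N. distr (M N) borel (F N)) lam"
  shows
    "(\<forall>t0. (\<lambda>N. real (k N) / real N) \<longlonglongrightarrow> t0 \<longrightarrow>
        (\<exists>\<gamma>. gaussian_ii_law T (\<lambda>t. A (t + t0) - A t0) \<gamma> \<and>
              weak_conv_XD T M F (\<lambda>N. xi_proc T U N (k N)) (lam \<Otimes>\<^sub>M \<gamma>)))
     \<and> (\<forall>A'. (\<forall>t\<ge>0. (\<lambda>N. L1_norm (M N) (\<lambda>\<omega>.
             (\<Sum>n\<in>{k N + 1..k N + nat \<lfloor>real N * t\<rfloor>}. (Wmart M G U N n \<omega>)\<^sup>2) / real N - A' t))
             \<longlonglongrightarrow> 0) \<longrightarrow>
        (\<exists>\<gamma>. gaussian_ii_law T A' \<gamma> \<and>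
              weak_conv_XD T M F (\<lambda>N. xi_proc T U N (k N)) (lam \<Otimes>\<^sub>M \<gamma>)))
     \<and> (\<exists>\<gamma>. gaussian_ii_law T A \<gamma> \<and> weak_conv_D T M (\<lambda>N. xi_proc T U N 0) \<gamma>)"
proof -
  interpret mixingale_array M G U c by (rule mixingale_array.intro[OF prob filt B1 B2 B3_c B3])
  have A: "(\<lambda>N. \<integral>x. \<bar>vari 0 N t x - A t\<bar> \<partial>M N) \<longlonglongrightarrow> 0" if "0 \<le> t" for t
    using B4[OF that] vari_limit_iff_L1_norm[of "\<lambda>_. 0" t "A t"] by simp
  have shifted: "\<exists>\<gamma>. gaussian_ii_law T (\<lambda>t. A (t + t0) - A t0) \<gamma> \<and> weak_conv_XD T M F (\<lambda>N. xi_proc T U N (k N)) (lam \<Otimes>\<^sub>M \<gamma>)"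
    if "(\<lambda>N. real (k N) / real N) \<longlonglongrightarrow> t0" for t0
    using joint_functional_clt[of T k "\<lambda>t. A (t + t0) - A t0", OF T_pos vari_shift_limit[OF that _ A] F_meas lam_prob lam_sets F_weak] by blast
  have general: "\<exists>\<gamma>. gaussian_ii_law T A' \<gamma> \<and> weak_conv_XD T M F (\<lambda>N. xi_proc T U N (k N)) (lam \<Otimes>\<^sub>M \<gamma>)"
    if A': "\<forall>t\<ge>0. (\<lambda>N. L1_norm (M N) (\<lambda>\<omega>.
             (\<Sum>n\<in>{k N + 1..k N + nat \<lfloor>real N * t\<rfloor>}. (Wmart M G U N n \<omega>)\<^sup>2) / real N - A' t)) \<longlonglongrightarrow> 0" for A'
  proof -
    have "(\<lambda>N. \<integral>x. \<bar>vari (k N) N t x - A' t\<bar> \<partial>M N) \<longlonglongrightarrow> 0" if "0 \<le> t" for t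
      using A' that unfolding vari_limit_iff_L1_norm by blast
    from joint_functional_clt[of T k A', OF T_pos this F_meas lam_prob lam_sets F_weak] show ?thesis by blast
  qed
  have unshifted: "\<exists>\<gamma>. gaussian_ii_law T A \<gamma> \<and> weak_conv_D T M (\<lambda>N. xi_proc T U N 0) \<gamma>"
  proof -
    \<comment> \<open>A constant first coordinate is measurable for every filtration and has a point
      mass as law, so the statement about the process alone becomes an instance of the joint one
      with start 0.\<close>
    let ?l = "return borel (undefined :: 'x)"
    have l: "prob_space ?l" "sets ?l = sets borel" by (simp_all add: prob_space_return)
    from joint_functional_clt[of T "\<lambda>_. 0" A, OF T_pos A measurable_const l weak_conv_meas_constant[OF prob]]
    obtain \<gamma> where \<gamma>: "gaussian_ii_law T A \<gamma>" "space \<gamma> = cont_paths T"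
      "weak_conv_XD T M (\<lambda>_ _. undefined) (\<lambda>N. xi_proc T U N 0) (?l \<Otimes>\<^sub>M \<gamma>)" by auto
    then show ?thesis using weak_conv_D_of_XD[OF T_pos \<gamma>(1,2) l \<gamma>(3)] by blast
  qed
  from shifted general unshifted show ?thesis by (intro conjI allI impI)
qed

end
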